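(* Let $\epsilon,\delta>0$. The Fenchel predual of the problem $$-\inf\Big\{\int_\Omega \mathcal G_{\epsilon,\delta}^*\Big(x,\tfrac{dq}{dx}(x)\Big)dx \;:\; q\in\mathcal M(\Omega;\mathbb R^d),\ q\ll dx,\ \tfrac{dq}{dx}\in L^\alpha(\Omega;\mathbb R^d),\ \operatorname{div}\tfrac{dq}{dx}=\mu\text{ in }W^{-1,\alpha}_\perp(\Omega)\Big\}$$ is the problem $$\min_{y\in W^{1,\alpha'}_\emptyset(\Omega)}\ \int_\Omega\mathcal G_{\epsilon,\delta}(x,-\nabla y(x))\,dx-\int_\Omega y\,d\mu ,$$ and strong duality holds, i.e. the two optimal values coincide (the first one including the leading minus sign).
   Context: Setting: $d\in\mathbb N$; $\Omega\subset\mathbb R^d$ is a compact set whose interior is a bounded Lipschitz domain; $w:\Omega\to[0,\infty)$ is continuous; $1<\alpha<\frac{d}{d-1}$ and $\alpha'=\frac{\alpha}{\alpha-1}$; $\mu^+,\mu^-$ are Borel probability measures on $\Omega$ and $\mu:=\mu^+-\mu^-$. $|\cdot|$ is the Euclidean norm, $dx$ is Lebesgue measure, $\mathcal M(\Omega;\mathbb R^d)$ is the space of $\mathbb R^d$-valued Radon measures on $\Omega$, and $\frac{dq}{dx}$ is the density of $q\ll dx$. Sobolev spaces $W^{1,p}(\Omega)$ are understood on the interior of $\Omega$. Definitions: $W^{1,p}_\emptyset(\Omega):=\{v\in W^{1,p}(\Omega):\int_\Omega v\,dx=0\}$. For $p\in(1,\infty)$ with conjugate exponent $p'$, $W^{-1,p}_\perp(\Omega):=\{v\in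 (W^{1,p'}(\Omega))^*:\langle v,1\rangle=0\}$ and $\operatorname{div}:L^p(\Omega;\mathbb R^d)\to W^{-1,p}_\perp(\Omega)$, $\langle \operatorname{div}q,\phi\rangle:=-\int_\Omega q\cdot\nabla\phi\,dx$ for all $\phi\in W^{1,p'}_\emptyset(\Omega)$. Since $W^{1,\alpha'}(\Omega)$ embeds into $C(\Omega)$, $\mu$ is regarded as an element of $W^{-1,\alpha}_\perp(\Omega)$ via $\phi\mapsto\int_\Omega\phi\,d\mu$. Integrand: $\mathcal G_{\epsilon,\delta}:\Omega\times\mathbb R^d\to\mathbb R$, $$\mathcal G_{\epsilon,\delta}(x,p)=\frac{\epsilon}{\alpha'}\Big(\frac1\epsilon\max\{|p|-w(x),0\}\Big)^{\alpha'}+\delta\max\{|p|,w(x)\}+\frac\delta2\min\Big\{\frac{|p|^2}{w(x)},w(x)\Big\},$$ where the last minimum is read as $0$ if $w(x)=0$. $\mathcal G^*_{\epsilon,\delta}(x,q)=\sup_{p\in\mathbb R^d}(q\cdot p-\mathcal G_{\epsilon,\delta}(x,p))$ is the Fenchel conjugate with respect to the second variable; explicitly $\mathcal G^*_{\epsilon,\delta}(x,q)=|q|^2\frac{w(x)}{2\delta}-\delta w(x)$ if $|q|\le\delta$, and $\frac\epsilon\alpha(|q|-\delta)^\alpha-\frac32\delta w(x)+|q|w(x)$ otherwise. "Predual" is meant in the sense of Fenchel duality: the first problem is the Fenchel(-Rockafellar) dual of the second one. Standing assumption on $\Omega$: for every $\nu\in W^{-1,\alpha'}_\perp(\Omega)$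 the equation $-\int_\Omega\nabla y\cdot\nabla\phi\,dx=\langle\nu,\phi\rangle$ for all $\phi\in W^{1,\alpha}_\emptyset(\Omega)$ has a unique solution $y\in W^{1,\alpha'}_\emptyset(\Omega)$. *)

theory Defs
  imports "HOL-Probability.Probability"
begin

text \<open>
  Elements of Lebesgue and Sobolev spaces are represented by functions; almost everywhere equal
  functions are not identified.  Functionals that are bounded with respect to the seminorms
  below automatically respect almost everywhere equality.
\<close>

subsection \<open>Lipschitz domains\<close>

text \<open>
  Near each boundary point the domain is the strict epigraph, in direction \<open>e\<close>, of a Lipschitz
  function \<open>\<gamma>\<close> on the hyperplane orthogonal to \<open>e\<close>; the vector \<open>x - (x \<bullet> e) *\<^sub>R e\<close> is the
  orthogonal projection of \<open>x\<close> onto that hyperplane.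
\<close>

definition bounded_lipschitz_domain :: "'a::euclidean_space set \<Rightarrow> bool" where
  "bounded_lipschitz_domain U \<longleftrightarrow>
     open U \<and> connected U \<and> U \<noteq> {} \<and> bounded U \<and>
     (\<forall>z\<in>frontier U. \<exists>r>0. \<exists>e (\<gamma> :: 'a \<Rightarrow> real) L.
        norm e = 1 \<and> L-lipschitz_on {v. v \<bullet> e = 0} \<gamma> \<and>
        (\<forall>x\<in>ball z r. x \<in> U \<longleftrightarrow> \<gamma> (x - (x \<bullet> e) *\<^sub>R e) < x \<bullet> e))"

subsection \<open>Lebesgue and Sobolev spaces\<close>

definition conj_exp :: "real \<Rightarrow> real" where
  "conj_exp p = p / (p - 1)"

definition Lp :: "real \<Rightarrow> 'a::euclidean_space set \<Rightarrow> ('a \<Rightarrow> 'b::euclidean_space) set" where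
  "Lp p S = {f \<in> borel_measurable (lebesgue_on S).
     integrable (lebesgue_on S) (\<lambda>x. norm (f x) powr p)}"

definition Lp_norm :: "real \<Rightarrow> 'a::euclidean_space set \<Rightarrow> ('a \<Rightarrow> 'b::euclidean_space) \<Rightarrow> real" where
  "Lp_norm p S f = (\<integral>x. norm (f x) powr p \<partial>lebesgue_on S) powr (1 / p)"

primrec Ck :: "nat \<Rightarrow> ('a::euclidean_space \<Rightarrow> real) \<Rightarrow> bool" where
  "Ck 0 f \<longleftrightarrow> continuous_on UNIV f"
| "Ck (Suc n) f \<longleftrightarrow> (\<forall>x. f differentiable (at x)) \<and>
     (\<forall>b\<in>Basis. Ck n (\<lambda>x. frechet_derivative f (at x) b))"

definition test_functions :: "'a::euclidean_space set \<Rightarrow> ('a \<Rightarrow> real) set" where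
  "test_functions U = {\<phi>. (\<forall>n. Ck n \<phi>) \<and>
     compact (closure {x. \<phi> x \<noteq> 0}) \<and> closure {x. \<phi> x \<noteq> 0} \<subseteq> U}"

definition locally_integrable :: "'a::euclidean_space set \<Rightarrow> ('a \<Rightarrow> 'b::euclidean_space) \<Rightarrow> bool" where
  "locally_integrable U f \<longleftrightarrow> (\<forall>K. compact K \<and> K \<subseteq> U \<longrightarrow> integrable (lebesgue_on K) f)"

definition is_weak_gradient ::
    "'a::euclidean_space set \<Rightarrow> ('a \<Rightarrow> real) \<Rightarrow> ('a \<Rightarrow> 'a) \<Rightarrow> bool" where
  "is_weak_gradient U y g \<longleftrightarrow> locally_integrable U y \<and> locally_integrable U g \<and>
     (\<forall>\<phi>\<in>test_functions U. \<forall>b\<in>Basis.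
        (\<integral>x. y x * frechet_derivative \<phi> (at x) b \<partial>lebesgue_on U)
          = - (\<integral>x. (g x \<bullet> b) * \<phi> x \<partial>lebesgue_on U))"

text \<open>
  As for \<open>W\<^sup>1\<^sup>,\<^sup>p(\<Omega>)\<close> below, the gradient is taken on the interior of \<open>\<Omega>\<close>.  It is unique only
  up to a null set; outside the interior its values are arbitrary, which is harmless because
  the boundary of a Lipschitz domain is a null set.
\<close>

definition wgrad :: "'a::euclidean_space set \<Rightarrow> ('a \<Rightarrow> real) \<Rightarrow> 'a \<Rightarrow> 'a" where
  "wgrad \<Omega> y = (SOME g. is_weak_gradient (interior \<Omega>) y g)"

definition W1p :: "real \<Rightarrow> 'a::euclidean_space set \<Rightarrow> ('a \<Rightarrow> real) set" where
  "W1p p \<Omega> = {y \<in> Lp p (interior \<Omega>). \<exists>g \<in> Lp p (interior \<Omega>). is_weak_gradient (interior \<Omega>) y g}"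

definition W1p_norm :: "real \<Rightarrow> 'a::euclidean_space set \<Rightarrow> ('a \<Rightarrow> real) \<Rightarrow> real" where
  "W1p_norm p \<Omega> y =
     (Lp_norm p (interior \<Omega>) y powr p + Lp_norm p (interior \<Omega>) (wgrad \<Omega> y) powr p) powr (1 / p)"

definition W1p_mean0 :: "real \<Rightarrow> 'a::euclidean_space set \<Rightarrow> ('a \<Rightarrow> real) set" where
  "W1p_mean0 p \<Omega> = {y \<in> W1p p \<Omega>. (\<integral>x. y x \<partial>lebesgue_on \<Omega>) = 0}"

text \<open>The representative furnished by the embedding of \<open>W\<^sup>1\<^sup>,\<^sup>p(\<Omega>)\<close> into \<open>C(\<Omega>)\<close> for \<open>p > d\<close>.\<close>

definition cont_rep :: "'a::euclidean_space set \<Rightarrow> ('a \<Rightarrow> real) \<Rightarrow> 'a \<Rightarrow> real" where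
  "cont_rep \<Omega> y = (SOME u. continuous_on \<Omega> u \<and> (AE x in lebesgue_on \<Omega>. u x = y x))"

subsection \<open>Dual spaces\<close>

definition dual_space ::
    "('a \<Rightarrow> 'b::real_vector) set \<Rightarrow> (('a \<Rightarrow> 'b) \<Rightarrow> real) \<Rightarrow> (('a \<Rightarrow> 'b) \<Rightarrow> real) set" where
  "dual_space X nrm = {\<xi>.
     (\<forall>f\<in>X. \<forall>g\<in>X. \<forall>a b. \<xi> (\<lambda>x. a *\<^sub>R f x + b *\<^sub>R g x) = a * \<xi> f + b * \<xi> g) \<and>
     (\<exists>C. \<forall>f\<in>X. \<bar>\<xi> f\<bar> \<le> C * nrm f)}"

definition Wneg_perp :: "real \<Rightarrow> 'a::euclidean_space set \<Rightarrow> (('a \<Rightarrow> real) \<Rightarrow> real) set" where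
  "Wneg_perp p \<Omega> = {\<nu> \<in> dual_space (W1p (conj_exp p) \<Omega>) (W1p_norm (conj_exp p) \<Omega>).
     \<nu> (\<lambda>x. 1) = 0}"

definition div_op :: "'a::euclidean_space set \<Rightarrow> ('a \<Rightarrow> 'a) \<Rightarrow> ('a \<Rightarrow> real) \<Rightarrow> real" where
  "div_op \<Omega> f \<phi> = - (\<integral>x. f x \<bullet> wgrad \<Omega> \<phi> x \<partial>lebesgue_on \<Omega>)"

text \<open>The functional \<open>\<phi> \<mapsto> \<integral>\<phi> d\<mu>\<close> for \<open>\<mu> = \<mu>\<^sup>+ - \<mu>\<^sup>-\<close>.\<close>

definition meas_pairing ::
    "'a::euclidean_space set \<Rightarrow> 'a measure \<Rightarrow> 'a measure \<Rightarrow> ('a \<Rightarrow> real) \<Rightarrow> real" where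
  "meas_pairing \<Omega> \<mu>p \<mu>m \<phi> = (\<integral>x. cont_rep \<Omega> \<phi> x \<partial>\<mu>p) - (\<integral>x. cont_rep \<Omega> \<phi> x \<partial>\<mu>m)"

text \<open>Unique solvability of the weak Neumann problem; \<open>p'\<close> is the conjugate exponent of \<open>p\<close>.\<close>

definition neumann_uniquely_solvable :: "real \<Rightarrow> 'a::euclidean_space set \<Rightarrow> bool" where
  "neumann_uniquely_solvable p \<Omega> \<longleftrightarrow>
     (\<forall>\<nu>\<in>Wneg_perp p \<Omega>.
        let sol = {y \<in> W1p_mean0 p \<Omega>. \<forall>\<phi>\<in>W1p_mean0 (conj_exp p) \<Omega>.
                     - (\<integral>x. wgrad \<Omega> y x \<bullet> wgrad \<Omega> \<phi> x \<partial>lebesgue_on \<Omega>) = \<nu> \<phi>}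
        in sol \<noteq> {} \<and> (\<forall>y1\<in>sol. \<forall>y2\<in>sol. AE x in lebesgue_on \<Omega>. y1 x = y2 x))"

subsection \<open>Vector measures\<close>

text \<open>
  On a compact \<open>\<Omega>\<close>, the vector-valued Radon measures are the countably additive vector-valued
  set functions on the Borel sets of \<open>\<Omega>\<close>: finiteness and regularity are automatic.  The value 0
  on other sets is a normalisation making equality of measures equality of functions.
\<close>

definition vector_measures :: "'a::euclidean_space set \<Rightarrow> ('a set \<Rightarrow> 'a) set" where
  "vector_measures \<Omega> = {q.
     (\<forall>A :: nat \<Rightarrow> 'a set. range A \<subseteq> sets (restrict_space borel \<Omega>) \<and> disjoint_family A \<longrightarrow>
        (\<lambda>n. q (A n)) sums q (\<Union>n. A n)) \<and>
     (\<forall>A. A \<notin> sets (restrict_space borel \<Omega>) \<longrightarrow> q A = 0)}"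

definition abs_cont :: "'a::euclidean_space set \<Rightarrow> ('a set \<Rightarrow> 'a) \<Rightarrow> bool" where
  "abs_cont \<Omega> q \<longleftrightarrow> (\<forall>A\<in>sets (restrict_space borel \<Omega>). emeasure lborel A = 0 \<longrightarrow> q A = 0)"

definition is_density :: "'a::euclidean_space set \<Rightarrow> ('a set \<Rightarrow> 'a) \<Rightarrow> ('a \<Rightarrow> 'a) \<Rightarrow> bool" where
  "is_density \<Omega> q f \<longleftrightarrow> integrable (lebesgue_on \<Omega>) f \<and>
     (\<forall>A\<in>sets (restrict_space borel \<Omega>). q A = (\<integral>x. indicator A x *\<^sub>R f x \<partial>lebesgue_on \<Omega>))"

definition dens :: "'a::euclidean_space set \<Rightarrow> ('a set \<Rightarrow> 'a) \<Rightarrow> 'a \<Rightarrow> 'a" where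
  "dens \<Omega> q = (SOME f. is_density \<Omega> q f)"

definition measures_with_Lp_density ::
    "real \<Rightarrow> 'a::euclidean_space set \<Rightarrow> ('a set \<Rightarrow> 'a) set" where
  "measures_with_Lp_density p \<Omega> =
     {q \<in> vector_measures \<Omega>. abs_cont \<Omega> q \<and> (\<exists>f\<in>Lp p \<Omega>. is_density \<Omega> q f)}"

subsection \<open>The integrand and its conjugate\<close>

definition G_int ::
    "real \<Rightarrow> ('a \<Rightarrow> real) \<Rightarrow> real \<Rightarrow> real \<Rightarrow> 'a::euclidean_space \<Rightarrow> 'a \<Rightarrow> real" where
  "G_int \<alpha> w \<epsilon> \<delta> x p =
     \<epsilon> / conj_exp \<alpha> * (1 / \<epsilon> * max (norm p - w x) 0) powr conj_exp \<alpha>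
     + \<delta> * max (norm p) (w x)
     + \<delta> / 2 * (if w x = 0 then 0 else min ((norm p)\<^sup>2 / w x) (w x))"

text \<open>The supremum is finite because \<^term>\<open>G_int \<alpha> w \<epsilon> \<delta> x\<close> grows superlinearly.\<close>

definition G_conj ::
    "real \<Rightarrow> ('a \<Rightarrow> real) \<Rightarrow> real \<Rightarrow> real \<Rightarrow> 'a::euclidean_space \<Rightarrow> 'a \<Rightarrow> real" where
  "G_conj \<alpha> w \<epsilon> \<delta> x q = (SUP p. q \<bullet> p - G_int \<alpha> w \<epsilon> \<delta> x p)"

subsection \<open>Fenchel--Rockafellar duality\<close>

definition fenchel_conj :: "'v set \<Rightarrow> ('v \<Rightarrow> ereal) \<Rightarrow> ('v \<Rightarrow> real) \<Rightarrow> ereal" where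
  "fenchel_conj X F \<xi> = (SUP v\<in>X. ereal (\<xi> v) - F v)"

text \<open>
  The problem \<open>inf {F v + G (\<Lambda> v) | v \<in> X}\<close> with \<open>\<Lambda> : X \<rightarrow> Y\<close> linear has the dual problem of
  maximising \<open>- F\<^sup>* (- \<Lambda>\<^sup>* \<xi>) - G\<^sup>* \<xi>\<close> over \<open>\<xi>\<close> in the dual space of \<open>Y\<close>.
\<close>

definition fenchel_primal_objective ::
    "('v \<Rightarrow> ereal) \<Rightarrow> ('u \<Rightarrow> ereal) \<Rightarrow> ('v \<Rightarrow> 'u) \<Rightarrow> 'v \<Rightarrow> ereal" where
  "fenchel_primal_objective F G \<Lambda> v = F v + G (\<Lambda> v)"

definition fenchel_dual_objective ::
    "'v set \<Rightarrow> ('v \<Rightarrow> ereal) \<Rightarrow> 'u set \<Rightarrow> ('u \<Rightarrow> ereal) \<Rightarrow> ('v \<Rightarrow> 'u) \<Rightarrow> ('u \<Rightarrow> real) \<Rightarrow> ereal" where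
  "fenchel_dual_objective X F Y G \<Lambda> \<xi> =
     - fenchel_conj X F (\<lambda>v. - \<xi> (\<Lambda> v)) - fenchel_conj Y G \<xi>"

subsection \<open>The two problems\<close>

definition primal_functional ::
    "real \<Rightarrow> ('a::euclidean_space \<Rightarrow> real) \<Rightarrow> real \<Rightarrow> real \<Rightarrow> 'a set \<Rightarrow> 'a measure \<Rightarrow> 'a measure \<Rightarrow>
     ('a \<Rightarrow> real) \<Rightarrow> real" where
  "primal_functional \<alpha> w \<epsilon> \<delta> \<Omega> \<mu>p \<mu>m y =
     (\<integral>x. G_int \<alpha> w \<epsilon> \<delta> x (- wgrad \<Omega> y x) \<partial>lebesgue_on \<Omega>) - meas_pairing \<Omega> \<mu>p \<mu>m y"

definition dual_functional ::
    "real \<Rightarrow> ('a::euclidean_space \<Rightarrow> real) \<Rightarrow> real \<Rightarrow> real \<Rightarrow> 'a set \<Rightarrow> ('a set \<Rightarrow> 'a) \<Rightarrow> real" where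
  "dual_functional \<alpha> w \<epsilon> \<delta> \<Omega> q = (\<integral>x. G_conj \<alpha> w \<epsilon> \<delta> x (dens \<Omega> q x) \<partial>lebesgue_on \<Omega>)"

definition dual_admissible ::
    "real \<Rightarrow> 'a::euclidean_space set \<Rightarrow> 'a measure \<Rightarrow> 'a measure \<Rightarrow> ('a set \<Rightarrow> 'a) set" where
  "dual_admissible \<alpha> \<Omega> \<mu>p \<mu>m = {q \<in> measures_with_Lp_density \<alpha> \<Omega>.
     \<forall>\<phi>\<in>W1p_mean0 (conj_exp \<alpha>) \<Omega>. div_op \<Omega> (dens \<Omega> q) \<phi> = meas_pairing \<Omega> \<mu>p \<mu>m \<phi>}"

text \<open>
  The Fenchel data of the primal problem: \<open>X = W\<^sup>1\<^sup>,\<^sup>\<alpha>\<^sup>'\<close> with mean zero, \<open>Y = L\<^sup>\<alpha>\<^sup>'(\<Omega>; \<real>\<^sup>d)\<close>,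
  \<open>F y = - \<integral>y d\<mu>\<close>, \<open>G p = \<integral>G(x, p(x)) dx\<close> and \<open>\<Lambda> = -\<nabla>\<close>.
\<close>

definition F_term ::
    "'a::euclidean_space set \<Rightarrow> 'a measure \<Rightarrow> 'a measure \<Rightarrow> ('a \<Rightarrow> real) \<Rightarrow> ereal" where
  "F_term \<Omega> \<mu>p \<mu>m y = ereal (- meas_pairing \<Omega> \<mu>p \<mu>m y)"

definition G_term ::
    "real \<Rightarrow> ('a::euclidean_space \<Rightarrow> real) \<Rightarrow> real \<Rightarrow> real \<Rightarrow> 'a set \<Rightarrow> ('a \<Rightarrow> 'a) \<Rightarrow> ereal" where
  "G_term \<alpha> w \<epsilon> \<delta> \<Omega> p = ereal (\<integral>x. G_int \<alpha> w \<epsilon> \<delta> x (p x) \<partial>lebesgue_on \<Omega>)"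

definition neg_grad :: "'a::euclidean_space set \<Rightarrow> ('a \<Rightarrow> real) \<Rightarrow> 'a \<Rightarrow> 'a" where
  "neg_grad \<Omega> y = (\<lambda>x. - wgrad \<Omega> y x)"

text \<open>The functional on \<open>L\<^sup>\<alpha>\<^sup>'(\<Omega>; \<real>\<^sup>d)\<close> represented by a vector measure.\<close>

definition riesz_functional ::
    "'a::euclidean_space set \<Rightarrow> ('a set \<Rightarrow> 'a) \<Rightarrow> ('a \<Rightarrow> 'a) \<Rightarrow> real" where
  "riesz_functional \<Omega> q p = (\<integral>x. dens \<Omega> q x \<bullet> p x \<partial>lebesgue_on \<Omega>)"

end

theory Submission
  imports Defs
begin

text \<open>
  The primal problem lives on the space of gradients, a closed subspace of the uniformly convex
  space \<open>L\<^sup>p\<close> with \<open>p = \<alpha>'\<close>.  Minimising sequences of small norm converge there, which gives the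
  primal minimiser and, applied to \<open>\<bar>v\<bar>\<^sup>p / p - \<xi> v\<close>, the representation of the dual space.  Closedness
  of the space of gradients and continuity of the linear term both come from Morrey's inequality:
  \<open>\<mu>\<close> being a difference of probability measures, only the oscillation of \<open>y\<close> matters.

  The integrand is not differentiable at \<open>0\<close> where \<open>w\<close> vanishes.  Replacing \<open>w\<close> by \<open>max w \<eta>\<close> in its
  \<open>\<delta>\<close>-part changes it by at most \<open>\<delta> \<eta>\<close> and makes the derivative \<open>f\<close> along the minimiser available.
  The Euler--Lagrange equation says that \<open>f\<close> has divergence \<open>\<mu>\<close>, and equality in the Fenchel--Young
  inequality shows that \<open>f\<close> is optimal in the dual problem up to \<open>\<delta> \<eta> \<bar>\<Omega>\<bar>\<close>.  Together with weak
  duality this gives strong duality.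
\<close>

subsection \<open>Smooth functions\<close>

lemma Ck_continuous: "Ck n f \<Longrightarrow> continuous_on UNIV f"
proof (cases n)
  case (Suc m)
  assume "Ck n f"
  then show ?thesis using Suc
    by (meson Ck.simps(2) continuous_at_imp_continuous_on differentiable_imp_continuous_within)
qed simp

lemma Ck_SucD: "Ck (Suc n) f \<Longrightarrow> Ck n f"
proof (induction n arbitrary: f)
  case 0
  then show ?case using Ck_continuous[of "Suc 0" f] by (simp only: Ck.simps(1) One_nat_def)
next
  case (Suc n)
  show ?case unfolding Ck.simps(2)[of n]
  proof (intro conjI ballI)
    show "\<forall>x. f differentiable at x" using Suc.prems by simp
    fix b :: 'a assume "b \<in> Basis"
    then show "Ck n (\<lambda>x. frechet_derivative f (at x) b)"
      using Suc.prems Suc.IH by (metis Ck.simps(2))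
  qed
qed

lemma Ck_SucI:
  assumes "\<And>x. (f has_derivative F x) (at x)"
    and "\<And>b. b \<in> Basis \<Longrightarrow> Ck n (\<lambda>x. F x b)"
  shows "Ck (Suc n) f"
proof -
  have "frechet_derivative f (at x) = F x" for x
    using assms(1) frechet_derivative_at by metis
  then show ?thesis using assms by (auto simp: differentiable_def)
qed

lemma Ck_SucE:
  assumes "Ck (Suc n) f"
  shows "(f has_derivative frechet_derivative f (at x)) (at x)"
  using assms frechet_derivative_works by auto

lemma Ck_const [simp]: "Ck n (\<lambda>x::'a::euclidean_space. c)"
proof (induction n arbitrary: c)
  case (Suc n)
  show ?case by (rule Ck_SucI[where F="\<lambda>x h. 0"]) (auto intro: Suc)
qed simp

lemma Ck_add: "Ck n f \<Longrightarrow> Ck n g \<Longrightarrow> Ck n (\<lambda>x. f x + g x)"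
proof (induction n arbitrary: f g)
  case (Suc n)
  show ?case
    by (rule Ck_SucI[OF has_derivative_add[OF Ck_SucE[OF Suc.prems(1)] Ck_SucE[OF Suc.prems(2)]]])
       (use Suc in auto)
qed (simp add: continuous_on_add)

lemma Ck_mult: "Ck n f \<Longrightarrow> Ck n g \<Longrightarrow> Ck n (\<lambda>x. f x * g x)"
proof (induction n arbitrary: f g)
  case (Suc n)
  show ?case
  proof (rule Ck_SucI[OF has_derivative_mult[OF Ck_SucE[OF Suc.prems(1)] Ck_SucE[OF Suc.prems(2)]]])
    fix b :: 'a assume b: "b \<in> Basis"
    show "Ck n (\<lambda>x. f x * frechet_derivative g (at x) b + frechet_derivative f (at x) b * g x)"
      using Suc.prems b Ck_SucD by (intro Ck_add Suc.IH) auto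
  qed
qed (simp add: continuous_on_mult)

lemma Ck_prod: "finite A \<Longrightarrow> (\<And>i. i \<in> A \<Longrightarrow> Ck n (f i)) \<Longrightarrow> Ck n (\<lambda>x. \<Prod>i\<in>A. f i x)"
  by (induction A rule: finite_induct) (auto intro: Ck_mult)

lemma Ck_inner: "Ck n (\<lambda>x. x \<bullet> c)"
proof (cases n)
  case (Suc m)
  show ?thesis unfolding Suc
    by (rule Ck_SucI[where F="\<lambda>x h. h \<bullet> c"]) (auto intro!: derivative_eq_intros)
qed (simp add: continuous_intros)

lemma Ck_affine: "Ck n f \<Longrightarrow> Ck n (\<lambda>x. f (m *\<^sub>R x + a))"
proof (induction n arbitrary: f)
  case 0
  then have "continuous_on UNIV (f \<circ> (\<lambda>x. m *\<^sub>R x + a))"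
    by (intro continuous_on_compose) (auto intro!: continuous_intros intro: continuous_on_subset)
  then show ?case by (simp add: o_def)
next
  case (Suc n)
  show ?case
  proof (rule Ck_SucI)
    fix x
    have "((\<lambda>x. m *\<^sub>R x + a) has_derivative (\<lambda>h. m *\<^sub>R h)) (at x)"
      by (auto intro!: derivative_eq_intros)
    from has_derivative_compose[OF this Ck_SucE[OF Suc.prems]]
    show "((\<lambda>x. f (m *\<^sub>R x + a)) has_derivative
        (\<lambda>h. frechet_derivative f (at (m *\<^sub>R x + a)) (m *\<^sub>R h))) (at x)" .
  next
    fix b :: 'a assume b: "b \<in> Basis"
    have "frechet_derivative f (at x) (m *\<^sub>R b) = m * frechet_derivative f (at x) b" for x
      using linear_scale[OF has_derivative_linear[OF Ck_SucE[OF Suc.prems]]] by simp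
    then show "Ck n (\<lambda>x. frechet_derivative f (at (m *\<^sub>R x + a)) (m *\<^sub>R b))"
      using b Suc.prems by (simp only: Ck.simps(2)) (intro Ck_mult Ck_const Suc.IH, blast)
  qed
qed

definition flat_exp :: "nat \<Rightarrow> real \<Rightarrow> real" where
  "flat_exp k t = (if t > 0 then exp (- 1 / t) / t ^ k else 0)"

lemma flat_exp_div_tendsto_0: "((\<lambda>t. exp (- 1 / t) / t ^ k) \<longlongrightarrow> 0) (at_right (0::real))"
proof -
  have "((\<lambda>s::real. s ^ k / exp s) \<longlongrightarrow> 0) at_top"
    by (rule tendsto_power_div_exp_0)
  then have "((\<lambda>t. (inverse t) ^ k / exp (inverse t)) \<longlongrightarrow> 0) (at_right (0::real))"
    by (rule filterlim_compose) (rule filterlim_inverse_at_top_right)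
  moreover have "(inverse t) ^ k / exp (inverse t) = exp (- 1 / t) / t ^ k" for t :: real
    by (simp add: exp_minus divide_simps power_inverse inverse_eq_divide)
  ultimately show ?thesis by simp
qed

lemma flat_exp_has_derivative:
  "(flat_exp k has_real_derivative (flat_exp (k + 2) t - real k * flat_exp (k + 1) t)) (at t)"
proof -
  consider "t > 0" | "t < 0" | "t = 0" by linarith
  then show ?thesis
  proof cases
    case 1
    have "((\<lambda>t. exp (- 1 / t) / t ^ k) has_real_derivative
        (flat_exp (k + 2) t - real k * flat_exp (k + 1) t)) (at t)"
      using 1 by (auto intro!: derivative_eq_intros simp: flat_exp_def field_simps power_add
          power2_eq_square power_eq_if[of t k])
    moreover have ev: "\<forall>\<^sub>F s in nhds t. flat_exp k s = exp (- 1 / s) / s ^ k"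
      using eventually_nhds_in_open[of "{0<..}" t] 1
      by (auto simp: flat_exp_def elim!: eventually_mono)
    ultimately show ?thesis using DERIV_cong_ev[OF refl ev refl] by blast
  next
    case 2
    have ev: "\<forall>\<^sub>F s in nhds t. flat_exp k s = 0"
      using eventually_nhds_in_open[of "{..<0}" t] 2
      by (auto simp: flat_exp_def elim!: eventually_mono)
    moreover have "((\<lambda>s. 0::real) has_real_derivative 0) (at t)" by simp
    ultimately have "(flat_exp k has_real_derivative 0) (at t)"
      using DERIV_cong_ev[OF refl ev refl] by blast
    then show ?thesis using 2 by (simp add: flat_exp_def)
  next
    case 3
    have "((\<lambda>s. flat_exp k s / s) \<longlongrightarrow> 0) (at 0)"
      unfolding filterlim_at_split
    proof
      show "((\<lambda>s. flat_exp k s / s) \<longlongrightarrow> 0) (at_left 0)"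
        by (rule tendsto_eventually) (auto simp: flat_exp_def eventually_at_filter)
      have "\<forall>\<^sub>F s in at_right 0. exp (- 1 / s) / s ^ (k + 1) = flat_exp k s / s"
        by (auto simp: flat_exp_def eventually_at_filter)
      then show "((\<lambda>s. flat_exp k s / s) \<longlongrightarrow> 0) (at_right 0)"
        using flat_exp_div_tendsto_0[of "k+1"] by (rule Lim_transform_eventually[rotated])
    qed
    then have "(flat_exp k has_real_derivative 0) (at 0)"
      unfolding has_field_derivative_iff by (simp add: flat_exp_def)
    then show ?thesis using 3 by (simp add: flat_exp_def)
  qed
qed

lemma Ck_flat_exp_affine: "Ck n (\<lambda>x::'a::euclidean_space. flat_exp k (m * (x \<bullet> b) + c))"
proof (induction n arbitrary: k)
  case 0
  have "continuous_on UNIV (flat_exp k)"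
    using flat_exp_has_derivative DERIV_isCont continuous_at_imp_continuous_on by blast
  then have "continuous_on UNIV (flat_exp k \<circ> (\<lambda>x::'a. m * (x \<bullet> b) + c))"
    by (intro continuous_on_compose) (auto intro!: continuous_intros intro: continuous_on_subset)
  then show ?case by (simp add: o_def)
next
  case (Suc n)
  let ?D = "\<lambda>t. flat_exp (k + 2) t - real k * flat_exp (k + 1) t"
  show ?case
  proof (rule Ck_SucI)
    fix x :: 'a
    have "((\<lambda>x. m * (x \<bullet> b) + c) has_derivative (\<lambda>h. m * (h \<bullet> b))) (at x)"
      by (auto intro!: derivative_eq_intros)
    from has_derivative_compose[OF this flat_exp_has_derivative[unfolded has_field_derivative_def]]
    show "((\<lambda>x. flat_exp k (m * (x \<bullet> b) + c)) has_derivative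
       (\<lambda>h. ?D (m * (x \<bullet> b) + c) * (m * (h \<bullet> b)))) (at x)" .
  next
    fix b' :: 'a
    have "Ck n (\<lambda>x::'a. (flat_exp (k + 2) (m * (x \<bullet> b) + c)
        + (- real k) * flat_exp (k + 1) (m * (x \<bullet> b) + c)) * (m * (b' \<bullet> b)))"
      by (intro Ck_mult Ck_add Suc.IH Ck_const)
    then show "Ck n (\<lambda>x::'a. ?D (m * (x \<bullet> b) + c) * (m * (b' \<bullet> b)))"
      by simp
  qed
qed

definition box_bump :: "real \<Rightarrow> 'a::euclidean_space \<Rightarrow> 'a \<Rightarrow> 'a \<Rightarrow> real" where
  "box_bump m a c x =
     (\<Prod>b\<in>Basis. flat_exp 0 (m * (x \<bullet> b - a \<bullet> b)) * flat_exp 0 (m * (c \<bullet> b - x \<bullet> b)))"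

lemma Ck_box_bump: "Ck n (box_bump m a c)"
proof -
  have "Ck n (\<lambda>x. \<Prod>b\<in>Basis. flat_exp 0 (m * (x \<bullet> b) + (- m * (a \<bullet> b)))
      * flat_exp 0 ((- m) * (x \<bullet> b) + m * (c \<bullet> b)))"
    by (intro Ck_prod Ck_mult Ck_flat_exp_affine) simp
  moreover have "box_bump m a c = (\<lambda>x. \<Prod>b\<in>Basis. flat_exp 0 (m * (x \<bullet> b) + (- m * (a \<bullet> b)))
      * flat_exp 0 ((- m) * (x \<bullet> b) + m * (c \<bullet> b)))"
    by (auto simp: box_bump_def algebra_simps)
  ultimately show ?thesis by simp
qed

lemma flat_exp_bounds: "0 \<le> flat_exp 0 t" "flat_exp 0 t \<le> 1"
  by (auto simp: flat_exp_def)

lemma box_bump_bounds: "0 \<le> box_bump m a c x" "box_bump m a c x \<le> 1"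
  unfolding box_bump_def
  by (auto intro!: prod_nonneg prod_le_1 mult_nonneg_nonneg mult_le_one simp: flat_exp_bounds)

lemma box_bump_support:
  assumes "m > 0"
  shows "box_bump m a c x \<noteq> 0 \<longleftrightarrow> x \<in> box a c"
  using assms by (auto simp: box_bump_def flat_exp_def mem_box zero_less_mult_iff)

lemma box_bump_tendsto_indicator:
  "(\<lambda>n. box_bump (real (Suc n)) a c x) \<longlonglongrightarrow> indicator (box a c) x"
proof (cases "x \<in> box a c")
  case True
  have *: "(\<lambda>n. flat_exp 0 (real (Suc n) * t)) \<longlonglongrightarrow> 1" if "t > 0" for t
  proof -
    have "(\<lambda>n. - (1 / t) * inverse (real (Suc n))) \<longlonglongrightarrow> - (1 / t) * 0"
      by (intro tendsto_intros LIMSEQ_inverse_real_of_nat)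
    then have "(\<lambda>n. exp (- (1 / t) * inverse (real (Suc n)))) \<longlonglongrightarrow> exp 0"
      by (intro tendsto_exp) simp
    moreover have "flat_exp 0 (real (Suc n) * t) = exp (- (1 / t) * inverse (real (Suc n)))" for n
      using that unfolding flat_exp_def by (simp add: divide_simps)
    ultimately show ?thesis by simp
  qed
  have "(\<lambda>n. box_bump (real (Suc n)) a c x) \<longlonglongrightarrow> (\<Prod>b\<in>(Basis::'a set). 1 * 1)"
    unfolding box_bump_def using True by (intro tendsto_prod tendsto_mult *) (auto simp: mem_box)
  then show ?thesis using True by simp
next
  case False
  then have "box_bump (real (Suc n)) a c x = 0" for n
    using box_bump_support[of "real (Suc n)" a c x] by auto
  then show ?thesis using False by simp
qed

subsection \<open>Test functions and weak gradients\<close>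

lemma frechet_derivative_outside_support:
  assumes "x \<notin> closure {x. f x \<noteq> (0::real)}"
  shows "frechet_derivative f (at x) = (\<lambda>h. 0)"
proof -
  have "((\<lambda>_. 0) has_derivative (\<lambda>h. 0)) (at x)" by simp
  then have "(f has_derivative (\<lambda>h. 0)) (at x)"
  proof (rule has_derivative_transform_within_open)
    show "open (- closure {x. f x \<noteq> 0})" by auto
    show "x \<in> - closure {x. f x \<noteq> 0}" using assms by simp
    fix z assume "z \<in> - closure {x. f x \<noteq> 0}"
    then show "0 = f z" using closure_subset[of "{x. f x \<noteq> 0}"] by auto
  qed
  then show ?thesis by (rule frechet_derivative_at[symmetric])
qed

lemma test_functionsD:
  assumes "\<phi> \<in> test_functions U"
  shows "continuous_on UNIV \<phi>" "compact (closure {x. \<phi> x \<noteq> 0})" "closure {x. \<phi> x \<noteq> 0} \<subseteq> U"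
    "x \<notin> closure {x. \<phi> x \<noteq> 0} \<Longrightarrow> \<phi> x = 0"
    "x \<notin> closure {x. \<phi> x \<noteq> 0} \<Longrightarrow> frechet_derivative \<phi> (at x) b = 0"
    "b \<in> Basis \<Longrightarrow> continuous_on UNIV (\<lambda>x. frechet_derivative \<phi> (at x) b)"
proof -
  have ck: "Ck n \<phi>" for n using assms by (auto simp: test_functions_def)
  show "continuous_on UNIV \<phi>" using Ck_continuous[OF ck] .
  show "b \<in> Basis \<Longrightarrow> continuous_on UNIV (\<lambda>x. frechet_derivative \<phi> (at x) b)"
    using ck[of "Suc 0"] by simp
  show "x \<notin> closure {x. \<phi> x \<noteq> 0} \<Longrightarrow> \<phi> x = 0"
    using closure_subset[of "{x. \<phi> x \<noteq> 0}"] by auto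
qed (use assms in \<open>auto simp: test_functions_def frechet_derivative_outside_support\<close>)

lemma compact_in_lebesgue [simp]: "compact K \<Longrightarrow> K \<in> sets lebesgue"
  by (rule fmeasurableD[OF lmeasurable_compact])

lemma integrable_mult_compact_support:
  fixes g :: "'a::euclidean_space \<Rightarrow> 'b::euclidean_space"
  assumes g: "locally_integrable U g" and U: "open U" and \<phi>: "continuous_on UNIV \<phi>"
    and K: "compact K" "K \<subseteq> U" and z: "\<And>x. x \<notin> K \<Longrightarrow> \<phi> x = (0::real)"
  shows "integrable (lebesgue_on U) (\<lambda>x. \<phi> x *\<^sub>R g x)"
proof -
  have gK: "integrable (lebesgue_on K) g" using g K by (auto simp: locally_integrable_def)
  obtain B where B: "\<And>x. x \<in> K \<Longrightarrow> norm (\<phi> x) \<le> B"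
    using compact_imp_bounded[OF compact_continuous_image[OF continuous_on_subset[OF \<phi>] K(1)]]
    by (auto simp: bounded_iff)
  have m: "\<phi> \<in> borel_measurable (lebesgue_on K)"
    using continuous_imp_measurable_on_sets_lebesgue[OF continuous_on_subset[OF \<phi>]] K by auto
  have "integrable (lebesgue_on K) (\<lambda>x. \<phi> x *\<^sub>R g x)"
  proof (rule Bochner_Integration.integrable_bound)
    show "integrable (lebesgue_on K) (\<lambda>x. B *\<^sub>R g x)" using gK by simp
    show "(\<lambda>x. \<phi> x *\<^sub>R g x) \<in> borel_measurable (lebesgue_on K)" using m gK by simp
    have "norm (\<phi> x *\<^sub>R g x) \<le> norm (B *\<^sub>R g x)" if "x \<in> K" for x
      using B[OF that] by (auto intro!: mult_right_mono)
    then show "AE x in lebesgue_on K. norm (\<phi> x *\<^sub>R g x) \<le> norm (B *\<^sub>R g x)"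
      by (intro AE_I2) simp
  qed
  then have "integrable lebesgue (\<lambda>x. indicator K x *\<^sub>R (\<phi> x *\<^sub>R g x))"
    using K by (subst integrable_restrict_space[symmetric]) simp_all
  also have "(\<lambda>x. indicator K x *\<^sub>R (\<phi> x *\<^sub>R g x)) = (\<lambda>x. indicator U x *\<^sub>R (\<phi> x *\<^sub>R g x))"
    using z K by (fastforce simp: indicator_def)
  finally show ?thesis using U by (subst integrable_restrict_space) simp_all
qed

lemma integral_boxes_zero_imp_AE_zero:
  fixes f :: "'a::euclidean_space \<Rightarrow> real"
  assumes f: "integrable lborel f"
    and box0: "\<And>a c. (\<integral>x. indicator (box a c) x *\<^sub>R f x \<partial>lborel) = 0"
    and tot: "(\<integral>x. f x \<partial>lborel) = 0"
  shows "AE x in lborel. f x = 0"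
proof -
  have [measurable]: "f \<in> borel_measurable borel" using f by auto
  let ?G = "range (\<lambda>(a, b). box a b :: 'a set)"
  have "(\<integral>x. indicator A x *\<^sub>R f x \<partial>lborel) = 0" if "A \<in> sigma_sets UNIV ?G" for A
    using _ _ that
  proof (rule sigma_sets_induct_disjoint)
    show "Int_stable ?G"
    proof (rule Int_stableI)
      fix A B assume "A \<in> ?G" "B \<in> ?G"
      then obtain a b c d where *: "A = box a b" "B = box c d" by auto
      show "A \<inter> B \<in> ?G" unfolding * box_Int_box by auto
    qed
  next
    fix A assume "A \<in> ?G" then show "(\<integral>x. indicator A x *\<^sub>R f x \<partial>lborel) = 0" using box0 by auto
  next
    fix A assume A: "A \<in> sigma_sets UNIV ?G" "(\<integral>x. indicator A x *\<^sub>R f x \<partial>lborel) = 0"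
    have A': "A \<in> sets borel" using A(1) by (simp add: borel_eq_box)
    have "(\<integral>x. indicator (UNIV - A) x *\<^sub>R f x \<partial>lborel) = (\<integral>x. f x - indicator A x *\<^sub>R f x \<partial>lborel)"
      by (intro Bochner_Integration.integral_cong) (auto simp: indicator_def)
    also have "\<dots> = (\<integral>x. f x \<partial>lborel) - (\<integral>x. indicator A x *\<^sub>R f x \<partial>lborel)"
      using f A' by (intro Bochner_Integration.integral_diff integrable_mult_indicator) auto
    finally show "(\<integral>x. indicator (UNIV - A) x *\<^sub>R f x \<partial>lborel) = 0" using A tot by simp
  next
    fix A :: "nat \<Rightarrow> 'a set"
    assume A: "disjoint_family A" "range A \<subseteq> sigma_sets UNIV ?G"
      "\<And>i. (\<integral>x. indicator (A i) x *\<^sub>R f x \<partial>lborel) = 0"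
    have A': "A i \<in> sets lborel" for i using A(2) by (auto simp: borel_eq_box)
    have "(LINT x:(\<Union>i. A i)|lborel. f x) = (\<Sum>i. (LINT x:A i|lborel. f x))"
    proof (rule lebesgue_integral_countable_add)
      show "set_integrable lborel (\<Union>i. A i) f" unfolding set_integrable_def
        using f A' by (intro integrable_mult_indicator) auto
    qed (use A A' in \<open>auto simp: disjoint_family_on_def\<close>)
    then show "(\<integral>x. indicator (\<Union>i. A i) x *\<^sub>R f x \<partial>lborel) = 0"
      using A(3) by (simp add: set_lebesgue_integral_def)
  qed auto
  then have "(LINT x:A|lborel. f x) = (LINT x:A|lborel. 0)" if "A \<in> sets lborel" for A
    using that by (simp add: set_lebesgue_integral_def borel_eq_box)
  then show ?thesis using f by (intro density_unique_real) auto
qed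

lemma box_bump_in_test_functions:
  assumes "cbox a c \<subseteq> U" "m > 0"
  shows "box_bump m a c \<in> test_functions U"
proof -
  have "{x. box_bump m a c x \<noteq> 0} = box a c" using box_bump_support[OF assms(2)] by auto
  moreover have "closure (box a c) \<subseteq> cbox a c"
    by (rule closure_minimal) (auto simp: box_subset_cbox)
  moreover have "compact (closure (box a c))" by (simp add: bounded_box)
  ultimately show ?thesis using assms Ck_box_bump by (auto simp: test_functions_def)
qed

lemma integral_test_functions_zero_imp_AE_zero:
  fixes g :: "'a::euclidean_space \<Rightarrow> real"
  assumes U: "open U" and g: "locally_integrable U g"
    and z: "\<And>\<phi>. \<phi> \<in> test_functions U \<Longrightarrow> (\<integral>x. g x * \<phi> x \<partial>lebesgue_on U) = 0"
  shows "AE x in lebesgue_on U. g x = 0"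
proof -
  have 1: "(\<integral>x. indicator (box a c) x * g x \<partial>lebesgue) = 0" if ac: "cbox a c \<subseteq> U" for a c
  proof -
    have gK: "integrable lebesgue (\<lambda>x. indicator (cbox a c) x *\<^sub>R g x)"
      using g ac integrable_restrict_space[of "cbox a c" lebesgue g]
      by (auto simp: locally_integrable_def)
    have eq: "indicator U x *\<^sub>R (g x * box_bump (Suc n) a c x)
        = (indicator (cbox a c) x *\<^sub>R g x) * box_bump (Suc n) a c x" for x n
      using ac box_bump_support[of "Suc n" a c x] box_subset_cbox[of a c] by (auto simp: indicator_def fun_eq_iff)
    have "(\<lambda>n. \<integral>x. (indicator (cbox a c) x *\<^sub>R g x) * box_bump (Suc n) a c x \<partial>lebesgue)
        \<longlonglongrightarrow> (\<integral>x. (indicator (cbox a c) x *\<^sub>R g x) * indicator (box a c) x \<partial>lebesgue)"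
    proof (rule integral_dominated_convergence[where w="\<lambda>x. norm (indicator (cbox a c) x *\<^sub>R g x)"])
      have "box_bump (Suc n) a c \<in> borel_measurable lebesgue" for n
        using continuous_imp_measurable_on_sets_lebesgue[OF Ck_continuous[OF Ck_box_bump]]
        by (auto simp: lebesgue_on_UNIV_eq)
      then show "(\<lambda>x. (indicator (cbox a c) x *\<^sub>R g x) * box_bump (Suc n) a c x) \<in> borel_measurable lebesgue" for n
        using gK by (intro borel_measurable_times) auto
      show "(\<lambda>x. (indicator (cbox a c) x *\<^sub>R g x) * indicator (box a c) x) \<in> borel_measurable lebesgue"
        using gK by (intro borel_measurable_times borel_measurable_indicator) auto
      show "AE x in lebesgue. (\<lambda>n. (indicator (cbox a c) x *\<^sub>R g x) * box_bump (Suc n) a c x)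
          \<longlonglongrightarrow> (indicator (cbox a c) x *\<^sub>R g x) * indicator (box a c) x"
        by (intro AE_I2 tendsto_mult tendsto_const box_bump_tendsto_indicator)
      show "AE x in lebesgue. norm ((indicator (cbox a c) x *\<^sub>R g x) * box_bump (Suc n) a c x)
          \<le> norm (indicator (cbox a c) x *\<^sub>R g x)" for n
        using box_bump_bounds[of "Suc n" a c]
        by (intro AE_I2) (auto simp: abs_mult intro!: mult_left_le)
    qed (use gK in auto)
    moreover have "(\<integral>x. (indicator (cbox a c) x *\<^sub>R g x) * box_bump (Suc n) a c x \<partial>lebesgue) = 0" for n
    proof -
      have "(\<integral>x. (indicator (cbox a c) x *\<^sub>R g x) * box_bump (Suc n) a c x \<partial>lebesgue)
          = (\<integral>x. g x * box_bump (Suc n) a c x \<partial>lebesgue_on U)"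
        unfolding eq[symmetric] using U by (intro integral_restrict_space[symmetric]) simp
      then show ?thesis using z[OF box_bump_in_test_functions[OF ac, of "Suc n"]] by simp
    qed
    ultimately have "(\<integral>x. (indicator (cbox a c) x *\<^sub>R g x) * indicator (box a c) x \<partial>lebesgue) = 0"
      by (simp add: LIMSEQ_const_iff)
    moreover have "(\<lambda>x. (indicator (cbox a c) x *\<^sub>R g x) * indicator (box a c) x)
        = (\<lambda>x. indicator (box a c) x * g x)"
      using box_subset_cbox[of a c] by (auto simp: indicator_def fun_eq_iff)
    ultimately show ?thesis by (simp only:)
  qed
  have 2: "AE x in lebesgue. x \<in> box a c \<longrightarrow> g x = 0" if ac: "cbox a c \<subseteq> U" for a c
  proof -
    let ?f = "\<lambda>x. indicator (box a c) x * g x"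
    have "integrable lebesgue (\<lambda>x. indicator (box a c) x *\<^sub>R (indicator (cbox a c) x *\<^sub>R g x))"
      using g ac
      by (intro integrable_mult_indicator integrable_restrict_space[THEN iffD1])
        (auto simp: locally_integrable_def)
    moreover have "(\<lambda>x. indicator (box a c) x *\<^sub>R (indicator (cbox a c) x *\<^sub>R g x)) = ?f"
      using box_subset_cbox[of a c] by (auto simp: indicator_def fun_eq_iff)
    ultimately have fi: "integrable lebesgue ?f" by simp
    then have "?f \<in> borel_measurable lebesgue" by auto
    then obtain f' where f': "f' \<in> borel_measurable lborel" "AE x in lborel. ?f x = f' x"
      using completion_ex_borel_measurable_real[of ?f lborel] by auto
    have f'm [measurable]: "f' \<in> borel_measurable lebesgue" using f'(1) by (rule measurable_completion)
    have ae: "AE x in lebesgue. ?f x = f' x" using f'(2) by (rule AE_completion)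
    have f'i: "integrable lborel f'"
      using integrable_cong_AE[OF _ f'm ae] fi f'(1) by (simp add: integrable_completion)
    have f'int: "(\<integral>x. indicator A x *\<^sub>R f' x \<partial>lborel) = (\<integral>x. indicator A x *\<^sub>R ?f x \<partial>lebesgue)"
      if "A \<in> sets borel" for A
    proof -
      have "(\<integral>x. indicator A x *\<^sub>R f' x \<partial>lborel) = (\<integral>x. indicator A x *\<^sub>R f' x \<partial>lebesgue)"
        using that f'(1) by (intro integral_completion[symmetric]) auto
      also have "\<dots> = (\<integral>x. indicator A x *\<^sub>R ?f x \<partial>lebesgue)"
        using that f'm borel_measurable_integrable[OF fi] ae
        by (intro integral_cong_AE borel_measurable_scaleR borel_measurable_indicator) auto
      finally show ?thesis .
    qed
    have "AE x in lborel. f' x = 0"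
    proof (rule integral_boxes_zero_imp_AE_zero[OF f'i])
      fix u v
      obtain a' c' where *: "box u v \<inter> box a c = box a' c'" "cbox u v \<inter> cbox a c = cbox a' c'"
        unfolding box_Int_box Int_interval by blast
      have "(\<integral>x. indicator (box u v) x *\<^sub>R ?f x \<partial>lebesgue) = (\<integral>x. indicator (box a' c') x * g x \<partial>lebesgue)"
        unfolding *(1)[symmetric] by (intro Bochner_Integration.integral_cong) (auto simp: indicator_def)
      also have "\<dots> = 0" using *(2) ac by (intro 1) auto
      finally show "(\<integral>x. indicator (box u v) x *\<^sub>R f' x \<partial>lborel) = 0" using f'int by simp
    next
      show "(\<integral>x. f' x \<partial>lborel) = 0" using f'int[of UNIV] 1[OF ac] by simp
    qed
    then have "AE x in lebesgue. f' x = 0" by (rule AE_completion)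
    then show ?thesis using ae by eventually_elim (auto simp: indicator_def)
  qed
  let ?F = "{box a c | a c. cbox a c \<subseteq> U}"
  have "\<Union>?F = U"
  proof
    show "\<Union>?F \<subseteq> U" using box_subset_cbox by blast
    show "U \<subseteq> \<Union>?F"
    proof
      fix x assume "x \<in> U"
      then obtain a b where "cbox a b \<subseteq> U" "x \<in> box a b"
        using U open_contains_cbox by metis
      then show "x \<in> \<Union>?F" by blast
    qed
  qed
  moreover obtain F' where F': "F' \<subseteq> ?F" "countable F'" "\<Union>F' = \<Union>?F"
    by (rule Lindelof[of ?F]) auto
  moreover have "AE x in lebesgue. \<forall>B\<in>F'. x \<in> B \<longrightarrow> g x = 0"
    using F'(1) 2 by (intro AE_ball_countable'[OF _ F'(2)]) auto
  ultimately have "AE x in lebesgue. x \<in> U \<longrightarrow> g x = 0"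
    by (auto elim!: eventually_mono)
  then show ?thesis using U by (subst AE_restrict_space_iff) auto
qed

lemma locally_integrable_lincomb:
  fixes f g :: "'a::euclidean_space \<Rightarrow> 'b::euclidean_space"
  shows "locally_integrable U f \<Longrightarrow> locally_integrable U g \<Longrightarrow>
    locally_integrable U (\<lambda>x. a *\<^sub>R f x + b *\<^sub>R g x)"
  by (auto simp: locally_integrable_def)

lemma locally_integrable_inner:
  fixes f :: "'a::euclidean_space \<Rightarrow> 'b::euclidean_space"
  shows "locally_integrable U f \<Longrightarrow> locally_integrable U (\<lambda>x. f x \<bullet> b)"
  by (auto simp: locally_integrable_def)

lemma test_function_integrable:
  assumes "open U" "locally_integrable U f" "\<phi> \<in> test_functions U"
  shows "integrable (lebesgue_on U) (\<lambda>x. f x * \<phi> x)"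
    and "b \<in> Basis \<Longrightarrow> integrable (lebesgue_on U) (\<lambda>x. f x * frechet_derivative \<phi> (at x) b)"
proof -
  note t = test_functionsD[OF assms(3)]
  show "integrable (lebesgue_on U) (\<lambda>x. f x * \<phi> x)"
    using integrable_mult_compact_support[OF assms(2,1) t(1-3), OF t(4)] by (simp add: mult.commute)
  show "integrable (lebesgue_on U) (\<lambda>x. f x * frechet_derivative \<phi> (at x) b)" if "b \<in> Basis"
    using integrable_mult_compact_support[OF assms(2,1) t(6)[OF that] t(2,3), OF t(5)]
    by (simp add: mult.commute)
qed

lemma weak_gradient_unique:
  assumes U: "open U" and g: "is_weak_gradient U y g1" "is_weak_gradient U y g2"
  shows "AE x in lebesgue_on U. g1 x = g2 x"
proof -
  have loc: "locally_integrable U g1" "locally_integrable U g2"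
    using g by (auto simp: is_weak_gradient_def)
  have "AE x in lebesgue_on U. (g1 x - g2 x) \<bullet> b = 0" if b: "b \<in> Basis" for b
  proof (rule integral_test_functions_zero_imp_AE_zero[OF U])
    show "locally_integrable U (\<lambda>x. (g1 x - g2 x) \<bullet> b)"
      using locally_integrable_inner[OF locally_integrable_lincomb[OF loc, of 1 "-1"]] by simp
    fix \<phi> assume \<phi>: "\<phi> \<in> test_functions U"
    have "(\<integral>x. y x * frechet_derivative \<phi> (at x) b \<partial>lebesgue_on U)
        = - (\<integral>x. (g x \<bullet> b) * \<phi> x \<partial>lebesgue_on U)" if "g \<in> {g1, g2}" for g
      using g \<phi> b that unfolding is_weak_gradient_def by blast
    from this[of g1] this[of g2]
    have "(\<integral>x. (g1 x \<bullet> b) * \<phi> x \<partial>lebesgue_on U) = (\<integral>x. (g2 x \<bullet> b) * \<phi> x \<partial>lebesgue_on U)"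
      by simp
    moreover have "(\<integral>x. ((g1 x - g2 x) \<bullet> b) * \<phi> x \<partial>lebesgue_on U)
        = (\<integral>x. (g1 x \<bullet> b) * \<phi> x - (g2 x \<bullet> b) * \<phi> x \<partial>lebesgue_on U)"
      by (simp add: inner_diff_left left_diff_distrib)
    ultimately show "(\<integral>x. ((g1 x - g2 x) \<bullet> b) * \<phi> x \<partial>lebesgue_on U) = 0"
      using test_function_integrable(1)[OF U locally_integrable_inner[OF loc(1)] \<phi>]
        test_function_integrable(1)[OF U locally_integrable_inner[OF loc(2)] \<phi>] by simp
  qed
  then have "AE x in lebesgue_on U. \<forall>b\<in>Basis. (g1 x - g2 x) \<bullet> b = 0"
    by (intro AE_ball_countable') (auto simp: countable_finite)
  then show ?thesis
    by eventually_elim (auto simp: inner_diff_left intro: euclidean_eqI)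
qed

lemma is_weak_gradient_lincomb:
  assumes U: "open U" and 1: "is_weak_gradient U y1 g1" and 2: "is_weak_gradient U y2 g2"
  shows "is_weak_gradient U (\<lambda>x. a * y1 x + b * y2 x) (\<lambda>x. a *\<^sub>R g1 x + b *\<^sub>R g2 x)"
  unfolding is_weak_gradient_def
proof (intro conjI ballI)
  have l: "locally_integrable U y1" "locally_integrable U y2" "locally_integrable U g1" "locally_integrable U g2"
    using 1 2 by (auto simp: is_weak_gradient_def)
  show "locally_integrable U (\<lambda>x. a * y1 x + b * y2 x)"
    using locally_integrable_lincomb[OF l(1,2), of a b] by simp
  show "locally_integrable U (\<lambda>x. a *\<^sub>R g1 x + b *\<^sub>R g2 x)"
    using locally_integrable_lincomb[OF l(3,4)] by simp
  fix \<phi> and c :: 'a assume \<phi>: "\<phi> \<in> test_functions U" and c: "c \<in> Basis"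
  let ?D = "\<lambda>x. frechet_derivative \<phi> (at x) c"
  have eq: "(\<integral>x. y1 x * ?D x \<partial>lebesgue_on U) = - (\<integral>x. (g1 x \<bullet> c) * \<phi> x \<partial>lebesgue_on U)"
    "(\<integral>x. y2 x * ?D x \<partial>lebesgue_on U) = - (\<integral>x. (g2 x \<bullet> c) * \<phi> x \<partial>lebesgue_on U)"
    using 1 2 \<phi> c by (auto simp: is_weak_gradient_def)
  have "(\<integral>x. (a * y1 x + b * y2 x) * ?D x \<partial>lebesgue_on U)
      = (\<integral>x. a * (y1 x * ?D x) + b * (y2 x * ?D x) \<partial>lebesgue_on U)"
    by (simp add: algebra_simps)
  also have "\<dots> = - (a * (\<integral>x. (g1 x \<bullet> c) * \<phi> x \<partial>lebesgue_on U) + b * (\<integral>x. (g2 x \<bullet> c) * \<phi> x \<partial>lebesgue_on U))"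
    using test_function_integrable(2)[OF U l(1) \<phi> c] test_function_integrable(2)[OF U l(2) \<phi> c] eq
    by simp
  also have "a * (\<integral>x. (g1 x \<bullet> c) * \<phi> x \<partial>lebesgue_on U) + b * (\<integral>x. (g2 x \<bullet> c) * \<phi> x \<partial>lebesgue_on U)
      = (\<integral>x. a * ((g1 x \<bullet> c) * \<phi> x) + b * ((g2 x \<bullet> c) * \<phi> x) \<partial>lebesgue_on U)"
    using test_function_integrable(1)[OF U locally_integrable_inner[OF l(3)] \<phi>]
      test_function_integrable(1)[OF U locally_integrable_inner[OF l(4)] \<phi>] by simp
  also have "\<dots> = (\<integral>x. ((a *\<^sub>R g1 x + b *\<^sub>R g2 x) \<bullet> c) * \<phi> x \<partial>lebesgue_on U)"
    by (simp add: algebra_simps)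
  finally show "(\<integral>x. (a * y1 x + b * y2 x) * ?D x \<partial>lebesgue_on U)
      = - (\<integral>x. ((a *\<^sub>R g1 x + b *\<^sub>R g2 x) \<bullet> c) * \<phi> x \<partial>lebesgue_on U)" .
qed

lemma continuous_compact_support_bounded:
  fixes \<phi> :: "'a::euclidean_space \<Rightarrow> real"
  assumes "continuous_on UNIV \<phi>" "compact K" "\<And>x. x \<notin> K \<Longrightarrow> \<phi> x = 0"
  obtains B where "B \<ge> 0" "\<And>x. \<bar>\<phi> x\<bar> \<le> B"
proof -
  obtain B where B: "\<And>x. x \<in> K \<Longrightarrow> norm (\<phi> x) \<le> B"
    using compact_imp_bounded[OF compact_continuous_image[OF continuous_on_subset[OF assms(1)] assms(2)]]
    by (auto simp: bounded_iff)
  have "\<bar>\<phi> x\<bar> \<le> max B 0" for x using B[of x] assms(3)[of x] by (cases "x \<in> K") auto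
  then show ?thesis using that[of "max B 0"] by auto
qed

lemma tendsto_integral_mult_L1:
  fixes f :: "nat \<Rightarrow> 'a::euclidean_space \<Rightarrow> real"
  assumes f: "\<And>n. integrable M (f n)" "integrable M h"
    and lim: "(\<lambda>n. \<integral>x. \<bar>f n x - h x\<bar> \<partial>M) \<longlonglongrightarrow> 0"
    and \<phi>: "\<phi> \<in> borel_measurable M" "\<And>x. \<bar>\<phi> x\<bar> \<le> B"
  shows "(\<lambda>n. \<integral>x. f n x * \<phi> x \<partial>M) \<longlonglongrightarrow> (\<integral>x. h x * \<phi> x \<partial>M)"
proof -
  have B0: "0 \<le> B" using \<phi>(2) abs_ge_zero order_trans by blast
  have i: "integrable M (\<lambda>x. k x * \<phi> x)" if "integrable M k" for k
  proof (rule Bochner_Integration.integrable_bound)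
    show "integrable M (\<lambda>x. B * k x)" using that by simp
    show "AE x in M. norm (k x * \<phi> x) \<le> norm (B * k x)"
      using \<phi>(2) B0 by (intro AE_I2) (auto simp: abs_mult mult.commute intro!: mult_right_mono)
  qed (use that \<phi> in auto)
  have "norm ((\<integral>x. f n x * \<phi> x \<partial>M) - (\<integral>x. h x * \<phi> x \<partial>M)) \<le> B * (\<integral>x. \<bar>f n x - h x\<bar> \<partial>M)" for n
  proof -
    have "(\<integral>x. f n x * \<phi> x \<partial>M) - (\<integral>x. h x * \<phi> x \<partial>M) = (\<integral>x. (f n x - h x) * \<phi> x \<partial>M)"
      using i[OF f(1)[of n]] i[OF f(2)] by (simp add: left_diff_distrib)
    also have "norm \<dots> \<le> (\<integral>x. norm ((f n x - h x) * \<phi> x) \<partial>M)" by (rule integral_norm_bound)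
    also have "\<dots> \<le> (\<integral>x. B * \<bar>f n x - h x\<bar> \<partial>M)"
    proof (rule integral_mono)
      show "integrable M (\<lambda>x. norm ((f n x - h x) * \<phi> x))" using i[of "\<lambda>x. f n x - h x"] f by auto
      show "integrable M (\<lambda>x. B * \<bar>f n x - h x\<bar>)" using f by auto
      show "norm ((f n x - h x) * \<phi> x) \<le> B * \<bar>f n x - h x\<bar>" for x
        using \<phi>(2)[of x] by (auto simp: abs_mult mult.commute intro!: mult_right_mono)
    qed
    also have "\<dots> = B * (\<integral>x. \<bar>f n x - h x\<bar> \<partial>M)" by simp
    finally show ?thesis .
  qed
  then have "(\<lambda>n. (\<integral>x. f n x * \<phi> x \<partial>M) - (\<integral>x. h x * \<phi> x \<partial>M)) \<longlonglongrightarrow> 0"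
    by (intro Lim_null_comparison[OF always_eventually tendsto_mult_right_zero[OF lim, of B]] allI)
  then show ?thesis by (simp add: LIM_zero_iff)
qed

lemma integrable_imp_locally_integrable:
  fixes f :: "'a::euclidean_space \<Rightarrow> 'b::euclidean_space"
  assumes "integrable (lebesgue_on U) f" "open U"
  shows "locally_integrable U f"
  unfolding locally_integrable_def
proof (intro allI impI)
  fix K assume K: "compact K \<and> K \<subseteq> U"
  have "integrable lebesgue (\<lambda>x. indicator K x *\<^sub>R (indicator U x *\<^sub>R f x))"
    using assms(1) K
    by (intro integrable_mult_indicator integrable_restrict_space[THEN iffD1]) (simp_all add: assms(2))
  moreover have "(\<lambda>x. indicator K x *\<^sub>R (indicator U x *\<^sub>R f x)) = (\<lambda>x. indicator K x *\<^sub>R f x)"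
    using K by (auto simp: indicator_def fun_eq_iff)
  ultimately show "integrable (lebesgue_on K) f"
    using K integrable_restrict_space[of K lebesgue f] by simp
qed

lemma is_weak_gradient_limit:
  assumes U: "open U" and wg: "\<And>n. is_weak_gradient U (y n) (g n)"
    and i: "\<And>n. integrable (lebesgue_on U) (y n)" "\<And>n. integrable (lebesgue_on U) (g n)"
      "integrable (lebesgue_on U) y'" "integrable (lebesgue_on U) g'"
    and ly: "(\<lambda>n. \<integral>x. \<bar>y n x - y' x\<bar> \<partial>lebesgue_on U) \<longlonglongrightarrow> 0"
    and lg: "(\<lambda>n. \<integral>x. norm (g n x - g' x) \<partial>lebesgue_on U) \<longlonglongrightarrow> 0"
  shows "is_weak_gradient U y' g'"
  unfolding is_weak_gradient_def
proof (intro conjI ballI integrable_imp_locally_integrable i U)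
  fix \<phi> and b :: 'a assume \<phi>: "\<phi> \<in> test_functions U" and b: "b \<in> Basis"
  let ?D = "\<lambda>x. frechet_derivative \<phi> (at x) b"
  note t = test_functionsD[OF \<phi>]
  have m: "f \<in> borel_measurable (lebesgue_on U)" if "continuous_on UNIV f" for f :: "'a \<Rightarrow> real"
    using continuous_imp_measurable_on_sets_lebesgue[OF continuous_on_subset[OF that]] U by auto
  obtain B1 where B1: "\<And>x. \<bar>\<phi> x\<bar> \<le> B1"
    using continuous_compact_support_bounded[OF t(1,2)] t(4) by metis
  obtain B2 where B2: "\<And>x. \<bar>?D x\<bar> \<le> B2"
    using continuous_compact_support_bounded[OF t(6)[OF b] t(2)] t(5) by metis
  have 1: "(\<lambda>n. \<integral>x. y n x * ?D x \<partial>lebesgue_on U) \<longlonglongrightarrow> (\<integral>x. y' x * ?D x \<partial>lebesgue_on U)"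
    using B2 by (intro tendsto_integral_mult_L1[OF i(1,3) ly] m t(6)[OF b])
  have lg': "(\<lambda>n. \<integral>x. \<bar>g n x \<bullet> b - g' x \<bullet> b\<bar> \<partial>lebesgue_on U) \<longlonglongrightarrow> 0"
  proof (rule Lim_null_comparison[OF always_eventually lg], intro allI)
    fix n
    have "(\<integral>x. \<bar>g n x \<bullet> b - g' x \<bullet> b\<bar> \<partial>lebesgue_on U) \<le> (\<integral>x. norm (g n x - g' x) \<partial>lebesgue_on U)"
      using i b by (intro integral_mono) (auto simp: inner_diff_left[symmetric] Basis_le_norm)
    then show "norm (\<integral>x. \<bar>g n x \<bullet> b - g' x \<bullet> b\<bar> \<partial>lebesgue_on U) \<le> (\<integral>x. norm (g n x - g' x) \<partial>lebesgue_on U)"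
      by simp
  qed
  have 2: "(\<lambda>n. \<integral>x. (g n x \<bullet> b) * \<phi> x \<partial>lebesgue_on U) \<longlonglongrightarrow> (\<integral>x. (g' x \<bullet> b) * \<phi> x \<partial>lebesgue_on U)"
    using B1 by (intro tendsto_integral_mult_L1[OF _ _ lg'] m t(1) integrable_inner_left i)
  have "(\<integral>x. y n x * ?D x \<partial>lebesgue_on U) = - (\<integral>x. (g n x \<bullet> b) * \<phi> x \<partial>lebesgue_on U)" for n
    using wg \<phi> b by (auto simp: is_weak_gradient_def)
  then show "(\<integral>x. y' x * ?D x \<partial>lebesgue_on U) = - (\<integral>x. (g' x \<bullet> b) * \<phi> x \<partial>lebesgue_on U)"
    using LIMSEQ_unique[OF 1] tendsto_minus[OF 2] by simp
qed

subsection \<open>Lebesgue spaces\<close>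

definition Lp_on :: "real \<Rightarrow> 'a measure \<Rightarrow> ('a \<Rightarrow> 'b::euclidean_space) set" where
  "Lp_on p M = {f \<in> borel_measurable M. integrable M (\<lambda>x. norm (f x) powr p)}"

lemma Lp_eq_Lp_on: "Lp p S = Lp_on p (lebesgue_on S)"
  by (simp add: Lp_def Lp_on_def)

lemma Lp_onD:
  assumes "f \<in> Lp_on p M"
  shows "f \<in> borel_measurable M" "integrable M (\<lambda>x. norm (f x) powr p)"
  using assms by (auto simp: Lp_on_def)

lemma powr_add_le:
  fixes a b p :: real
  assumes "0 \<le> a" "0 \<le> b" "0 < p"
  shows "(a + b) powr p \<le> 2 powr p * (a powr p + b powr p)"
proof -
  have "(a + b) powr p \<le> (2 * max a b) powr p" using assms by (intro powr_mono2) auto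
  also have "\<dots> = 2 powr p * max a b powr p" using assms by (intro powr_mult)
  also have "max a b powr p \<le> a powr p + b powr p" by (auto simp: max_def)
  finally show ?thesis by (simp add: mult_left_mono)
qed

lemma young_scaled:
  fixes a p :: real
  assumes "1 < p" "0 < t" "0 \<le> a"
  shows "a \<le> t powr (p - 1) * a powr p + 1 / t"
proof (cases "a \<le> 1 / t")
  case True
  then show ?thesis using assms by (smt (verit) mult_nonneg_nonneg powr_ge_zero)
next
  case False
  then have ta: "1 \<le> t * a" and a: "a > 0"
    using assms by (auto simp: field_simps) (cases "a = 0"; simp)
  have "a * 1 \<le> a * (t * a) powr (p - 1)"
    using a assms ta by (intro mult_left_mono ge_one_powr_ge_zero) auto
  also have "\<dots> = t powr (p - 1) * (a powr (p - 1) * a powr 1)"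
    using a assms by (simp add: powr_mult)
  also have "a powr (p - 1) * a powr 1 = a powr p" by (simp only: powr_add[symmetric]) simp
  finally show ?thesis using assms by (smt (verit) divide_pos_pos)
qed

lemma young_mixed:
  fixes X Y p :: real
  assumes "1 < p" "0 < t" "0 \<le> X" "0 \<le> Y"
  shows "X powr (p - 1) * Y \<le> t * X powr p + t powr (1 - p) * Y powr p"
proof (cases "Y \<le> t * X")
  case True
  have "X powr (p - 1) * Y \<le> X powr (p - 1) * (t * X)" using True by (intro mult_left_mono) auto
  also have "\<dots> = t * X powr p"
    using assms by (cases "X = 0") (auto simp: powr_diff)
  finally show ?thesis using assms by (smt (verit) mult_nonneg_nonneg powr_ge_zero)
next
  case False
  then have Y: "Y > 0" "X \<le> Y / t" using assms by (auto simp: field_simps) (smt (verit) mult_nonneg_nonneg)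
  have "X powr (p - 1) * Y \<le> (Y / t) powr (p - 1) * Y"
    using Y assms by (intro mult_right_mono powr_mono2) auto
  also have "\<dots> = t powr (1 - p) * Y powr p"
    using Y assms by (simp add: powr_divide powr_diff field_simps)
  finally show ?thesis using assms by (smt (verit) mult_nonneg_nonneg powr_ge_zero)
qed

lemma Lp_on_lincomb:
  fixes f g :: "'a \<Rightarrow> 'b::euclidean_space"
  assumes f: "f \<in> Lp_on p M" and g: "g \<in> Lp_on p M" and p: "0 < p"
  shows "(\<lambda>x. a *\<^sub>R f x + b *\<^sub>R g x) \<in> Lp_on p M"
proof -
  note [measurable] = Lp_onD(1)[OF f] Lp_onD(1)[OF g]
  have "integrable M (\<lambda>x. norm (a *\<^sub>R f x + b *\<^sub>R g x) powr p)"
  proof (rule Bochner_Integration.integrable_bound)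
    show "integrable M (\<lambda>x. 2 powr p * (\<bar>a\<bar> powr p * norm (f x) powr p + \<bar>b\<bar> powr p * norm (g x) powr p))"
      using Lp_onD(2)[OF f] Lp_onD(2)[OF g] by auto
    have "norm (a *\<^sub>R f x + b *\<^sub>R g x) powr p
        \<le> 2 powr p * (\<bar>a\<bar> powr p * norm (f x) powr p + \<bar>b\<bar> powr p * norm (g x) powr p)" for x
    proof -
      have "norm (a *\<^sub>R f x + b *\<^sub>R g x) powr p \<le> (\<bar>a\<bar> * norm (f x) + \<bar>b\<bar> * norm (g x)) powr p"
        using p by (intro powr_mono2) (auto intro: norm_triangle_le)
      also have "\<dots> \<le> 2 powr p * ((\<bar>a\<bar> * norm (f x)) powr p + (\<bar>b\<bar> * norm (g x)) powr p)"
        using p by (intro powr_add_le) auto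
      finally show ?thesis by (simp add: powr_mult)
    qed
    then show "AE x in M. norm (norm (a *\<^sub>R f x + b *\<^sub>R g x) powr p)
      \<le> norm (2 powr p * (\<bar>a\<bar> powr p * norm (f x) powr p + \<bar>b\<bar> powr p * norm (g x) powr p))"
      by (intro AE_I2) (smt (verit) norm_of_real powr_ge_zero real_norm_def)
  qed measurable
  then show ?thesis by (simp add: Lp_on_def)
qed

lemma Lp_on_diff:
  fixes f g :: "'a \<Rightarrow> 'b::euclidean_space"
  assumes "f \<in> Lp_on p M" "g \<in> Lp_on p M" "0 < p"
  shows "(\<lambda>x. f x - g x) \<in> Lp_on p M"
  using Lp_on_lincomb[OF assms, of 1 "-1"] by simp

lemma Lp_on_zero: "(\<lambda>x. 0) \<in> Lp_on p M"
  by (simp add: Lp_on_def)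

lemma conj_exp_props:
  assumes "1 < p"
  shows "1 < conj_exp p" "1 / (p - 1) * p = conj_exp p" "(p - 1) * conj_exp p = p"
    "conj_exp (conj_exp p) = p" "conj_exp p - 1 = 1 / (p - 1)"
  using assms by (auto simp: conj_exp_def field_simps)

lemma norm_mult_le_powr:
  fixes f v p :: real
  assumes "1 < p" "0 \<le> f" "0 \<le> v"
  shows "f * v \<le> f powr conj_exp p + v powr p"
proof -
  have "(f powr (1 / (p - 1))) powr (p - 1) = f" using assms by (simp add: powr_powr)
  moreover have "(f powr (1 / (p - 1))) powr p = f powr conj_exp p"
    using assms by (simp add: powr_powr conj_exp_props(2)[symmetric])
  ultimately show ?thesis using young_mixed[of p 1 "f powr (1 / (p - 1))" v] assms by simp
qed

lemma Lp_on_pairing_integrable: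
  fixes f v :: "'a \<Rightarrow> 'b::euclidean_space"
  assumes p: "1 < p" and f: "f \<in> Lp_on (conj_exp p) M" and v: "v \<in> Lp_on p M"
  shows "integrable M (\<lambda>x. f x \<bullet> v x)" "integrable M (\<lambda>x. norm (f x) * norm (v x))"
    "\<bar>\<integral>x. f x \<bullet> v x \<partial>M\<bar> \<le> (\<integral>x. norm (f x) powr conj_exp p \<partial>M) + (\<integral>x. norm (v x) powr p \<partial>M)"
proof -
  note [measurable] = Lp_onD(1)[OF f] Lp_onD(1)[OF v]
  have i: "integrable M (\<lambda>x. norm (f x) powr conj_exp p + norm (v x) powr p)"
    using Lp_onD(2)[OF f] Lp_onD(2)[OF v] by auto
  have b: "norm (f x) * norm (v x) \<le> norm (f x) powr conj_exp p + norm (v x) powr p" for x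
    using p by (intro norm_mult_le_powr) auto
  have b': "\<bar>f x \<bullet> v x\<bar> \<le> norm (f x) powr conj_exp p + norm (v x) powr p" for x
    using b[of x] Cauchy_Schwarz_ineq2[of "f x" "v x"] by linarith
  show 1: "integrable M (\<lambda>x. f x \<bullet> v x)"
    by (rule Bochner_Integration.integrable_bound[OF i]) (use b' in \<open>auto intro!: AE_I2\<close>)
  show "integrable M (\<lambda>x. norm (f x) * norm (v x))"
    by (rule Bochner_Integration.integrable_bound[OF i]) (use b in \<open>auto intro!: AE_I2\<close>)
  have "\<bar>\<integral>x. f x \<bullet> v x \<partial>M\<bar> \<le> (\<integral>x. \<bar>f x \<bullet> v x\<bar> \<partial>M)"
    by (rule integral_abs_bound)
  also have "\<dots> \<le> (\<integral>x. norm (f x) powr conj_exp p + norm (v x) powr p \<partial>M)"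
    using 1 i b' by (intro integral_mono) auto
  also have "\<dots> = (\<integral>x. norm (f x) powr conj_exp p \<partial>M) + (\<integral>x. norm (v x) powr p \<partial>M)"
    using Lp_onD(2)[OF f] Lp_onD(2)[OF v] by (intro Bochner_Integration.integral_add)
  finally show "\<bar>\<integral>x. f x \<bullet> v x \<partial>M\<bar>
    \<le> (\<integral>x. norm (f x) powr conj_exp p \<partial>M) + (\<integral>x. norm (v x) powr p \<partial>M)" .
qed

lemma Lp_on_imp_integrable:
  fixes v :: "'a \<Rightarrow> 'b::euclidean_space"
  assumes p: "1 < p" and M: "finite_measure M" and v: "v \<in> Lp_on p M" and t: "0 < t"
  shows "integrable M v"
    "(\<integral>x. norm (v x) \<partial>M) \<le> t powr (p - 1) * (\<integral>x. norm (v x) powr p \<partial>M) + measure M (space M) / t"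
proof -
  interpret finite_measure M by fact
  note [measurable] = Lp_onD(1)[OF v]
  have i: "integrable M (\<lambda>x. t powr (p - 1) * norm (v x) powr p + 1 / t)"
    using Lp_onD(2)[OF v] by auto
  have b: "norm (v x) \<le> t powr (p - 1) * norm (v x) powr p + 1 / t" for x
    using young_scaled[OF p t, of "norm (v x)"] by simp
  show 1: "integrable M v"
    by (rule Bochner_Integration.integrable_bound[OF i])
       (use b in \<open>auto intro!: AE_I2 order_trans[OF _ abs_ge_self]\<close>)
  have "(\<integral>x. norm (v x) \<partial>M) \<le> (\<integral>x. t powr (p - 1) * norm (v x) powr p + 1 / t \<partial>M)"
    using 1 i b by (intro integral_mono) auto
  also have "\<dots> = t powr (p - 1) * (\<integral>x. norm (v x) powr p \<partial>M) + measure M (space M) / t"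
    using Lp_onD(2)[OF v] by (subst Bochner_Integration.integral_add) auto
  finally show "(\<integral>x. norm (v x) \<partial>M)
    \<le> t powr (p - 1) * (\<integral>x. norm (v x) powr p \<partial>M) + measure M (space M) / t" .
qed

lemma Lp_convergence_imp_L1:
  fixes v :: "nat \<Rightarrow> 'a \<Rightarrow> 'b::euclidean_space"
  assumes p: "1 < p" and M: "finite_measure M" and v: "\<And>n. v n \<in> Lp_on p M" "u \<in> Lp_on p M"
    and lim: "(\<lambda>n. \<integral>x. norm (v n x - u x) powr p \<partial>M) \<longlonglongrightarrow> 0"
  shows "(\<lambda>n. \<integral>x. norm (v n x - u x) \<partial>M) \<longlonglongrightarrow> 0"
proof (rule LIMSEQ_I)
  fix r :: real assume r: "r > 0"
  define t where "t = 2 * (measure M (space M) + 1) / r"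
  have t: "t > 0" using r by (auto simp: t_def add_nonneg_pos)
  have mt: "measure M (space M) / t < r / 2"
    using r by (simp add: t_def divide_simps add_nonneg_pos)
  have "(\<lambda>n. t powr (p - 1) * (\<integral>x. norm (v n x - u x) powr p \<partial>M)) \<longlonglongrightarrow> 0"
    using lim by (rule tendsto_mult_right_zero)
  then obtain N where N: "\<And>n. n \<ge> N \<Longrightarrow> norm (t powr (p - 1) * (\<integral>x. norm (v n x - u x) powr p \<partial>M)) < r / 2"
    using r LIMSEQ_D[of _ 0 "r/2"] by force
  have "norm ((\<integral>x. norm (v n x - u x) \<partial>M) - 0) < r" if "n \<ge> N" for n
  proof -
    have "(\<integral>x. norm (v n x - u x) \<partial>M)
        \<le> t powr (p - 1) * (\<integral>x. norm (v n x - u x) powr p \<partial>M) + measure M (space M) / t"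
      using p by (intro Lp_on_imp_integrable(2)[OF p M _ t] Lp_on_diff v) auto
    moreover have "t powr (p - 1) * (\<integral>x. norm (v n x - u x) powr p \<partial>M) < r / 2"
      using N[OF that] unfolding real_norm_def by linarith
    moreover have "0 \<le> (\<integral>x. norm (v n x - u x) \<partial>M)" by simp
    ultimately show ?thesis using mt unfolding real_norm_def by linarith
  qed
  then show "\<exists>N. \<forall>n\<ge>N. norm ((\<integral>x. norm (v n x - u x) \<partial>M) - 0) < r" by blast
qed

lemma convergent_if_geometric_differences:
  fixes z :: "nat \<Rightarrow> 'b::banach"
  assumes "\<And>k. norm (z (Suc k) - z k) \<le> C * (1/2) ^ k"
  shows "convergent z"
proof -
  have "summable (\<lambda>k. C * (1/2::real) ^ k)" by (intro summable_mult summable_geometric) simp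
  then have "summable (\<lambda>k. z (Suc k) - z k)"
    by (rule summable_comparison_test'[where N=0]) (rule assms)
  then have "convergent (\<lambda>n. \<Sum>k<n. z (Suc k) - z k)" by (simp add: summable_iff_convergent)
  then have "convergent (\<lambda>n. z n - z 0)" by (simp add: sum_lessThan_telescope)
  then show ?thesis by (simp add: convergent_diff_const_right_iff)
qed

lemma Lp_on_complete:
  fixes v :: "nat \<Rightarrow> 'a \<Rightarrow> 'b::euclidean_space"
  assumes p: "1 < p" and v: "\<And>n. v n \<in> Lp_on p M"
    and cau: "\<And>e. e > 0 \<Longrightarrow> \<exists>N. \<forall>m\<ge>N. \<forall>n\<ge>N. (\<integral>x. norm (v m x - v n x) powr p \<partial>M) \<le> e"
  obtains u where "u \<in> Lp_on p M" "(\<lambda>n. \<integral>x. norm (v n x - u x) powr p \<partial>M) \<longlonglongrightarrow> 0"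
proof -
  note [measurable] = Lp_onD(1)[OF v]
  have vd: "(\<lambda>x. v m x - v n x) \<in> Lp_on p M" for m n using p by (intro Lp_on_diff v) auto
  have nn: "(\<integral>\<^sup>+x. ennreal (norm (v m x - v n x) powr p) \<partial>M) = ennreal (\<integral>x. norm (v m x - v n x) powr p \<partial>M)" for m n
    using Lp_onD(2)[OF vd] by (intro nn_integral_eq_integral) auto
  define e where "e k = (1/2) ^ k * (1 / 2 powr p) ^ k" for k :: nat
  have e0: "e k > 0" for k by (auto simp: e_def)
  obtain N where N: "\<And>k m n. m \<ge> N k \<Longrightarrow> n \<ge> N k \<Longrightarrow> (\<integral>x. norm (v m x - v n x) powr p \<partial>M) \<le> e k"
    using cau[OF e0] by metis
  define r where "r k = (\<Sum>j\<le>k. N j)" for k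
  have rN: "r j \<ge> N k" if "k \<le> j" for j k
    unfolding r_def using that by (intro member_le_sum) auto
  define w where "w k x = norm (v (r (Suc k)) x - v (r k) x) powr p * (2 powr p) ^ k" for k x
  have [measurable]: "w k \<in> borel_measurable M" for k unfolding w_def by measurable
  have wint: "(\<integral>\<^sup>+x. ennreal (w k x) \<partial>M) \<le> ennreal ((1/2)^k)" for k
  proof -
    have "(\<integral>\<^sup>+x. ennreal (w k x) \<partial>M)
        = (\<integral>\<^sup>+x. ennreal (norm (v (r (Suc k)) x - v (r k) x) powr p) * ennreal ((2 powr p) ^ k) \<partial>M)"
      by (simp add: w_def ennreal_mult)
    also have "\<dots> = ennreal (\<integral>x. norm (v (r (Suc k)) x - v (r k) x) powr p \<partial>M) * ennreal ((2 powr p) ^ k)"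
      by (subst nn_integral_multc) (simp_all add: nn)
    also have "\<dots> \<le> ennreal (e k) * ennreal ((2 powr p) ^ k)"
      by (intro mult_right_mono ennreal_leI N rN) auto
    also have "\<dots> = ennreal ((1/2)^k)"
      by (subst ennreal_mult[symmetric]) (auto simp: e_def power_one_over)
    finally show ?thesis .
  qed
  have "(\<integral>\<^sup>+x. (\<Sum>k. ennreal (w k x)) \<partial>M) = (\<Sum>k. \<integral>\<^sup>+x. ennreal (w k x) \<partial>M)"
    by (rule nn_integral_suminf) simp
  also have "\<dots> \<le> (\<Sum>k. ennreal ((1/2)^k))" by (intro suminf_le wint) auto
  also have "\<dots> = ennreal (\<Sum>k. (1/2)^k)" by (intro suminf_ennreal2 summable_geometric) auto
  finally have "(\<integral>\<^sup>+x. (\<Sum>k. ennreal (w k x)) \<partial>M) \<noteq> \<infinity>" by (auto simp: top_unique)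
  then have ae: "AE x in M. (\<Sum>k. ennreal (w k x)) \<noteq> \<infinity>"
    by (intro nn_integral_PInf_AE) auto
  define u where "u x = lim (\<lambda>k. v (r k) x)" for x
  have um [measurable]: "u \<in> borel_measurable M"
    unfolding u_def by (rule borel_measurable_lim_metric) measurable
  have conv: "AE x in M. (\<lambda>k. v (r k) x) \<longlonglongrightarrow> u x"
    using ae
  proof eventually_elim
    case (elim x)
    define C where "C = enn2real (\<Sum>k. ennreal (w k x))"
    have "w k x \<le> C" for k
    proof -
      have "ennreal (w k x) \<le> (\<Sum>k. ennreal (w k x))"
        using sum_le_suminf[of "\<lambda>k. ennreal (w k x)" "{k}"] by simp
      then show ?thesis unfolding C_def using elim
        by (metis enn2real_ennreal enn2real_mono infinity_ennreal_def less_top w_def mult_nonneg_nonneg powr_ge_zero zero_le_power)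
    qed
    have "norm (v (r (Suc k)) x - v (r k) x) \<le> C powr (1/p) * (1/2)^k" for k
    proof -
      have 2: "(2 powr p) ^ k = (2 ^ k) powr p"
        by (simp add: powr_realpow[symmetric] powr_powr mult.commute)
      have "(norm (v (r (Suc k)) x - v (r k) x) * 2 ^ k) powr p \<le> C"
        using \<open>w k x \<le> C\<close> by (simp add: w_def 2 powr_mult)
      then have "((norm (v (r (Suc k)) x - v (r k) x) * 2 ^ k) powr p) powr (1/p) \<le> C powr (1/p)"
        using p by (intro powr_mono2) auto
      then have "norm (v (r (Suc k)) x - v (r k) x) * 2 ^ k \<le> C powr (1/p)"
        using p by (simp add: powr_powr)
      then show ?thesis by (simp add: power_one_over field_simps)
    qed
    then have "convergent (\<lambda>k. v (r k) x)"
      by (rule convergent_if_geometric_differences)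
    then show ?case unfolding u_def by (simp add: convergent_LIMSEQ_iff)
  qed
  have fatou: "(\<integral>\<^sup>+x. ennreal (norm (v n x - u x) powr p) \<partial>M) \<le> ennreal (e k)" if n: "n \<ge> N k" for n k
  proof -
    have "(\<integral>\<^sup>+x. ennreal (norm (v n x - u x) powr p) \<partial>M)
        = (\<integral>\<^sup>+x. liminf (\<lambda>j. ennreal (norm (v n x - v (r j) x) powr p)) \<partial>M)"
      using conv
    proof (intro nn_integral_cong_AE, eventually_elim)
      case (elim x)
      have "(\<lambda>j. ennreal (norm (v n x - v (r j) x) powr p)) \<longlonglongrightarrow> ennreal (norm (v n x - u x) powr p)"
        using p by (intro tendsto_ennrealI tendsto_powr' tendsto_norm tendsto_diff tendsto_const elim) auto
      then show ?case by (rule lim_imp_Liminf[OF trivial_limit_sequentially, symmetric])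
    qed
    also have "\<dots> \<le> liminf (\<lambda>j. \<integral>\<^sup>+x. ennreal (norm (v n x - v (r j) x) powr p) \<partial>M)"
      by (rule nn_integral_liminf) measurable
    also have "\<dots> \<le> limsup (\<lambda>j. \<integral>\<^sup>+x. ennreal (norm (v n x - v (r j) x) powr p) \<partial>M)"
      by (rule Liminf_le_Limsup) simp
    also have "\<dots> \<le> ennreal (e k)"
    proof (rule Limsup_bounded)
      show "\<forall>\<^sub>F j in sequentially. (\<integral>\<^sup>+x. ennreal (norm (v n x - v (r j) x) powr p) \<partial>M) \<le> ennreal (e k)"
        using eventually_ge_at_top[of k]
        by eventually_elim (auto simp: nn intro!: ennreal_leI N n rN)
    qed
    finally show ?thesis .
  qed
  have fin: "(\<lambda>x. v n x - u x) \<in> Lp_on p M" "(\<integral>x. norm (v n x - u x) powr p \<partial>M) \<le> e k"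
    if "n \<ge> N k" for n k
  proof -
    have "integrable M (\<lambda>x. norm (v n x - u x) powr p)"
      using fatou[OF that] by (intro integrableI_nonneg) (auto simp: le_less_trans[OF _ ennreal_less_top])
    then show "(\<lambda>x. v n x - u x) \<in> Lp_on p M" "(\<integral>x. norm (v n x - u x) powr p \<partial>M) \<le> e k"
      using fatou[OF that] e0[of k] by (auto simp: Lp_on_def nn_integral_eq_integral)
  qed
  have "(\<lambda>x. v (N 0) x - (v (N 0) x - u x)) \<in> Lp_on p M"
    using p by (intro Lp_on_diff v fin(1)[of 0]) auto
  then have "u \<in> Lp_on p M" by simp
  moreover have "(\<lambda>n. \<integral>x. norm (v n x - u x) powr p \<partial>M) \<longlonglongrightarrow> 0"
  proof (rule LIMSEQ_I)
    fix s :: real assume s: "s > 0"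
    obtain k where k: "(1/2) ^ k < s" using real_arch_pow_inv[OF s, of "1/2"] by auto
    have "(1 / 2 powr p) ^ k \<le> 1" using p by (intro power_le_one) (auto simp: ge_one_powr_ge_zero)
    then have "e k \<le> (1/2)^k * 1" unfolding e_def by (intro mult_left_mono) auto
    then have "norm ((\<integral>x. norm (v n x - u x) powr p \<partial>M) - 0) < s" if "n \<ge> N k" for n
      using fin(2)[OF that] k by simp
    then show "\<exists>n0. \<forall>n\<ge>n0. norm ((\<integral>x. norm (v n x - u x) powr p \<partial>M) - 0) < s" by blast
  qed
  ultimately show ?thesis using that by blast
qed

subsection \<open>Uniform convexity\<close>

lemma powr_strict_midpoint:
  fixes x y p :: real
  assumes p: "1 < p" and xy: "0 \<le> x" "x < y"
  shows "((x + y) / 2) powr p < (x powr p + y powr p) / 2"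
proof -
  let ?f = "\<lambda>x::real. x powr p" and ?t = "(x + y) / 2"
  have c: "continuous_on {a..b} ?f" if "0 \<le> a" for a b
    using p that by (intro continuous_on_powr' continuous_intros) auto
  have d: "(?f has_real_derivative p * z powr (p - 1)) (at z)" if "z > 0" for z
    using that by (rule has_real_derivative_powr)
  have mvt: "\<exists>z. a < z \<and> z < b \<and> ?f b - ?f a = (b - a) * (p * z powr (p - 1))" if ab: "0 \<le> a" "a < b" for a b
  proof -
    have "\<exists>l z. a < z \<and> z < b \<and> (?f has_real_derivative l) (at z) \<and> ?f b - ?f a = (b - a) * l"
    proof (rule MVT[OF ab(2) c[OF ab(1)]])
      show "?f differentiable (at z)" if "a < z" "z < b" for z
        using d[of z] that ab by (auto simp: real_differentiable_def)
    qed
    then obtain l z where *: "a < z" "z < b" "(?f has_real_derivative l) (at z)" "?f b - ?f a = (b - a) * l" by auto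
    moreover have "l = p * z powr (p - 1)" using * ab by (intro DERIV_unique[OF *(3) d]) auto
    ultimately show ?thesis by blast
  qed
  obtain z1 where z1: "x < z1" "z1 < ?t" "?f ?t - ?f x = (?t - x) * (p * z1 powr (p - 1))"
    using mvt[of x ?t] xy by auto
  obtain z2 where z2: "?t < z2" "z2 < y" "?f y - ?f ?t = (y - ?t) * (p * z2 powr (p - 1))"
    using mvt[of ?t y] xy by auto
  have "z1 powr (p - 1) < z2 powr (p - 1)" using z1 z2 xy p by (intro powr_less_mono2) auto
  moreover have eq: "?t - x = (y - x) / 2" "y - ?t = (y - x) / 2" by (simp_all add: field_simps)
  ultimately have "(?t - x) * (p * z1 powr (p - 1)) < (y - ?t) * (p * z2 powr (p - 1))"
    unfolding eq using xy p by (intro mult_strict_left_mono) auto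
  then show ?thesis using z1 z2 by simp
qed

lemma norm_powr_midpoint:
  fixes a b :: "'b::euclidean_space"
  assumes p: "1 < p"
  shows "norm ((1/2) *\<^sub>R a + (1/2) *\<^sub>R b) powr p \<le> (norm a powr p + norm b powr p) / 2"
    and "a \<noteq> b \<Longrightarrow> norm ((1/2) *\<^sub>R a + (1/2) *\<^sub>R b) powr p < (norm a powr p + norm b powr p) / 2"
proof -
  let ?m = "(1/2) *\<^sub>R a + (1/2) *\<^sub>R b"
  have mid: "norm ?m \<le> (norm a + norm b) / 2"
    using norm_triangle_ineq[of "(1/2) *\<^sub>R a" "(1/2) *\<^sub>R b"] by simp
  then have mp: "norm ?m powr p \<le> ((norm a + norm b) / 2) powr p"
    using p by (intro powr_mono2) auto
  show strict: "norm ?m powr p < (norm a powr p + norm b powr p) / 2" if ne: "a \<noteq> b"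
  proof (cases "norm a = norm b")
    case False
    then have "((norm a + norm b) / 2) powr p < (norm a powr p + norm b powr p) / 2"
      using powr_strict_midpoint[OF p, of "norm a" "norm b"] powr_strict_midpoint[OF p, of "norm b" "norm a"]
      by (auto simp: add.commute neq_iff)
    then show ?thesis using mp by linarith
  next
    case True
    have "(norm (a + b))\<^sup>2 + (norm (a - b))\<^sup>2 = 2 * ((norm a)\<^sup>2 + (norm b)\<^sup>2)"
      by (simp add: power2_norm_eq_inner algebra_simps)
    then have "(norm (a + b))\<^sup>2 < (2 * norm a)\<^sup>2" using ne True
      by (simp add: power_mult_distrib) (smt (verit) norm_eq_zero right_minus_eq zero_less_power2)
    then have "norm (a + b) < 2 * norm a" by (rule power2_less_imp_less) simp
    moreover have "norm ?m = norm (a + b) / 2" by (simp add: scaleR_add_right[symmetric])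
    ultimately have "norm ?m < norm a" by simp
    then have "norm ?m powr p < norm a powr p" using p by (intro powr_less_mono2) auto
    then show ?thesis using True by simp
  qed
  show "norm ?m powr p \<le> (norm a powr p + norm b powr p) / 2"
    using strict by (cases "a = b") (auto simp: scaleR_add_left[symmetric] less_imp_le)
qed

lemma norm_powr_uniformly_convex:
  assumes p: "1 < p" and t: "0 < t"
  shows "\<exists>c>0. \<forall>a b :: 'b::euclidean_space. norm (a - b) powr p
    \<le> t * (norm a powr p + norm b powr p)
      + c * ((norm a powr p + norm b powr p) / 2 - norm ((1/2) *\<^sub>R a + (1/2) *\<^sub>R b) powr p)"
proof -
  define df where "df = (\<lambda>z::'b\<times>'b. (norm (fst z) powr p + norm (snd z) powr p) / 2
      - norm ((1/2) *\<^sub>R fst z + (1/2) *\<^sub>R snd z) powr p)"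
  define S where "S = {z::'b\<times>'b. norm (fst z) powr p + norm (snd z) powr p = 1
      \<and> norm (fst z - snd z) powr p \<ge> t}"
  have df0: "df z \<ge> 0" for z using norm_powr_midpoint(1)[OF p, of "fst z" "snd z"] by (simp add: df_def)
  have cpow: "continuous_on UNIV (\<lambda>z. norm (h z) powr p)" if "continuous_on UNIV h" for h :: "'b\<times>'b \<Rightarrow> 'b"
    using p that by (intro continuous_on_powr' continuous_intros) auto
  have le1: "norm a \<le> 1" if "norm a powr p + norm b powr p = 1" for a b :: 'b
  proof (rule ccontr)
    assume "\<not> norm a \<le> 1"
    then have "1 powr p < norm a powr p" using p by (intro powr_less_mono2) auto
    then show False using that powr_ge_zero[of "norm b" p] by simp
  qed
  have "compact S"
    unfolding compact_eq_bounded_closed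
  proof
    have "norm z \<le> 2" if "z \<in> S" for z
    proof -
      have "norm (fst z) \<le> 1" "norm (snd z) \<le> 1"
        using that le1[of "fst z" "snd z"] le1[of "snd z" "fst z"] by (auto simp: S_def add.commute)
      then show ?thesis using norm_Pair_le[of "fst z" "snd z"] by simp
    qed
    then show "bounded S" unfolding bounded_iff by blast
    have "closed {z::'b\<times>'b. norm (fst z) powr p + norm (snd z) powr p = 1}"
      by (intro closed_Collect_eq continuous_on_add cpow continuous_intros)
    moreover have "closed {z::'b\<times>'b. t \<le> norm (fst z - snd z) powr p}"
      by (intro closed_Collect_le cpow continuous_intros)
    ultimately show "closed S" unfolding S_def by (auto simp: Collect_conj_eq intro: closed_Int)
  qed
  have cdf: "continuous_on S df"
    unfolding df_def
    by (rule continuous_on_subset[of UNIV]) (intro continuous_on_diff continuous_on_divide continuous_on_add cpow continuous_intros, auto)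
  obtain m where m: "m > 0" "\<And>z. z \<in> S \<Longrightarrow> m \<le> df z"
  proof (cases "S = {}")
    case True then show ?thesis using that[of 1] by auto
  next
    case False
    obtain z where z: "z \<in> S" "\<And>y. y \<in> S \<Longrightarrow> df z \<le> df y"
      using continuous_attains_inf[OF \<open>compact S\<close> False cdf] by auto
    have "fst z \<noteq> snd z" using z(1) t by (auto simp: S_def)
    then have "df z > 0" using norm_powr_midpoint(2)[OF p, of "fst z" "snd z"] by (simp add: df_def)
    then show ?thesis using that z by blast
  qed
  let ?c = "2 powr p / m"
  have c0: "?c > 0" using m by simp
  have unit: "norm (a - b) powr p \<le> t + ?c * df (a, b)" if "norm a powr p + norm b powr p = 1" for a b :: 'b
  proof (cases "norm (a - b) powr p \<ge> t")
    case True
    then have "m \<le> df (a, b)" using that m(2)[of "(a, b)"] by (auto simp: S_def)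
    then have "?c * m \<le> ?c * df (a, b)" using c0 by (intro mult_left_mono) auto
    moreover have "norm (a - b) \<le> 2"
      using le1[of a b] le1[of b a] that norm_triangle_ineq4[of a b] by (simp add: add.commute)
    then have "norm (a - b) powr p \<le> 2 powr p" using p by (intro powr_mono2) auto
    ultimately show ?thesis using m t by simp
  next
    case False
    then show ?thesis using df0[of "(a, b)"] c0 by (smt (verit) mult_nonneg_nonneg)
  qed
  have "norm (a - b) powr p \<le> t * (norm a powr p + norm b powr p) + ?c * df (a, b)" for a b :: 'b
  proof (cases "a = 0 \<and> b = 0")
    case True then show ?thesis using p by (simp add: df_def)
  next
    case False
    define s where "s = norm a powr p + norm b powr p"
    have s: "s > 0" using False unfolding s_def
      by (smt (verit) norm_eq_zero powr_gt_zero powr_ge_zero)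
    define l where "l = s powr (- 1 / p)"
    have "l powr p = s powr (- 1)" using p by (simp add: l_def powr_powr)
    then have l: "l > 0" "l powr p = 1 / s" using s by (auto simp: l_def powr_neg_one)
    have sc: "norm (l *\<^sub>R v) powr p = norm v powr p / s" for v :: 'b
      using l by (simp add: powr_mult)
    have "norm (l *\<^sub>R a - l *\<^sub>R b) powr p \<le> t + ?c * df (l *\<^sub>R a, l *\<^sub>R b)"
    proof (rule unit)
      show "norm (l *\<^sub>R a) powr p + norm (l *\<^sub>R b) powr p = 1"
        unfolding sc using s by (simp add: add_divide_distrib[symmetric] s_def[symmetric])
    qed
    moreover have "norm (l *\<^sub>R a - l *\<^sub>R b) powr p = norm (a - b) powr p / s"
      using sc[of "a - b"] by (simp add: scaleR_diff_right)
    moreover have "df (l *\<^sub>R a, l *\<^sub>R b) = df (a, b) / s"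
    proof -
      have "(1/2) *\<^sub>R l *\<^sub>R a + (1/2) *\<^sub>R l *\<^sub>R b = l *\<^sub>R ((1/2) *\<^sub>R a + (1/2) *\<^sub>R b)"
        by (simp add: scaleR_add_right)
      then have "df (l *\<^sub>R a, l *\<^sub>R b) = (norm a powr p / s + norm b powr p / s) / 2
          - norm ((1/2) *\<^sub>R a + (1/2) *\<^sub>R b) powr p / s"
        by (simp only: df_def fst_conv snd_conv sc)
      also have "\<dots> = df (a, b) / s"
        by (simp only: df_def fst_conv snd_conv diff_divide_distrib add_divide_distrib
          divide_divide_eq_left mult.commute)
      finally show ?thesis .
    qed
    ultimately have "norm (a - b) powr p / s \<le> t + ?c * (df (a, b) / s)" by simp
    then have "norm (a - b) powr p / s * s \<le> (t + ?c * (df (a, b) / s)) * s"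
      using s by (intro mult_right_mono) auto
    then show ?thesis using s by (simp add: algebra_simps s_def[symmetric])
  qed
  then show ?thesis using c0 by (intro exI[of _ ?c]) (simp add: df_def)
qed

subsection \<open>Minimisation of convex integral functionals\<close>

text \<open>
  Instead of weak compactness, uniform convexity of the Lebesgue space is used: elements of
  almost minimal norm of the nested sublevel sets form a Cauchy sequence.
\<close>

lemma Lp_minimum_exists:
  fixes V :: "('a \<Rightarrow> 'b::euclidean_space) set" and J :: "('a \<Rightarrow> 'b) \<Rightarrow> real"
  assumes p: "1 < p" and V: "V \<subseteq> Lp_on p M" "V \<noteq> {}"
    and mid: "\<And>u v. u \<in> V \<Longrightarrow> v \<in> V \<Longrightarrow> (\<lambda>x. (1/2) *\<^sub>R u x + (1/2) *\<^sub>R v x) \<in> V"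
    and Jmid: "\<And>u v. u \<in> V \<Longrightarrow> v \<in> V \<Longrightarrow> J (\<lambda>x. (1/2) *\<^sub>R u x + (1/2) *\<^sub>R v x) \<le> max (J u) (J v)"
    and lsc: "\<And>s u c l. (\<And>n. s n \<in> V) \<Longrightarrow> u \<in> Lp_on p M \<Longrightarrow>
        (\<lambda>n. \<integral>x. norm (s n x - u x) powr p \<partial>M) \<longlonglongrightarrow> 0 \<Longrightarrow> (\<And>n. J (s n) \<le> c n) \<Longrightarrow> c \<longlonglongrightarrow> l
        \<Longrightarrow> u \<in> V \<and> J u \<le> l"
    and bdd: "\<And>v. v \<in> V \<Longrightarrow> B \<le> J v"
    and coer: "\<And>c. \<exists>K. \<forall>v\<in>V. J v \<le> c \<longrightarrow> (\<integral>x. norm (v x) powr p \<partial>M) \<le> K"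
  shows "\<exists>v\<in>V. \<forall>u\<in>V. J v \<le> J u"
proof -
  define m where "m = (INF v\<in>V. J v)"
  have bb: "bdd_below (J ` V)" using bdd by (intro bdd_belowI2)
  have mle: "m \<le> J v" if "v \<in> V" for v unfolding m_def by (rule cINF_lower[OF bb that])
  define S where "S n = {v\<in>V. J v \<le> m + 1 / real (Suc n)}" for n
  define I where "I v = (\<integral>x. norm (v x) powr p \<partial>M)" for v :: "'a \<Rightarrow> 'b"
  have I0: "0 \<le> I v" for v by (simp add: I_def)
  have Sne: "S n \<noteq> {}" for n
  proof -
    have "\<exists>v\<in>V. J v < m + 1 / real (Suc n)"
      using cINF_less_iff[OF V(2) bb, of "m + 1 / real (Suc n)"] by (simp add: m_def)
    then show ?thesis by (auto simp: S_def less_imp_le)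
  qed
  obtain K where K: "\<And>v. v \<in> V \<Longrightarrow> J v \<le> m + 1 \<Longrightarrow> I v \<le> K" using coer[of "m + 1"] by (auto simp: I_def)
  have SK: "I v \<le> K" if "v \<in> S n" for v n
  proof -
    have "1 / real (Suc n) \<le> 1" by simp
    then have "v \<in> V" "J v \<le> m + 1" using that unfolding S_def mem_Collect_eq by linarith+
    then show ?thesis by (rule K)
  qed
  define a where "a n = (INF v\<in>S n. I v)" for n
  have bI: "bdd_below (I ` S n)" for n using I0 by (intro bdd_belowI2)
  have ale: "a n \<le> I v" if "v \<in> S n" for v n unfolding a_def by (rule cINF_lower[OF bI that])
  have Santi: "S k \<subseteq> S n" if "n \<le> k" for n k
  proof -
    have "1 / real (Suc k) \<le> 1 / real (Suc n)" using that by (intro divide_left_mono) auto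
    then show ?thesis by (auto simp: S_def)
  qed
  have "incseq a" unfolding incseq_def a_def using Sne Santi bI by (auto intro!: cINF_superset_mono)
  moreover have "a n \<le> K" for n using Sne[of n] ale SK by (meson all_not_in_conv order_trans)
  ultimately obtain L where L: "a \<longlonglongrightarrow> L" by (meson incseq_convergent)
  have "\<exists>v. v \<in> S n \<and> I v < a n + 1 / real (Suc n)" for n
    using cINF_less_iff[OF Sne bI, of n "a n + 1 / real (Suc n)"] by (auto simp: a_def)
  then obtain s where s: "\<And>n. s n \<in> S n" "\<And>n. I (s n) < a n + 1 / real (Suc n)" by metis
  have sV: "s n \<in> V" for n using s(1)[of n] by (simp add: S_def)
  have sL: "s n \<in> Lp_on p M" for n using sV V by auto
  define b where "b n = L - a n + 1 / real (Suc n)" for n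
  have "(\<lambda>n. L - a n + 1 / real (Suc n)) \<longlonglongrightarrow> L - L + 0"
    using LIMSEQ_inverse_real_of_nat by (intro tendsto_intros L) (simp add: inverse_eq_divide)
  then have b0: "b \<longlonglongrightarrow> 0" by (simp add: b_def[abs_def])
  have aL: "a n \<le> L" for n using \<open>incseq a\<close> L by (rule incseq_le)
  have defect: "(I (s n) + I (s k)) / 2 - I (\<lambda>x. (1/2) *\<^sub>R s n x + (1/2) *\<^sub>R s k x) \<le> b n"
    if nk: "n \<le> k" for n k
  proof -
    have "s k \<in> S n" using Santi[OF nk] s(1) by auto
    then have "(\<lambda>x. (1/2) *\<^sub>R s n x + (1/2) *\<^sub>R s k x) \<in> S n"
      using s(1)[of n] mid[of "s n" "s k"] Jmid[of "s n" "s k"] by (auto simp: S_def)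
    then have "a n \<le> I (\<lambda>x. (1/2) *\<^sub>R s n x + (1/2) *\<^sub>R s k x)" by (rule ale)
    moreover have "1 / real (Suc k) \<le> 1 / real (Suc n)" using nk by (intro divide_left_mono) auto
    moreover have "(x + y) / 2 - z \<le> l - a1 + q"
      if "a1 \<le> z" "q' \<le> q" "x < a1 + q" "y < a2 + q'" "a1 \<le> l" "a2 \<le> l" for x y z l a1 a2 q q' :: real
      using that by (simp add: field_simps)
    ultimately show ?thesis using s(2)[of n] s(2)[of k] aL[of n] aL[of k] unfolding b_def by blast
  qed
  have K0: "K \<ge> 0" using SK[OF s(1)] I0 order_trans by blast
  have "\<exists>N. \<forall>j\<ge>N. \<forall>k\<ge>N. (\<integral>x. norm (s j x - s k x) powr p \<partial>M) \<le> e" if e: "e > 0" for e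
  proof -
    define t where "t = e / (4 * (K + 1))"
    have t: "t > 0" using e K0 by (simp add: t_def)
    have tK: "t * (2 * K) \<le> e / 2" using e K0 by (simp add: t_def field_simps)
    obtain c where c: "c > 0" "\<And>x y :: 'b. norm (x - y) powr p
        \<le> t * (norm x powr p + norm y powr p)
          + c * ((norm x powr p + norm y powr p) / 2 - norm ((1/2) *\<^sub>R x + (1/2) *\<^sub>R y) powr p)"
      using norm_powr_uniformly_convex[OF p t] by metis
    obtain N where N: "\<And>n. n \<ge> N \<Longrightarrow> b n < e / (2 * c)"
      using order_tendstoD(2)[OF b0, of "e / (2 * c)"] c e by (auto simp: eventually_sequentially)
    have key: "(\<integral>x. norm (s j x - s k x) powr p \<partial>M) \<le> e" if jk: "N \<le> j" "j \<le> k" for j k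
    proof -
      have i: "integrable M (\<lambda>x. norm (s j x - s k x) powr p)" "integrable M (\<lambda>x. norm (s j x) powr p)"
        "integrable M (\<lambda>x. norm (s k x) powr p)"
        "integrable M (\<lambda>x. norm ((1/2) *\<^sub>R s j x + (1/2) *\<^sub>R s k x) powr p)"
        using Lp_onD(2)[OF Lp_on_diff[OF sL[of j] sL[of k]]] Lp_onD(2)[OF sL] p
          Lp_onD(2)[OF Lp_on_lincomb[OF sL[of j] sL[of k], of "1/2" "1/2"]] by simp_all
      have "(\<integral>x. norm (s j x - s k x) powr p \<partial>M)
          \<le> (\<integral>x. t * (norm (s j x) powr p + norm (s k x) powr p)
          + c * ((norm (s j x) powr p + norm (s k x) powr p) / 2
            - norm ((1/2) *\<^sub>R s j x + (1/2) *\<^sub>R s k x) powr p) \<partial>M)"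
        using i c(2) by (intro integral_mono) auto
      also have "\<dots> = t * (I (s j) + I (s k))
          + c * ((I (s j) + I (s k)) / 2 - I (\<lambda>x. (1/2) *\<^sub>R s j x + (1/2) *\<^sub>R s k x))"
        using i by (simp add: I_def)
      also have "\<dots> \<le> t * (2 * K) + c * (e / (2 * c))"
      proof (intro add_mono mult_left_mono)
        show "I (s j) + I (s k) \<le> 2 * K" using SK[OF s(1)[of j]] SK[OF s(1)[of k]] by linarith
        show "(I (s j) + I (s k)) / 2 - I (\<lambda>x. (1/2) *\<^sub>R s j x + (1/2) *\<^sub>R s k x) \<le> e / (2 * c)"
          using defect[OF jk(2)] N[OF jk(1)] by linarith
      qed (use t c in auto)
      also have "\<dots> \<le> e" using tK c(1) e by simp
      finally show ?thesis .
    qed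
    have "(\<integral>x. norm (s j x - s k x) powr p \<partial>M) \<le> e" if "N \<le> j" "N \<le> k" for j k
      using key[of j k] key[of k j] that by (cases "j \<le> k") (simp_all add: norm_minus_commute)
    then show ?thesis by blast
  qed
  from Lp_on_complete[OF p sL this] obtain u where
    u: "u \<in> Lp_on p M" "(\<lambda>n. \<integral>x. norm (s n x - u x) powr p \<partial>M) \<longlonglongrightarrow> 0" by blast
  have "(\<lambda>n. m + 1 / real (Suc n)) \<longlonglongrightarrow> m + 0"
    using LIMSEQ_inverse_real_of_nat by (intro tendsto_intros) (simp add: inverse_eq_divide)
  then have "u \<in> V \<and> J u \<le> m"
    using s(1) by (intro lsc[OF sV u]) (auto simp: S_def)
  then show ?thesis using mle order_trans by blast
qed

locale convex_integral_problem = finite_measure M for M :: "'a measure" +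
  fixes p c C CL :: real
    and \<Gamma> :: "'a \<Rightarrow> 'b::euclidean_space \<Rightarrow> real" and D :: "'a \<Rightarrow> 'b \<Rightarrow> 'b"
    and V :: "('a \<Rightarrow> 'b) set" and ell :: "('a \<Rightarrow> 'b) \<Rightarrow> real"
  assumes p1: "1 < p" and c0: "0 < c" and C0: "0 \<le> C" and CL0: "0 \<le> CL"
    and \<Gamma>_measurable: "\<And>v. v \<in> borel_measurable M \<Longrightarrow> (\<lambda>x. \<Gamma> x (v x)) \<in> borel_measurable M"
    and D_measurable: "\<And>v. v \<in> borel_measurable M \<Longrightarrow> (\<lambda>x. D x (v x)) \<in> borel_measurable M"
    and subgradient: "\<And>x a b. x \<in> space M \<Longrightarrow> \<Gamma> x a + D x a \<bullet> (b - a) \<le> \<Gamma> x b"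
    and growth: "\<And>x a. x \<in> space M \<Longrightarrow> norm (D x a) \<le> C * (1 + norm a) powr (p - 1)"
    and at_zero: "\<And>x. x \<in> space M \<Longrightarrow> \<bar>\<Gamma> x 0\<bar> \<le> C"
    and coercive: "\<And>x a. x \<in> space M \<Longrightarrow> c * norm a powr p - C \<le> \<Gamma> x a"
    and V_subset: "V \<subseteq> Lp_on p M" and V_zero: "(\<lambda>x. 0) \<in> V"
    and V_lincomb: "\<And>u v a b. u \<in> V \<Longrightarrow> v \<in> V \<Longrightarrow> (\<lambda>x. a *\<^sub>R u x + b *\<^sub>R v x) \<in> V"
    and V_closed: "\<And>s u. (\<And>n. s n \<in> V) \<Longrightarrow> u \<in> Lp_on p M \<Longrightarrow>
        (\<lambda>n. \<integral>x. norm (s n x - u x) powr p \<partial>M) \<longlonglongrightarrow> 0 \<Longrightarrow> u \<in> V"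
    and ell_linear: "\<And>u v a b. u \<in> V \<Longrightarrow> v \<in> V \<Longrightarrow> ell (\<lambda>x. a *\<^sub>R u x + b *\<^sub>R v x) = a * ell u + b * ell v"
    and ell_bounded: "\<And>v. v \<in> V \<Longrightarrow> \<bar>ell v\<bar> \<le> CL * (\<integral>x. norm (v x) powr p \<partial>M) powr (1 / p)"
begin

definition J :: "('a \<Rightarrow> 'b) \<Rightarrow> real" where
  "J v = (\<integral>x. \<Gamma> x (v x) \<partial>M) - ell v"

lemma one_plus_norm_powr_integrable:
  assumes "v \<in> Lp_on p M"
  shows "integrable M (\<lambda>x. (1 + norm (v x)) powr p)"
proof (rule Bochner_Integration.integrable_bound)
  note [measurable] = Lp_onD(1)[OF assms]
  show "integrable M (\<lambda>x. 2 powr p * (1 + norm (v x) powr p))" using Lp_onD(2)[OF assms] by simp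
  show "(\<lambda>x. (1 + norm (v x)) powr p) \<in> borel_measurable M" by measurable
  have "(1 + norm (v x)) powr p \<le> 2 powr p * (1 powr p + norm (v x) powr p)" for x
    using p1 by (intro powr_add_le) auto
  then show "AE x in M. norm ((1 + norm (v x)) powr p) \<le> norm (2 powr p * (1 + norm (v x) powr p))"
    by (intro AE_I2) (simp add: abs_mult)
qed

lemma D_Lp:
  assumes "v \<in> Lp_on p M"
  shows "(\<lambda>x. D x (v x)) \<in> Lp_on (conj_exp p) M"
proof -
  note [measurable] = D_measurable[OF Lp_onD(1)[OF assms]]
  have q: "conj_exp p > 1" using conj_exp_props(1)[OF p1] .
  have "integrable M (\<lambda>x. norm (D x (v x)) powr conj_exp p)"
  proof (rule Bochner_Integration.integrable_bound)
    show "integrable M (\<lambda>x. C powr conj_exp p * (1 + norm (v x)) powr p)"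
      using one_plus_norm_powr_integrable[OF assms] by simp
    have "norm (D x (v x)) powr conj_exp p \<le> C powr conj_exp p * (1 + norm (v x)) powr p" if "x \<in> space M" for x
    proof -
      have "norm (D x (v x)) powr conj_exp p \<le> (C * (1 + norm (v x)) powr (p - 1)) powr conj_exp p"
        using growth[OF that] q by (intro powr_mono2) auto
      also have "\<dots> = C powr conj_exp p * (1 + norm (v x)) powr ((p - 1) * conj_exp p)"
        using C0 by (simp add: powr_mult powr_powr)
      finally show ?thesis using conj_exp_props(3)[OF p1] by simp
    qed
    then show "AE x in M. norm (norm (D x (v x)) powr conj_exp p) \<le> norm (C powr conj_exp p * (1 + norm (v x)) powr p)"
      by (intro AE_I2) (simp add: abs_mult)
  qed measurable
  then show ?thesis by (simp add: Lp_on_def)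
qed

lemma \<Gamma>_integrable:
  assumes v: "v \<in> Lp_on p M"
  shows "integrable M (\<lambda>x. \<Gamma> x (v x))"
proof (rule Bochner_Integration.integrable_bound)
  note [measurable] = \<Gamma>_measurable[OF Lp_onD(1)[OF v]]
  have z: "(\<lambda>x. D x 0) \<in> Lp_on (conj_exp p) M" using D_Lp[OF Lp_on_zero] .
  show "integrable M (\<lambda>x. C + norm (D x (v x)) * norm (v x) + norm (D x 0) * norm (v x))"
    using Lp_on_pairing_integrable(2)[OF p1 D_Lp[OF v] v] Lp_on_pairing_integrable(2)[OF p1 z v] by simp
  show "(\<lambda>x. \<Gamma> x (v x)) \<in> borel_measurable M" by measurable
  have "\<bar>\<Gamma> x (v x)\<bar> \<le> C + norm (D x (v x)) * norm (v x) + norm (D x 0) * norm (v x)" if "x \<in> space M" for x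
  proof -
    have 1: "\<Gamma> x (v x) \<le> \<Gamma> x 0 + D x (v x) \<bullet> v x" using subgradient[OF that, of "v x" 0] by simp
    have 2: "\<Gamma> x 0 + D x 0 \<bullet> v x \<le> \<Gamma> x (v x)" using subgradient[OF that, of 0 "v x"] by simp
    show ?thesis
      using 1 2 at_zero[OF that] Cauchy_Schwarz_ineq2[of "D x (v x)" "v x"] Cauchy_Schwarz_ineq2[of "D x 0" "v x"]
      by (simp add: abs_le_iff)
  qed
  then show "AE x in M. norm (\<Gamma> x (v x)) \<le> norm (C + norm (D x (v x)) * norm (v x) + norm (D x 0) * norm (v x))"
    using C0 by (intro AE_I2) (simp add: abs_of_nonneg)
qed

lemma J_coercive: "\<exists>K. \<forall>v\<in>V. c / 2 * (\<integral>x. norm (v x) powr p \<partial>M) - K \<le> J v"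
proof -
  define t where "t = (c / (2 * (CL + 1))) powr (1 / (p - 1))"
  have t: "t > 0" using c0 CL0 by (simp add: t_def)
  have tp: "t powr (p - 1) = c / (2 * (CL + 1))" using p1 c0 CL0 by (simp add: t_def powr_powr)
  have "c / 2 * (\<integral>x. norm (v x) powr p \<partial>M) - (C * measure M (space M) + CL / t) \<le> J v" if v: "v \<in> V" for v
  proof -
    let ?I = "\<integral>x. norm (v x) powr p \<partial>M"
    have vL: "v \<in> Lp_on p M" using v V_subset by auto
    have "(\<integral>x. c * norm (v x) powr p - C \<partial>M) \<le> (\<integral>x. \<Gamma> x (v x) \<partial>M)"
      using Lp_onD(2)[OF vL] coercive by (intro integral_mono \<Gamma>_integrable vL) auto
    then have 1: "c * ?I - C * measure M (space M) \<le> (\<integral>x. \<Gamma> x (v x) \<partial>M)"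
      using Lp_onD(2)[OF vL] by (simp add: mult.commute)
    have I0: "0 \<le> ?I" by simp
    have "?I powr (1/p) \<le> t powr (p - 1) * (?I powr (1/p)) powr p + 1 / t"
      using p1 t by (intro young_scaled) auto
    also have "(?I powr (1/p)) powr p = ?I" using p1 I0 by (simp add: powr_powr)
    finally have "CL * ?I powr (1/p) \<le> CL * (t powr (p - 1) * ?I + 1 / t)"
      using CL0 by (rule mult_left_mono)
    also have "\<dots> = (CL / (CL + 1)) * (c / 2 * ?I) + CL / t" unfolding tp using CL0 by (simp add: field_simps)
    also have "(CL / (CL + 1)) * (c / 2 * ?I) \<le> 1 * (c / 2 * ?I)"
      using CL0 c0 by (intro mult_right_mono) auto
    finally have "ell v \<le> c / 2 * ?I + CL / t" using ell_bounded[OF v] by linarith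
    then show ?thesis using 1 unfolding J_def by simp
  qed
  then show ?thesis by blast
qed

lemma J_lsc:
  assumes s: "\<And>n. s n \<in> V" and u: "u \<in> Lp_on p M"
    and lim: "(\<lambda>n. \<integral>x. norm (s n x - u x) powr p \<partial>M) \<longlonglongrightarrow> 0"
    and b: "\<And>n. J (s n) \<le> b n" and l: "b \<longlonglongrightarrow> l"
  shows "u \<in> V \<and> J u \<le> l"
proof
  show uV: "u \<in> V" by (rule V_closed[OF s u lim])
  have sL: "s n \<in> Lp_on p M" for n using s V_subset by auto
  have dL: "(\<lambda>x. s n x - u x) \<in> Lp_on p M" for n using p1 by (intro Lp_on_diff sL u) auto
  define e where "e n = (\<integral>x. norm (s n x - u x) powr p \<partial>M)" for n
  define Q where "Q = (\<integral>x. (1 + norm (u x)) powr p \<partial>M)"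
  have Q0: "Q \<ge> 0" by (simp add: Q_def)
  have bound: "J u \<le> b n + (C * (t * Q + t powr (1 - p) * e n) + CL * e n powr (1/p))" if t: "t > 0" for t n
  proof -
    have 1: "(\<integral>x. \<Gamma> x (u x) \<partial>M) - (\<integral>x. C * (t * (1 + norm (u x)) powr p + t powr (1 - p) * norm (s n x - u x) powr p) \<partial>M)
        \<le> (\<integral>x. \<Gamma> x (s n x) \<partial>M)"
    proof -
      have i: "integrable M (\<lambda>x. C * (t * (1 + norm (u x)) powr p + t powr (1 - p) * norm (s n x - u x) powr p))"
        using one_plus_norm_powr_integrable[OF u] Lp_onD(2)[OF dL] by simp
      have "(\<integral>x. \<Gamma> x (u x) - C * (t * (1 + norm (u x)) powr p + t powr (1 - p) * norm (s n x - u x) powr p) \<partial>M)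
          \<le> (\<integral>x. \<Gamma> x (s n x) \<partial>M)"
      proof (rule integral_mono)
        show "integrable M (\<lambda>x. \<Gamma> x (u x) - C * (t * (1 + norm (u x)) powr p + t powr (1 - p) * norm (s n x - u x) powr p))"
          by (rule Bochner_Integration.integrable_diff[OF \<Gamma>_integrable[OF u] i])
        show "integrable M (\<lambda>x. \<Gamma> x (s n x))" by (rule \<Gamma>_integrable[OF sL])
        fix x assume x: "x \<in> space M"
        have "\<bar>D x (u x) \<bullet> (s n x - u x)\<bar> \<le> norm (D x (u x)) * norm (s n x - u x)"
          by (rule Cauchy_Schwarz_ineq2)
        also have "\<dots> \<le> C * (1 + norm (u x)) powr (p - 1) * norm (s n x - u x)"
          using growth[OF x] by (intro mult_right_mono) auto
        also have "\<dots> \<le> C * (t * (1 + norm (u x)) powr p + t powr (1 - p) * norm (s n x - u x) powr p)"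
          using C0 p1 t young_mixed[of p t "1 + norm (u x)" "norm (s n x - u x)"]
          by (simp only: mult.assoc) (intro mult_left_mono, auto)
        finally show "\<Gamma> x (u x) - C * (t * (1 + norm (u x)) powr p + t powr (1 - p) * norm (s n x - u x) powr p) \<le> \<Gamma> x (s n x)"
          using subgradient[OF x, of "u x" "s n x"] by linarith
      qed
      then show ?thesis using i \<Gamma>_integrable[OF u] by (simp only: Bochner_Integration.integral_diff)
    qed
    have "(\<integral>x. C * (t * (1 + norm (u x)) powr p + t powr (1 - p) * norm (s n x - u x) powr p) \<partial>M)
        = C * (t * Q + t powr (1 - p) * e n)"
      using one_plus_norm_powr_integrable[OF u] Lp_onD(2)[OF dL] by (simp add: Q_def e_def)
    moreover have "(\<lambda>x. s n x - u x) \<in> V" using V_lincomb[OF s[of n] uV, of 1 "-1"] by simp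
    then have "\<bar>ell (\<lambda>x. s n x - u x)\<bar> \<le> CL * e n powr (1/p)" unfolding e_def by (rule ell_bounded)
    moreover have "ell (\<lambda>x. s n x - u x) = ell (s n) - ell u" using ell_linear[OF s[of n] uV, of 1 "-1"] by simp
    ultimately show ?thesis using 1 b[of n] unfolding J_def by linarith
  qed
  have "J u \<le> l + C * (t * Q)" if t: "t > 0" for t
  proof (rule LIMSEQ_le_const)
    have e0: "e \<longlonglongrightarrow> 0" using lim by (simp add: e_def[abs_def])
    have ep: "(\<lambda>n. e n powr (1/p)) \<longlonglongrightarrow> 0 powr (1/p)"
      using p1 by (intro tendsto_powr' e0 tendsto_const) (auto simp: e_def)
    have "(\<lambda>n. b n + (C * (t * Q + t powr (1 - p) * e n) + CL * e n powr (1/p)))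
        \<longlonglongrightarrow> l + (C * (t * Q + t powr (1 - p) * 0) + CL * 0 powr (1/p))"
      by (intro tendsto_add tendsto_mult tendsto_const l e0 ep)
    then show "(\<lambda>n. b n + (C * (t * Q + t powr (1 - p) * e n) + CL * e n powr (1/p))) \<longlonglongrightarrow> l + C * (t * Q)"
      by simp
    show "\<exists>N. \<forall>n\<ge>N. J u \<le> b n + (C * (t * Q + t powr (1 - p) * e n) + CL * e n powr (1/p))"
      using bound[OF t] by blast
  qed
  note bt = this
  show "J u \<le> l"
  proof (rule field_le_epsilon)
    fix e :: real assume e: "e > 0"
    have "C * (e / (C * Q + 1) * Q) \<le> e"
    proof -
      have "C * (e / (C * Q + 1) * Q) = e * ((C * Q) / (C * Q + 1))" by simp
      also have "\<dots> \<le> e * 1" using e C0 Q0 by (intro mult_left_mono) (auto simp: divide_le_eq_1 add_nonneg_pos)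
      finally show ?thesis by simp
    qed
    moreover have "e / (C * Q + 1) > 0" using e C0 Q0 by (simp add: add_nonneg_pos)
    ultimately show "J u \<le> l + e" using bt[of "e / (C * Q + 1)"] by linarith
  qed
qed

lemma minimizer_exists: "\<exists>v\<in>V. \<forall>u\<in>V. J v \<le> J u"
proof -
  obtain K where K: "\<And>v. v \<in> V \<Longrightarrow> c / 2 * (\<integral>x. norm (v x) powr p \<partial>M) - K \<le> J v" using J_coercive by blast
  show ?thesis
  proof (rule Lp_minimum_exists[OF p1 V_subset _ V_lincomb _ J_lsc])
    show "V \<noteq> {}" using V_zero by auto
    fix v assume v: "v \<in> V"
    have "0 \<le> c / 2 * (\<integral>x. norm (v x) powr p \<partial>M)" using c0 by simp
    then show "- K \<le> J v" using K[OF v] by linarith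
  next
    fix r
    have "(\<integral>x. norm (v x) powr p \<partial>M) \<le> (r + K) / (c / 2)" if "v \<in> V" "J v \<le> r" for v
    proof -
      have "c / 2 * (\<integral>x. norm (v x) powr p \<partial>M) \<le> r + K" using K[OF that(1)] that(2) by linarith
      then show ?thesis using c0 by (simp add: field_simps)
    qed
    then show "\<exists>K. \<forall>v\<in>V. J v \<le> r \<longrightarrow> (\<integral>x. norm (v x) powr p \<partial>M) \<le> K" by blast
  next
    fix u v assume uv: "u \<in> V" "v \<in> V"
    let ?m = "\<lambda>x. (1/2) *\<^sub>R u x + (1/2) *\<^sub>R v x"
    have L: "u \<in> Lp_on p M" "v \<in> Lp_on p M" "?m \<in> Lp_on p M" using uv V_subset V_lincomb by auto
    have "\<Gamma> x (?m x) \<le> (1/2) * \<Gamma> x (u x) + (1/2) * \<Gamma> x (v x)" if "x \<in> space M" for x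
    proof -
      have "u x - ?m x = (1/2) *\<^sub>R (u x - v x)" "v x - ?m x = - ((1/2) *\<^sub>R (u x - v x))"
        by (simp_all add: algebra_simps scaleR_add_left[symmetric])
      then show ?thesis
        using subgradient[OF that, of "?m x" "u x"] subgradient[OF that, of "?m x" "v x"] by simp
    qed
    then have "(\<integral>x. \<Gamma> x (?m x) \<partial>M) \<le> (\<integral>x. (1/2) * \<Gamma> x (u x) + (1/2) * \<Gamma> x (v x) \<partial>M)"
      using \<Gamma>_integrable[OF L(1)] \<Gamma>_integrable[OF L(2)] by (intro integral_mono \<Gamma>_integrable L) auto
    also have "\<dots> = (1/2) * (\<integral>x. \<Gamma> x (u x) \<partial>M) + (1/2) * (\<integral>x. \<Gamma> x (v x) \<partial>M)"
      using \<Gamma>_integrable[OF L(1)] \<Gamma>_integrable[OF L(2)] by simp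
    finally show "J ?m \<le> max (J u) (J v)"
      unfolding J_def ell_linear[OF uv] by (simp add: max_def)
  qed
qed

lemma euler_lagrange_le:
  assumes cont: "\<And>x. x \<in> space M \<Longrightarrow> continuous_on UNIV (D x)"
    and v: "v \<in> V" "\<And>u. u \<in> V \<Longrightarrow> J v \<le> J u" and h: "h \<in> V"
  shows "ell h \<le> (\<integral>x. D x (v x) \<bullet> h x \<partial>M)"
proof -
  have L: "v \<in> Lp_on p M" "h \<in> Lp_on p M" using v h V_subset by auto
  note [measurable] = Lp_onD(1)[OF L(1)] Lp_onD(1)[OF L(2)]
  define t where "t n = 1 / real (Suc n)" for n
  have t: "0 < t n" "t n \<le> 1" for n by (auto simp: t_def)
  have t0: "t \<longlonglongrightarrow> 0" unfolding t_def using LIMSEQ_inverse_real_of_nat by (simp add: inverse_eq_divide)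
  define vt where "vt n x = 1 *\<^sub>R v x + t n *\<^sub>R h x" for n x
  have vtV: "vt n \<in> V" for n unfolding vt_def by (rule V_lincomb[OF v(1) h])
  then have vtL: "vt n \<in> Lp_on p M" for n using V_subset by auto
  have "ell h \<le> (\<integral>x. D x (vt n x) \<bullet> h x \<partial>M)" for n
  proof -
    have i: "integrable M (\<lambda>x. D x (vt n x) \<bullet> h x)" by (rule Lp_on_pairing_integrable(1)[OF p1 D_Lp[OF vtL] L(2)])
    have "J v \<le> J (vt n)" by (rule v(2)[OF vtV])
    moreover have "ell (vt n) = ell v + t n * ell h" unfolding vt_def using ell_linear[OF v(1) h, of 1 "t n"] by simp
    moreover have "(\<integral>x. \<Gamma> x (vt n x) - t n * (D x (vt n x) \<bullet> h x) \<partial>M) \<le> (\<integral>x. \<Gamma> x (v x) \<partial>M)"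
    proof (rule integral_mono)
      show "integrable M (\<lambda>x. \<Gamma> x (vt n x) - t n * (D x (vt n x) \<bullet> h x))"
        using \<Gamma>_integrable[OF vtL] i by (intro Bochner_Integration.integrable_diff integrable_mult_right)
      show "integrable M (\<lambda>x. \<Gamma> x (v x))" by (rule \<Gamma>_integrable[OF L(1)])
      fix x assume "x \<in> space M"
      from subgradient[OF this, of "vt n x" "v x"]
      show "\<Gamma> x (vt n x) - t n * (D x (vt n x) \<bullet> h x) \<le> \<Gamma> x (v x)" by (simp add: vt_def inner_diff_right inner_add_right)
    qed
    then have "(\<integral>x. \<Gamma> x (vt n x) \<partial>M) - t n * (\<integral>x. D x (vt n x) \<bullet> h x \<partial>M) \<le> (\<integral>x. \<Gamma> x (v x) \<partial>M)"
      using \<Gamma>_integrable[OF vtL] i by simp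
    ultimately have "t n * ell h \<le> t n * (\<integral>x. D x (vt n x) \<bullet> h x \<partial>M)" unfolding J_def by linarith
    then show ?thesis using t(1)[of n] by simp
  qed
  moreover have "(\<lambda>n. \<integral>x. D x (vt n x) \<bullet> h x \<partial>M) \<longlonglongrightarrow> (\<integral>x. D x (v x) \<bullet> h x \<partial>M)"
  proof (rule integral_dominated_convergence)
    have nn: "(\<lambda>x. \<bar>norm (v x)\<bar> + \<bar>norm (h x)\<bar>) \<in> Lp_on p M"
    proof -
      have "(\<lambda>x. norm (f x)) \<in> Lp_on p M" if "f \<in> Lp_on p M" for f :: "'a \<Rightarrow> 'b" using that by (auto simp: Lp_on_def)
      from Lp_on_lincomb[OF this[OF L(1)] this[OF L(2)], of 1 1] show ?thesis using p1 by simp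
    qed
    show "integrable M (\<lambda>x. C * ((1 + norm (\<bar>norm (v x)\<bar> + \<bar>norm (h x)\<bar>)) powr (p - 1) * norm (h x)))"
    proof -
      have ri: "integrable M (\<lambda>x. (1 + \<bar>\<bar>norm (v x)\<bar> + \<bar>norm (h x)\<bar>\<bar>) powr p)"
      proof (rule Bochner_Integration.integrable_bound)
        show "integrable M (\<lambda>x. 2 powr p * (1 + norm (\<bar>norm (v x)\<bar> + \<bar>norm (h x)\<bar>) powr p))"
          using Lp_onD(2)[OF nn] by simp
        have "(1 + norm (\<bar>norm (v x)\<bar> + \<bar>norm (h x)\<bar>)) powr p
            \<le> 2 powr p * (1 powr p + norm (\<bar>norm (v x)\<bar> + \<bar>norm (h x)\<bar>) powr p)" for x
          using p1 by (intro powr_add_le) auto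
        then show "AE x in M. norm ((1 + \<bar>\<bar>norm (v x)\<bar> + \<bar>norm (h x)\<bar>\<bar>) powr p)
            \<le> norm (2 powr p * (1 + norm (\<bar>norm (v x)\<bar> + \<bar>norm (h x)\<bar>) powr p))"
          by (intro AE_I2) (simp add: abs_mult)
      qed measurable
      have "integrable M (\<lambda>x. (1 + norm (\<bar>norm (v x)\<bar> + \<bar>norm (h x)\<bar>)) powr (p - 1) * norm (h x))"
      proof (rule Bochner_Integration.integrable_bound)
        show "integrable M (\<lambda>x. (1 + \<bar>\<bar>norm (v x)\<bar> + \<bar>norm (h x)\<bar>\<bar>) powr p + norm (h x) powr p)"
          using ri Lp_onD(2)[OF L(2)] by simp
        show "AE x in M. norm ((1 + norm (\<bar>norm (v x)\<bar> + \<bar>norm (h x)\<bar>)) powr (p - 1) * norm (h x))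
            \<le> norm ((1 + \<bar>\<bar>norm (v x)\<bar> + \<bar>norm (h x)\<bar>\<bar>) powr p + norm (h x) powr p)"
        proof (intro AE_I2)
          fix x
          show "norm ((1 + norm (\<bar>norm (v x)\<bar> + \<bar>norm (h x)\<bar>)) powr (p - 1) * norm (h x))
            \<le> norm ((1 + \<bar>\<bar>norm (v x)\<bar> + \<bar>norm (h x)\<bar>\<bar>) powr p + norm (h x) powr p)"
            using young_mixed[OF p1, of 1 "1 + norm (\<bar>norm (v x)\<bar> + \<bar>norm (h x)\<bar>)" "norm (h x)"] by simp
        qed
      qed measurable
      then show ?thesis by simp
    qed
    show "AE x in M. norm (D x (vt n x) \<bullet> h x)
        \<le> C * ((1 + norm (\<bar>norm (v x)\<bar> + \<bar>norm (h x)\<bar>)) powr (p - 1) * norm (h x))" for n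
    proof (intro AE_I2)
      fix x assume x: "x \<in> space M"
      have vn: "norm (vt n x) \<le> norm (v x) + norm (h x)"
        unfolding vt_def using t[of n] mult_right_mono[OF t(2)[of n], of "norm (h x)"]
        by (intro norm_triangle_le) simp
      have "norm (D x (vt n x) \<bullet> h x) \<le> norm (D x (vt n x)) * norm (h x)" using Cauchy_Schwarz_ineq2 by simp
      also have "\<dots> \<le> (C * (1 + norm (vt n x)) powr (p - 1)) * norm (h x)"
        using growth[OF x] by (intro mult_right_mono) auto
      also have "\<dots> \<le> (C * (1 + norm (\<bar>norm (v x)\<bar> + \<bar>norm (h x)\<bar>)) powr (p - 1)) * norm (h x)"
        using C0 p1 vn by (intro mult_right_mono mult_left_mono powr_mono2) auto
      finally show "norm (D x (vt n x) \<bullet> h x)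
        \<le> C * ((1 + norm (\<bar>norm (v x)\<bar> + \<bar>norm (h x)\<bar>)) powr (p - 1) * norm (h x))" by simp
    qed
    show "AE x in M. (\<lambda>n. D x (vt n x) \<bullet> h x) \<longlonglongrightarrow> D x (v x) \<bullet> h x"
    proof (intro AE_I2 tendsto_inner tendsto_const)
      fix x assume x: "x \<in> space M"
      have "(\<lambda>n. vt n x) \<longlonglongrightarrow> 1 *\<^sub>R v x + 0 *\<^sub>R h x" unfolding vt_def by (intro tendsto_intros t0)
      then have "(\<lambda>n. vt n x) \<longlonglongrightarrow> v x" by simp
      moreover have "isCont (D x) (v x)" using cont[OF x] by (simp add: continuous_on_eq_continuous_at)
      ultimately show "(\<lambda>n. D x (vt n x)) \<longlonglongrightarrow> D x (v x)"
        by (rule isCont_tendsto_compose[rotated])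
    qed
    show "(\<lambda>x. D x (v x) \<bullet> h x) \<in> borel_measurable M"
      using D_measurable[OF Lp_onD(1)[OF L(1)]] by simp
    show "(\<lambda>x. D x (vt n x) \<bullet> h x) \<in> borel_measurable M" for n
      using D_measurable[OF Lp_onD(1)[OF vtL]] by simp
  qed
  ultimately show ?thesis by (intro LIMSEQ_le_const) auto
qed

lemma euler_lagrange:
  assumes cont: "\<And>x. x \<in> space M \<Longrightarrow> continuous_on UNIV (D x)"
    and v: "v \<in> V" "\<And>u. u \<in> V \<Longrightarrow> J v \<le> J u" and h: "h \<in> V"
  shows "(\<integral>x. D x (v x) \<bullet> h x \<partial>M) = ell h"
proof -
  have mh: "(\<lambda>x. - h x) \<in> V" using V_lincomb[OF h h, of "-1" 0] by simp
  have "ell (\<lambda>x. - h x) = - ell h" using ell_linear[OF h h, of "-1" 0] by simp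
  then show ?thesis
    using euler_lagrange_le[OF cont v h] euler_lagrange_le[OF cont v mh] by simp
qed

end

subsection \<open>Geometry of Lipschitz domains\<close>

lemma lipschitz_domain_cone:
  fixes U :: "'a::euclidean_space set"
  assumes U: "bounded_lipschitz_domain U" and z: "z \<in> closure U"
  obtains r e s h0 where "r > 0" "s > 0" "h0 > 0"
    "\<And>x h v. x \<in> closure U \<Longrightarrow> x \<in> ball z r \<Longrightarrow> 0 < h \<Longrightarrow> h \<le> h0 \<Longrightarrow> v \<in> cball e s \<Longrightarrow> x + h *\<^sub>R v \<in> U"
proof (cases "z \<in> U")
  case True
  have "open U" using U by (simp add: bounded_lipschitz_domain_def)
  then obtain R where R: "R > 0" "ball z R \<subseteq> U" using True open_contains_ball by blast
  have "x + h *\<^sub>R v \<in> U" if "x \<in> ball z (R/2)" "0 < h" "h \<le> R / 2" "v \<in> cball 0 1" for x h and v :: 'a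
  proof -
    have "norm (h *\<^sub>R v) \<le> (R/2) * 1" unfolding norm_scaleR using that by (intro mult_mono) auto
    moreover have "norm (x - z) < R / 2" using that by (simp add: dist_norm norm_minus_commute)
    ultimately have "norm ((x - z) + h *\<^sub>R v) < R" using norm_triangle_ineq[of "x - z" "h *\<^sub>R v"] by linarith
    then have "x + h *\<^sub>R v \<in> ball z R" by (simp add: dist_norm norm_minus_commute algebra_simps)
    then show ?thesis using R by auto
  qed
  then show ?thesis using that[of "R/2" 1 "R/2" 0] R by auto
next
  case False
  have "open U" using U by (simp add: bounded_lipschitz_domain_def)
  then have "z \<in> frontier U" using z False by (simp add: frontier_def interior_open)
  then obtain r e \<gamma> L where r: "r > 0" and e: "norm e = 1" and \<gamma>: "L-lipschitz_on {v. v \<bullet> e = 0} \<gamma>"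
    and ep: "\<And>x. x \<in> ball z r \<Longrightarrow> x \<in> U \<longleftrightarrow> \<gamma> (x - (x \<bullet> e) *\<^sub>R e) < x \<bullet> e"
    using U unfolding bounded_lipschitz_domain_def by blast
  define P where "P x = x - (x \<bullet> e) *\<^sub>R e" for x
  have ee: "e \<bullet> e = 1" using e by (simp add: dot_square_norm)
  have P0: "P x \<bullet> e = 0" for x by (simp add: P_def inner_diff_left ee)
  have Pn: "norm (P x) \<le> norm x" for x
  proof -
    have "(norm (P x))\<^sup>2 = (norm x)\<^sup>2 - (x \<bullet> e)\<^sup>2"
      unfolding power2_norm_eq_inner by (simp add: P_def algebra_simps ee inner_commute power2_eq_square)
    then have "(norm (P x))\<^sup>2 \<le> (norm x)\<^sup>2" by simp
    then show ?thesis by (rule power2_le_imp_le) simp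
  qed
  have Pd: "P x - P y = P (x - y)" for x y by (simp add: P_def algebra_simps)
  have L0: "L \<ge> 0" using \<gamma> by (rule lipschitz_on_nonneg)
  have \<gamma>l: "\<bar>\<gamma> (P x) - \<gamma> (P y)\<bar> \<le> L * norm (P (x - y))" for x y
    using lipschitz_onD[OF \<gamma>, of "P x" "P y"] by (simp add: P0 dist_norm Pd)
  have cl: "\<gamma> (P x) \<le> x \<bullet> e" if x: "x \<in> closure U" "x \<in> ball z r" for x
  proof (rule ccontr)
    assume "\<not> \<gamma> (P x) \<le> x \<bullet> e"
    then have gap: "\<gamma> (P x) - x \<bullet> e > 0" by simp
    define d where "d = min (r - dist z x) ((\<gamma> (P x) - x \<bullet> e) / (L + 1))"
    have "d > 0" using x gap L0 by (simp add: d_def)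
    then obtain y where y: "y \<in> U" "dist y x < d" using x(1) closure_approachable by blast
    have "y \<in> ball z r" using y(2) dist_triangle[of z y x] by (simp add: d_def dist_commute)
    then have "\<gamma> (P y) < y \<bullet> e" using ep y(1) by (simp add: P_def)
    moreover have "\<gamma> (P x) - \<gamma> (P y) \<le> L * norm (x - y)"
      using \<gamma>l[of x y] mult_left_mono[OF Pn L0, of "x - y"] by linarith
    moreover have "y \<bullet> e - x \<bullet> e \<le> norm (x - y)"
      using Cauchy_Schwarz_ineq2[of "y - x" e] e by (simp add: inner_diff_left norm_minus_commute)
    ultimately have "\<gamma> (P x) - x \<bullet> e < (L + 1) * norm (x - y)" by (simp add: algebra_simps)
    also have "\<dots> \<le> (L + 1) * ((\<gamma> (P x) - x \<bullet> e) / (L + 1))"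
      using y(2) L0 by (intro mult_left_mono) (auto simp: d_def dist_norm norm_minus_commute)
    finally show False using L0 by simp
  qed
  define s where "s = 1 / (2 * (1 + L))"
  have s: "s > 0" "s \<le> 1 / 2" "(1 + L) * s = 1 / 2" using L0 by (auto simp: s_def field_simps)
  have "x + h *\<^sub>R v \<in> U" if x: "x \<in> closure U" "x \<in> ball z (r/2)" and h: "0 < h" "h \<le> r / 4" and v: "v \<in> cball e s" for x h v
  proof -
    have ve: "norm (v - e) \<le> s" using v by (simp add: dist_norm norm_minus_commute)
    have "norm v \<le> norm (v - e) + norm e" using norm_triangle_ineq[of "v - e" e] by simp
    then have "norm (h *\<^sub>R v) \<le> (r/4) * 2" unfolding norm_scaleR using h ve s e by (intro mult_mono) auto
    then have "norm ((x - z) + h *\<^sub>R v) < r"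
      using norm_triangle_ineq[of "x - z" "h *\<^sub>R v"] x(2) by (simp add: dist_norm norm_minus_commute)
    then have b: "x + h *\<^sub>R v \<in> ball z r" by (simp add: dist_norm norm_minus_commute algebra_simps)
    have "P (h *\<^sub>R v) = h *\<^sub>R P (v - e)" by (simp add: P_def algebra_simps ee)
    then have "norm (P (h *\<^sub>R v)) \<le> h * s"
      using Pn[of "v - e"] ve h by simp
    then have "L * norm (P (h *\<^sub>R v)) \<le> L * (h * s)" using L0 by (rule mult_left_mono)
    then have 1: "\<gamma> (P (x + h *\<^sub>R v)) \<le> \<gamma> (P x) + L * (h * s)"
      using \<gamma>l[of "x + h *\<^sub>R v" x] by simp
    have 2: "\<gamma> (P x) \<le> x \<bullet> e" using cl x r by auto
    have "(e - v) \<bullet> e \<le> s" using Cauchy_Schwarz_ineq2[of "e - v" e] e ve by (simp add: norm_minus_commute)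
    then have "1 - s \<le> v \<bullet> e" by (simp add: inner_diff_left ee)
    then have 3: "h * (1 - s) \<le> h * (v \<bullet> e)" using h by simp
    have "h * ((1 + L) * s) < h * 1" unfolding s using h by simp
    then have "L * (h * s) < h * (1 - s)" by (simp add: algebra_simps)
    then have "\<gamma> (P (x + h *\<^sub>R v)) < (x + h *\<^sub>R v) \<bullet> e"
      using 1 2 3 by (simp add: inner_add_left)
    then show ?thesis using ep[OF b] by (simp add: P_def)
  qed
  then show ?thesis using that[of "r/2" s "r/4" e] r s(1) by auto
qed

lemma negligible_disjoint_translates:
  fixes A :: "'a::euclidean_space set"
  assumes A: "compact A" and e: "norm e \<le> 1"
    and dis: "\<And>a b x y. 0 < a \<Longrightarrow> a < b \<Longrightarrow> b \<le> h \<Longrightarrow> x \<in> A \<Longrightarrow> y \<in> A \<Longrightarrow> x + a *\<^sub>R e \<noteq> y + b *\<^sub>R e" and h: "h > 0"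
  shows "negligible A"
proof -
  have Am: "A \<in> lmeasurable" using A by (rule lmeasurable_compact)
  define t where "t n = h / real (Suc n)" for n
  define T where "T n = (+) (t n *\<^sub>R e) ` A" for n
  obtain R where R: "\<And>x. x \<in> A \<Longrightarrow> norm x \<le> R" using compact_imp_bounded[OF A] by (auto simp: bounded_iff)
  have t: "0 < t n" "t n \<le> h" for n using h by (auto simp: t_def field_simps)
  have Tsub: "T n \<subseteq> cball 0 (R + h)" for n
  proof
    fix y assume "y \<in> T n"
    then obtain x where x: "x \<in> A" "y = t n *\<^sub>R e + x" by (auto simp: T_def)
    have "norm (t n *\<^sub>R e) \<le> h * 1" unfolding norm_scaleR using t[of n] e by (intro mult_mono) auto
    then show "y \<in> cball 0 (R + h)" using R[OF x(1)] norm_triangle_ineq[of "t n *\<^sub>R e" x] x(2) by simp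
  qed
  have Tm: "T n \<in> lmeasurable" "measure lebesgue (T n) = measure lebesgue A" for n
    unfolding T_def using Am by (auto simp: measurable_translation measure_translation)
  have disj: "disjnt (T m) (T n)" if "m < n" for m n
  proof -
    have "t n < t m" using that h by (auto simp: t_def intro!: divide_strict_left_mono)
    then have "x + t n *\<^sub>R e \<noteq> y + t m *\<^sub>R e" if "x \<in> A" "y \<in> A" for x y
      using dis[OF t(1)[of n] _ t(2)[of m]] that by blast
    then show ?thesis unfolding disjnt_def T_def by (auto simp: add.commute) (metis add.commute)
  qed
  have "real k * measure lebesgue A \<le> measure lebesgue (cball 0 (R + h) :: 'a set)" for k
  proof -
    have "measure lebesgue (\<Union>n<k. T n) = (\<Sum>n<k. measure lebesgue (T n))"
    proof (rule measure_UNION')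
      show "pairwise (\<lambda>i j. disjnt (T i) (T j)) {..<k}"
        using disj unfolding pairwise_def by (metis disjnt_sym linorder_neqE_nat)
    qed (use Tm in auto)
    also have "\<dots> = real k * measure lebesgue A" by (simp add: Tm)
    finally have "real k * measure lebesgue A = measure lebesgue (\<Union>n<k. T n)" by simp
    also have "\<dots> \<le> measure lebesgue (cball 0 (R + h) :: 'a set)"
      using Tsub Tm by (intro measure_mono_fmeasurable) (auto intro!: fmeasurableD)
    finally show ?thesis .
  qed
  then have "measure lebesgue A = 0"
    using reals_Archimedean3[of "measure lebesgue A"] by (metis measure_nonneg not_le order_le_less)
  then show ?thesis using Am by (simp add: negligible_iff_measure0)
qed

lemma lipschitz_domain_frontier_negligible:
  fixes U :: "'a::euclidean_space set"
  assumes U: "bounded_lipschitz_domain U"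
  shows "negligible (frontier U)"
proof -
  have o: "open U" using U by (simp add: bounded_lipschitz_domain_def)
  have "\<exists>V. openin (top_of_set (frontier U)) V \<and> z \<in> V \<and> negligible V" if z: "z \<in> frontier U" for z
  proof -
    have "z \<in> closure U" using z by (simp add: frontier_def)
    then obtain r e s h0 where c: "r > 0" "s > 0" "h0 > 0"
      "\<And>x h v. x \<in> closure U \<Longrightarrow> x \<in> ball z r \<Longrightarrow> 0 < h \<Longrightarrow> h \<le> h0 \<Longrightarrow> v \<in> cball e s \<Longrightarrow> x + h *\<^sub>R v \<in> U"
      using lipschitz_domain_cone[OF U] by metis
    let ?A = "frontier U \<inter> cball z (r/2)"
    define e' where "e' = (1 / (norm e + 1)) *\<^sub>R e"
    have n1: "norm e + 1 > 0" by (smt (verit) norm_ge_zero)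
    have "negligible ?A"
    proof (rule negligible_disjoint_translates[where e=e' and h=h0])
      show "compact ?A" by (simp add: compact_Int_closed closed_Int_compact)
      show "norm e' \<le> 1" using n1 by (simp add: e'_def field_simps)
      fix a b x y assume ab: "0 < a" "a < b" "b \<le> h0" and xy: "x \<in> ?A" "y \<in> ?A"
      show "x + a *\<^sub>R e' \<noteq> y + b *\<^sub>R e'"
      proof
        assume "x + a *\<^sub>R e' = y + b *\<^sub>R e'"
        then have "x = y + ((b - a) / (norm e + 1)) *\<^sub>R e"
          by (simp add: e'_def algebra_simps diff_divide_distrib)
        moreover have "y + ((b - a) / (norm e + 1)) *\<^sub>R e \<in> U"
        proof (rule c(4))
          show "y \<in> closure U" using xy by (simp add: frontier_def)
          show "y \<in> ball z r" using xy c(1) by auto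
          show "0 < (b - a) / (norm e + 1)" using ab n1 by simp
          have "(b - a) / (norm e + 1) \<le> (b - a) / 1" using ab n1 by (intro divide_left_mono) auto
          then show "(b - a) / (norm e + 1) \<le> h0" using ab by simp
        qed (use c in auto)
        ultimately show False using xy(1) o by (auto simp: frontier_def interior_open)
      qed
    qed (use c in auto)
    then have "negligible (frontier U \<inter> ball z (r/2))" by (rule negligible_subset) auto
    then show ?thesis using c(1) z
      by (intro exI[of _ "frontier U \<inter> ball z (r/2)"]) (auto simp: openin_open)
  qed
  then show ?thesis by (subst locally_negligible_alt) blast
qed

lemma AE_on_closure_lipschitz_domain:
  fixes U :: "'a::euclidean_space set"
  assumes U: "bounded_lipschitz_domain U" and P: "AE x in lebesgue_on U. P x"
  shows "AE x in lebesgue_on (closure U). P x"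
proof -
  have o: "open U" using U by (simp add: bounded_lipschitz_domain_def)
  have "AE x in lebesgue. x \<notin> frontier U"
    using lipschitz_domain_frontier_negligible[OF U] by (simp add: negligible_iff_null_sets AE_not_in)
  moreover have "AE x in lebesgue. x \<in> U \<longrightarrow> P x" using P o by (subst (asm) AE_restrict_space_iff) auto
  ultimately have "AE x in lebesgue. x \<in> closure U \<longrightarrow> P x"
    by eventually_elim (use o in \<open>auto simp: frontier_def interior_open\<close>)
  then show ?thesis by (subst AE_restrict_space_iff) auto
qed

lemma continuous_AE_eq_imp_eq:
  fixes f g :: "'a::euclidean_space \<Rightarrow> real"
  assumes U: "open U" and W: "open W" and f: "continuous_on (closure U \<inter> W) f" and g: "continuous_on (closure U \<inter> W) g"
    and ae: "AE x in lebesgue_on (U \<inter> W). f x = g x" and x: "x \<in> closure U \<inter> W"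
  shows "f x = g x"
proof (rule ccontr)
  assume ne: "f x \<noteq> g x"
  have "continuous_on (closure U \<inter> W) (\<lambda>x. f x - g x)" using f g by (rule continuous_on_diff)
  then have "\<forall>e>0. \<exists>d>0. \<forall>y\<in>closure U \<inter> W. dist y x < d \<longrightarrow> dist (f y - g y) (f x - g x) < e"
    using x unfolding continuous_on_iff by blast
  then obtain d where d: "d > 0"
    "\<And>y. y \<in> closure U \<inter> W \<Longrightarrow> dist y x < d \<Longrightarrow> dist (f y - g y) (f x - g x) < \<bar>f x - g x\<bar>"
    using ne by (metis abs_of_nonneg abs_ge_zero eq_iff_diff_eq_0 zero_less_abs_iff)
  let ?B = "U \<inter> W \<inter> ball x d"
  have o: "open ?B" using U W by auto
  have "W \<inter> ball x d \<in> {S. open S}" "x \<in> W \<inter> ball x d" using W x d by auto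
  then have "U \<inter> (W \<inter> ball x d) \<noteq> {}"
    using x open_Int_closure_eq_empty[of "W \<inter> ball x d" U] by auto
  then have ne': "?B \<noteq> {}" by (simp add: Int_assoc)
  have neq: "f y \<noteq> g y" if "y \<in> ?B" for y
  proof -
    have "y \<in> closure U \<inter> W" using that closure_subset[of U] by auto
    moreover have "dist y x < d" using that by (simp add: dist_commute)
    ultimately have "\<bar>(f y - g y) - (f x - g x)\<bar> < \<bar>f x - g x\<bar>" using d(2) unfolding dist_real_def by blast
    then show ?thesis by auto
  qed
  have "AE x in lebesgue. x \<in> U \<inter> W \<longrightarrow> f x = g x" using ae U W by (subst (asm) AE_restrict_space_iff) auto
  then have "AE x in lebesgue. x \<notin> ?B" by eventually_elim (use neq in auto)
  then have "?B \<in> null_sets lebesgue" using AE_iff_null_sets[of ?B lebesgue] o by auto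
  then have "negligible ?B" by (simp add: negligible_iff_null_sets)
  then show False using open_not_negligible[OF o ne'] by simp
qed

subsection \<open>Averages over scaled cones\<close>

text \<open>
  Averages of \<open>y\<close> against the rescaled mollifier centred near \<open>x + h e\<close>, with the support inside
  the domain whenever \<open>x\<close> lies in its closure.  Moving \<open>x\<close> and \<open>h\<close> changes the average by an
  integral of the weak gradient, because the derivative of the rescaled mollifier is a divergence.
\<close>

locale mollifier =
  fixes \<rho> :: "'a::euclidean_space \<Rightarrow> real" and e :: 'a and s B :: real
  assumes smooth: "\<And>n. Ck n \<rho>" and support: "\<And>x. \<rho> x \<noteq> 0 \<Longrightarrow> x \<in> cball e s"
    and nonneg: "\<And>x. 0 \<le> \<rho> x" and mass: "integrable lborel \<rho>" "(\<integral>x. \<rho> x \<partial>lborel) = 1"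
    and bound: "\<And>x. \<rho> x \<le> B" and deriv_bound: "\<And>x k. \<bar>frechet_derivative \<rho> (at x) k\<bar> \<le> B * norm k"
    and s0: "0 < s" and B0: "0 < B"

lemma mollifier_exists:
  fixes e :: "'a::euclidean_space"
  assumes s: "s > 0"
  shows "\<exists>\<rho> B. mollifier \<rho> e s B"
proof -
  obtain a c where ac: "cbox a c \<subseteq> ball e s" "e \<in> box a c"
    using open_contains_cbox[of "ball e s" e] s by (metis centre_in_ball open_ball)
  define f where "f = box_bump 1 a c"
  have f: "f \<in> test_functions (ball e s)" unfolding f_def using ac by (intro box_bump_in_test_functions) auto
  note t = test_functionsD[OF f]
  have fs: "f x \<noteq> 0 \<longleftrightarrow> x \<in> box a c" for x unfolding f_def by (rule box_bump_support) simp
  have f0: "0 \<le> f x" "f x \<le> 1" for x unfolding f_def by (rule box_bump_bounds)+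
  have fm [measurable]: "f \<in> borel_measurable borel" using t(1) by (rule borel_measurable_continuous_onI)
  have fi: "integrable lborel f"
  proof (rule integrableI_bounded_set[where A="box a c" and B=1])
    show "AE x in lborel. x \<notin> box a c \<longrightarrow> f x = 0" using fs by auto
  qed (use f0 emeasure_lborel_box_finite in auto)
  have "(\<integral>x. f x \<partial>lborel) > 0"
  proof (rule ccontr)
    assume "\<not> (\<integral>x. f x \<partial>lborel) > 0"
    then have "(\<integral>x. f x \<partial>lborel) = 0" using f0 integral_nonneg_AE[of f lborel] by fastforce
    then have "AE x in lborel. f x = 0" using integral_nonneg_eq_0_iff_AE[OF fi] f0 by simp
    then have "AE x in lborel. x \<notin> box a c" by eventually_elim (use fs in auto)
    then have "box a c \<in> null_sets lborel" using AE_iff_null_sets[of "box a c" lborel] by auto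
    then have "negligible (box a c)" using null_sets_completionI negligible_iff_null_sets by blast
    then show False using open_not_negligible[of "box a c"] ac(2) by auto
  qed
  then obtain m where m: "m > 0" "(\<integral>x. f x \<partial>lborel) = m" by blast
  have "\<exists>Bb. \<forall>x. \<bar>frechet_derivative f (at x) b\<bar> \<le> Bb" if "b \<in> Basis" for b
    using continuous_compact_support_bounded[OF t(6)[OF that] t(2) t(5)] by metis
  then obtain Bb where Bb: "\<And>b x. b \<in> Basis \<Longrightarrow> \<bar>frechet_derivative f (at x) b\<bar> \<le> Bb b" by metis
  define B where "B = (1 + (\<Sum>b\<in>Basis. Bb b)) / m"
  have Bb0: "0 \<le> Bb b" if "b \<in> Basis" for b using Bb[OF that, of 0] by linarith
  then have sB: "0 \<le> (\<Sum>b\<in>Basis. Bb b)" by (rule sum_nonneg)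
  have ck: "Ck n (\<lambda>x. (1/m) * f x)" for n unfolding f_def by (intro Ck_mult Ck_const Ck_box_bump)
  have fd: "(f has_derivative frechet_derivative f (at x)) (at x)" for x
    unfolding f_def using Ck_SucE[OF Ck_box_bump] .
  have fr: "frechet_derivative (\<lambda>x. (1/m) * f x) (at x) = (\<lambda>k. (1/m) * frechet_derivative f (at x) k)" for x
    using frechet_derivative_at[OF has_derivative_mult_right[OF fd[of x], of "1/m"]] by simp
  have "mollifier (\<lambda>x. (1/m) * f x) e s B"
  proof
    show "Ck n (\<lambda>x. (1/m) * f x)" for n by (rule ck)
    show "x \<in> cball e s" if "(1/m) * f x \<noteq> 0" for x
    proof -
      have "x \<in> box a c" using that fs[of x] by auto
      then show ?thesis using ac(1) box_subset_cbox[of a c] ball_subset_cball[of e s] by blast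
    qed
    show "0 \<le> (1/m) * f x" for x using f0 m by simp
    show "integrable lborel (\<lambda>x. (1/m) * f x)" using fi by simp
    show "(\<integral>x. (1/m) * f x \<partial>lborel) = 1" using m by simp
    show "(1/m) * f x \<le> B" for x
      using f0(2)[of x] m(1) sB by (simp add: B_def divide_right_mono)
    show "0 < B" using m sB by (simp add: B_def add_pos_nonneg)
    show "\<bar>frechet_derivative (\<lambda>x. (1/m) * f x) (at x) k\<bar> \<le> B * norm k" for x k
    proof -
      let ?F = "frechet_derivative f (at x)"
      have "?F k = ?F (\<Sum>b\<in>Basis. (k \<bullet> b) *\<^sub>R b)" by (simp add: euclidean_representation)
      also have "\<dots> = (\<Sum>b\<in>Basis. (k \<bullet> b) * ?F b)"
        using has_derivative_linear[OF fd[of x]] by (simp add: linear_sum linear_scale)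
      also have "\<bar>\<dots>\<bar> \<le> (\<Sum>b\<in>Basis. norm k * Bb b)"
        unfolding abs_mult using Bb Basis_le_norm
        by (intro order_trans[OF sum_abs] sum_mono) (auto simp: abs_mult intro!: mult_mono)
      also have "\<dots> = norm k * (\<Sum>b\<in>Basis. Bb b)" by (simp add: sum_distrib_left)
      also have "\<dots> \<le> norm k * (1 + (\<Sum>b\<in>Basis. Bb b))" by (intro mult_left_mono) auto
      finally have "(1/m) * \<bar>?F k\<bar> \<le> (1/m) * (norm k * (1 + (\<Sum>b\<in>Basis. Bb b)))"
        using m by (intro mult_left_mono) auto
      then show ?thesis using m unfolding fr by (simp add: abs_mult B_def mult.commute)
    qed
  qed (use s in auto)
  then show ?thesis by blast
qed

context mollifier
begin

lemma continuous: "continuous_on UNIV \<rho>"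
  by (rule Ck_continuous[OF smooth])

lemma has_deriv: "(\<rho> has_derivative frechet_derivative \<rho> (at x)) (at x)"
  by (rule Ck_SucE[OF smooth])

lemma closure_support: "closure {x. \<rho> x \<noteq> 0} \<subseteq> cball e s"
  by (rule closure_minimal) (use support in auto)

lemma deriv_support: "x \<notin> cball e s \<Longrightarrow> frechet_derivative \<rho> (at x) k = 0"
proof -
  assume "x \<notin> cball e s"
  then have "x \<notin> closure {x. \<rho> x \<noteq> 0}" using closure_support by blast
  then show ?thesis by (simp add: frechet_derivative_outside_support)
qed

lemma lipschitz: "\<bar>\<rho> x - \<rho> x'\<bar> \<le> B * norm (x - x')"
proof -
  have "norm (\<rho> x - \<rho> x') \<le> B * norm (x - x')"
  proof (rule differentiable_bound[where S=UNIV])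
    show "(\<rho> has_derivative frechet_derivative \<rho> (at x)) (at x within UNIV)" for x by (simp add: has_deriv)
    show "onorm (frechet_derivative \<rho> (at x)) \<le> B" for x
      by (rule onorm_le) (use deriv_bound in \<open>simp add: mult.commute\<close>)
  qed auto
  then show ?thesis by simp
qed

definition kernel :: "'a \<Rightarrow> real \<Rightarrow> 'a \<Rightarrow> real" where
  "kernel x h z = \<rho> ((1/h) *\<^sub>R (z - x)) * (1/h) ^ DIM('a)"

definition kernel_deriv :: "'a \<Rightarrow> real \<Rightarrow> 'a \<Rightarrow> real \<Rightarrow> 'a \<Rightarrow> real" where
  "kernel_deriv k l x h z = - ((1/h) ^ (DIM('a) + 1) * (real DIM('a) * l * \<rho> ((1/h) *\<^sub>R (z - x))
      + frechet_derivative \<rho> (at ((1/h) *\<^sub>R (z - x))) (k + l *\<^sub>R ((1/h) *\<^sub>R (z - x)))))"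

lemma kernel_support:
  assumes "h > 0" "kernel x h z \<noteq> 0"
  shows "\<exists>v\<in>cball e s. z = x + h *\<^sub>R v"
proof -
  have "\<rho> ((1/h) *\<^sub>R (z - x)) \<noteq> 0" using assms by (auto simp: kernel_def)
  from support[OF this] show ?thesis using assms(1) by (intro bexI[of _ "(1/h) *\<^sub>R (z - x)"]) simp_all
qed

lemma kernel_has_derivative:
  assumes h: "h + t * l > 0"
  shows "((\<lambda>t. kernel (x + t *\<^sub>R k) (h + t * l) z) has_real_derivative
    kernel_deriv k l (x + t *\<^sub>R k) (h + t * l) z) (at t)"
proof -
  let ?h = "h + t * l" and ?x = "x + t *\<^sub>R k"
  let ?\<zeta> = "(1/?h) *\<^sub>R (z - ?x)"
  have d1: "((\<lambda>t. (1/(h + t * l)) *\<^sub>R (z - (x + t *\<^sub>R k))) has_vector_derivative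
     - ((1/?h) *\<^sub>R (k + l *\<^sub>R ?\<zeta>))) (at t)"
  proof -
    have "((\<lambda>t. (1/(h + t * l)) *\<^sub>R (z - (x + t *\<^sub>R k))) has_vector_derivative
     ((1/?h) *\<^sub>R (- k) + (- l / ?h^2) *\<^sub>R (z - ?x))) (at t)"
      using h by (intro has_vector_derivative_scaleR)
        (auto intro!: derivative_eq_intros simp: power2_eq_square field_simps)
    moreover have "(1/?h) *\<^sub>R (- k) + (- l / ?h^2) *\<^sub>R (z - ?x) = - ((1/?h) *\<^sub>R (k + l *\<^sub>R ?\<zeta>))"
      by (simp add: power2_eq_square scaleR_add_right)
    ultimately show ?thesis by simp
  qed
  have "((\<lambda>t. \<rho> ((1/(h + t * l)) *\<^sub>R (z - (x + t *\<^sub>R k)))) has_derivative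
     (\<lambda>u. frechet_derivative \<rho> (at ?\<zeta>) (u *\<^sub>R (- ((1/?h) *\<^sub>R (k + l *\<^sub>R ?\<zeta>)))))) (at t)"
    by (rule has_derivative_compose[OF d1[unfolded has_vector_derivative_def] has_deriv])
  moreover have "frechet_derivative \<rho> (at ?\<zeta>) (u *\<^sub>R v) = u * frechet_derivative \<rho> (at ?\<zeta>) v" for u v
    using has_derivative_linear[OF has_deriv] by (simp only: linear_scale real_scaleR_def)
  moreover have "frechet_derivative \<rho> (at ?\<zeta>) (- ((1/?h) *\<^sub>R (k + l *\<^sub>R ?\<zeta>)))
      = - ((1/?h) * frechet_derivative \<rho> (at ?\<zeta>) (k + l *\<^sub>R ?\<zeta>))"
    using has_derivative_linear[OF has_deriv] by (simp only: linear_neg linear_scale real_scaleR_def)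
  ultimately have d2: "((\<lambda>t. \<rho> ((1/(h + t * l)) *\<^sub>R (z - (x + t *\<^sub>R k)))) has_real_derivative
     - ((1/?h) * frechet_derivative \<rho> (at ?\<zeta>) (k + l *\<^sub>R ?\<zeta>))) (at t)"
    by (simp only: has_field_derivative_def mult_commute_abs)
  have d3: "((\<lambda>t. (1/(h + t * l)) ^ DIM('a)) has_real_derivative
     - (real DIM('a) * l * (1/?h) ^ (DIM('a) + 1))) (at t)"
  proof -
    have "((\<lambda>t. 1/(h + t * l)) has_real_derivative - (l / ?h^2)) (at t)"
      using h by (auto intro!: derivative_eq_intros simp: power2_eq_square field_simps)
    from DERIV_power[OF this, of "DIM('a)"]
    have "((\<lambda>t. (1/(h + t * l)) ^ DIM('a)) has_real_derivative
       real DIM('a) * (- (l / ?h^2) * (1/?h) ^ (DIM('a) - Suc 0))) (at t)" .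
    moreover have "(1/?h) ^ (DIM('a) + 1) = (1/?h)^2 * (1/?h) ^ (DIM('a) - Suc 0)"
      by (simp only: power_add[symmetric]) (simp add: Suc_pred)
    ultimately show ?thesis by (simp add: power_divide)
  qed
  show ?thesis
    unfolding kernel_def
    by (rule DERIV_cong[OF DERIV_mult[OF d2 d3]]) (simp add: kernel_deriv_def algebra_simps)
qed

lemma kernel_deriv_bound:
  assumes h: "0 < h0" "h0 \<le> h"
  shows "\<bar>kernel_deriv k l x h z\<bar>
    \<le> (1/h0) ^ (DIM('a) + 1) * (real DIM('a) * \<bar>l\<bar> * B + B * (norm k + \<bar>l\<bar> * (norm e + s)))"
proof -
  let ?\<zeta> = "(1/h) *\<^sub>R (z - x)"
  have 1: "\<bar>real DIM('a) * l * \<rho> ?\<zeta>\<bar> \<le> real DIM('a) * \<bar>l\<bar> * B"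
    unfolding abs_mult using bound nonneg by (intro mult_mono) auto
  have 2: "\<bar>frechet_derivative \<rho> (at ?\<zeta>) (k + l *\<^sub>R ?\<zeta>)\<bar> \<le> B * (norm k + \<bar>l\<bar> * (norm e + s))"
  proof (cases "?\<zeta> \<in> cball e s")
    case True
    have "norm ?\<zeta> \<le> norm e + norm (?\<zeta> - e)" using norm_triangle_ineq[of e "?\<zeta> - e"] by simp
    then have "norm ?\<zeta> \<le> norm e + s" using True by (simp add: dist_norm norm_minus_commute)
    then have "\<bar>l\<bar> * norm ?\<zeta> \<le> \<bar>l\<bar> * (norm e + s)" by (rule mult_left_mono) simp
    then have "norm (k + l *\<^sub>R ?\<zeta>) \<le> norm k + \<bar>l\<bar> * (norm e + s)"
      using norm_triangle_ineq[of k "l *\<^sub>R ?\<zeta>"] unfolding norm_scaleR by linarith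
    then have "B * norm (k + l *\<^sub>R ?\<zeta>) \<le> B * (norm k + \<bar>l\<bar> * (norm e + s))" using B0 by (intro mult_left_mono) auto
    then show ?thesis using deriv_bound[of ?\<zeta> "k + l *\<^sub>R ?\<zeta>"] by linarith
  next
    case False
    then show ?thesis using deriv_support[OF False] B0 s0 by simp
  qed
  have 3: "(1/h) ^ (DIM('a) + 1) \<le> (1/h0) ^ (DIM('a) + 1)"
    using h by (intro power_mono divide_left_mono) auto
  have "\<bar>real DIM('a) * l * \<rho> ?\<zeta> + frechet_derivative \<rho> (at ?\<zeta>) (k + l *\<^sub>R ?\<zeta>)\<bar>
      \<le> real DIM('a) * \<bar>l\<bar> * B + B * (norm k + \<bar>l\<bar> * (norm e + s))"
    using 1 2 by linarith
  then have "(1/h) ^ (DIM('a) + 1) * \<bar>real DIM('a) * l * \<rho> ?\<zeta> + frechet_derivative \<rho> (at ?\<zeta>) (k + l *\<^sub>R ?\<zeta>)\<bar>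
      \<le> (1/h0) ^ (DIM('a) + 1) * (real DIM('a) * \<bar>l\<bar> * B + B * (norm k + \<bar>l\<bar> * (norm e + s)))"
    using 3 h by (intro mult_mono) auto
  moreover have "0 \<le> (1/h) ^ (DIM('a) + 1)" using h by simp
  ultimately show ?thesis unfolding kernel_deriv_def abs_minus_cancel by (simp only: abs_mult abs_of_nonneg)
qed

lemma kernel_continuous: "continuous_on UNIV (kernel x h)"
proof -
  have "continuous_on UNIV (\<lambda>z. \<rho> ((1/h) *\<^sub>R (z - x)))"
    by (rule continuous_on_compose2[OF continuous]) (auto intro!: continuous_intros)
  then show ?thesis unfolding kernel_def[abs_def] by (intro continuous_intros)
qed

lemma kernel_bound: "\<bar>kernel x h z\<bar> \<le> B * \<bar>1/h\<bar> ^ DIM('a)"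
  unfolding kernel_def abs_mult power_abs using bound nonneg by (intro mult_right_mono) auto

definition avg :: "'a set \<Rightarrow> ('a \<Rightarrow> real) \<Rightarrow> 'a \<Rightarrow> real \<Rightarrow> real" where
  "avg U y x h = (\<integral>z. y z * kernel x h z \<partial>lebesgue_on U)"

lemma kernel_measurable: "kernel x h \<in> borel_measurable (lebesgue_on U)" if "U \<in> sets lebesgue"
  using continuous_imp_measurable_on_sets_lebesgue[OF continuous_on_subset[OF kernel_continuous]] that by simp

lemma integrable_mult_kernel:
  assumes U: "U \<in> sets lebesgue" and y: "integrable (lebesgue_on U) (y :: 'a \<Rightarrow> real)"
  shows "integrable (lebesgue_on U) (\<lambda>z. y z * kernel x h z)"
proof (rule Bochner_Integration.integrable_bound)
  show "integrable (lebesgue_on U) (\<lambda>z. (B * \<bar>1/h\<bar> ^ DIM('a)) * y z)" using y by simp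
  show "(\<lambda>z. y z * kernel x h z) \<in> borel_measurable (lebesgue_on U)"
    by (rule borel_measurable_times[OF borel_measurable_integrable[OF y] kernel_measurable[OF U]])
  have "norm (y z * kernel x h z) \<le> norm ((B * \<bar>1/h\<bar> ^ DIM('a)) * y z)" for z
  proof -
    have "norm (y z * kernel x h z) \<le> \<bar>y z\<bar> * (B * \<bar>1/h\<bar> ^ DIM('a))"
      unfolding real_norm_def abs_mult by (intro mult_left_mono kernel_bound) simp
    then show ?thesis using B0 by (simp add: abs_mult mult.commute)
  qed
  then show "AE z in lebesgue_on U. norm (y z * kernel x h z) \<le> norm ((B * \<bar>1/h\<bar> ^ DIM('a)) * y z)" by simp
qed

lemma avg_has_derivative_kernel:
  assumes U: "U \<in> sets lebesgue" and y: "integrable (lebesgue_on U) y" and h: "h > 0"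
  shows "((\<lambda>t. avg U y (x + t *\<^sub>R k) (h + t * l)) has_real_derivative
    (\<integral>z. y z * kernel_deriv k l x h z \<partial>lebesgue_on U)) (at 0)"
proof -
  define t0 where "t0 = h / (2 * (\<bar>l\<bar> + 1))"
  have t0: "t0 > 0" using h by (simp add: t0_def)
  have ht: "h/2 \<le> h + t * l" if "\<bar>t\<bar> \<le> t0" for t
  proof -
    have "\<bar>t * l\<bar> \<le> t0 * (\<bar>l\<bar> + 1)" unfolding abs_mult using that by (intro mult_mono) auto
    also have "t0 * (\<bar>l\<bar> + 1) = h/2" using abs_ge_zero[of l] by (simp add: t0_def divide_simps)
    finally show ?thesis by (simp add: abs_le_iff)
  qed
  define K where "K = (1/(h/2)) ^ (DIM('a) + 1) * (real DIM('a) * \<bar>l\<bar> * B + B * (norm k + \<bar>l\<bar> * (norm e + s)))"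
  define q where "q t z = (kernel (x + t *\<^sub>R k) (h + t * l) z - kernel x h z) / t" for t z
  have qb: "\<bar>q t z\<bar> \<le> K" if t: "\<bar>t\<bar> \<le> t0" "t \<noteq> 0" for t z
  proof -
    have "norm (kernel (x + t *\<^sub>R k) (h + t * l) z - kernel (x + 0 *\<^sub>R k) (h + 0 * l) z) \<le> K * norm (t - 0)"
    proof (rule field_differentiable_bound[where S="{-t0..t0}"])
      fix u assume u: "u \<in> {-t0..t0}"
      then have hu: "h / 2 \<le> h + u * l" by (intro ht) auto
      then have hu0: "h + u * l > 0" using h by linarith
      show "((\<lambda>t. kernel (x + t *\<^sub>R k) (h + t * l) z) has_field_derivative
          kernel_deriv k l (x + u *\<^sub>R k) (h + u * l) z) (at u within {-t0..t0})"
        by (rule DERIV_subset[OF kernel_has_derivative[OF hu0]]) simp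
      show "norm (kernel_deriv k l (x + u *\<^sub>R k) (h + u * l) z) \<le> K"
        unfolding K_def real_norm_def by (rule kernel_deriv_bound[OF _ hu]) (use h in simp)
    qed (use t t0 in auto)
    then show ?thesis using t by (simp add: q_def abs_divide divide_le_eq)
  qed
  have ql: "((\<lambda>t. q t z) \<longlongrightarrow> kernel_deriv k l x h z) (at 0)" for z
    using kernel_has_derivative[of h 0 l x k z] h by (simp add: has_field_derivative_iff q_def)
  have "((\<lambda>t. \<integral>z. y z * q t z \<partial>lebesgue_on U) \<longlongrightarrow> (\<integral>z. y z * kernel_deriv k l x h z \<partial>lebesgue_on U)) (at 0)"
    unfolding tendsto_at_iff_sequentially
  proof (intro allI impI)
    fix X :: "nat \<Rightarrow> real" assume X: "\<forall>i. X i \<in> UNIV - {0}" "X \<longlonglongrightarrow> 0"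
    have "\<forall>\<^sub>F n in sequentially. \<bar>X n\<bar> \<le> t0"
      using tendstoD[OF X(2) t0] by eventually_elim simp
    then obtain N where N: "\<And>n. n \<ge> N \<Longrightarrow> \<bar>X n\<bar> \<le> t0" by (auto simp: eventually_sequentially)
    have qm: "q t \<in> borel_measurable (lebesgue_on U)" for t
      unfolding q_def by (intro borel_measurable_divide borel_measurable_diff kernel_measurable U borel_measurable_const)
    have XX: "(\<lambda>n. q (X (n + N)) z) \<longlonglongrightarrow> kernel_deriv k l x h z" for z
    proof (rule LIMSEQ_ignore_initial_segment)
      show "(\<lambda>n. q (X n) z) \<longlonglongrightarrow> kernel_deriv k l x h z"
        using ql[of z] X unfolding tendsto_at_iff_sequentially by (simp add: o_def)
    qed
    have "(\<lambda>n. \<integral>z. y z * q (X (n + N)) z \<partial>lebesgue_on U) \<longlonglongrightarrow> (\<integral>z. y z * kernel_deriv k l x h z \<partial>lebesgue_on U)"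
    proof (rule integral_dominated_convergence[where w="\<lambda>z. K * \<bar>y z\<bar>"])
      show "(\<lambda>z. y z * kernel_deriv k l x h z) \<in> borel_measurable (lebesgue_on U)"
      proof (rule borel_measurable_times[OF borel_measurable_integrable[OF y]])
        show "kernel_deriv k l x h \<in> borel_measurable (lebesgue_on U)"
          by (rule borel_measurable_LIMSEQ_metric[OF qm XX])
      qed
      show "(\<lambda>z. y z * q (X (n + N)) z) \<in> borel_measurable (lebesgue_on U)" for n
        by (rule borel_measurable_times[OF borel_measurable_integrable[OF y] qm])
      show "integrable (lebesgue_on U) (\<lambda>z. K * \<bar>y z\<bar>)" using y by simp
      show "AE z in lebesgue_on U. (\<lambda>n. y z * q (X (n + N)) z) \<longlonglongrightarrow> y z * kernel_deriv k l x h z"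
        by (intro AE_I2 tendsto_mult tendsto_const XX)
      show "AE z in lebesgue_on U. norm (y z * q (X (n + N)) z) \<le> K * \<bar>y z\<bar>" for n
      proof (intro AE_I2)
        fix z
        have "\<bar>q (X (n + N)) z\<bar> \<le> K" using X(1) by (intro qb N) auto
        then have "\<bar>q (X (n + N)) z\<bar> * \<bar>y z\<bar> \<le> K * \<bar>y z\<bar>" by (rule mult_right_mono) simp
        then show "norm (y z * q (X (n + N)) z) \<le> K * \<bar>y z\<bar>" by (simp add: abs_mult mult.commute)
      qed
    qed
    then show "((\<lambda>t. \<integral>z. y z * q t z \<partial>lebesgue_on U) \<circ> X) \<longlonglongrightarrow> (\<integral>z. y z * kernel_deriv k l x h z \<partial>lebesgue_on U)"
      unfolding o_def by (rule LIMSEQ_offset)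
  qed
  moreover have "(\<integral>z. y z * q t z \<partial>lebesgue_on U) = (avg U y (x + t *\<^sub>R k) (h + t * l) - avg U y x h) / t" for t
  proof -
    have "(\<integral>z. y z * q t z \<partial>lebesgue_on U)
        = (\<integral>z. (y z * kernel (x + t *\<^sub>R k) (h + t * l) z - y z * kernel x h z) / t \<partial>lebesgue_on U)"
      by (simp add: q_def right_diff_distrib)
    then show ?thesis unfolding avg_def using integrable_mult_kernel[OF U y] by simp
  qed
  ultimately show ?thesis unfolding has_field_derivative_iff by simp
qed

lemma integral_kernel_deriv:
  assumes U: "open U" and wg: "is_weak_gradient U y g" and h: "h > 0"
    and sup: "\<And>v. v \<in> cball e s \<Longrightarrow> x + h *\<^sub>R v \<in> U"
  shows "(\<integral>z. y z * kernel_deriv k l x h z \<partial>lebesgue_on U)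
    = (\<integral>z. (g z \<bullet> (k + l *\<^sub>R ((1/h) *\<^sub>R (z - x)))) * kernel x h z \<partial>lebesgue_on U)"
    and "integrable (lebesgue_on U) (\<lambda>z. (g z \<bullet> (k + l *\<^sub>R ((1/h) *\<^sub>R (z - x)))) * kernel x h z)"
proof -
  define \<Phi> where "\<Phi> b z = \<rho> ((1/h) *\<^sub>R z + (- (1/h) *\<^sub>R x)) * ((l / h) * (z \<bullet> b) + ((k \<bullet> b) - (l / h) * (x \<bullet> b))) * (1/h) ^ DIM('a)" for b z
  have \<zeta>: "(1/h) *\<^sub>R z + (- (1/h) *\<^sub>R x) = (1/h) *\<^sub>R (z - x)" for z by (simp add: scaleR_diff_right)
  have \<Phi>e: "\<Phi> b z = kernel x h z * ((k + l *\<^sub>R ((1/h) *\<^sub>R (z - x))) \<bullet> b)" for b z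
    unfolding \<Phi>_def \<zeta> kernel_def by (simp add: algebra_simps inner_add_left inner_diff_left diff_divide_distrib)
  have loc: "locally_integrable U y" "locally_integrable U g" using wg by (auto simp: is_weak_gradient_def)
  let ?K = "(\<lambda>v. x + h *\<^sub>R v) ` cball e s"
  have cK: "compact ?K" by (intro compact_continuous_image continuous_intros compact_cball)
  have test: "\<Phi> b \<in> test_functions U" for b
    unfolding test_functions_def
  proof (intro CollectI conjI allI)
    show "Ck n (\<Phi> b)" for n unfolding \<Phi>_def
      by (intro Ck_mult Ck_add Ck_const Ck_inner Ck_affine[OF smooth])
    have "{z. \<Phi> b z \<noteq> 0} \<subseteq> ?K"
    proof
      fix z assume "z \<in> {z. \<Phi> b z \<noteq> 0}"
      then have "kernel x h z \<noteq> 0" by (auto simp: \<Phi>e)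
      then show "z \<in> ?K" using kernel_support[OF h] by blast
    qed
    then have sub: "closure {z. \<Phi> b z \<noteq> 0} \<subseteq> ?K" by (rule closure_minimal) (rule compact_imp_closed[OF cK])
    show "compact (closure {z. \<Phi> b z \<noteq> 0})" using compact_Int_closed[OF cK closed_closure] sub by (metis inf.absorb_iff2)
    show "closure {z. \<Phi> b z \<noteq> 0} \<subseteq> U" using sub sup by auto
  qed
  have fd: "frechet_derivative (\<Phi> b) (at z) b
      = (1/h) ^ (DIM('a) + 1) * (frechet_derivative \<rho> (at ((1/h) *\<^sub>R (z - x))) b * ((k + l *\<^sub>R ((1/h) *\<^sub>R (z - x))) \<bullet> b)
          + l * \<rho> ((1/h) *\<^sub>R (z - x)))" if b: "b \<in> Basis" for b z
  proof -
    have a: "((\<lambda>z. (1/h) *\<^sub>R z + (- (1/h) *\<^sub>R x)) has_derivative (\<lambda>v. (1/h) *\<^sub>R v)) (at z)"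
      by (auto intro!: derivative_eq_intros)
    have "((\<lambda>z. \<rho> ((1/h) *\<^sub>R z + (- (1/h) *\<^sub>R x))) has_derivative
        (\<lambda>v. frechet_derivative \<rho> (at ((1/h) *\<^sub>R z + (- (1/h) *\<^sub>R x))) ((1/h) *\<^sub>R v))) (at z)"
      by (rule has_derivative_compose[OF a has_deriv])
    moreover have "((\<lambda>z. (l / h) * (z \<bullet> b) + ((k \<bullet> b) - (l / h) * (x \<bullet> b))) has_derivative (\<lambda>v. (l / h) * (v \<bullet> b))) (at z)"
      using h by (auto intro!: derivative_eq_intros)
    ultimately have "(\<Phi> b has_derivative (\<lambda>v. (\<rho> ((1/h) *\<^sub>R z + (- (1/h) *\<^sub>R x)) * ((l / h) * (v \<bullet> b))
        + frechet_derivative \<rho> (at ((1/h) *\<^sub>R z + (- (1/h) *\<^sub>R x))) ((1/h) *\<^sub>R v)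
          * ((l / h) * (z \<bullet> b) + ((k \<bullet> b) - (l / h) * (x \<bullet> b)))) * (1/h) ^ DIM('a))) (at z)"
      unfolding \<Phi>_def by (intro has_derivative_mult_left has_derivative_mult)
    from frechet_derivative_at[OF this, symmetric]
    have "frechet_derivative (\<Phi> b) (at z) b = (\<rho> ((1/h) *\<^sub>R (z - x)) * ((l / h) * (b \<bullet> b))
        + frechet_derivative \<rho> (at ((1/h) *\<^sub>R (z - x))) ((1/h) *\<^sub>R b)
          * ((l / h) * (z \<bullet> b) + ((k \<bullet> b) - (l / h) * (x \<bullet> b)))) * (1/h) ^ DIM('a)"
      unfolding \<zeta> by simp
    moreover have "frechet_derivative \<rho> (at ((1/h) *\<^sub>R (z - x))) ((1/h) *\<^sub>R b)
        = (1/h) * frechet_derivative \<rho> (at ((1/h) *\<^sub>R (z - x))) b"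
      using has_derivative_linear[OF has_deriv] by (simp only: linear_scale real_scaleR_def)
    moreover have "(l / h) * (z \<bullet> b) + ((k \<bullet> b) - (l / h) * (x \<bullet> b)) = (k + l *\<^sub>R ((1/h) *\<^sub>R (z - x))) \<bullet> b"
      by (simp add: inner_add_left inner_diff_left algebra_simps diff_divide_distrib)
    moreover have "b \<bullet> b = 1" using b by simp
    ultimately show ?thesis by (simp add: algebra_simps add_divide_distrib)
  qed
  have div: "(\<Sum>b\<in>Basis. frechet_derivative (\<Phi> b) (at z) b) = - kernel_deriv k l x h z" for z
  proof -
    let ?D = "frechet_derivative \<rho> (at ((1/h) *\<^sub>R (z - x)))" and ?w = "k + l *\<^sub>R ((1/h) *\<^sub>R (z - x))"
    have "?D ?w = ?D (\<Sum>b\<in>Basis. (?w \<bullet> b) *\<^sub>R b)" by (simp only: euclidean_representation)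
    also have "\<dots> = (\<Sum>b\<in>Basis. (?w \<bullet> b) * ?D b)"
      using has_derivative_linear[OF has_deriv] by (simp only: linear_sum linear_scale real_scaleR_def)
    finally have w: "(\<Sum>b\<in>Basis. ?D b * (?w \<bullet> b)) = ?D ?w" by (simp only: mult.commute)
    have "(\<Sum>b\<in>Basis. frechet_derivative (\<Phi> b) (at z) b)
        = (\<Sum>b\<in>Basis. (1/h) ^ (DIM('a) + 1) * (?D b * (?w \<bullet> b) + l * \<rho> ((1/h) *\<^sub>R (z - x))))"
      by (intro sum.cong refl fd)
    also have "\<dots> = (1/h) ^ (DIM('a) + 1) * (?D ?w + real DIM('a) * (l * \<rho> ((1/h) *\<^sub>R (z - x))))"
      unfolding sum_distrib_left[symmetric] sum.distrib w by simp
    finally show ?thesis by (simp add: kernel_deriv_def algebra_simps)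
  qed
  have i1: "integrable (lebesgue_on U) (\<lambda>z. y z * frechet_derivative (\<Phi> b) (at z) b)" if "b \<in> Basis" for b
    by (rule test_function_integrable(2)[OF U loc(1) test that])
  have i2: "integrable (lebesgue_on U) (\<lambda>z. (g z \<bullet> b) * \<Phi> b z)" for b
    by (rule test_function_integrable(1)[OF U locally_integrable_inner[OF loc(2)] test])
  have e1: "(\<lambda>z. y z * kernel_deriv k l x h z) = (\<lambda>z. - (\<Sum>b\<in>Basis. y z * frechet_derivative (\<Phi> b) (at z) b))"
    by (simp only: sum_distrib_left[symmetric] div mult_minus_right minus_minus)
  have e2: "(\<lambda>z. (g z \<bullet> (k + l *\<^sub>R ((1/h) *\<^sub>R (z - x)))) * kernel x h z) = (\<lambda>z. \<Sum>b\<in>Basis. (g z \<bullet> b) * \<Phi> b z)"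
  proof
    fix z
    show "(g z \<bullet> (k + l *\<^sub>R ((1/h) *\<^sub>R (z - x)))) * kernel x h z = (\<Sum>b\<in>Basis. (g z \<bullet> b) * \<Phi> b z)"
      unfolding \<Phi>e by (subst euclidean_inner, unfold sum_distrib_right) (intro sum.cong refl, simp only: mult_ac)
  qed
  show "integrable (lebesgue_on U) (\<lambda>z. (g z \<bullet> (k + l *\<^sub>R ((1/h) *\<^sub>R (z - x)))) * kernel x h z)"
    unfolding e2 by (intro Bochner_Integration.integrable_sum i2)
  have "(\<integral>z. y z * kernel_deriv k l x h z \<partial>lebesgue_on U)
      = - (\<Sum>b\<in>Basis. \<integral>z. y z * frechet_derivative (\<Phi> b) (at z) b \<partial>lebesgue_on U)"
    unfolding e1 by (simp only: Bochner_Integration.integral_minus Bochner_Integration.integral_sum[OF i1])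
  also have "\<dots> = - (\<Sum>b\<in>Basis. - (\<integral>z. (g z \<bullet> b) * \<Phi> b z \<partial>lebesgue_on U))"
    using wg test unfolding is_weak_gradient_def by (intro arg_cong[where f=uminus] sum.cong refl) blast
  also have "\<dots> = (\<Sum>b\<in>Basis. \<integral>z. (g z \<bullet> b) * \<Phi> b z \<partial>lebesgue_on U)" by (simp add: sum_negf)
  also have "\<dots> = (\<integral>z. (g z \<bullet> (k + l *\<^sub>R ((1/h) *\<^sub>R (z - x)))) * kernel x h z \<partial>lebesgue_on U)"
    unfolding e2 by (simp only: Bochner_Integration.integral_sum[OF i2])
  finally show "(\<integral>z. y z * kernel_deriv k l x h z \<partial>lebesgue_on U)
    = (\<integral>z. (g z \<bullet> (k + l *\<^sub>R ((1/h) *\<^sub>R (z - x)))) * kernel x h z \<partial>lebesgue_on U)" .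
qed

end

subsection \<open>Morrey's inequality\<close>

lemma integral_lborel_affine:
  fixes f :: "'a::euclidean_space \<Rightarrow> real"
  assumes c: "c \<noteq> 0" and f: "f \<in> borel_measurable borel"
  shows "(\<integral>x. f x \<partial>lborel) = \<bar>c\<bar> ^ DIM('a) * (\<integral>v. f (t + c *\<^sub>R v) \<partial>lborel)"
proof -
  have "(\<integral>x. f x \<partial>lborel) = (\<integral>x. f x \<partial>density (distr lborel borel (\<lambda>x. t + c *\<^sub>R x)) (\<lambda>_. \<bar>c\<bar>^DIM('a)))"
    using lborel_affine[OF c, of t] by simp
  also have "\<dots> = (\<integral>x. \<bar>c\<bar>^DIM('a) *\<^sub>R f x \<partial>distr lborel borel (\<lambda>x. t + c *\<^sub>R x))"
    using f by (subst integral_density) auto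
  also have "\<dots> = (\<integral>v. \<bar>c\<bar>^DIM('a) *\<^sub>R f (t + c *\<^sub>R v) \<partial>lborel)"
    using f by (subst integral_distr) auto
  finally show ?thesis by simp
qed

context mollifier
begin

definition vol :: real where
  "vol = unit_ball_vol (real DIM('a)) * s ^ DIM('a)"

lemma vol_nonneg: "0 \<le> vol"
  using s0 by (simp add: vol_def)

lemma gradient_kernel_bound:
  assumes U: "open U" and p: "1 < p" and g: "g \<in> Lp_on p (lebesgue_on U)" and G: "0 < G"
    and gG: "(\<integral>z. norm (g z) powr p \<partial>lebesgue_on U) \<le> G powr p" and h: "h > 0"
    and i: "integrable (lebesgue_on U) (\<lambda>z. (g z \<bullet> (k + l *\<^sub>R ((1/h) *\<^sub>R (z - x)))) * kernel x h z)"
  shows "\<bar>\<integral>z. (g z \<bullet> (k + l *\<^sub>R ((1/h) *\<^sub>R (z - x)))) * kernel x h z \<partial>lebesgue_on U\<bar>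
    \<le> B * (norm k + \<bar>l\<bar> * (norm e + s)) * (1 + vol) * G * h powr (- (DIM('a) / p))"
proof -
  let ?d = "real DIM('a)"
  define R where "R = norm k + \<bar>l\<bar> * (norm e + s)"
  have R0: "R \<ge> 0" using s0 by (simp add: R_def)
  define E where "E = cball (x + h *\<^sub>R e) (h * s)"
  define t where "t = h powr (?d / p) / G"
  have t: "t > 0" using h G by (simp add: t_def)
  have E: "measure lebesgue E = vol * h ^ DIM('a)"
    unfolding E_def using h s0 by (simp add: content_cball vol_def power_mult_distrib)
  have Em: "E \<in> lmeasurable" unfolding E_def by (rule lmeasurable_cball)
  have pw: "\<bar>(g z \<bullet> (k + l *\<^sub>R ((1/h) *\<^sub>R (z - x)))) * kernel x h z\<bar>
      \<le> B * (1/h) ^ DIM('a) * R * (t powr (p - 1) * norm (g z) powr p + (1/t) * indicator E z)" for z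
  proof (cases "kernel x h z = 0")
    case True
    then show ?thesis using B0 h R0 t by (simp add: add_nonneg_nonneg)
  next
    case False
    then obtain v where v: "v \<in> cball e s" "z = x + h *\<^sub>R v" using kernel_support[OF h] by blast
    have "h * norm (e - v) \<le> h * s" using v(1) h by (intro mult_left_mono) (auto simp: dist_norm)
    moreover have "norm (x + h *\<^sub>R e - z) = h * norm (e - v)"
    proof -
      have "x + h *\<^sub>R e - z = h *\<^sub>R (e - v)" by (simp add: v(2) scaleR_diff_right)
      then show ?thesis using h by simp
    qed
    ultimately have zE: "z \<in> E" by (simp add: E_def dist_norm)
    have \<zeta>: "(1/h) *\<^sub>R (z - x) = v" using v(2) h by simp
    have "norm v \<le> norm e + norm (v - e)" using norm_triangle_ineq[of e "v - e"] by simp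
    then have "norm v \<le> norm e + s" using v(1) by (simp add: dist_norm norm_minus_commute)
    then have "\<bar>l\<bar> * norm v \<le> \<bar>l\<bar> * (norm e + s)" by (rule mult_left_mono) simp
    then have "norm (k + l *\<^sub>R v) \<le> R"
      unfolding R_def using norm_triangle_ineq[of k "l *\<^sub>R v"] unfolding norm_scaleR by linarith
    then have "norm (g z) * norm (k + l *\<^sub>R v) \<le> norm (g z) * R" by (rule mult_left_mono) simp
    then have 1: "\<bar>g z \<bullet> (k + l *\<^sub>R v)\<bar> \<le> norm (g z) * R"
      using Cauchy_Schwarz_ineq2[of "g z" "k + l *\<^sub>R v"] by linarith
    have "\<bar>(g z \<bullet> (k + l *\<^sub>R v)) * kernel x h z\<bar> \<le> (norm (g z) * R) * (B * \<bar>1/h\<bar> ^ DIM('a))"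
      unfolding abs_mult by (intro mult_mono 1 kernel_bound) (use R0 in auto)
    also have "\<dots> = B * (1/h) ^ DIM('a) * R * norm (g z)" using h by (simp add: mult_ac)
    also have "\<dots> \<le> B * (1/h) ^ DIM('a) * R * (t powr (p - 1) * norm (g z) powr p + (1/t) * indicator E z)"
      using young_scaled[OF p t, of "norm (g z)"] zE B0 h R0 by (intro mult_left_mono) auto
    finally show ?thesis unfolding \<zeta> .
  qed
  have indi: "integrable (lebesgue_on U) (\<lambda>z. indicator E z :: real)"
    and indb: "(\<integral>z. indicator E z \<partial>lebesgue_on U) \<le> vol * h ^ DIM('a)"
  proof -
    have UE: "U \<inter> E \<in> lmeasurable" using U Em by (simp add: fmeasurable_Int_fmeasurable Int_commute)
    have eq: "(\<lambda>z. indicator U z *\<^sub>R (indicator E z :: real)) = indicator (U \<inter> E)"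
      by (auto simp: indicator_def fun_eq_iff)
    show "integrable (lebesgue_on U) (\<lambda>z. indicator E z :: real)"
    proof -
      have "U \<inter> E \<in> sets lebesgue" "emeasure lebesgue (U \<inter> E) < \<infinity>" using UE unfolding fmeasurable_def by blast+
      then have "integrable lebesgue (indicator (U \<inter> E) :: 'a \<Rightarrow> real)" by (rule integrable_real_indicator)
      then show ?thesis using U by (subst integrable_restrict_space) (simp_all only: eq, simp_all)
    qed
    have "(\<integral>z. indicator E z \<partial>lebesgue_on U) = (\<integral>z. indicator (U \<inter> E) z \<partial>lebesgue :: real)"
      using U by (subst integral_restrict_space) (simp_all only: eq, simp_all)
    also have "\<dots> = measure lebesgue (U \<inter> E)" by simp
    also have "\<dots> \<le> measure lebesgue E" using UE Em by (intro measure_mono_fmeasurable) (auto intro: fmeasurableD)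
    finally show "(\<integral>z. indicator E z \<partial>lebesgue_on U) \<le> vol * h ^ DIM('a)" by (simp only: E)
  qed
  have bi: "integrable (lebesgue_on U) (\<lambda>z. B * (1/h) ^ DIM('a) * R * (t powr (p - 1) * norm (g z) powr p + (1/t) * indicator E z))"
    using Lp_onD(2)[OF g] indi by (intro integrable_mult_right Bochner_Integration.integrable_add)
  have "\<bar>\<integral>z. (g z \<bullet> (k + l *\<^sub>R ((1/h) *\<^sub>R (z - x)))) * kernel x h z \<partial>lebesgue_on U\<bar>
      \<le> (\<integral>z. \<bar>(g z \<bullet> (k + l *\<^sub>R ((1/h) *\<^sub>R (z - x)))) * kernel x h z\<bar> \<partial>lebesgue_on U)"
    by (rule integral_abs_bound)
  also have "\<dots> \<le> (\<integral>z. B * (1/h) ^ DIM('a) * R * (t powr (p - 1) * norm (g z) powr p + (1/t) * indicator E z) \<partial>lebesgue_on U)"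
    by (rule integral_mono[OF integrable_abs[OF i] bi pw])
  also have "\<dots> = B * (1/h) ^ DIM('a) * R * (t powr (p - 1) * (\<integral>z. norm (g z) powr p \<partial>lebesgue_on U)
      + (1/t) * (\<integral>z. indicator E z \<partial>lebesgue_on U))"
    using Lp_onD(2)[OF g] indi
    by (simp only: integral_mult_right_zero Bochner_Integration.integral_add integrable_mult_right)
  also have "\<dots> \<le> B * (1/h) ^ DIM('a) * R * (t powr (p - 1) * G powr p + (1/t) * (vol * h ^ DIM('a)))"
    using gG indb t B0 h R0 by (intro mult_left_mono add_mono) auto
  also have "\<dots> = B * R * (1 + vol) * G * h powr (- (?d / p))"
  proof -
    have hd: "(1/h) ^ DIM('a) = h powr (- ?d)"
      using h by (simp add: powr_minus powr_realpow power_one_over inverse_eq_divide)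
    have "h powr (- ?d) * (t powr (p - 1) * G powr p) = h powr (- ?d) * (h powr (?d / p * (p - 1)) * (G powr p / G powr (p - 1)))"
      using h G by (simp add: t_def powr_divide powr_powr)
    also have "G powr p / G powr (p - 1) = G" using G by (simp add: powr_diff[symmetric])
    also have "h powr (- ?d) * (h powr (?d / p * (p - 1)) * G) = h powr (- ?d + ?d / p * (p - 1)) * G"
      by (simp only: powr_add mult.assoc)
    also have "- ?d + ?d / p * (p - 1) = - (?d / p)" using p by (simp add: field_simps)
    finally have 1: "h powr (- ?d) * (t powr (p - 1) * G powr p) = h powr (- (?d / p)) * G" .
    have hh: "h powr (- ?d) * h ^ DIM('a) = 1" using h by (simp add: powr_minus powr_realpow)
    have t1: "1/t = h powr (- (?d / p)) * G" using h G by (simp add: t_def powr_minus field_simps)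
    have "h powr (- ?d) * ((1/t) * (vol * h ^ DIM('a))) = (h powr (- ?d) * h ^ DIM('a)) * (vol * (1/t))"
      by (simp only: mult_ac)
    then have 2: "h powr (- ?d) * ((1/t) * (vol * h ^ DIM('a))) = vol * (h powr (- (?d / p)) * G)"
      unfolding hh unfolding t1 by simp
    have "B * h powr (- ?d) * R * (t powr (p - 1) * G powr p + (1/t) * (vol * h ^ DIM('a)))
        = B * R * (h powr (- ?d) * (t powr (p - 1) * G powr p) + h powr (- ?d) * ((1/t) * (vol * h ^ DIM('a))))"
      by (simp only: distrib_left mult_ac)
    then show ?thesis unfolding hd 1 2 by (simp add: algebra_simps)
  qed
  finally show ?thesis unfolding R_def .
qed

lemma avg_has_derivative:
  assumes U: "open U" and y: "integrable (lebesgue_on U) y" and wg: "is_weak_gradient U y g"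
    and p: "1 < p" and g: "g \<in> Lp_on p (lebesgue_on U)" and G: "0 < G"
    and gG: "(\<integral>z. norm (g z) powr p \<partial>lebesgue_on U) \<le> G powr p" and h: "h > 0"
    and sup: "\<And>v. v \<in> cball e s \<Longrightarrow> x + h *\<^sub>R v \<in> U"
  shows "\<exists>D. ((\<lambda>t. avg U y (x + t *\<^sub>R k) (h + t * l)) has_real_derivative D) (at 0)
    \<and> \<bar>D\<bar> \<le> B * (norm k + \<bar>l\<bar> * (norm e + s)) * (1 + vol) * G * h powr (- (DIM('a) / p))"
proof -
  have Um: "U \<in> sets lebesgue" using U by simp
  show ?thesis
    using avg_has_derivative_kernel[OF Um y h, of x k l] integral_kernel_deriv[OF U wg h sup, of k l]
      gradient_kernel_bound[OF U p g G gG h, of k l x] by auto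
qed

definition scale_const :: "real \<Rightarrow> real" where
  "scale_const p = B * (norm e + s) * (1 + vol) / (1 - DIM('a) / p)"

lemma avg_scale_diff:
  assumes U: "open U" and y: "integrable (lebesgue_on U) y" and wg: "is_weak_gradient U y g"
    and p: "1 < p" "real DIM('a) < p" and g: "g \<in> Lp_on p (lebesgue_on U)" and G: "0 < G"
    and gG: "(\<integral>z. norm (g z) powr p \<partial>lebesgue_on U) \<le> G powr p" and ab: "0 < a" "a \<le> b"
    and sup: "\<And>h v. 0 < h \<Longrightarrow> h \<le> b \<Longrightarrow> v \<in> cball e s \<Longrightarrow> x + h *\<^sub>R v \<in> U"
  shows "\<bar>avg U y x b - avg U y x a\<bar> \<le> scale_const p * G * b powr (1 - DIM('a) / p)"
proof -
  let ?d = "real DIM('a)"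
  define \<beta> where "\<beta> = 1 - ?d / p"
  have \<beta>: "\<beta> > 0" using p by (simp add: \<beta>_def)
  define c where "c = scale_const p * G"
  have c\<beta>: "c * \<beta> = B * (norm e + s) * (1 + vol) * G" using p by (simp add: c_def scale_const_def \<beta>_def)
  have c0: "c \<ge> 0" using B0 s0 vol_nonneg G \<beta> by (simp add: c_def scale_const_def \<beta>_def)
  have der: "\<exists>D. (avg U y x has_real_derivative D) (at h) \<and> \<bar>D\<bar> \<le> c * \<beta> * h powr (\<beta> - 1)" if h: "a \<le> h" "h \<le> b" for h
  proof -
    have "\<exists>D. ((\<lambda>t. avg U y (x + t *\<^sub>R 0) (h + t * 1)) has_real_derivative D) (at 0)
      \<and> \<bar>D\<bar> \<le> B * (norm (0::'a) + \<bar>1\<bar> * (norm e + s)) * (1 + vol) * G * h powr (- (?d / p))"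
      using h ab by (intro avg_has_derivative[OF U y wg p(1) g G gG] sup) auto
    then obtain D where D: "((\<lambda>t. avg U y x (t + h)) has_real_derivative D) (at 0)"
      "\<bar>D\<bar> \<le> B * (norm e + s) * (1 + vol) * G * h powr (- (?d / p))" by (auto simp: add.commute)
    then have "(avg U y x has_real_derivative D) (at h)" using DERIV_shift[of "avg U y x" D 0 h] by simp
    moreover have "- (?d / p) = \<beta> - 1" by (simp add: \<beta>_def)
    ultimately show ?thesis using D(2) unfolding c\<beta> by metis
  qed
  have pd: "((\<lambda>h. c * h powr \<beta>) has_real_derivative c * \<beta> * h powr (\<beta> - 1)) (at h)" if "h > 0" for h
    using DERIV_cmult[OF has_real_derivative_powr[OF that, of \<beta>], of c] by (simp add: mult.assoc)
  have "c * a powr \<beta> + avg U y x a \<le> c * b powr \<beta> + avg U y x b"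
  proof (rule DERIV_nonneg_imp_nondecreasing[OF ab(2)])
    fix h assume h: "a \<le> h" "h \<le> b"
    then obtain D where D: "(avg U y x has_real_derivative D) (at h)" "\<bar>D\<bar> \<le> c * \<beta> * h powr (\<beta> - 1)" using der by blast
    have "((\<lambda>h. c * h powr \<beta> + avg U y x h) has_real_derivative c * \<beta> * h powr (\<beta> - 1) + D) (at h)"
      using ab h by (intro DERIV_add pd D) auto
    then show "\<exists>y'. ((\<lambda>h. c * h powr \<beta> + avg U y x h) has_real_derivative y') (at h) \<and> 0 \<le> y'"
      using D(2) by (intro exI[of _ "c * \<beta> * h powr (\<beta> - 1) + D"]) (auto simp: abs_le_iff)
  qed
  moreover have "c * a powr \<beta> - avg U y x a \<le> c * b powr \<beta> - avg U y x b"
  proof (rule DERIV_nonneg_imp_nondecreasing[OF ab(2)])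
    fix h assume h: "a \<le> h" "h \<le> b"
    then obtain D where D: "(avg U y x has_real_derivative D) (at h)" "\<bar>D\<bar> \<le> c * \<beta> * h powr (\<beta> - 1)" using der by blast
    have "((\<lambda>h. c * h powr \<beta> - avg U y x h) has_real_derivative c * \<beta> * h powr (\<beta> - 1) - D) (at h)"
      using ab h by (intro DERIV_diff pd D) auto
    then show "\<exists>y'. ((\<lambda>h. c * h powr \<beta> - avg U y x h) has_real_derivative y') (at h) \<and> 0 \<le> y'"
      using D(2) by (intro exI[of _ "c * \<beta> * h powr (\<beta> - 1) - D"]) (auto simp: abs_le_iff)
  qed
  moreover have "0 \<le> c * a powr \<beta>" using c0 by simp
  ultimately show ?thesis unfolding c_def[symmetric] \<beta>_def[symmetric] by linarith
qed

lemma avg_shift_diff: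
  assumes U: "open U" and y: "integrable (lebesgue_on U) y" and wg: "is_weak_gradient U y g"
    and p: "1 < p" and g: "g \<in> Lp_on p (lebesgue_on U)" and G: "0 < G"
    and gG: "(\<integral>z. norm (g z) powr p \<partial>lebesgue_on U) \<le> G powr p" and h: "0 < h"
    and sup: "\<And>t v. 0 \<le> t \<Longrightarrow> t \<le> 1 \<Longrightarrow> v \<in> cball e s \<Longrightarrow> (x + t *\<^sub>R (x' - x)) + h *\<^sub>R v \<in> U"
  shows "\<bar>avg U y x' h - avg U y x h\<bar> \<le> B * norm (x' - x) * (1 + vol) * G * h powr (- (DIM('a) / p))"
proof -
  let ?N = "\<lambda>t. avg U y (x + t *\<^sub>R (x' - x)) h"
  let ?K = "B * norm (x' - x) * (1 + vol) * G * h powr (- (DIM('a) / p))"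
  have der: "\<exists>D. (?N has_real_derivative D) (at t) \<and> \<bar>D\<bar> \<le> ?K" if t: "0 \<le> t" "t \<le> 1" for t
  proof -
    have "\<exists>D. ((\<lambda>r. avg U y ((x + t *\<^sub>R (x' - x)) + r *\<^sub>R (x' - x)) (h + r * 0)) has_real_derivative D) (at 0)
      \<and> \<bar>D\<bar> \<le> B * (norm (x' - x) + \<bar>0\<bar> * (norm e + s)) * (1 + vol) * G * h powr (- (DIM('a) / p))"
      using t by (intro avg_has_derivative[OF U y wg p g G gG h] sup) auto
    then obtain D where D: "((\<lambda>r. ?N (r + t)) has_real_derivative D) (at 0)" "\<bar>D\<bar> \<le> ?K"
      by (auto simp: scaleR_add_left add_ac)
    then have "(?N has_real_derivative D) (at t)" using DERIV_shift[of ?N D 0 t] by simp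
    then show ?thesis using D(2) by blast
  qed
  then obtain D where D: "\<And>t. 0 \<le> t \<Longrightarrow> t \<le> 1 \<Longrightarrow> (?N has_real_derivative D t) (at t)"
    "\<And>t. 0 \<le> t \<Longrightarrow> t \<le> 1 \<Longrightarrow> \<bar>D t\<bar> \<le> ?K" by metis
  obtain t where t: "0 < t" "t < 1" "?N 1 - ?N 0 = (1 - 0) * D t"
    using MVT2[of 0 1 ?N D] D(1) by auto
  have "\<bar>?N 1 - ?N 0\<bar> \<le> ?K" using t(3) D(2)[of t] t(1,2) by simp
  then show ?thesis by simp
qed

lemma avg_continuous:
  assumes U: "U \<in> sets lebesgue" and y: "integrable (lebesgue_on U) y" and h: "h > 0"
  shows "continuous_on S (\<lambda>x. avg U y x h)"
proof (rule continuous_on_subset[OF lipschitz_on_continuous_on])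
  let ?L = "(1/h) ^ DIM('a) * (B / h) * (\<integral>z. \<bar>y z\<bar> \<partial>lebesgue_on U)"
  show "?L-lipschitz_on UNIV (\<lambda>x. avg U y x h)"
  proof (rule lipschitz_onI)
    show "0 \<le> ?L" using h B0 by simp
    fix x x'
    have kl: "\<bar>kernel x h z - kernel x' h z\<bar> \<le> (1/h) ^ DIM('a) * (B / h) * norm (x - x')" for z
    proof -
      have "\<bar>\<rho> ((1/h) *\<^sub>R (z - x)) - \<rho> ((1/h) *\<^sub>R (z - x'))\<bar> \<le> B * norm ((1/h) *\<^sub>R (z - x) - (1/h) *\<^sub>R (z - x'))"
        by (rule lipschitz)
      also have "(1/h) *\<^sub>R (z - x) - (1/h) *\<^sub>R (z - x') = (1/h) *\<^sub>R (x' - x)" by (simp add: scaleR_diff_right)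
      also have "B * norm ((1/h) *\<^sub>R (x' - x)) = (B / h) * norm (x - x')" using h by (simp add: norm_minus_commute)
      finally have "\<bar>\<rho> ((1/h) *\<^sub>R (z - x)) - \<rho> ((1/h) *\<^sub>R (z - x'))\<bar> * (1/h) ^ DIM('a)
          \<le> (B / h) * norm (x - x') * (1/h) ^ DIM('a)" using h by (intro mult_right_mono) auto
      moreover have "kernel x h z - kernel x' h z = (\<rho> ((1/h) *\<^sub>R (z - x)) - \<rho> ((1/h) *\<^sub>R (z - x'))) * (1/h) ^ DIM('a)"
        by (simp add: kernel_def left_diff_distrib)
      ultimately show ?thesis using h by (simp add: abs_mult mult_ac)
    qed
    have i: "integrable (lebesgue_on U) (\<lambda>z. y z * kernel x h z - y z * kernel x' h z)"
      by (intro Bochner_Integration.integrable_diff integrable_mult_kernel U y)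
    have "avg U y x h - avg U y x' h = (\<integral>z. y z * kernel x h z - y z * kernel x' h z \<partial>lebesgue_on U)"
      unfolding avg_def by (rule Bochner_Integration.integral_diff[symmetric]) (intro integrable_mult_kernel U y)+
    also have "\<bar>\<dots>\<bar> \<le> (\<integral>z. \<bar>y z * kernel x h z - y z * kernel x' h z\<bar> \<partial>lebesgue_on U)"
      by (rule integral_abs_bound)
    also have "\<dots> \<le> (\<integral>z. (1/h) ^ DIM('a) * (B / h) * norm (x - x') * \<bar>y z\<bar> \<partial>lebesgue_on U)"
    proof (rule integral_mono)
      show "integrable (lebesgue_on U) (\<lambda>z. (1/h) ^ DIM('a) * (B / h) * norm (x - x') * \<bar>y z\<bar>)" using y by simp
      show "integrable (lebesgue_on U) (\<lambda>z. \<bar>y z * kernel x h z - y z * kernel x' h z\<bar>)" using i by simp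
      fix z
      have "\<bar>y z * kernel x h z - y z * kernel x' h z\<bar> = \<bar>kernel x h z - kernel x' h z\<bar> * \<bar>y z\<bar>"
        by (simp add: right_diff_distrib[symmetric] abs_mult)
      also have "\<dots> \<le> (1/h) ^ DIM('a) * (B / h) * norm (x - x') * \<bar>y z\<bar>" by (intro mult_right_mono kl) simp
      finally show "\<bar>y z * kernel x h z - y z * kernel x' h z\<bar> \<le> (1/h) ^ DIM('a) * (B / h) * norm (x - x') * \<bar>y z\<bar>" .
    qed
    also have "\<dots> = ?L * dist x x'" by (simp add: dist_norm mult_ac)
    finally show "dist (avg U y x h) (avg U y x' h) \<le> ?L * dist x x'" by (simp add: dist_real_def)
  qed
qed simp

lemma convolution_tendsto:
  fixes \<phi> :: "'a \<Rightarrow> real"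
  assumes \<phi>: "continuous_on UNIV \<phi>" and Q: "\<And>x. \<bar>\<phi> x\<bar> \<le> Q" and X: "\<And>n. 0 < X n" "X \<longlonglongrightarrow> 0"
  shows "(\<lambda>n. \<integral>x. kernel x (X n) z * \<phi> x \<partial>lborel) \<longlonglongrightarrow> \<phi> z"
    and "\<bar>\<integral>x. kernel x (X n) z * \<phi> x \<partial>lborel\<bar> \<le> Q"
proof -
  have \<phi>m [measurable]: "\<phi> \<in> borel_measurable borel" by (rule borel_measurable_continuous_onI[OF \<phi>])
  have \<rho>m [measurable]: "\<rho> \<in> borel_measurable borel" by (rule borel_measurable_continuous_onI[OF continuous])
  have eq: "(\<integral>x. kernel x h z * \<phi> x \<partial>lborel) = (\<integral>v. \<rho> v * \<phi> (z + (- h) *\<^sub>R v) \<partial>lborel)" if h: "h > 0" for h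
  proof -
    have "(\<lambda>x. kernel x h z * \<phi> x) \<in> borel_measurable borel" unfolding kernel_def by measurable
    then have "(\<integral>x. kernel x h z * \<phi> x \<partial>lborel)
        = \<bar>- h\<bar> ^ DIM('a) * (\<integral>v. kernel (z + (- h) *\<^sub>R v) h z * \<phi> (z + (- h) *\<^sub>R v) \<partial>lborel)"
      using h by (intro integral_lborel_affine) auto
    also have "\<dots> = (\<integral>v. h ^ DIM('a) * (kernel (z + (- h) *\<^sub>R v) h z * \<phi> (z + (- h) *\<^sub>R v)) \<partial>lborel)"
      using h by simp
    also have "(\<lambda>v. h ^ DIM('a) * (kernel (z + (- h) *\<^sub>R v) h z * \<phi> (z + (- h) *\<^sub>R v)))
        = (\<lambda>v. \<rho> v * \<phi> (z + (- h) *\<^sub>R v))"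
    proof
      fix v
      have "kernel (z + (- h) *\<^sub>R v) h z = \<rho> v * (1/h) ^ DIM('a)" using h by (simp add: kernel_def)
      moreover have "h ^ DIM('a) * (1/h) ^ DIM('a) = 1" using h by (simp add: power_mult_distrib[symmetric])
      ultimately show "h ^ DIM('a) * (kernel (z + (- h) *\<^sub>R v) h z * \<phi> (z + (- h) *\<^sub>R v)) = \<rho> v * \<phi> (z + (- h) *\<^sub>R v)"
        by (metis mult.assoc mult.commute mult_1)
    qed
    finally show ?thesis .
  qed
  have b: "norm (\<rho> v * \<phi> u) \<le> Q * \<rho> v" for v u
    using mult_left_mono[OF Q[of u] nonneg[of v]] nonneg[of v] by (simp add: abs_mult mult.commute)
  have Qi: "integrable lborel (\<lambda>v. Q * \<rho> v)" using mass by simp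
  have i: "integrable lborel (\<lambda>v. \<rho> v * \<phi> (z + (- h) *\<^sub>R v))" for h
  proof (rule Bochner_Integration.integrable_bound[OF Qi])
    show "AE v in lborel. norm (\<rho> v * \<phi> (z + (- h) *\<^sub>R v)) \<le> norm (Q * \<rho> v)"
      using b by (intro AE_I2) (metis abs_ge_self order_trans real_norm_def)
  qed measurable
  have "(\<lambda>n. \<integral>v. \<rho> v * \<phi> (z + (- X n) *\<^sub>R v) \<partial>lborel) \<longlonglongrightarrow> (\<integral>v. \<rho> v * \<phi> z \<partial>lborel)"
  proof (rule integral_dominated_convergence[OF _ _ Qi])
    show "AE v in lborel. (\<lambda>n. \<rho> v * \<phi> (z + (- X n) *\<^sub>R v)) \<longlonglongrightarrow> \<rho> v * \<phi> z"
    proof (intro AE_I2 tendsto_mult tendsto_const)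
      fix v
      have "(\<lambda>n. z + (- X n) *\<^sub>R v) \<longlonglongrightarrow> z + (- 0) *\<^sub>R v" by (intro tendsto_intros X)
      then have "(\<lambda>n. z + (- X n) *\<^sub>R v) \<longlonglongrightarrow> z" by simp
      moreover have "isCont \<phi> z" using \<phi> by (simp add: continuous_on_eq_continuous_at)
      ultimately show "(\<lambda>n. \<phi> (z + (- X n) *\<^sub>R v)) \<longlonglongrightarrow> \<phi> z" by (rule isCont_tendsto_compose[rotated])
    qed
    show "AE v in lborel. norm (\<rho> v * \<phi> (z + (- X n) *\<^sub>R v)) \<le> Q * \<rho> v" for n by (intro AE_I2 b)
  qed measurable
  moreover have "(\<integral>v. \<rho> v * \<phi> z \<partial>lborel) = \<phi> z" using mass by simp
  ultimately show "(\<lambda>n. \<integral>x. kernel x (X n) z * \<phi> x \<partial>lborel) \<longlonglongrightarrow> \<phi> z" by (simp only: eq[OF X(1)])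
  have "\<bar>\<integral>v. \<rho> v * \<phi> (z + (- X n) *\<^sub>R v) \<partial>lborel\<bar> \<le> (\<integral>v. \<bar>\<rho> v * \<phi> (z + (- X n) *\<^sub>R v)\<bar> \<partial>lborel)"
    by (rule integral_abs_bound)
  also have "\<dots> \<le> (\<integral>v. Q * \<rho> v \<partial>lborel)"
    using b by (intro integral_mono Qi integrable_abs i) auto
  also have "\<dots> = Q" using mass by simp
  finally show "\<bar>\<integral>x. kernel x (X n) z * \<phi> x \<partial>lborel\<bar> \<le> Q" by (simp only: eq[OF X(1)])
qed

lemma avg_weak_convergence:
  fixes \<phi> :: "'a \<Rightarrow> real"
  assumes U: "open U" and y: "integrable (lebesgue_on U) y"
    and \<phi>: "continuous_on UNIV \<phi>" and K: "compact K" "\<And>x. x \<notin> K \<Longrightarrow> \<phi> x = 0"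
    and X: "\<And>n. 0 < X n" "X \<longlonglongrightarrow> 0"
  shows "(\<lambda>n. \<integral>x. avg U y x (X n) * \<phi> x \<partial>lborel) \<longlonglongrightarrow> (\<integral>z. y z * \<phi> z \<partial>lebesgue_on U)"
proof -
  have \<phi>m [measurable]: "\<phi> \<in> borel_measurable borel" by (rule borel_measurable_continuous_onI[OF \<phi>])
  have \<rho>m [measurable]: "\<rho> \<in> borel_measurable borel" by (rule borel_measurable_continuous_onI[OF continuous])
  obtain Q where Q: "Q \<ge> 0" "\<And>x. \<bar>\<phi> x\<bar> \<le> Q" using continuous_compact_support_bounded[OF \<phi> K] by blast
  have \<phi>i: "integrable lborel \<phi>"
  proof (rule integrableI_bounded_set[where A=K and B=Q])
    show "emeasure lborel K < \<infinity>" by (rule emeasure_compact_finite[OF K(1)])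
  qed (use K Q borel_compact in auto)
  let ?f = "\<lambda>z. indicator U z *\<^sub>R y z"
  have fi: "integrable lebesgue ?f" using y U by (intro integrable_restrict_space[THEN iffD1]) auto
  obtain y' where y': "y' \<in> borel_measurable lborel" "AE z in lborel. ?f z = y' z"
    using completion_ex_borel_measurable_real[of ?f lborel] borel_measurable_integrable[OF fi] by auto
  have [measurable]: "y' \<in> borel_measurable borel" using y'(1) by simp
  have y'm: "y' \<in> borel_measurable lebesgue" using y'(1) by (rule measurable_completion)
  have ae: "AE z in lebesgue. ?f z = y' z" using y'(2) by (rule AE_completion)
  have y'i: "integrable lborel y'"
    using integrable_cong_AE[OF borel_measurable_integrable[OF fi] y'm ae] fi y'(1) by (simp add: integrable_completion)
  have conv: "(\<integral>z. y z * \<psi> z \<partial>lebesgue_on U) = (\<integral>z. y' z * \<psi> z \<partial>lborel)" if \<psi>: "\<psi> \<in> borel_measurable borel" for \<psi>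
  proof -
    have \<psi>': "\<psi> \<in> borel_measurable lebesgue" using \<psi> by (intro measurable_completion) simp
    have "(\<integral>z. y z * \<psi> z \<partial>lebesgue_on U) = (\<integral>z. indicator U z *\<^sub>R (y z * \<psi> z) \<partial>lebesgue)"
      using U by (intro integral_restrict_space) simp
    also have "\<dots> = (\<integral>z. ?f z * \<psi> z \<partial>lebesgue)" by (simp add: mult.assoc)
    also have "\<dots> = (\<integral>z. y' z * \<psi> z \<partial>lebesgue)"
    proof (rule integral_cong_AE)
      show "(\<lambda>z. ?f z * \<psi> z) \<in> borel_measurable lebesgue"
        by (rule borel_measurable_times[OF borel_measurable_integrable[OF fi] \<psi>'])
      show "(\<lambda>z. y' z * \<psi> z) \<in> borel_measurable lebesgue" by (rule borel_measurable_times[OF y'm \<psi>'])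
      show "AE z in lebesgue. ?f z * \<psi> z = y' z * \<psi> z" using ae by eventually_elim simp
    qed
    also have "\<dots> = (\<integral>z. y' z * \<psi> z \<partial>lborel)" using \<psi> y'(1) by (intro integral_completion) simp
    finally show ?thesis .
  qed
  have km: "kernel x h \<in> borel_measurable borel" for x h unfolding kernel_def by measurable
  have swap: "(\<integral>x. avg U y x h * \<phi> x \<partial>lborel) = (\<integral>z. y' z * (\<integral>x. kernel x h z * \<phi> x \<partial>lborel) \<partial>lborel)" for h
  proof -
    let ?H = "\<lambda>x z. y' z * kernel x h z * \<phi> x"
    have Hm: "case_prod ?H \<in> borel_measurable (lborel \<Otimes>\<^sub>M lborel)" unfolding kernel_def by measurable
    have Hi: "integrable lborel (\<lambda>z. ?H x z)" for x
    proof (rule Bochner_Integration.integrable_bound)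
      show "integrable lborel (\<lambda>z. (B * \<bar>1/h\<bar> ^ DIM('a) * \<bar>\<phi> x\<bar>) * y' z)" using y'i by simp
      show "(\<lambda>z. ?H x z) \<in> borel_measurable lborel" using km by measurable
      show "AE z in lborel. norm (?H x z) \<le> norm ((B * \<bar>1/h\<bar> ^ DIM('a) * \<bar>\<phi> x\<bar>) * y' z)"
      proof (intro AE_I2)
        fix z
        have "\<bar>y' z\<bar> * \<bar>kernel x h z\<bar> * \<bar>\<phi> x\<bar> \<le> \<bar>y' z\<bar> * (B * \<bar>1/h\<bar> ^ DIM('a)) * \<bar>\<phi> x\<bar>"
          by (intro mult_right_mono mult_left_mono kernel_bound) auto
        then show "norm (?H x z) \<le> norm ((B * \<bar>1/h\<bar> ^ DIM('a) * \<bar>\<phi> x\<bar>) * y' z)"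
          using B0 by (simp add: abs_mult mult_ac)
      qed
    qed
    have int: "integrable (lborel \<Otimes>\<^sub>M lborel) (case_prod ?H)"
    proof (rule lborel_pair.Fubini_integrable[OF Hm])
      show "AE x in lborel. integrable lborel (\<lambda>z. case (x, z) of (x, z) \<Rightarrow> ?H x z)" using Hi by simp
      let ?Y = "\<integral>z. \<bar>y' z\<bar> \<partial>lborel"
      show "integrable lborel (\<lambda>x. \<integral>z. norm (case (x, z) of (x, z) \<Rightarrow> ?H x z) \<partial>lborel)"
      proof (rule Bochner_Integration.integrable_bound)
        show "integrable lborel (\<lambda>x. (B * \<bar>1/h\<bar> ^ DIM('a) * ?Y) * \<phi> x)" using \<phi>i by simp
        show "(\<lambda>x. \<integral>z. norm (case (x, z) of (x, z) \<Rightarrow> ?H x z) \<partial>lborel) \<in> borel_measurable lborel"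
          unfolding kernel_def by measurable
        show "AE x in lborel. norm (\<integral>z. norm (case (x, z) of (x, z) \<Rightarrow> ?H x z) \<partial>lborel)
            \<le> norm ((B * \<bar>1/h\<bar> ^ DIM('a) * ?Y) * \<phi> x)"
        proof (intro AE_I2)
          fix x
          have "(\<integral>z. norm (?H x z) \<partial>lborel) \<le> (\<integral>z. (B * \<bar>1/h\<bar> ^ DIM('a) * \<bar>\<phi> x\<bar>) * \<bar>y' z\<bar> \<partial>lborel)"
          proof (rule integral_mono)
            show "integrable lborel (\<lambda>z. norm (?H x z))" using Hi[of x] by (rule integrable_norm)
            show "integrable lborel (\<lambda>z. (B * \<bar>1/h\<bar> ^ DIM('a) * \<bar>\<phi> x\<bar>) * \<bar>y' z\<bar>)" using y'i by simp
            fix z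
            have "\<bar>y' z\<bar> * \<bar>kernel x h z\<bar> * \<bar>\<phi> x\<bar> \<le> \<bar>y' z\<bar> * (B * \<bar>1/h\<bar> ^ DIM('a)) * \<bar>\<phi> x\<bar>"
              by (intro mult_right_mono mult_left_mono kernel_bound) auto
            then show "norm (?H x z) \<le> (B * \<bar>1/h\<bar> ^ DIM('a) * \<bar>\<phi> x\<bar>) * \<bar>y' z\<bar>"
              by (simp add: abs_mult mult_ac)
          qed
          also have "\<dots> = (B * \<bar>1/h\<bar> ^ DIM('a) * ?Y) * \<bar>\<phi> x\<bar>" by (simp add: mult_ac)
          finally have "(\<integral>z. norm (?H x z) \<partial>lborel) \<le> \<bar>(B * \<bar>1/h\<bar> ^ DIM('a) * ?Y) * \<phi> x\<bar>"
            using B0 by (simp add: abs_mult)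
          moreover have "0 \<le> (\<integral>z. norm (?H x z) \<partial>lborel)" by simp
          ultimately show "norm (\<integral>z. norm (case (x, z) of (x, z) \<Rightarrow> ?H x z) \<partial>lborel)
            \<le> norm ((B * \<bar>1/h\<bar> ^ DIM('a) * ?Y) * \<phi> x)" by simp
        qed
      qed
    qed
    have "(\<integral>x. avg U y x h * \<phi> x \<partial>lborel) = (\<integral>x. (\<integral>z. ?H x z \<partial>lborel) \<partial>lborel)"
      unfolding avg_def by (subst conv[OF km]) simp
    also have "\<dots> = (\<integral>z. (\<integral>x. ?H x z \<partial>lborel) \<partial>lborel)"
      by (rule lborel_pair.Fubini_integral[OF int, symmetric])
    also have "\<dots> = (\<integral>z. y' z * (\<integral>x. kernel x h z * \<phi> x \<partial>lborel) \<partial>lborel)"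
      by (simp only: mult.assoc integral_mult_right_zero)
    finally show ?thesis .
  qed
  have "(\<lambda>n. \<integral>z. y' z * (\<integral>x. kernel x (X n) z * \<phi> x \<partial>lborel) \<partial>lborel) \<longlonglongrightarrow> (\<integral>z. y' z * \<phi> z \<partial>lborel)"
  proof (rule integral_dominated_convergence[where w="\<lambda>z. Q * \<bar>y' z\<bar>"])
    show "(\<lambda>z. y' z * (\<integral>x. kernel x (X n) z * \<phi> x \<partial>lborel)) \<in> borel_measurable lborel" for n
      unfolding kernel_def by measurable
    show "integrable lborel (\<lambda>z. Q * \<bar>y' z\<bar>)" using y'i by simp
    show "AE z in lborel. (\<lambda>n. y' z * (\<integral>x. kernel x (X n) z * \<phi> x \<partial>lborel)) \<longlonglongrightarrow> y' z * \<phi> z"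
      by (intro AE_I2 tendsto_mult tendsto_const convolution_tendsto(1)[OF \<phi> Q(2) X])
    show "AE z in lborel. norm (y' z * (\<integral>x. kernel x (X n) z * \<phi> x \<partial>lborel)) \<le> Q * \<bar>y' z\<bar>" for n
    proof (intro AE_I2)
      fix z
      have "\<bar>\<integral>x. kernel x (X n) z * \<phi> x \<partial>lborel\<bar> * \<bar>y' z\<bar> \<le> Q * \<bar>y' z\<bar>"
        by (intro mult_right_mono convolution_tendsto(2)[OF \<phi> Q(2) X]) simp
      then show "norm (y' z * (\<integral>x. kernel x (X n) z * \<phi> x \<partial>lborel)) \<le> Q * \<bar>y' z\<bar>"
        by (simp add: abs_mult mult.commute)
    qed
  qed simp_all
  then show ?thesis by (simp only: swap conv[OF \<phi>m])
qed

end

lemma integral_restrict_support: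
  fixes f :: "'a::euclidean_space \<Rightarrow> 'b::euclidean_space"
  assumes "S \<in> sets lebesgue" "K \<in> sets lebesgue" "K \<subseteq> S" "\<And>x. x \<in> S \<Longrightarrow> x \<notin> K \<Longrightarrow> f x = 0"
  shows "(\<integral>x. f x \<partial>lebesgue_on S) = (\<integral>x. f x \<partial>lebesgue_on K)"
proof -
  have "(\<lambda>x. indicator S x *\<^sub>R f x) = (\<lambda>x. indicator K x *\<^sub>R f x)"
    using assms(3,4) by (fastforce simp: indicator_def fun_eq_iff)
  then show ?thesis using assms(1,2) by (simp add: integral_restrict_space)
qed

lemma continuous_on_compact_integrable:
  fixes f :: "'a::euclidean_space \<Rightarrow> real"
  assumes "compact K" "continuous_on K f"
  shows "integrable (lebesgue_on K) f"
proof -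
  have i: "integrable lborel (\<lambda>x. indicator K x *\<^sub>R f x)" by (rule borel_integrable_compact[OF assms])
  then have "integrable lebesgue (\<lambda>x. indicator K x *\<^sub>R f x)"
    using integrable_completion borel_measurable_integrable by blast
  then show ?thesis using assms(1) by (intro integrable_restrict_space[THEN iffD2]) auto
qed

definition sobolev_data ::
    "'a::euclidean_space set \<Rightarrow> real \<Rightarrow> ('a \<Rightarrow> real) \<Rightarrow> ('a \<Rightarrow> 'a) \<Rightarrow> real \<Rightarrow> bool" where
  "sobolev_data U p y g G \<longleftrightarrow> integrable (lebesgue_on U) y \<and> is_weak_gradient U y g \<and>
     g \<in> Lp_on p (lebesgue_on U) \<and> 0 < G \<and> (\<integral>x. norm (g x) powr p \<partial>lebesgue_on U) \<le> G powr p"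

lemma morrey_local:
  fixes U :: "'a::euclidean_space set"
  assumes U: "bounded_lipschitz_domain U" and z: "z \<in> closure U" and p: "1 < p" "real DIM('a) < p"
  shows "\<exists>r>0. \<exists>C\<ge>0. \<forall>y g G. sobolev_data U p y g G \<longrightarrow>
    (\<exists>u. continuous_on (closure U \<inter> ball z r) u \<and> (AE x in lebesgue_on (U \<inter> ball z r). u x = y x) \<and>
      (\<forall>x\<in>closure U \<inter> ball z r. \<forall>x'\<in>closure U \<inter> ball z r. \<bar>u x - u x'\<bar> \<le> C * G))"
proof -
  have oU: "open U" using U by (simp add: bounded_lipschitz_domain_def)
  obtain r e s h0 where c: "r > 0" "s > 0" "h0 > 0" and cone:
    "\<And>x h v. x \<in> closure U \<Longrightarrow> x \<in> ball z r \<Longrightarrow> 0 < h \<Longrightarrow> h \<le> h0 \<Longrightarrow> v \<in> cball e s \<Longrightarrow> x + h *\<^sub>R v \<in> U"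
    using lipschitz_domain_cone[OF U z] by metis
  obtain \<rho> B where "mollifier \<rho> e (s/2) B" using mollifier_exists[of "s/2" e] c by auto
  then interpret mollifier \<rho> e "s/2" B .
  define r1 where "r1 = min r (h0 * s / 2)"
  have r1: "r1 > 0" "r1 \<le> r" "r1 \<le> h0 * s / 2" using c by (auto simp: r1_def)
  define S where "S = closure U \<inter> ball z r1"
  have sup: "x + h *\<^sub>R v \<in> U" if "x \<in> S" "0 < h" "h \<le> h0" "v \<in> cball e (s/2)" for x h v
    using that c r1 by (intro cone) (auto simp: S_def)
  have sup0: "x + h0 *\<^sub>R v \<in> U" if x: "x \<in> ball z r1" and v: "v \<in> cball e (s/2)" for x v
  proof -
    let ?w = "v + (1/h0) *\<^sub>R (x - z)"
    have "norm (x - z) < h0 * s / 2" using x r1 by (simp add: dist_norm norm_minus_commute)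
    then have "norm ((1/h0) *\<^sub>R (x - z)) \<le> s / 2" unfolding norm_scaleR using c by (simp add: field_simps)
    moreover have "norm (v - e) \<le> s / 2" using v by (simp add: dist_norm norm_minus_commute)
    ultimately have "norm ((v - e) + (1/h0) *\<^sub>R (x - z)) \<le> s"
      using norm_triangle_ineq[of "v - e" "(1/h0) *\<^sub>R (x - z)"] by linarith
    moreover have "(v - e) + (1/h0) *\<^sub>R (x - z) = ?w - e" by simp
    ultimately have "norm (?w - e) \<le> s" by (simp only:)
    then have "?w \<in> cball e s" by (simp add: dist_norm norm_minus_commute)
    then have "z + h0 *\<^sub>R ?w \<in> U" using c z by (intro cone) auto
    moreover have "z + h0 *\<^sub>R ?w = x + h0 *\<^sub>R v" using c by (simp add: algebra_simps)
    ultimately show ?thesis by simp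
  qed
  define \<beta> where "\<beta> = 1 - real DIM('a) / p"
  have \<beta>: "\<beta> > 0" using p by (simp add: \<beta>_def)
  have sc0: "scale_const p \<ge> 0" using B0 s0 vol_nonneg p by (simp add: scale_const_def)
  define C where "C = 2 * (scale_const p * h0 powr \<beta>) + B * (2 * r1) * (1 + vol) * h0 powr (- (real DIM('a) / p))"
  have C0: "C \<ge> 0" using sc0 B0 r1 vol_nonneg by (simp add: C_def)
  have "\<exists>u. continuous_on S u \<and> (AE x in lebesgue_on (U \<inter> ball z r1). u x = y x) \<and>
      (\<forall>x\<in>S. \<forall>x'\<in>S. \<bar>u x - u x'\<bar> \<le> C * G)" if sd: "sobolev_data U p y g G" for y g G
  proof -
    have y: "integrable (lebesgue_on U) y" and wg: "is_weak_gradient U y g" and g: "g \<in> Lp_on p (lebesgue_on U)"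
      and G: "0 < G" and gG: "(\<integral>x. norm (g x) powr p \<partial>lebesgue_on U) \<le> G powr p"
      using sd by (auto simp: sobolev_data_def)
    define K where "K = scale_const p * G"
    define X where "X n = h0 / real (Suc n)" for n
    have X: "0 < X n" "X n \<le> h0" for n using c by (auto simp: X_def field_simps)
    have Xanti: "X m \<le> X n" if "n \<le> m" for n m using that c by (auto simp: X_def intro!: divide_left_mono)
    have X0: "X \<longlonglongrightarrow> 0"
    proof -
      have "(\<lambda>n. h0 * inverse (real (Suc n))) \<longlonglongrightarrow> h0 * 0" by (intro tendsto_intros LIMSEQ_inverse_real_of_nat)
      then show ?thesis by (simp add: X_def[abs_def] divide_inverse)
    qed
    have KX: "(\<lambda>n. K * X n powr \<beta>) \<longlonglongrightarrow> 0"
    proof -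
      have "(\<lambda>n. X n powr \<beta>) \<longlonglongrightarrow> 0 powr \<beta>"
        using \<beta> X(1) by (intro tendsto_powr' X0 tendsto_const) (auto simp: less_imp_le)
      then have "(\<lambda>n. K * X n powr \<beta>) \<longlonglongrightarrow> K * (0 powr \<beta>)" by (intro tendsto_mult tendsto_const)
      then show ?thesis by simp
    qed
    have diff: "\<bar>avg U y x (X n) - avg U y x (X m)\<bar> \<le> K * X n powr \<beta>" if x: "x \<in> S" and nm: "n \<le> m" for x n m
      unfolding K_def \<beta>_def
    proof (rule avg_scale_diff[OF oU y wg p g G gG X(1) Xanti[OF nm]])
      fix h v assume "0 < h" "h \<le> X n" "v \<in> cball e (s/2)"
      then show "x + h *\<^sub>R v \<in> U" using X(2)[of n] by (intro sup x) auto
    qed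
    define u where "u x = lim (\<lambda>n. avg U y x (X n))" for x
    have conv: "(\<lambda>n. avg U y x (X n)) \<longlonglongrightarrow> u x" if x: "x \<in> S" for x
    proof -
      have "Cauchy (\<lambda>n. avg U y x (X n))"
      proof (rule metric_CauchyI)
        fix \<epsilon> :: real assume "\<epsilon> > 0"
        then have "\<forall>\<^sub>F n in sequentially. K * X n powr \<beta> < \<epsilon> / 2" by (intro order_tendstoD(2)[OF KX]) simp
        then obtain N where N: "K * X N powr \<beta> < \<epsilon> / 2" by (auto simp: eventually_sequentially)
        have "dist (avg U y x (X m)) (avg U y x (X n)) < \<epsilon>" if "m \<ge> N" "n \<ge> N" for m n
          using diff[OF x that(1)] diff[OF x that(2)] N unfolding dist_real_def by linarith
        then show "\<exists>M. \<forall>m\<ge>M. \<forall>n\<ge>M. dist (avg U y x (X m)) (avg U y x (X n)) < \<epsilon>" by blast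
      qed
      then have "convergent (\<lambda>n. avg U y x (X n))" by (rule Cauchy_convergent)
      then show ?thesis unfolding u_def by (simp only: convergent_LIMSEQ_iff)
    qed
    have udiff: "\<bar>avg U y x (X n) - u x\<bar> \<le> K * X n powr \<beta>" if x: "x \<in> S" for x n
    proof (rule LIMSEQ_le_const2)
      show "(\<lambda>m. \<bar>avg U y x (X n) - avg U y x (X m)\<bar>) \<longlonglongrightarrow> \<bar>avg U y x (X n) - u x\<bar>"
        by (intro tendsto_rabs tendsto_diff tendsto_const conv x)
      show "\<exists>N. \<forall>m\<ge>N. \<bar>avg U y x (X n) - avg U y x (X m)\<bar> \<le> K * X n powr \<beta>" using diff[OF x] by blast
    qed
    have cont: "continuous_on S u"
    proof (rule uniform_limit_theorem)
      show "\<forall>\<^sub>F n in sequentially. continuous_on S (\<lambda>x. avg U y x (X n))"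
        using oU by (intro always_eventually allI avg_continuous y X) auto
      show "uniform_limit S (\<lambda>n x. avg U y x (X n)) u sequentially"
      proof (rule uniform_limitI)
        fix \<epsilon> :: real assume "\<epsilon> > 0"
        then have "\<forall>\<^sub>F n in sequentially. K * X n powr \<beta> < \<epsilon>" by (rule order_tendstoD(2)[OF KX])
        then show "\<forall>\<^sub>F n in sequentially. \<forall>x\<in>S. dist (avg U y x (X n)) (u x) < \<epsilon>"
        proof eventually_elim
          case (elim n)
          then show ?case using udiff unfolding dist_real_def by (meson le_less_trans)
        qed
      qed
    qed simp
    have osc: "\<bar>u x - u x'\<bar> \<le> C * G" if x: "x \<in> S" "x' \<in> S" for x x'
    proof -
      have bx: "x \<in> ball z r1" "x' \<in> ball z r1" using x by (auto simp: S_def)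
      have "\<bar>avg U y x' h0 - avg U y x h0\<bar> \<le> B * norm (x' - x) * (1 + vol) * G * h0 powr (- (real DIM('a) / p))"
      proof (rule avg_shift_diff[OF oU y wg p(1) g G gG c(3)])
        fix t :: real and v assume t: "0 \<le> t" "t \<le> 1" and v: "v \<in> cball e (s/2)"
        have "(1 - t) *\<^sub>R x + t *\<^sub>R x' \<in> ball z r1"
          using convex_ball bx t unfolding convex_alt by blast
        then have "x + t *\<^sub>R (x' - x) \<in> ball z r1" by (simp add: algebra_simps)
        then show "(x + t *\<^sub>R (x' - x)) + h0 *\<^sub>R v \<in> U" by (rule sup0[OF _ v])
      qed
      also have "\<dots> \<le> B * (2 * r1) * (1 + vol) * G * h0 powr (- (real DIM('a) / p))"
      proof -
        have "dist x' x < 2 * r1" using bx dist_triangle_half_l[of x' z "2 * r1" x] by (auto simp: dist_commute intro: dist_triangle_lt)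
        then show ?thesis using B0 vol_nonneg G by (intro mult_right_mono mult_left_mono) (auto simp: dist_norm)
      qed
      finally have 1: "\<bar>avg U y x' h0 - avg U y x h0\<bar> \<le> B * (2 * r1) * (1 + vol) * G * h0 powr (- (real DIM('a) / p))" .
      have "X 0 = h0" by (simp add: X_def)
      then have "\<bar>avg U y x h0 - u x\<bar> \<le> K * h0 powr \<beta>" "\<bar>avg U y x' h0 - u x'\<bar> \<le> K * h0 powr \<beta>"
        using udiff[OF x(1), of 0] udiff[OF x(2), of 0] by simp_all
      then have "\<bar>u x - u x'\<bar> \<le> 2 * (K * h0 powr \<beta>) + B * (2 * r1) * (1 + vol) * G * h0 powr (- (real DIM('a) / p))"
        using 1 by linarith
      also have "\<dots> = C * G" by (simp add: C_def K_def algebra_simps)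
      finally show ?thesis .
    qed
    let ?W = "U \<inter> ball z r1"
    have oW: "open ?W" using oU by auto
    have WS: "?W \<subseteq> S" using closure_subset[of U] by (auto simp: S_def)
    have "AE x in lebesgue_on ?W. u x - y x = 0"
    proof (rule integral_test_functions_zero_imp_AE_zero[OF oW])
      have lu: "locally_integrable ?W u"
        unfolding locally_integrable_def using WS
        by (intro allI impI continuous_on_compact_integrable continuous_on_subset[OF cont]) auto
      have ly: "locally_integrable ?W y"
        using integrable_imp_locally_integrable[OF y oU] by (auto simp: locally_integrable_def)
      show "locally_integrable ?W (\<lambda>x. u x - y x)" using locally_integrable_lincomb[OF lu ly, of 1 "-1"] by simp
      fix \<phi> assume \<phi>: "\<phi> \<in> test_functions ?W"
      note t = test_functionsD[OF \<phi>]
      let ?Q = "closure {x. \<phi> x \<noteq> 0}"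
      have QS: "?Q \<subseteq> S" using t(3) WS by blast
      have Qm: "?Q \<in> sets lebesgue" by (rule compact_in_lebesgue[OF t(2)])
      have supp: "(\<integral>x. f x * \<phi> x \<partial>lebesgue_on T) = (\<integral>x. f x * \<phi> x \<partial>lebesgue_on ?Q)"
        if "T \<in> sets lebesgue" "?Q \<subseteq> T" for T and f :: "'a \<Rightarrow> real"
      proof (rule integral_restrict_support[OF that(1) Qm that(2)])
        fix x assume "x \<notin> ?Q"
        then have "\<phi> x = 0" by (rule t(4))
        then show "f x * \<phi> x = 0" by (rule mult_eq_0_iff[THEN iffD2, OF disjI2])
      qed
      have QU: "?Q \<subseteq> U" using t(3) by blast
      have Um: "U \<in> sets lebesgue" "?W \<in> sets lebesgue" using oU oW by auto
      obtain b where b: "\<And>x. \<bar>\<phi> x\<bar> \<le> b" using continuous_compact_support_bounded[OF t(1,2,4)] by metis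
      have ac: "continuous_on T (\<lambda>x. avg U y x (X n))" for T n using oU by (intro avg_continuous y X) simp
      have ai: "integrable (lebesgue_on ?Q) (\<lambda>x. avg U y x (X n))" for n
        by (rule continuous_on_compact_integrable[OF t(2) ac])
      have ui: "integrable (lebesgue_on ?Q) u"
        by (rule continuous_on_compact_integrable[OF t(2) continuous_on_subset[OF cont QS]])
      have "(\<lambda>n. \<integral>x. avg U y x (X n) * \<phi> x \<partial>lebesgue_on ?Q) \<longlonglongrightarrow> (\<integral>x. u x * \<phi> x \<partial>lebesgue_on ?Q)"
      proof (rule tendsto_integral_mult_L1[OF ai ui _ _ b])
        show "\<phi> \<in> borel_measurable (lebesgue_on ?Q)"
          by (rule continuous_imp_measurable_on_sets_lebesgue[OF continuous_on_subset[OF t(1)] Qm]) simp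
        show "(\<lambda>n. \<integral>x. \<bar>avg U y x (X n) - u x\<bar> \<partial>lebesgue_on ?Q) \<longlonglongrightarrow> 0"
        proof (rule Lim_null_comparison[OF always_eventually])
          show "(\<lambda>n. K * X n powr \<beta> * measure lebesgue ?Q) \<longlonglongrightarrow> 0" by (rule tendsto_mult_left_zero[OF KX])
          show "\<forall>n. norm (\<integral>x. \<bar>avg U y x (X n) - u x\<bar> \<partial>lebesgue_on ?Q) \<le> K * X n powr \<beta> * measure lebesgue ?Q"
          proof
            fix n
            have fin: "finite_measure (lebesgue_on ?Q)"
              by (rule finite_measure_lebesgue_on[OF lmeasurable_compact[OF t(2)]])
            have "(\<integral>x. \<bar>avg U y x (X n) - u x\<bar> \<partial>lebesgue_on ?Q) \<le> (\<integral>x. K * X n powr \<beta> \<partial>lebesgue_on ?Q)"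
            proof (rule integral_mono)
              show "integrable (lebesgue_on ?Q) (\<lambda>x. \<bar>avg U y x (X n) - u x\<bar>)" using ai ui by simp
              show "integrable (lebesgue_on ?Q) (\<lambda>x. K * X n powr \<beta>)" using fin by (rule finite_measure.integrable_const)
              show "\<bar>avg U y x (X n) - u x\<bar> \<le> K * X n powr \<beta>" if "x \<in> space (lebesgue_on ?Q)" for x
                using that QS by (intro udiff) auto
            qed
            then show "norm (\<integral>x. \<bar>avg U y x (X n) - u x\<bar> \<partial>lebesgue_on ?Q) \<le> K * X n powr \<beta> * measure lebesgue ?Q"
              using Qm by (simp add: measure_restrict_space mult_ac)
          qed
        qed
      qed
      moreover have "(\<integral>x. avg U y x (X n) * \<phi> x \<partial>lborel) = (\<integral>x. avg U y x (X n) * \<phi> x \<partial>lebesgue_on ?Q)" for n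
      proof -
        have "(\<lambda>x. avg U y x (X n) * \<phi> x) \<in> borel_measurable borel"
          by (intro borel_measurable_continuous_onI continuous_on_mult ac t(1))
        then have "(\<integral>x. avg U y x (X n) * \<phi> x \<partial>lborel) = (\<integral>x. avg U y x (X n) * \<phi> x \<partial>lebesgue)"
          by (intro integral_completion[symmetric]) simp
        also have "\<dots> = (\<integral>x. avg U y x (X n) * \<phi> x \<partial>lebesgue_on UNIV)" by (simp only: lebesgue_on_UNIV_eq)
        also have "\<dots> = (\<integral>x. avg U y x (X n) * \<phi> x \<partial>lebesgue_on ?Q)"
          by (rule supp) auto
        finally show ?thesis .
      qed
      moreover have "(\<lambda>n. \<integral>x. avg U y x (X n) * \<phi> x \<partial>lborel) \<longlonglongrightarrow> (\<integral>x. y x * \<phi> x \<partial>lebesgue_on U)"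
        by (rule avg_weak_convergence[OF oU y t(1,2,4) X(1) X0])
      ultimately have "(\<integral>x. u x * \<phi> x \<partial>lebesgue_on ?Q) = (\<integral>x. y x * \<phi> x \<partial>lebesgue_on U)"
        using LIMSEQ_unique by simp
      moreover have "(\<integral>x. y x * \<phi> x \<partial>lebesgue_on U) = (\<integral>x. y x * \<phi> x \<partial>lebesgue_on ?Q)"
        by (rule supp[OF Um(1) QU])
      moreover have "(\<integral>x. y x * \<phi> x \<partial>lebesgue_on ?W) = (\<integral>x. y x * \<phi> x \<partial>lebesgue_on ?Q)"
        by (rule supp[OF Um(2) t(3)])
      moreover have "(\<integral>x. u x * \<phi> x \<partial>lebesgue_on ?W) = (\<integral>x. u x * \<phi> x \<partial>lebesgue_on ?Q)"
        by (rule supp[OF Um(2) t(3)])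
      moreover have "(\<integral>x. (u x - y x) * \<phi> x \<partial>lebesgue_on ?W)
          = (\<integral>x. u x * \<phi> x \<partial>lebesgue_on ?W) - (\<integral>x. y x * \<phi> x \<partial>lebesgue_on ?W)"
        unfolding left_diff_distrib
        by (rule Bochner_Integration.integral_diff[OF test_function_integrable(1)[OF oW lu \<phi>] test_function_integrable(1)[OF oW ly \<phi>]])
      ultimately show "(\<integral>x. (u x - y x) * \<phi> x \<partial>lebesgue_on ?W) = 0" by simp
    qed
    then have "AE x in lebesgue_on ?W. u x = y x" by simp
    then show ?thesis using cont osc by blast
  qed
  then show ?thesis using r1(1) C0 unfolding S_def by blast
qed

theorem morrey:
  fixes U :: "'a::euclidean_space set"
  assumes U: "bounded_lipschitz_domain U" and p: "1 < p" "real DIM('a) < p"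
  obtains C where "C \<ge> 0" "\<And>y g G. sobolev_data U p y g G \<Longrightarrow>
    (\<exists>u. continuous_on (closure U) u \<and> (AE x in lebesgue_on U. u x = y x) \<and>
      (\<forall>x\<in>closure U. \<forall>x'\<in>closure U. \<bar>u x - u x'\<bar> \<le> C * G))"
proof -
  have oU: "open U" and conU: "connected (closure U)" and cU: "compact (closure U)"
    using U by (auto simp: bounded_lipschitz_domain_def compact_closure intro: connected_imp_connected_closure)
  define P where "P z r C \<longleftrightarrow> (\<forall>y g G. sobolev_data U p y g G \<longrightarrow>
    (\<exists>u. continuous_on (closure U \<inter> ball z r) u \<and> (AE x in lebesgue_on (U \<inter> ball z r). u x = y x) \<and>
      (\<forall>x\<in>closure U \<inter> ball z r. \<forall>x'\<in>closure U \<inter> ball z r. \<bar>u x - u x'\<bar> \<le> C * G)))" for z r C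
  have "\<exists>r C. r > 0 \<and> C \<ge> 0 \<and> P z r C" if "z \<in> closure U" for z
    using morrey_local[OF U that p] unfolding P_def by blast
  then obtain r C where rC: "\<And>z. z \<in> closure U \<Longrightarrow> r z > (0::real)" "\<And>z. z \<in> closure U \<Longrightarrow> C z \<ge> (0::real)"
    and PrC: "\<And>z. z \<in> closure U \<Longrightarrow> P z (r z) (C z)" by metis
  have loc: "\<exists>u. continuous_on (closure U \<inter> ball z (r z)) u \<and> (AE x in lebesgue_on (U \<inter> ball z (r z)). u x = y x) \<and>
      (\<forall>x\<in>closure U \<inter> ball z (r z). \<forall>x'\<in>closure U \<inter> ball z (r z). \<bar>u x - u x'\<bar> \<le> C z * G)"
    if "z \<in> closure U" "sobolev_data U p y g G" for z y g G
    using PrC[OF that(1)] that(2) unfolding P_def by blast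
  obtain F where F: "F \<subseteq> closure U" "finite F" "closure U \<subseteq> (\<Union>z\<in>F. ball z (r z))"
  proof (rule compactE_image[OF cU, of "closure U" "\<lambda>z. ball z (r z)"])
    show "closure U \<subseteq> (\<Union>z\<in>closure U. ball z (r z))" using rC(1) by auto
  qed auto
  have sub: "AE x in lebesgue_on (U \<inter> W'). P x" if "AE x in lebesgue_on (U \<inter> W). P x" "open W" "open W'" "W' \<subseteq> W" for P W W'
  proof -
    have "AE x in lebesgue. x \<in> U \<inter> W \<longrightarrow> P x" using that oU by (subst (asm) AE_restrict_space_iff) auto
    then have "AE x in lebesgue. x \<in> U \<inter> W' \<longrightarrow> P x" by eventually_elim (use that(4) in auto)
    then show ?thesis using that oU by (subst AE_restrict_space_iff) auto
  qed
  have ex: "\<exists>u. continuous_on (closure U) u \<and> (AE x in lebesgue_on U. u x = y x)" if sd: "sobolev_data U p y g G" for y g G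
  proof -
    obtain v where v: "\<And>z. z \<in> closure U \<Longrightarrow> continuous_on (closure U \<inter> ball z (r z)) (v z)"
      "\<And>z. z \<in> closure U \<Longrightarrow> AE x in lebesgue_on (U \<inter> ball z (r z)). v z x = y x"
    proof -
      define Q where "Q z v \<longleftrightarrow> continuous_on (closure U \<inter> ball z (r z)) v \<and>
        (AE x in lebesgue_on (U \<inter> ball z (r z)). v x = y x)" for z v
      have "\<exists>v. Q z v" if "z \<in> closure U" for z using loc[OF that sd] unfolding Q_def by blast
      then obtain v where "\<And>z. z \<in> closure U \<Longrightarrow> Q z (v z)" by metis
      then show ?thesis using that unfolding Q_def by blast
    qed
    define u where "u x = v x x" for x
    have uv: "u x = v z x" if z: "z \<in> closure U" and x: "x \<in> closure U \<inter> ball z (r z)" for x z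
    proof -
      have xc: "x \<in> closure U" using x by simp
      let ?W = "ball x (r x) \<inter> ball z (r z)"
      have "v x x = v z x"
      proof (rule continuous_AE_eq_imp_eq[OF oU, where W="?W" and f="v x" and g="v z"])
        show "continuous_on (closure U \<inter> ?W) (v x)" by (rule continuous_on_subset[OF v(1)[OF xc]]) auto
        show "continuous_on (closure U \<inter> ?W) (v z)" by (rule continuous_on_subset[OF v(1)[OF z]]) auto
        have "AE t in lebesgue_on (U \<inter> ?W). v x t = y t" by (rule sub[OF v(2)[OF xc]]) auto
        moreover have "AE t in lebesgue_on (U \<inter> ?W). v z t = y t" by (rule sub[OF v(2)[OF z]]) auto
        ultimately show "AE t in lebesgue_on (U \<inter> ?W). v x t = v z t" by eventually_elim simp
        show "x \<in> closure U \<inter> ?W" using x rC(1)[OF xc] by simp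
      qed auto
      then show ?thesis by (simp add: u_def)
    qed
    have "continuous_on (closure U) u"
      unfolding continuous_on_eq_continuous_within
    proof
      fix z assume z: "z \<in> closure U"
      have "continuous_on (closure U \<inter> ball z (r z)) u"
        using v(1)[OF z] uv[OF z] by (metis (no_types, lifting) continuous_on_cong)
      then have "continuous (at z within closure U \<inter> ball z (r z)) u"
        using z rC(1)[OF z] by (simp add: continuous_on_eq_continuous_within)
      moreover have "at z within closure U \<inter> ball z (r z) = at z within closure U"
        using rC(1)[OF z] by (intro at_within_nhd[of _ "ball z (r z)"]) auto
      ultimately show "continuous (at z within closure U) u" by simp
    qed
    moreover have "AE x in lebesgue_on U. u x = y x"
    proof -
      have "AE x in lebesgue. x \<in> U \<inter> ball z (r z) \<longrightarrow> v z x = y x" if "z \<in> F" for z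
      proof -
        have "U \<inter> ball z (r z) \<inter> space lebesgue \<in> sets lebesgue" using oU by auto
        moreover have "AE x in lebesgue_on (U \<inter> ball z (r z)). v z x = y x" using that F(1) by (intro v(2)) auto
        ultimately show ?thesis by (simp only: AE_restrict_space_iff)
      qed
      then have "AE x in lebesgue. \<forall>z\<in>F. x \<in> U \<inter> ball z (r z) \<longrightarrow> v z x = y x"
        by (intro AE_ball_countable' countable_finite F(2))
      then have "AE x in lebesgue. x \<in> U \<longrightarrow> u x = y x"
      proof eventually_elim
        case (elim x)
        show ?case
        proof
          assume x: "x \<in> U"
          then have xc: "x \<in> closure U" using closure_subset by auto
          then obtain z where z: "z \<in> F" "x \<in> ball z (r z)" using F(3) by blast
          then have "v z x = y x" using elim x by blast
          moreover have "u x = v z x" using z F(1) xc by (intro uv) auto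
          ultimately show "u x = y x" by simp
        qed
      qed
      then show ?thesis using oU by (subst AE_restrict_space_iff) auto
    qed
    ultimately show ?thesis by blast
  qed
  have osc: "\<bar>u x - u x'\<bar> \<le> C z * G"
    if sd: "sobolev_data U p y g G" and u: "continuous_on (closure U) u" "AE x in lebesgue_on U. u x = y x"
      and z: "z \<in> closure U" and x: "x \<in> closure U \<inter> ball z (r z)" "x' \<in> closure U \<inter> ball z (r z)" for y g G u z x x'
  proof -
    obtain v where v: "continuous_on (closure U \<inter> ball z (r z)) v"
      "AE x in lebesgue_on (U \<inter> ball z (r z)). v x = y x"
      "\<forall>x\<in>closure U \<inter> ball z (r z). \<forall>x'\<in>closure U \<inter> ball z (r z). \<bar>v x - v x'\<bar> \<le> C z * G"
      using loc[OF z sd] by blast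
    have uv: "u t = v t" if "t \<in> closure U \<inter> ball z (r z)" for t
    proof (rule continuous_AE_eq_imp_eq[OF oU _ _ v(1) _ that])
      show "continuous_on (closure U \<inter> ball z (r z)) u" by (rule continuous_on_subset[OF u(1)]) auto
      have "AE x in lebesgue_on (U \<inter> UNIV). u x = y x" unfolding Int_UNIV_right by (rule u(2))
      then have "AE x in lebesgue_on (U \<inter> ball z (r z)). u x = y x" by (rule sub) auto
      then show "AE x in lebesgue_on (U \<inter> ball z (r z)). u x = v x" using v(2) by eventually_elim simp
    qed auto
    show ?thesis using v(3) x uv by simp
  qed
  define E where "E y g G u \<longleftrightarrow> sobolev_data U p y g G \<and> continuous_on (closure U) u \<and>
    (AE x in lebesgue_on U. u x = y x)" for y g G u
  have oscE: "\<bar>u x - u x'\<bar> \<le> C z * G"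
    if "E y g G u" "z \<in> closure U" "x \<in> closure U \<inter> ball z (r z)" "x' \<in> closure U \<inter> ball z (r z)" for y g G u z x x'
    using that(1) unfolding E_def by (elim conjE) (rule osc[OF _ _ _ that(2-4)])
  define R where "R a b \<longleftrightarrow> (\<exists>K\<ge>0. \<forall>y g G u. E y g G u \<longrightarrow> \<bar>u a - u b\<bar> \<le> K * G)" for a b
  have Rab: "R a b" if "a \<in> closure U" "b \<in> closure U" for a b
  proof (rule connected_equivalence_relation[OF conU that])
    show "R x y" if "R y x" for x y using that unfolding R_def by (simp add: abs_minus_commute)
    show "R x z" if "R x y" "R y z" for x y z
    proof -
      from that(1)[unfolded R_def] obtain K1 where K1: "K1 \<ge> 0"
        "\<forall>y' g G u. E y' g G u \<longrightarrow> \<bar>u x - u y\<bar> \<le> K1 * G" by (elim exE conjE)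
      from that(2)[unfolded R_def] obtain K2 where K2: "K2 \<ge> 0"
        "\<forall>y' g G u. E y' g G u \<longrightarrow> \<bar>u y - u z\<bar> \<le> K2 * G" by (elim exE conjE)
      have "\<forall>y' g G u. E y' g G u \<longrightarrow> \<bar>u x - u z\<bar> \<le> (K1 + K2) * G"
      proof (intro allI impI)
        fix y' g G u assume e: "E y' g G u"
        show "\<bar>u x - u z\<bar> \<le> (K1 + K2) * G"
          using K1(2)[rule_format, OF e] K2(2)[rule_format, OF e] unfolding distrib_right by linarith
      qed
      then show ?thesis unfolding R_def using add_nonneg_nonneg[OF K1(1) K2(1)]
        by (intro exI[of _ "K1 + K2"] conjI)
    qed
    show "\<exists>T. openin (top_of_set (closure U)) T \<and> a \<in> T \<and> (\<forall>x\<in>T. R a x)" if a: "a \<in> closure U" for a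
    proof (intro exI conjI ballI)
      show "openin (top_of_set (closure U)) (closure U \<inter> ball a (r a))" by (simp add: openin_open_Int)
      show aT: "a \<in> closure U \<inter> ball a (r a)" using a rC(1) by simp
      fix x assume "x \<in> closure U \<inter> ball a (r a)"
      then show "R a x" unfolding R_def
        by (intro exI[of _ "C a"] conjI allI impI rC(2)[OF a] oscE[OF _ a aT])
    qed
  qed
  obtain x0 where x0: "x0 \<in> closure U" using U closure_subset[of U] unfolding bounded_lipschitz_domain_def by blast
  define Q where "Q z k \<longleftrightarrow> k \<ge> 0 \<and> (\<forall>y g G u. E y g G u \<longrightarrow> \<bar>u x0 - u z\<bar> \<le> k * G)" for z and k :: real
  have "\<exists>k. Q z k" if "z \<in> closure U" for z using Rab[OF x0 that] unfolding R_def Q_def .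
  then obtain K where KQ: "\<And>z. z \<in> closure U \<Longrightarrow> Q z (K z)" by metis
  have K: "K z \<ge> 0" if "z \<in> closure U" for z using KQ[OF that] unfolding Q_def by (rule conjunct1)
  have KE: "\<bar>u x0 - u z\<bar> \<le> K z * G" if "z \<in> closure U" "E y g G u" for z y g G u
    using KQ[OF that(1), unfolded Q_def, THEN conjunct2, rule_format, OF that(2)] .
  define M where "M = (\<Sum>z\<in>F. K z + C z)"
  have KC0: "0 \<le> K z + C z" if "z \<in> F" for z using K[of z] rC(2)[of z] that F(1) by auto
  have M0: "M \<ge> 0" unfolding M_def using KC0 by (rule sum_nonneg)
  show ?thesis
  proof (rule that[of "2 * M"])
    show "2 * M \<ge> 0" using M0 by simp
    fix y g G assume sd: "sobolev_data U p y g G"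
    then have G: "G > 0" by (simp add: sobolev_data_def)
    obtain u where u: "continuous_on (closure U) u" "AE x in lebesgue_on U. u x = y x" using ex[OF sd] by blast
    have Eu: "E y g G u" using sd u unfolding E_def by blast
    have *: "\<bar>u x0 - u x\<bar> \<le> M * G" if x: "x \<in> closure U" for x
    proof -
      obtain z where z: "z \<in> F" "x \<in> ball z (r z)" using F(3) x by blast
      have zc: "z \<in> closure U" using z F(1) by auto
      have "\<bar>u x0 - u z\<bar> \<le> K z * G" by (rule KE[OF zc Eu])
      moreover have "\<bar>u z - u x\<bar> \<le> C z * G"
        using zc x z(2) rC(1)[OF zc] by (intro oscE[OF Eu zc]) auto
      ultimately have "\<bar>u x0 - u x\<bar> \<le> (K z + C z) * G" unfolding distrib_right by linarith
      also have "K z + C z \<le> M" unfolding M_def using z(1) F(2) KC0 by (intro member_le_sum) auto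
      then have "(K z + C z) * G \<le> M * G" using G by (intro mult_right_mono) auto
      finally show ?thesis .
    qed
    have "\<bar>u x - u x'\<bar> \<le> 2 * M * G" if "x \<in> closure U" "x' \<in> closure U" for x x'
      using *[OF that(1)] *[OF that(2)] by (simp add: abs_le_iff)
    then show "\<exists>u. continuous_on (closure U) u \<and> (AE x in lebesgue_on U. u x = y x) \<and>
      (\<forall>x\<in>closure U. \<forall>x'\<in>closure U. \<bar>u x - u x'\<bar> \<le> 2 * M * G)" using u by blast
  qed
qed

subsection \<open>Radial integrands\<close>

lemma powr_tangent_le:
  fixes r s p :: real
  assumes p: "1 < p" and r: "0 \<le> r" "0 \<le> s"
  shows "r powr p / p + r powr (p - 1) * (s - r) \<le> s powr p / p"
proof -
  have q: "1 < conj_exp p" "1 / p + 1 / conj_exp p = 1" using p by (auto simp: conj_exp_def field_simps)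
  have "s * r powr (p - 1) \<le> s powr p / p + (r powr (p - 1)) powr conj_exp p / conj_exp p"
    using p q r by (intro Youngs_inequality) auto
  also have "(r powr (p - 1)) powr conj_exp p = r powr p" using conj_exp_props(3)[OF p] by (simp add: powr_powr)
  also have "r powr p / conj_exp p = r powr p - r powr p / p"
    using p by (simp add: conj_exp_def field_simps)
  finally have "s * r powr (p - 1) \<le> s powr p / p + (r powr p - r powr p / p)" .
  moreover have "r powr (p - 1) * r = r powr p" using r by (cases "r = 0") (auto simp: powr_diff)
  ultimately show ?thesis by (simp add: algebra_simps)
qed

lemma radial_subgradient:
  fixes a b q :: "'a::real_inner"
  assumes "\<gamma> (norm a) + \<phi> * (norm b - norm a) \<le> \<gamma> (norm b)" "q \<bullet> a = \<phi> * norm a" "norm q \<le> \<phi>"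
  shows "\<gamma> (norm a) + q \<bullet> (b - a) \<le> \<gamma> (norm b)"
proof -
  have "q \<bullet> b \<le> norm q * norm b" by (rule norm_cauchy_schwarz)
  also have "\<dots> \<le> \<phi> * norm b" using assms(3) by (rule mult_right_mono) simp
  finally show ?thesis using assms(1,2) by (simp add: inner_diff_right algebra_simps)
qed

lemma inner_scaleR_sgn: "(\<phi> *\<^sub>R sgn a) \<bullet> a = \<phi> * norm (a :: 'a::real_inner)"
  by (cases "a = 0") (simp_all add: sgn_div_norm power2_norm_eq_inner[symmetric] power2_eq_square)

lemma norm_scaleR_sgn_le: "0 \<le> \<phi> \<Longrightarrow> norm (\<phi> *\<^sub>R sgn (a :: 'a::real_normed_vector)) \<le> \<phi>"
  by (simp add: norm_sgn)

lemma continuous_radial_field: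
  fixes \<phi> :: "real \<Rightarrow> real"
  assumes \<phi>: "continuous_on {0..} \<phi>" "\<phi> 0 = 0"
  shows "continuous_on UNIV (\<lambda>a :: 'a::real_normed_vector. \<phi> (norm a) *\<^sub>R sgn a)"
proof -
  have c: "continuous_on UNIV (\<lambda>a :: 'a. \<phi> (norm a))"
    by (rule continuous_on_compose2[OF \<phi>(1)]) (auto intro!: continuous_intros)
  then have ca: "((\<lambda>a :: 'a. \<phi> (norm a)) \<longlongrightarrow> \<phi> (norm a)) (at a)" for a
    by (simp add: continuous_on_def)
  have "((\<lambda>a. \<phi> (norm a) *\<^sub>R sgn a) \<longlongrightarrow> \<phi> (norm a) *\<^sub>R sgn a) (at a)" for a :: 'a
  proof (cases "a = 0")
    case False
    then show ?thesis by (intro tendsto_scaleR ca tendsto_sgn tendsto_ident_at)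
  next
    case True
    have "((\<lambda>a :: 'a. norm (\<phi> (norm a))) \<longlongrightarrow> 0) (at 0)" using ca[of 0] \<phi>(2) by (simp add: tendsto_rabs_zero)
    then have "((\<lambda>a. \<phi> (norm a) *\<^sub>R sgn a) \<longlongrightarrow> 0) (at (0 :: 'a))"
      by (rule Lim_null_comparison[rotated]) (auto simp: norm_sgn intro!: always_eventually)
    then show ?thesis using True by simp
  qed
  then show ?thesis by (simp add: continuous_on_def)
qed

subsection \<open>The dual of a Lebesgue space\<close>

lemma riesz_Lp:
  fixes \<xi> :: "('a \<Rightarrow> 'b::euclidean_space) \<Rightarrow> real"
  assumes M: "finite_measure M" and p: "1 < p"
    and lin: "\<And>u v a b. u \<in> Lp_on p M \<Longrightarrow> v \<in> Lp_on p M \<Longrightarrow> \<xi> (\<lambda>x. a *\<^sub>R u x + b *\<^sub>R v x) = a * \<xi> u + b * \<xi> v"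
    and bd: "\<And>v. v \<in> Lp_on p M \<Longrightarrow> \<bar>\<xi> v\<bar> \<le> C * (\<integral>x. norm (v x) powr p \<partial>M) powr (1 / p)"
  obtains f where "f \<in> Lp_on (conj_exp p) M" "\<And>v. v \<in> Lp_on p M \<Longrightarrow> \<xi> v = (\<integral>x. f x \<bullet> v x \<partial>M)"
proof -
  interpret finite_measure M by fact
  interpret convex_integral_problem M p "1/p" 1 "\<bar>C\<bar>" "\<lambda>x a. norm a powr p / p"
    "\<lambda>x a. (norm a powr (p - 1)) *\<^sub>R sgn a" "Lp_on p M" \<xi>
  proof
    fix a b :: 'b
    show "norm a powr p / p + (norm a powr (p - 1)) *\<^sub>R sgn a \<bullet> (b - a) \<le> norm b powr p / p"
    proof (rule radial_subgradient[where \<gamma>="\<lambda>r. r powr p / p" and \<phi>="norm a powr (p - 1)"])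
      show "norm a powr p / p + norm a powr (p - 1) * (norm b - norm a) \<le> norm b powr p / p"
        using p by (intro powr_tangent_le) auto
      show "norm ((norm a powr (p - 1)) *\<^sub>R sgn a) \<le> norm a powr (p - 1)" by (rule norm_scaleR_sgn_le) simp
    qed (rule inner_scaleR_sgn)
    have "norm ((norm a powr (p - 1)) *\<^sub>R sgn a) \<le> norm a powr (p - 1)" by (rule norm_scaleR_sgn_le) simp
    also have "\<dots> \<le> (1 + norm a) powr (p - 1)" using p by (intro powr_mono2) auto
    finally show "norm ((norm a powr (p - 1)) *\<^sub>R sgn a) \<le> 1 * (1 + norm a) powr (p - 1)" by simp
  next
    fix v :: "'a \<Rightarrow> 'b" assume [measurable]: "v \<in> borel_measurable M"
    show "(\<lambda>x. norm (v x) powr p / p) \<in> borel_measurable M" by measurable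
    show "(\<lambda>x. (norm (v x) powr (p - 1)) *\<^sub>R sgn (v x)) \<in> borel_measurable M"
      unfolding sgn_div_norm by measurable
  next
    fix v :: "'a \<Rightarrow> 'b" assume v: "v \<in> Lp_on p M"
    have "C * (\<integral>x. norm (v x) powr p \<partial>M) powr (1 / p) \<le> \<bar>C\<bar> * (\<integral>x. norm (v x) powr p \<partial>M) powr (1 / p)"
      by (intro mult_right_mono) auto
    then show "\<bar>\<xi> v\<bar> \<le> \<bar>C\<bar> * (\<integral>x. norm (v x) powr p \<partial>M) powr (1 / p)" using bd[OF v] by linarith
  qed (use p lin in \<open>auto intro: Lp_on_zero Lp_on_lincomb\<close>)
  obtain v where v: "v \<in> Lp_on p M" "\<And>u. u \<in> Lp_on p M \<Longrightarrow> J v \<le> J u" using minimizer_exists by blast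
  have cont: "continuous_on UNIV (\<lambda>a :: 'b. (norm a powr (p - 1)) *\<^sub>R sgn a)"
    using p by (intro continuous_radial_field continuous_on_powr' continuous_intros) auto
  show ?thesis
    by (rule that[OF D_Lp[OF v(1)]]) (rule euler_lagrange[OF cont v, symmetric])
qed

subsection \<open>The integrand and its conjugate\<close>

definition growth_part :: "real \<Rightarrow> real \<Rightarrow> real \<Rightarrow> real \<Rightarrow> real" where
  "growth_part p \<epsilon> w r = \<epsilon> / p * (1 / \<epsilon> * max (r - w) 0) powr p"

definition huber_part :: "real \<Rightarrow> real \<Rightarrow> real" where
  "huber_part W r = max r W + (if W = 0 then 0 else min (r\<^sup>2 / W) W) / 2"

definition growth_slope :: "real \<Rightarrow> real \<Rightarrow> real \<Rightarrow> real \<Rightarrow> real" where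
  "growth_slope p \<epsilon> w r = (1 / \<epsilon> * max (r - w) 0) powr (p - 1)"

definition huber_slope :: "real \<Rightarrow> real \<Rightarrow> real" where
  "huber_slope W r = (if W = 0 then 1 else min (r / W) 1)"

lemma G_int_eq: "G_int \<alpha> w \<epsilon> \<delta> x a =
    growth_part (conj_exp \<alpha>) \<epsilon> (w x) (norm a) + \<delta> * huber_part (w x) (norm a)"
  by (simp add: G_int_def growth_part_def huber_part_def algebra_simps)

lemma growth_part_tangent:
  assumes p: "1 < p" and e: "0 < \<epsilon>"
  shows "growth_part p \<epsilon> w r + growth_slope p \<epsilon> w r * (s - r) \<le> growth_part p \<epsilon> w s"
proof -
  define X where "X = 1 / \<epsilon> * max (r - w) 0"
  define Y where "Y = 1 / \<epsilon> * max (s - w) 0"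
  have XY: "0 \<le> X" "0 \<le> Y" "\<epsilon> * X = max (r - w) 0" "\<epsilon> * Y = max (s - w) 0" using e by (auto simp: X_def Y_def)
  have "X powr (p - 1) * (s - r) \<le> X powr (p - 1) * (\<epsilon> * Y - \<epsilon> * X)"
  proof (cases "X = 0")
    case False
    then have "r - w > 0" using XY e by (auto simp: X_def max_def split: if_splits)
    then have "s - r \<le> \<epsilon> * Y - \<epsilon> * X" unfolding XY by auto
    then show ?thesis by (rule mult_left_mono) simp
  qed simp
  also have "\<dots> = \<epsilon> * (X powr (p - 1) * (Y - X))" by (simp add: algebra_simps)
  also have "\<dots> \<le> \<epsilon> * (Y powr p / p - X powr p / p)"
    using powr_tangent_le[OF p XY(1,2)] e by (intro mult_left_mono) auto
  finally have "\<epsilon> * (X powr p / p) + X powr (p - 1) * (s - r) \<le> \<epsilon> * (Y powr p / p)" by (simp add: algebra_simps)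
  then show ?thesis unfolding growth_part_def growth_slope_def X_def[symmetric] Y_def[symmetric] by simp
qed

lemma huber_part_eq:
  assumes "0 < W" "0 \<le> r"
  shows "huber_part W r = (if r \<le> W then W + r\<^sup>2 / (2 * W) else r + W / 2)"
proof (cases "r \<le> W")
  case True
  have "r\<^sup>2 / W \<le> W" using assms True by (simp add: power2_eq_square divide_le_eq mult_mono)
  then show ?thesis using assms True by (simp add: huber_part_def)
next
  case False
  have "W \<le> r\<^sup>2 / W" using assms False by (simp add: power2_eq_square le_divide_eq mult_mono)
  then show ?thesis using assms False by (simp add: huber_part_def)
qed

lemma huber_part_tangent:
  assumes W: "0 \<le> W" and r: "0 \<le> r" "0 \<le> s"
  shows "huber_part W r + huber_slope W r * (s - r) \<le> huber_part W s"
proof (cases "W = 0")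
  case True
  then show ?thesis using r by (simp add: huber_part_def huber_slope_def)
next
  case False
  then have W: "W > 0" using W by simp
  have q: "0 \<le> (a - b)\<^sup>2 / (2 * W)" for a b using W by simp
  show ?thesis
  proof (cases "r \<le> W"; cases "s \<le> W")
    assume c: "r \<le> W" "s \<le> W"
    have "(s - r)\<^sup>2 / (2 * W) = s\<^sup>2 / (2 * W) - r\<^sup>2 / (2 * W) - r / W * (s - r)"
      using W by (simp add: field_simps power2_eq_square)
    then show ?thesis using q[of s r] c W r by (simp add: huber_part_eq huber_slope_def)
  next
    assume c: "r \<le> W" "\<not> s \<le> W"
    have "0 \<le> (W - r) * (2 * s - W - r) / (2 * W)" using c W by (intro divide_nonneg_nonneg mult_nonneg_nonneg) auto
    also have "\<dots> = s + W / 2 - (W + r\<^sup>2 / (2 * W)) - r / W * (s - r)"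
      using W by (simp add: field_simps power2_eq_square)
    finally show ?thesis using c W r by (simp add: huber_part_eq huber_slope_def)
  next
    assume c: "\<not> r \<le> W" "s \<le> W"
    have "(s - W)\<^sup>2 / (2 * W) = W + s\<^sup>2 / (2 * W) - s - W / 2"
      using W by (simp add: field_simps power2_eq_square)
    then show ?thesis using q[of s W] c W r by (simp add: huber_part_eq huber_slope_def)
  next
    assume c: "\<not> r \<le> W" "\<not> s \<le> W"
    then show ?thesis using W r by (simp add: huber_part_eq huber_slope_def)
  qed
qed

lemma huber_part_weight_bounds:
  assumes W: "0 \<le> W" "W \<le> W'" and r: "0 \<le> r"
  shows "huber_part W r \<le> huber_part W' r" "huber_part W' r \<le> huber_part W r + (W' - W)"
proof -
  have "huber_part W r \<le> huber_part W' r \<and> huber_part W' r \<le> huber_part W r + (W' - W)"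
  proof (cases "W = 0")
    case True
    show ?thesis
    proof (cases "W' = 0")
      case False
      then have W': "W' > 0" using W by simp
      show ?thesis
      proof (cases "r \<le> W'")
        case c: True
        have "r\<^sup>2 / (2 * W') \<le> r" using W' r c by (simp add: power2_eq_square divide_le_eq mult_mono)
        moreover have "0 \<le> r\<^sup>2 / (2 * W')" using W' by simp
        moreover have "huber_part W' r = W' + r\<^sup>2 / (2 * W')" "huber_part W r = r"
          using W' r c True by (auto simp: huber_part_eq) (simp add: huber_part_def)
        ultimately show ?thesis using c True by linarith
      qed (use W' r True in \<open>simp add: huber_part_eq, simp add: huber_part_def\<close>)
    qed (use True in simp)
  next
    case False
    then have W0: "W > 0" "W' > 0" using W by auto
    consider "r \<le> W" | "W < r" "r \<le> W'" | "W' < r" by linarith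
    then show ?thesis
    proof cases
      case 1
      have "r\<^sup>2 / (2 * W') \<le> r\<^sup>2 / (2 * W)" using W0 W by (intro divide_left_mono) auto
      moreover have "r\<^sup>2 / (2 * W) - r\<^sup>2 / (2 * W') \<le> W' - W"
      proof -
        have "r\<^sup>2 / (2 * W) - r\<^sup>2 / (2 * W') = (W' - W) * (r\<^sup>2 / (2 * (W * W')))"
          using W0 by (simp add: field_simps)
        also have "\<dots> \<le> (W' - W) * 1"
        proof (rule mult_left_mono)
          have "r * r \<le> W * W'" using 1 r W by (intro mult_mono) auto
          then have "r\<^sup>2 \<le> 2 * (W * W')" using mult_pos_pos[OF W0] unfolding power2_eq_square by linarith
          then show "r\<^sup>2 / (2 * (W * W')) \<le> 1" using W0 by (simp add: divide_le_eq)
        qed (use W in simp)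
        finally show ?thesis by simp
      qed
      ultimately show ?thesis using 1 W0 r W by (simp add: huber_part_eq)
    next
      case 2
      have "(r - W')\<^sup>2 / (2 * W') = W' + r\<^sup>2 / (2 * W') - r - W' / 2"
        using W0 by (simp add: field_simps power2_eq_square)
      moreover have "0 \<le> (r - W')\<^sup>2 / (2 * W')" using W0 by simp
      moreover have "r\<^sup>2 / (2 * W') \<le> r / 2"
        using W0 2 r by (simp add: power2_eq_square divide_le_eq mult_mono)
      ultimately show ?thesis using 2 W0 r W by (simp add: huber_part_eq)
    next
      case 3
      then show ?thesis using W0 r W by (simp add: huber_part_eq)
    qed
  qed
  then show "huber_part W r \<le> huber_part W' r" "huber_part W' r \<le> huber_part W r + (W' - W)" by auto
qed

lemma slope_nonneg: "0 \<le> growth_slope p \<epsilon> w r" "0 \<le> W \<Longrightarrow> 0 \<le> r \<Longrightarrow> 0 \<le> huber_slope W r"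
  by (auto simp: growth_slope_def huber_slope_def)

text \<open>
  The weight \<open>W\<close> of the Huber part is kept separate from \<open>w\<close>: the subgradient field below is
  continuous only if \<open>W > 0\<close>, so that \<open>w\<close> has to be replaced by \<open>max w \<eta>\<close> there.
\<close>

definition G_split :: "real \<Rightarrow> real \<Rightarrow> real \<Rightarrow> real \<Rightarrow> real \<Rightarrow> 'a::euclidean_space \<Rightarrow> real" where
  "G_split p \<epsilon> \<delta> w W a = growth_part p \<epsilon> w (norm a) + \<delta> * huber_part W (norm a)"

definition G_field :: "real \<Rightarrow> real \<Rightarrow> real \<Rightarrow> real \<Rightarrow> real \<Rightarrow> 'a::euclidean_space \<Rightarrow> 'a" where
  "G_field p \<epsilon> \<delta> w W a = (growth_slope p \<epsilon> w (norm a) + \<delta> * huber_slope W (norm a)) *\<^sub>R sgn a"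

lemma G_int_eq_split: "G_int \<alpha> w \<epsilon> \<delta> x = G_split (conj_exp \<alpha>) \<epsilon> \<delta> (w x) (w x)"
  by (simp add: fun_eq_iff G_int_eq G_split_def)

context
  fixes p \<epsilon> \<delta> :: real
  assumes p: "1 < p" and eps: "0 < \<epsilon>" and del: "0 < \<delta>"
begin

lemma G_part_tangent:
  assumes W: "0 \<le> W" and r: "0 \<le> r" "0 \<le> s"
  shows "(growth_part p \<epsilon> w r + \<delta> * huber_part W r) + (growth_slope p \<epsilon> w r + \<delta> * huber_slope W r) * (s - r)
    \<le> growth_part p \<epsilon> w s + \<delta> * huber_part W s"
  using growth_part_tangent[OF p eps, of w r s] mult_left_mono[OF huber_part_tangent[OF W r], of \<delta>] del
  by (simp add: algebra_simps)

lemma G_subgradient: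
  fixes a b :: "'a::euclidean_space"
  assumes W: "0 \<le> W"
  shows "G_split p \<epsilon> \<delta> w W a + G_field p \<epsilon> \<delta> w W a \<bullet> (b - a) \<le> G_split p \<epsilon> \<delta> w W b"
proof -
  let ?\<phi> = "growth_slope p \<epsilon> w (norm a) + \<delta> * huber_slope W (norm a)"
  have "0 \<le> ?\<phi>" using slope_nonneg del W by (intro add_nonneg_nonneg mult_nonneg_nonneg) auto
  then have "norm (?\<phi> *\<^sub>R sgn a) \<le> ?\<phi>" by (rule norm_scaleR_sgn_le)
  then show ?thesis unfolding G_split_def G_field_def
    by (intro radial_subgradient[where \<gamma>="\<lambda>r. growth_part p \<epsilon> w r + \<delta> * huber_part W r" and \<phi>="?\<phi>"]
        G_part_tangent W inner_scaleR_sgn) auto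
qed

lemma G_field_growth:
  fixes a :: "'a::euclidean_space"
  assumes w: "0 \<le> w" "0 \<le> W"
  shows "norm (G_field p \<epsilon> \<delta> w W a) \<le> (\<epsilon> powr (1 - p) + \<delta>) * (1 + norm a) powr (p - 1)"
proof -
  let ?\<phi> = "growth_slope p \<epsilon> w (norm a) + \<delta> * huber_slope W (norm a)"
  have "0 \<le> ?\<phi>" using slope_nonneg del w by (intro add_nonneg_nonneg mult_nonneg_nonneg) auto
  then have "norm (G_field p \<epsilon> \<delta> w W a) \<le> ?\<phi>" unfolding G_field_def by (rule norm_scaleR_sgn_le)
  also have "\<dots> \<le> \<epsilon> powr (1 - p) * (1 + norm a) powr (p - 1) + \<delta> * (1 + norm a) powr (p - 1)"
  proof (rule add_mono)
    have "growth_slope p \<epsilon> w (norm a) \<le> (1 / \<epsilon> * (1 + norm a)) powr (p - 1)"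
      unfolding growth_slope_def using p eps w by (intro powr_mono2 mult_left_mono) auto
    also have "\<dots> = (1 / \<epsilon>) powr (p - 1) * (1 + norm a) powr (p - 1)" by (rule powr_mult)
    also have "(1 / \<epsilon>) powr (p - 1) = \<epsilon> powr (1 - p)" using eps by (simp add: powr_divide powr_diff)
    finally show "growth_slope p \<epsilon> w (norm a) \<le> \<epsilon> powr (1 - p) * (1 + norm a) powr (p - 1)" .
    have "huber_slope W (norm a) \<le> 1" by (simp add: huber_slope_def)
    also have "1 \<le> (1 + norm a) powr (p - 1)" using p by (intro ge_one_powr_ge_zero) auto
    finally show "\<delta> * huber_slope W (norm a) \<le> \<delta> * (1 + norm a) powr (p - 1)" using del by (intro mult_left_mono) auto
  qed
  finally show ?thesis by (simp add: distrib_right)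
qed

lemma huber_part_nonneg: "0 \<le> W \<Longrightarrow> 0 \<le> huber_part W r"
  by (auto simp: huber_part_def max_def)

lemma G_split_coercive:
  fixes a :: "'a::euclidean_space"
  assumes w: "0 \<le> w" "w \<le> m" "0 \<le> W"
  shows "\<epsilon> powr (1 - p) / (p * 2 powr p) * norm a powr p - \<epsilon> powr (1 - p) / p * m powr p \<le> G_split p \<epsilon> \<delta> w W a"
proof -
  have "norm a powr p \<le> (max (norm a - w) 0 + m) powr p" using p w by (intro powr_mono2) auto
  also have "\<dots> \<le> 2 powr p * (max (norm a - w) 0 powr p + m powr p)" using p w by (intro powr_add_le) auto
  finally have "norm a powr p / 2 powr p - m powr p \<le> max (norm a - w) 0 powr p"
    by (simp add: field_simps)
  then have "\<epsilon> powr (1 - p) / p * (norm a powr p / 2 powr p - m powr p) \<le> \<epsilon> powr (1 - p) / p * max (norm a - w) 0 powr p"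
    using p by (intro mult_left_mono) auto
  also have "\<dots> = growth_part p \<epsilon> w (norm a)"
    using eps unfolding growth_part_def powr_mult by (simp add: powr_divide powr_diff)
  also have "\<dots> \<le> G_split p \<epsilon> \<delta> w W a"
    using huber_part_nonneg[OF w(3)] del by (simp add: G_split_def)
  finally show ?thesis by (simp add: algebra_simps)
qed

lemma G_split_zero:
  assumes "0 \<le> w" "0 \<le> W"
  shows "G_split p \<epsilon> \<delta> w W (0 :: 'a::euclidean_space) = \<delta> * W"
  using assms by (simp add: G_split_def growth_part_def huber_part_def)

lemma G_field_continuous:
  assumes w: "0 \<le> w" "0 < W"
  shows "continuous_on UNIV (G_field p \<epsilon> \<delta> w W :: 'a::euclidean_space \<Rightarrow> 'a)"
proof -
  have "continuous_on {0..} (\<lambda>r. growth_slope p \<epsilon> w r + \<delta> * huber_slope W r)"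
    unfolding growth_slope_def huber_slope_def using w p eps
    by (simp, intro continuous_intros continuous_on_powr' continuous_on_max continuous_on_min) auto
  moreover have "growth_slope p \<epsilon> w 0 + \<delta> * huber_slope W 0 = 0"
    using w by (simp add: growth_slope_def huber_slope_def)
  ultimately show ?thesis unfolding G_field_def[abs_def] by (rule continuous_radial_field)
qed

lemma G_split_measurable:
  fixes v :: "'b \<Rightarrow> 'a::euclidean_space"
  assumes [measurable]: "v \<in> borel_measurable M" "w \<in> borel_measurable M" "W \<in> borel_measurable M"
  shows "(\<lambda>x. G_split p \<epsilon> \<delta> (w x) (W x) (v x)) \<in> borel_measurable M"
    "(\<lambda>x. G_field p \<epsilon> \<delta> (w x) (W x) (v x)) \<in> borel_measurable M"
  unfolding G_split_def G_field_def growth_part_def huber_part_def growth_slope_def huber_slope_def sgn_div_norm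
  by measurable

text \<open>The point at which the slope of the radial profile of the integrand equals \<open>norm q\<close>.\<close>

definition conj_point :: "real \<Rightarrow> 'a::euclidean_space \<Rightarrow> 'a" where
  "conj_point w q = (if norm q \<le> \<delta> then w / \<delta> else (w + \<epsilon> * (norm q - \<delta>) powr (1 / (p - 1))) / norm q) *\<^sub>R q"

lemma conj_point_maximal:
  fixes q b :: "'a::euclidean_space"
  assumes w: "0 \<le> w"
  shows "q \<bullet> b - G_split p \<epsilon> \<delta> w w b \<le> q \<bullet> conj_point w q - G_split p \<epsilon> \<delta> w w (conj_point w q)"
proof -
  let ?P = "conj_point w q"
  define c where "c = (if norm q \<le> \<delta> then w / \<delta> else (w + \<epsilon> * (norm q - \<delta>) powr (1 / (p - 1))) / norm q)"
  have c: "c \<ge> 0" "?P = c *\<^sub>R q" using w eps del by (auto simp: c_def conj_point_def)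
  have qP: "q \<bullet> ?P = norm q * norm ?P"
    using c by (simp add: power2_norm_eq_inner[symmetric] power2_eq_square)
  have slope: "(growth_part p \<epsilon> w (norm ?P) + \<delta> * huber_part w (norm ?P)) + norm q * (s - norm ?P)
      \<le> growth_part p \<epsilon> w s + \<delta> * huber_part w s" if s: "0 \<le> s" for s
  proof (cases "norm q \<le> \<delta>")
    case True
    then have nP: "norm ?P = w * norm q / \<delta>" using w del by (simp add: conj_point_def)
    show ?thesis
    proof (cases "w = 0")
      case w0: True
      have "norm q * s \<le> \<delta> * s" using True s by (rule mult_right_mono)
      moreover have "0 \<le> growth_part p \<epsilon> w s" using eps p by (simp add: growth_part_def)
      ultimately show ?thesis using w0 nP s by (simp add: growth_part_def huber_part_def)
    next
      case False
      then have w0: "w > 0" using w by simp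
      have "norm ?P \<le> w" unfolding nP using True w0 del by (simp add: divide_le_eq mult_left_mono)
      then have "growth_slope p \<epsilon> w (norm ?P) = 0" by (simp add: growth_slope_def)
      moreover have "\<delta> * huber_slope w (norm ?P) = norm q"
        unfolding nP using w0 del True by (simp add: huber_slope_def min_def divide_le_eq)
      ultimately show ?thesis using G_part_tangent[OF w, of "norm ?P" s w] s by simp
    qed
  next
    case False
    then have q0: "norm q > 0" using del by linarith
    let ?X = "(norm q - \<delta>) powr (1 / (p - 1))"
    have nP: "norm ?P = w + \<epsilon> * ?X" using False q0 w eps by (simp add: conj_point_def)
    have "growth_slope p \<epsilon> w (norm ?P) = ?X powr (p - 1)"
      unfolding nP growth_slope_def using eps by simp
    also have "\<dots> = norm q - \<delta>" using False p by (simp add: powr_powr)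
    finally have 1: "growth_slope p \<epsilon> w (norm ?P) = norm q - \<delta>" .
    have "w \<le> norm ?P" unfolding nP using eps by simp
    then have "huber_slope w (norm ?P) = 1" using w by (auto simp: huber_slope_def min_def le_divide_eq)
    then show ?thesis using G_part_tangent[OF w, of "norm ?P" s w] s 1 by simp
  qed
  have "G_split p \<epsilon> \<delta> w w ?P + q \<bullet> (b - ?P) \<le> G_split p \<epsilon> \<delta> w w b"
    unfolding G_split_def
    by (rule radial_subgradient[where \<gamma>="\<lambda>r. growth_part p \<epsilon> w r + \<delta> * huber_part w r" and \<phi>="norm q"])
       (use slope qP in auto)
  then show ?thesis by (simp add: inner_diff_right)
qed

lemma conj_point_Lp:
  fixes f :: "'b \<Rightarrow> 'a::euclidean_space"
  assumes M: "finite_measure M" and f: "f \<in> Lp_on (conj_exp p) M" and w: "w \<in> borel_measurable M"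
    "\<And>x. x \<in> space M \<Longrightarrow> 0 \<le> w x" "\<And>x. x \<in> space M \<Longrightarrow> w x \<le> m"
  shows "(\<lambda>x. conj_point (w x) (f x)) \<in> Lp_on p M"
proof -
  interpret finite_measure M by fact
  note [measurable] = Lp_onD(1)[OF f] w(1)
  have m: "(\<lambda>x. conj_point (w x) (f x)) \<in> borel_measurable M" unfolding conj_point_def by measurable
  have b: "norm (conj_point (w x) (f x)) powr p \<le> 2 powr p * (m powr p + \<epsilon> powr p * norm (f x) powr conj_exp p)"
    if x: "x \<in> space M" for x
  proof -
    have m0: "0 \<le> m" using w(2,3)[OF x] by linarith
    have "norm (conj_point (w x) (f x)) \<le> m + \<epsilon> * norm (f x) powr (1 / (p - 1))"
    proof (cases "norm (f x) \<le> \<delta>")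
      case True
      have "norm (conj_point (w x) (f x)) = w x * (norm (f x) / \<delta>)" using True w(2)[OF x] del by (simp add: conj_point_def)
      also have "\<dots> \<le> w x * 1" using True w(2)[OF x] del by (intro mult_left_mono) auto
      finally show ?thesis using w(3)[OF x] eps by (smt (verit) mult_nonneg_nonneg powr_ge_zero)
    next
      case False
      then have q0: "norm (f x) > 0" using del by linarith
      have "norm (conj_point (w x) (f x)) = w x + \<epsilon> * (norm (f x) - \<delta>) powr (1 / (p - 1))"
        using False q0 w(2)[OF x] eps by (simp add: conj_point_def)
      also have "\<dots> \<le> m + \<epsilon> * norm (f x) powr (1 / (p - 1))"
        using w(3)[OF x] eps False del p by (intro add_mono mult_left_mono powr_mono2) auto
      finally show ?thesis .
    qed
    then have "norm (conj_point (w x) (f x)) powr p \<le> (m + \<epsilon> * norm (f x) powr (1 / (p - 1))) powr p"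
      using p by (intro powr_mono2) auto
    also have "\<dots> \<le> 2 powr p * (m powr p + (\<epsilon> * norm (f x) powr (1 / (p - 1))) powr p)"
      using p m0 eps by (intro powr_add_le) auto
    also have "(\<epsilon> * norm (f x) powr (1 / (p - 1))) powr p = \<epsilon> powr p * norm (f x) powr conj_exp p"
      unfolding powr_mult powr_powr conj_exp_props(2)[OF p] ..
    finally show ?thesis .
  qed
  have "integrable M (\<lambda>x. norm (conj_point (w x) (f x)) powr p)"
  proof (rule Bochner_Integration.integrable_bound)
    show "integrable M (\<lambda>x. 2 powr p * (m powr p + \<epsilon> powr p * norm (f x) powr conj_exp p))"
      using Lp_onD(2)[OF f] by simp
    show "(\<lambda>x. norm (conj_point (w x) (f x)) powr p) \<in> borel_measurable M" using m by measurable
    show "AE x in M. norm (norm (conj_point (w x) (f x)) powr p)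
        \<le> norm (2 powr p * (m powr p + \<epsilon> powr p * norm (f x) powr conj_exp p))"
      using b by (intro AE_I2) (simp add: abs_of_nonneg)
  qed
  then show ?thesis using m by (simp add: Lp_on_def)
qed

end

lemma G_conj_eq:
  fixes q :: "'a::euclidean_space"
  assumes \<alpha>: "1 < \<alpha>" and eps: "0 < \<epsilon>" and del: "0 < \<delta>" and w: "0 \<le> w x"
  shows "G_conj \<alpha> w \<epsilon> \<delta> x q = q \<bullet> conj_point (conj_exp \<alpha>) \<epsilon> \<delta> (w x) q
      - G_int \<alpha> w \<epsilon> \<delta> x (conj_point (conj_exp \<alpha>) \<epsilon> \<delta> (w x) q)"
    and "q \<bullet> b - G_int \<alpha> w \<epsilon> \<delta> x b \<le> G_conj \<alpha> w \<epsilon> \<delta> x q"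
proof -
  note m = conj_point_maximal[OF conj_exp_props(1)[OF \<alpha>] eps del w, of q]
  show 1: "G_conj \<alpha> w \<epsilon> \<delta> x q = q \<bullet> conj_point (conj_exp \<alpha>) \<epsilon> \<delta> (w x) q
      - G_int \<alpha> w \<epsilon> \<delta> x (conj_point (conj_exp \<alpha>) \<epsilon> \<delta> (w x) q)"
    unfolding G_conj_def G_int_eq_split by (rule cSup_eq_maximum) (use m in auto)
  show "q \<bullet> b - G_int \<alpha> w \<epsilon> \<delta> x b \<le> G_conj \<alpha> w \<epsilon> \<delta> x q"
    unfolding 1 unfolding G_int_eq_split by (rule m)
qed

subsection \<open>Sobolev functions on Lipschitz domains\<close>

lemma borel_measurable_lebesgue_on_AE:
  fixes f g :: "'a::euclidean_space \<Rightarrow> 'b::euclidean_space"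
  assumes S: "S \<in> sets lebesgue" and g: "g \<in> borel_measurable (lebesgue_on S)"
    and ae: "AE x in lebesgue_on S. f x = g x"
  shows "f \<in> borel_measurable (lebesgue_on S)"
proof -
  have "AE x in lebesgue. x \<in> S \<longrightarrow> f x = g x" using ae S by (subst (asm) AE_restrict_space_iff) auto
  then obtain N where N: "N \<in> null_sets lebesgue" "{x \<in> space lebesgue. \<not> (x \<in> S \<longrightarrow> f x = g x)} \<subseteq> N"
    by (rule AE_E3) auto
  show ?thesis
  proof (rule measurableI)
    fix A :: "'b set" assume A: "A \<in> sets borel"
    have sub: "T \<in> sets lebesgue" if "T \<subseteq> N" for T
      using that N(1) by (meson completion.complete2 null_setsD2)
    have gA: "g -` A \<inter> S \<in> sets lebesgue"
      using measurable_sets[OF g A] S by (auto simp: sets_restrict_space_iff)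
    have "f -` A \<inter> S = ((g -` A \<inter> S) - N) \<union> ((f -` A \<inter> S) \<inter> N)" using N(2) by auto
    moreover have "((g -` A \<inter> S) - N) \<union> ((f -` A \<inter> S) \<inter> N) \<in> sets lebesgue"
      by (rule sets.Un[OF sets.Diff[OF gA null_setsD2[OF N(1)]] sub]) auto
    ultimately show "f -` A \<inter> space (lebesgue_on S) \<in> sets (lebesgue_on S)"
      using S by (simp add: sets_restrict_space_iff)
  qed auto
qed

locale lipschitz_compact =
  fixes \<Omega> :: "'a::euclidean_space set" and p :: real
  assumes compact: "compact \<Omega>" and closure_interior: "closure (interior \<Omega>) = \<Omega>"
    and lipschitz: "bounded_lipschitz_domain (interior \<Omega>)" and p1: "1 < p" and pd: "real DIM('a) < p"
begin

abbreviation U :: "'a set" where "U \<equiv> interior \<Omega>"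
abbreviation M :: "'a measure" where "M \<equiv> lebesgue_on \<Omega>"

lemma measurable_domain: "\<Omega> \<in> sets lebesgue" "U \<in> sets lebesgue" "U \<subseteq> \<Omega>" "open U"
  using compact interior_subset[of \<Omega>] by auto

lemma finite_measures: "finite_measure M" "finite_measure (lebesgue_on U)"
proof -
  have c: "\<Omega> \<in> lmeasurable" by (rule lmeasurable_compact[OF compact])
  then show "finite_measure M" by (rule finite_measure_lebesgue_on)
  have "U \<in> lmeasurable" using fmeasurableI2[OF c measurable_domain(3,2)] .
  then show "finite_measure (lebesgue_on U)" by (rule finite_measure_lebesgue_on)
qed

lemma AE_M_iff: "(AE x in M. P x) \<longleftrightarrow> (AE x in lebesgue_on U. P x)"
proof
  assume "AE x in lebesgue_on U. P x"
  from AE_on_closure_lipschitz_domain[OF lipschitz this] show "AE x in M. P x" by (simp only: closure_interior)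
next
  assume "AE x in M. P x"
  then have "AE x in lebesgue. x \<in> \<Omega> \<longrightarrow> P x" using measurable_domain by (subst (asm) AE_restrict_space_iff) auto
  then have "AE x in lebesgue. x \<in> U \<longrightarrow> P x" by eventually_elim (use measurable_domain in auto)
  then show "AE x in lebesgue_on U. P x" using measurable_domain by (subst AE_restrict_space_iff) auto
qed

lemma measurable_M_iff:
  fixes f :: "'a \<Rightarrow> 'b::euclidean_space"
  shows "f \<in> borel_measurable M \<longleftrightarrow> f \<in> borel_measurable (lebesgue_on U)"
proof
  assume f: "f \<in> borel_measurable M"
  have eq: "lebesgue_on U = restrict_space M U"
    using measurable_domain(3) by (simp add: restrict_restrict_space Int_absorb1 measurable_domain)
  show "f \<in> borel_measurable (lebesgue_on U)" unfolding eq by (rule measurable_restrict_space1[OF f])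
next
  assume f: "f \<in> borel_measurable (lebesgue_on U)"
  have "(\<lambda>x. if x \<in> U then f x else 0) \<in> borel_measurable lebesgue"
    using f measurable_domain by (subst (asm) measurable_restrict_space_iff[where c=0]) auto
  then have 1: "(\<lambda>x. if x \<in> U then f x else 0) \<in> borel_measurable M" by (rule measurable_restrict_space1)
  have "AE x in lebesgue_on U. f x = (if x \<in> U then f x else 0)" by (rule AE_I2) simp
  then have "AE x in M. f x = (if x \<in> U then f x else 0)" by (simp only: AE_M_iff)
  from borel_measurable_lebesgue_on_AE[OF measurable_domain(1) 1 this] show "f \<in> borel_measurable M" .
qed

lemma integral_M_measurable:
  fixes f :: "'a \<Rightarrow> 'b::euclidean_space"
  assumes f: "f \<in> borel_measurable M"
  shows "integrable M f \<longleftrightarrow> integrable (lebesgue_on U) f" "(\<integral>x. f x \<partial>M) = (\<integral>x. f x \<partial>lebesgue_on U)"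
proof -
  have "AE x in lebesgue_on U. x \<in> U" by (rule AE_I2) simp
  then have "AE x in M. x \<in> U" by (simp only: AE_M_iff)
  then have "AE x in lebesgue. x \<in> \<Omega> \<longrightarrow> x \<in> U" using measurable_domain by (subst (asm) AE_restrict_space_iff) auto
  then have ae: "AE x in lebesgue. indicator \<Omega> x *\<^sub>R f x = indicator U x *\<^sub>R f x"
    by eventually_elim (use measurable_domain(3) in \<open>auto simp: indicator_def\<close>)
  have m: "(\<lambda>x. indicator \<Omega> x *\<^sub>R f x) \<in> borel_measurable lebesgue"
    using f measurable_domain by (subst (asm) borel_measurable_restrict_space_iff) auto
  have m': "(\<lambda>x. indicator U x *\<^sub>R f x) \<in> borel_measurable lebesgue"
    using f measurable_domain unfolding measurable_M_iff by (subst (asm) borel_measurable_restrict_space_iff) auto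
  show "integrable M f \<longleftrightarrow> integrable (lebesgue_on U) f"
    using integrable_cong_AE[OF m m' ae] measurable_domain by (simp add: integrable_restrict_space)
  show "(\<integral>x. f x \<partial>M) = (\<integral>x. f x \<partial>lebesgue_on U)"
    using integral_cong_AE[OF m m' ae] measurable_domain by (simp add: integral_restrict_space)
qed

lemma integrable_M_iff:
  fixes f :: "'a \<Rightarrow> 'b::euclidean_space"
  shows "integrable M f \<longleftrightarrow> integrable (lebesgue_on U) f"
  using integral_M_measurable(1)[of f] borel_measurable_integrable[of M f]
    borel_measurable_integrable[of "lebesgue_on U" f] unfolding measurable_M_iff by blast

lemma integral_M:
  fixes f :: "'a \<Rightarrow> 'b::euclidean_space"
  shows "(\<integral>x. f x \<partial>M) = (\<integral>x. f x \<partial>lebesgue_on U)"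
proof (cases "integrable M f")
  case True
  then show ?thesis by (intro integral_M_measurable(2) borel_measurable_integrable)
next
  case False
  then show ?thesis using integrable_M_iff[of f] by (simp add: not_integrable_integral_eq)
qed

lemma Lp_on_M_iff:
  fixes f :: "'a \<Rightarrow> 'b::euclidean_space"
  shows "f \<in> Lp_on p M \<longleftrightarrow> f \<in> Lp_on p (lebesgue_on U)"
  by (simp add: Lp_on_def measurable_M_iff integrable_M_iff)

lemma W1pD:
  assumes "y \<in> W1p p \<Omega>"
  shows "y \<in> Lp_on p M" "integrable M y" "is_weak_gradient U y (wgrad \<Omega> y)" "wgrad \<Omega> y \<in> Lp_on p M"
proof -
  obtain g where g: "g \<in> Lp p U" "is_weak_gradient U y g" and y: "y \<in> Lp p U"
    using assms by (auto simp: W1p_def)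
  show yM: "y \<in> Lp_on p M" using y by (simp add: Lp_on_M_iff Lp_eq_Lp_on)
  show "integrable M y" using Lp_on_imp_integrable(1)[OF p1 finite_measures(1) yM, of 1] by simp
  show wg: "is_weak_gradient U y (wgrad \<Omega> y)" unfolding wgrad_def by (rule someI[of "is_weak_gradient U y", OF g(2)])
  have ae: "AE x in lebesgue_on U. wgrad \<Omega> y x = g x"
    by (rule weak_gradient_unique[OF measurable_domain(4) wg g(2)])
  have gL: "g \<in> Lp_on p (lebesgue_on U)" using g(1) by (simp add: Lp_eq_Lp_on)
  have m: "wgrad \<Omega> y \<in> borel_measurable (lebesgue_on U)"
    by (rule borel_measurable_lebesgue_on_AE[OF measurable_domain(2) Lp_onD(1)[OF gL] ae])
  have "integrable (lebesgue_on U) (\<lambda>x. norm (wgrad \<Omega> y x) powr p)"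
  proof (rule integrable_cong_AE_imp[OF Lp_onD(2)[OF gL]])
    show "(\<lambda>x. norm (wgrad \<Omega> y x) powr p) \<in> borel_measurable (lebesgue_on U)" using m by measurable
    show "AE x in lebesgue_on U. norm (g x) powr p = norm (wgrad \<Omega> y x) powr p" using ae by eventually_elim simp
  qed
  then show "wgrad \<Omega> y \<in> Lp_on p M" using m unfolding Lp_on_M_iff by (simp add: Lp_on_def)
qed

lemma wgrad_AE:
  assumes "is_weak_gradient U y g"
  shows "AE x in M. wgrad \<Omega> y x = g x"
proof -
  have "is_weak_gradient U y (wgrad \<Omega> y)" unfolding wgrad_def by (rule someI[of "is_weak_gradient U y", OF assms])
  from weak_gradient_unique[OF measurable_domain(4) this assms] show ?thesis by (simp only: AE_M_iff)
qed

lemma W1pI: "y \<in> Lp_on p M \<Longrightarrow> g \<in> Lp_on p M \<Longrightarrow> is_weak_gradient U y g \<Longrightarrow> y \<in> W1p p \<Omega>"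
  by (auto simp: W1p_def Lp_eq_Lp_on Lp_on_M_iff)

lemma W1p_lincomb:
  assumes y: "y \<in> W1p p \<Omega>" "z \<in> W1p p \<Omega>"
  shows "(\<lambda>x. a * y x + b * z x) \<in> W1p p \<Omega>"
    "AE x in M. wgrad \<Omega> (\<lambda>x. a * y x + b * z x) x = a *\<^sub>R wgrad \<Omega> y x + b *\<^sub>R wgrad \<Omega> z x"
proof -
  note wg = is_weak_gradient_lincomb[OF measurable_domain(4) W1pD(3)[OF y(1)] W1pD(3)[OF y(2)], of a b]
  show "AE x in M. wgrad \<Omega> (\<lambda>x. a * y x + b * z x) x = a *\<^sub>R wgrad \<Omega> y x + b *\<^sub>R wgrad \<Omega> z x"
    by (rule wgrad_AE[OF wg])
  show "(\<lambda>x. a * y x + b * z x) \<in> W1p p \<Omega>"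
  proof (rule W1pI[OF _ _ wg])
    show "(\<lambda>x. a * y x + b * z x) \<in> Lp_on p M"
      using Lp_on_lincomb[OF W1pD(1)[OF y(1)] W1pD(1)[OF y(2)], of a b] p1 by simp
    show "(\<lambda>x. a *\<^sub>R wgrad \<Omega> y x + b *\<^sub>R wgrad \<Omega> z x) \<in> Lp_on p M"
      using p1 by (intro Lp_on_lincomb W1pD y) auto
  qed
qed

lemma W1p_mean0_subset: "y \<in> W1p_mean0 p \<Omega> \<Longrightarrow> y \<in> W1p p \<Omega>"
  by (simp add: W1p_mean0_def)

lemma W1p_mean0_lincomb:
  assumes y: "y \<in> W1p_mean0 p \<Omega>" "z \<in> W1p_mean0 p \<Omega>"
  shows "(\<lambda>x. a * y x + b * z x) \<in> W1p_mean0 p \<Omega>"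
proof -
  have "integrable M y" "integrable M z" using y by (auto intro: W1pD W1p_mean0_subset)
  then show ?thesis using W1p_lincomb(1)[OF y[THEN W1p_mean0_subset], of a b] y by (simp add: W1p_mean0_def)
qed

lemma zero_in_W1p_mean0: "(\<lambda>x. 0) \<in> W1p_mean0 p \<Omega>" "AE x in M. wgrad \<Omega> (\<lambda>x. 0) x = 0"
proof -
  have wg: "is_weak_gradient U (\<lambda>x. 0) (\<lambda>x. 0)" by (simp add: is_weak_gradient_def locally_integrable_def)
  have "(\<lambda>x. 0) \<in> W1p p \<Omega>" by (rule W1pI[OF Lp_on_zero Lp_on_zero wg])
  then show "(\<lambda>x. 0) \<in> W1p_mean0 p \<Omega>" by (simp add: W1p_mean0_def)
  show "AE x in M. wgrad \<Omega> (\<lambda>x. 0) x = 0" by (rule wgrad_AE[OF wg])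
qed

lemma continuous_AE_unique:
  fixes u v :: "'a \<Rightarrow> real"
  assumes "continuous_on \<Omega> u" "continuous_on \<Omega> v" "AE x in M. u x = v x" "x \<in> \<Omega>"
  shows "u x = v x"
proof (rule continuous_AE_eq_imp_eq[OF measurable_domain(4) open_UNIV, where f=u and g=v])
  show "continuous_on (closure U \<inter> UNIV) u" "continuous_on (closure U \<inter> UNIV) v" "x \<in> closure U \<inter> UNIV"
    using assms by (simp_all add: closure_interior)
  show "AE x in lebesgue_on (U \<inter> UNIV). u x = v x" unfolding Int_UNIV_right using assms(3) by (simp only: AE_M_iff)
qed

definition seminorm :: "('a \<Rightarrow> real) \<Rightarrow> real" where
  "seminorm y = (\<integral>x. norm (wgrad \<Omega> y x) powr p \<partial>M) powr (1 / p)"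

lemma seminorm_nonneg: "0 \<le> seminorm y"
  by (simp add: seminorm_def)

lemma sobolev_data_W1p:
  assumes y: "y \<in> W1p p \<Omega>" and e: "e > 0"
  shows "sobolev_data U p y (wgrad \<Omega> y) (seminorm y + e)"
proof -
  have "(\<integral>x. norm (wgrad \<Omega> y x) powr p \<partial>M) = seminorm y powr p"
    using p1 by (simp add: seminorm_def powr_powr)
  also have "\<dots> \<le> (seminorm y + e) powr p" using e p1 seminorm_nonneg by (intro powr_mono2) auto
  finally show ?thesis unfolding sobolev_data_def
    using W1pD[OF y] e seminorm_nonneg[of y]
    by (simp add: integrable_M_iff[symmetric] Lp_on_M_iff[symmetric] integral_M[symmetric] add_nonneg_pos)
qed

lemma embedding:
  obtains C where "C \<ge> 0" "\<And>y. y \<in> W1p p \<Omega> \<Longrightarrow> continuous_on \<Omega> (cont_rep \<Omega> y)"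
    "\<And>y. y \<in> W1p p \<Omega> \<Longrightarrow> AE x in M. cont_rep \<Omega> y x = y x"
    "\<And>y x x'. y \<in> W1p p \<Omega> \<Longrightarrow> x \<in> \<Omega> \<Longrightarrow> x' \<in> \<Omega> \<Longrightarrow>
      \<bar>cont_rep \<Omega> y x - cont_rep \<Omega> y x'\<bar> \<le> C * seminorm y"
proof (rule morrey[OF lipschitz p1 pd])
  fix C :: real assume C: "C \<ge> 0" and mor: "\<And>y g G. sobolev_data U p y g G \<Longrightarrow>
    (\<exists>u. continuous_on (closure U) u \<and> (AE x in lebesgue_on U. u x = y x) \<and>
      (\<forall>x\<in>closure U. \<forall>x'\<in>closure U. \<bar>u x - u x'\<bar> \<le> C * G))"
  have rep: "continuous_on \<Omega> (cont_rep \<Omega> y) \<and> (AE x in M. cont_rep \<Omega> y x = y x)" if y: "y \<in> W1p p \<Omega>" for y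
  proof -
    obtain u where "continuous_on (closure U) u" "AE x in lebesgue_on U. u x = y x"
      using mor[OF sobolev_data_W1p[OF y zero_less_one]] by (elim exE conjE)
    then have "continuous_on \<Omega> u \<and> (AE x in M. u x = y x)" by (simp only: closure_interior AE_M_iff simp_thms)
    then show ?thesis unfolding cont_rep_def
      by (rule someI[of "\<lambda>u. continuous_on \<Omega> u \<and> (AE x in M. u x = y x)"])
  qed
  have osc: "\<bar>cont_rep \<Omega> y x - cont_rep \<Omega> y x'\<bar> \<le> C * seminorm y" if y: "y \<in> W1p p \<Omega>" and x: "x \<in> \<Omega>" "x' \<in> \<Omega>" for y x x'
  proof (rule field_le_epsilon)
    fix e :: real assume e: "e > 0"
    have e': "e / (C + 1) > 0" using e C by simp
    obtain u where u: "continuous_on (closure U) u" "AE x in lebesgue_on U. u x = y x"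
      "\<forall>x\<in>closure U. \<forall>x'\<in>closure U. \<bar>u x - u x'\<bar> \<le> C * (seminorm y + e / (C + 1))"
      using mor[OF sobolev_data_W1p[OF y e']] by (elim exE conjE)
    have uc: "continuous_on \<Omega> u" using u(1) by (simp only: closure_interior)
    have "AE x in M. u x = y x" using u(2) by (simp only: AE_M_iff)
    then have ae: "AE x in M. cont_rep \<Omega> y x = u x" using conjunct2[OF rep[OF y]] by eventually_elim simp
    have eq: "cont_rep \<Omega> y t = u t" if "t \<in> \<Omega>" for t
      by (rule continuous_AE_unique[OF conjunct1[OF rep[OF y]] uc ae that])
    have "\<bar>cont_rep \<Omega> y x - cont_rep \<Omega> y x'\<bar> \<le> C * (seminorm y + e / (C + 1))"
      using u(3) x unfolding closure_interior by (simp only: eq)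
    also have "\<dots> = C * seminorm y + e * (C / (C + 1))" by (simp add: algebra_simps)
    also have "e * (C / (C + 1)) \<le> e * 1" using e C by (intro mult_left_mono) auto
    finally show "\<bar>cont_rep \<Omega> y x - cont_rep \<Omega> y x'\<bar> \<le> C * seminorm y + e" by simp
  qed
  show thesis
    by (rule that[OF C conjunct1[OF rep] conjunct2[OF rep] osc])
qed

lemma cont_rep_props:
  assumes "y \<in> W1p p \<Omega>"
  shows "continuous_on \<Omega> (cont_rep \<Omega> y)" "AE x in M. cont_rep \<Omega> y x = y x"
  using embedding assms by metis+

lemma cont_rep_lincomb:
  assumes y: "y \<in> W1p p \<Omega>" "z \<in> W1p p \<Omega>" and x: "x \<in> \<Omega>"
  shows "cont_rep \<Omega> (\<lambda>x. a * y x + b * z x) x = a * cont_rep \<Omega> y x + b * cont_rep \<Omega> z x"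
proof (rule continuous_AE_unique[where u="cont_rep \<Omega> (\<lambda>x. a * y x + b * z x)" and v="\<lambda>x. a * cont_rep \<Omega> y x + b * cont_rep \<Omega> z x", OF _ _ _ x])
  show "continuous_on \<Omega> (cont_rep \<Omega> (\<lambda>x. a * y x + b * z x))" by (rule cont_rep_props(1)[OF W1p_lincomb(1)[OF y]])
  show "continuous_on \<Omega> (\<lambda>x. a * cont_rep \<Omega> y x + b * cont_rep \<Omega> z x)"
    by (intro continuous_intros cont_rep_props(1) y)
  show "AE x in M. cont_rep \<Omega> (\<lambda>x. a * y x + b * z x) x = a * cont_rep \<Omega> y x + b * cont_rep \<Omega> z x"
    using cont_rep_props(2)[OF W1p_lincomb(1)[OF y, of a b]] cont_rep_props(2)[OF y(1)] cont_rep_props(2)[OF y(2)]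
    by eventually_elim simp
qed

lemma volume_pos: "0 < measure lebesgue \<Omega>"
proof -
  have "U \<noteq> {}" using lipschitz by (simp add: bounded_lipschitz_domain_def)
  then have "\<not> negligible U" using open_not_negligible measurable_domain(4) by blast
  then have "\<not> negligible \<Omega>" using negligible_subset measurable_domain(3) by blast
  then have "measure lebesgue \<Omega> \<noteq> 0" using negligible_iff_measure0[OF lmeasurable_compact[OF compact]] by blast
  then show ?thesis using measure_nonneg[of lebesgue \<Omega>] by linarith
qed

lemma mean0_sup_bound:
  obtains C where "C \<ge> 0" "\<And>y x. y \<in> W1p_mean0 p \<Omega> \<Longrightarrow> x \<in> \<Omega> \<Longrightarrow> \<bar>cont_rep \<Omega> y x\<bar> \<le> C * seminorm y"
proof -
  obtain C where C: "C \<ge> 0"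
    "\<And>y x x'. y \<in> W1p p \<Omega> \<Longrightarrow> x \<in> \<Omega> \<Longrightarrow> x' \<in> \<Omega> \<Longrightarrow> \<bar>cont_rep \<Omega> y x - cont_rep \<Omega> y x'\<bar> \<le> C * seminorm y"
    using embedding by metis
  interpret finite_measure M by (rule finite_measures)
  have "\<bar>cont_rep \<Omega> y x\<bar> \<le> C * seminorm y" if y: "y \<in> W1p_mean0 p \<Omega>" and x: "x \<in> \<Omega>" for y x
  proof -
    have yW: "y \<in> W1p p \<Omega>" using y by (rule W1p_mean0_subset)
    let ?u = "cont_rep \<Omega> y"
    have ui: "integrable M ?u" by (rule continuous_on_compact_integrable[OF compact cont_rep_props(1)[OF yW]])
    have "(\<integral>x. ?u x \<partial>M) = (\<integral>x. y x \<partial>M)"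
      by (rule integral_cong_AE[OF borel_measurable_integrable[OF ui] borel_measurable_integrable[OF W1pD(2)[OF yW]] cont_rep_props(2)[OF yW]])
    then have u0: "(\<integral>x. ?u x \<partial>M) = 0" using y by (simp add: W1p_mean0_def)
    have V: "measure M (space M) = measure lebesgue \<Omega>" using measurable_domain by (simp add: measure_restrict_space)
    have "measure lebesgue \<Omega> * ?u x = (\<integral>x'. ?u x - ?u x' \<partial>M)" using ui u0 V by simp
    then have "\<bar>measure lebesgue \<Omega> * ?u x\<bar> \<le> (\<integral>x'. \<bar>?u x - ?u x'\<bar> \<partial>M)" using integral_abs_bound[of M "\<lambda>x'. ?u x - ?u x'"] by simp
    also have "\<dots> \<le> (\<integral>x'. C * seminorm y \<partial>M)"
    proof (rule integral_mono)
      show "integrable M (\<lambda>x'. \<bar>?u x - ?u x'\<bar>)" using ui by simp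
      show "\<bar>?u x - ?u x'\<bar> \<le> C * seminorm y" if "x' \<in> space M" for x' using that x by (intro C(2) yW) auto
    qed simp
    also have "\<dots> = measure lebesgue \<Omega> * (C * seminorm y)" using V by simp
    finally have "measure lebesgue \<Omega> * \<bar>?u x\<bar> \<le> measure lebesgue \<Omega> * (C * seminorm y)" by (simp add: abs_mult)
    then show ?thesis using volume_pos by simp
  qed
  then show ?thesis using that C(1) by blast
qed

lemma gradients_closed:
  assumes y: "\<And>n. y n \<in> W1p_mean0 p \<Omega>" and v: "v \<in> Lp_on p M"
    and lim: "(\<lambda>n. \<integral>x. norm (wgrad \<Omega> (y n) x - v x) powr p \<partial>M) \<longlonglongrightarrow> 0"
  shows "\<exists>z\<in>W1p_mean0 p \<Omega>. AE x in M. v x = wgrad \<Omega> z x"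
proof -
  obtain C where C: "C \<ge> 0" "\<And>y x. y \<in> W1p_mean0 p \<Omega> \<Longrightarrow> x \<in> \<Omega> \<Longrightarrow> \<bar>cont_rep \<Omega> y x\<bar> \<le> C * seminorm y"
    using mean0_sup_bound by metis
  interpret finite_measure M by (rule finite_measures)
  have yW: "y n \<in> W1p p \<Omega>" for n using y by (rule W1p_mean0_subset)
  define u where "u n = cont_rep \<Omega> (y n)" for n
  have uc: "continuous_on \<Omega> (u n)" for n unfolding u_def by (rule cont_rep_props(1)[OF yW])
  have uy: "AE x in M. u n x = y n x" for n unfolding u_def by (rule cont_rep_props(2)[OF yW])
  define e where "e n = (\<integral>x. norm (wgrad \<Omega> (y n) x - v x) powr p \<partial>M)" for n
  have e0: "e \<longlonglongrightarrow> 0" using lim by (simp add: e_def[abs_def])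
  have diff: "\<bar>u n x - u m x\<bar> \<le> C * (2 powr p * (e n + e m)) powr (1 / p)" if x: "x \<in> \<Omega>" for n m x
  proof -
    let ?d = "\<lambda>x. 1 * y n x + (- 1) * y m x"
    have d0: "?d \<in> W1p_mean0 p \<Omega>" by (rule W1p_mean0_lincomb[OF y y])
    have "u n x - u m x = cont_rep \<Omega> ?d x" unfolding u_def using cont_rep_lincomb[OF yW yW x, of 1 n "-1" m] by simp
    then have 1: "\<bar>u n x - u m x\<bar> \<le> C * seminorm ?d" using C(2)[OF d0 x] by simp
    have L: "(\<lambda>x. wgrad \<Omega> (y k) x - v x) \<in> Lp_on p M" for k using p1 by (intro Lp_on_diff W1pD yW v) auto
    have dL: "(\<lambda>x. wgrad \<Omega> (y n) x - wgrad \<Omega> (y m) x) \<in> Lp_on p M" using p1 by (intro Lp_on_diff W1pD yW) auto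
    have "(\<integral>x. norm (wgrad \<Omega> ?d x) powr p \<partial>M) = (\<integral>x. norm (wgrad \<Omega> (y n) x - wgrad \<Omega> (y m) x) powr p \<partial>M)"
    proof (rule integral_cong_AE)
      show "AE x in M. norm (wgrad \<Omega> ?d x) powr p = norm (wgrad \<Omega> (y n) x - wgrad \<Omega> (y m) x) powr p"
        using W1p_lincomb(2)[OF yW yW, of 1 n "-1" m] by eventually_elim simp
    qed (use Lp_onD(2)[OF W1pD(4)[OF W1p_mean0_subset[OF d0]]] Lp_onD(2)[OF dL] in auto)
    also have "\<dots> \<le> (\<integral>x. 2 powr p * (norm (wgrad \<Omega> (y n) x - v x) powr p + norm (wgrad \<Omega> (y m) x - v x) powr p) \<partial>M)"
    proof (rule integral_mono[OF Lp_onD(2)[OF dL]])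
      show "integrable M (\<lambda>x. 2 powr p * (norm (wgrad \<Omega> (y n) x - v x) powr p + norm (wgrad \<Omega> (y m) x - v x) powr p))"
        using Lp_onD(2)[OF L[of n]] Lp_onD(2)[OF L[of m]] by simp
      fix x
      have "norm (wgrad \<Omega> (y n) x - wgrad \<Omega> (y m) x) \<le> norm (wgrad \<Omega> (y n) x - v x) + norm (wgrad \<Omega> (y m) x - v x)"
        using norm_triangle_ineq4[of "wgrad \<Omega> (y n) x - v x" "wgrad \<Omega> (y m) x - v x"] by simp
      then have "norm (wgrad \<Omega> (y n) x - wgrad \<Omega> (y m) x) powr p
          \<le> (norm (wgrad \<Omega> (y n) x - v x) + norm (wgrad \<Omega> (y m) x - v x)) powr p" using p1 by (intro powr_mono2) auto
      also have "\<dots> \<le> 2 powr p * (norm (wgrad \<Omega> (y n) x - v x) powr p + norm (wgrad \<Omega> (y m) x - v x) powr p)"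
        using p1 by (intro powr_add_le) auto
      finally show "norm (wgrad \<Omega> (y n) x - wgrad \<Omega> (y m) x) powr p
          \<le> 2 powr p * (norm (wgrad \<Omega> (y n) x - v x) powr p + norm (wgrad \<Omega> (y m) x - v x) powr p)" .
    qed
    also have "\<dots> = 2 powr p * (e n + e m)" using Lp_onD(2)[OF L[of n]] Lp_onD(2)[OF L[of m]] by (simp add: e_def)
    finally have "seminorm ?d \<le> (2 powr p * (e n + e m)) powr (1 / p)"
      unfolding seminorm_def using p1 by (intro powr_mono2) auto
    then have "C * seminorm ?d \<le> C * (2 powr p * (e n + e m)) powr (1 / p)" using C(1) by (rule mult_left_mono)
    then show ?thesis using 1 by linarith
  qed
  have "uniformly_Cauchy_on \<Omega> u"
  proof (rule uniformly_Cauchy_onI)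
    fix r :: real assume r: "r > 0"
    define r' where "r' = (r / (C + 1)) powr p / 2 powr p / 2"
    have r': "r' > 0" using r C(1) by (simp add: r'_def)
    have "\<forall>\<^sub>F n in sequentially. e n < r'" by (rule order_tendstoD(2)[OF e0 r'])
    then obtain N where N: "\<And>n. n \<ge> N \<Longrightarrow> e n < r'" by (auto simp: eventually_sequentially)
    have "dist (u n x) (u m x) < r" if x: "x \<in> \<Omega>" and nm: "n \<ge> N" "m \<ge> N" for x n m
    proof -
      have "2 powr p * (e n + e m) \<le> 2 powr p * (r' + r')" using N[OF nm(1)] N[OF nm(2)] by (intro mult_left_mono) auto
      also have "\<dots> = (r / (C + 1)) powr p" by (simp add: r'_def)
      finally have "(2 powr p * (e n + e m)) powr (1 / p) \<le> ((r / (C + 1)) powr p) powr (1 / p)"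
        using p1 by (intro powr_mono2) (auto simp: e_def)
      also have "\<dots> = r / (C + 1)" using p1 r C(1) by (simp add: powr_powr)
      finally have "C * (2 powr p * (e n + e m)) powr (1 / p) \<le> C * (r / (C + 1))" using C(1) by (rule mult_left_mono)
      also have "\<dots> < r" using r C(1) by (simp add: field_simps)
      finally show ?thesis using diff[OF x, of n m] unfolding dist_real_def by linarith
    qed
    then show "\<exists>N. \<forall>x\<in>\<Omega>. \<forall>m\<ge>N. \<forall>n\<ge>N. dist (u m x) (u n x) < r" by blast
  qed
  then obtain z where z: "uniform_limit \<Omega> u z sequentially"
    using Cauchy_uniformly_convergent uniformly_convergent_on_def by blast
  have zc: "continuous_on \<Omega> z"
    by (rule uniform_limit_theorem[OF _ z]) (auto intro!: always_eventually uc)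
  have zi: "integrable M z" by (rule continuous_on_compact_integrable[OF compact zc])
  have zL: "z \<in> Lp_on p M"
  proof -
    have "continuous_on \<Omega> (\<lambda>x. norm (z x) powr p)" using p1 by (intro continuous_on_powr' continuous_intros zc) auto
    then have "integrable M (\<lambda>x. norm (z x) powr p)" by (rule continuous_on_compact_integrable[OF compact])
    then show ?thesis using zi by (auto simp: Lp_on_def)
  qed
  have yi: "integrable M (y n)" for n by (rule W1pD(2)[OF yW])
  have ui: "integrable M (u n)" for n by (rule continuous_on_compact_integrable[OF compact uc])
  have L1: "(\<lambda>n. \<integral>x. \<bar>y n x - z x\<bar> \<partial>M) \<longlonglongrightarrow> 0"
  proof (rule LIMSEQ_I)
    fix r :: real assume r: "r > 0"
    define r' where "r' = r / (2 * measure M (space M) + 1)"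
    have pos: "2 * measure M (space M) + 1 > 0" using measure_nonneg[of M "space M"] by linarith
    have r': "r' > 0" using r pos by (simp add: r'_def)
    have "\<forall>\<^sub>F n in sequentially. \<forall>x\<in>\<Omega>. dist (u n x) (z x) < r'" by (rule uniform_limitD[OF z r'])
    then obtain N where N: "\<And>n x. n \<ge> N \<Longrightarrow> x \<in> \<Omega> \<Longrightarrow> dist (u n x) (z x) < r'"
      by (auto simp: eventually_sequentially)
    have "norm ((\<integral>x. \<bar>y n x - z x\<bar> \<partial>M) - 0) < r" if n: "n \<ge> N" for n
    proof -
      have "(\<integral>x. \<bar>y n x - z x\<bar> \<partial>M) = (\<integral>x. \<bar>u n x - z x\<bar> \<partial>M)"
      proof (rule integral_cong_AE)
        show "AE x in M. \<bar>y n x - z x\<bar> = \<bar>u n x - z x\<bar>" using uy[of n] by eventually_elim simp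
      qed (use borel_measurable_integrable[OF yi[of n]] borel_measurable_integrable[OF ui[of n]] borel_measurable_integrable[OF zi] in measurable)
      also have "\<dots> \<le> (\<integral>x. r' \<partial>M)"
      proof (rule integral_mono)
        show "integrable M (\<lambda>x. \<bar>u n x - z x\<bar>)" using ui zi by simp
        show "\<bar>u n x - z x\<bar> \<le> r'" if "x \<in> space M" for x
          using N[OF n, of x] that unfolding dist_real_def by simp
      qed simp
      also have "\<dots> = measure M (space M) * r'" by simp
      also have "\<dots> < r"
      proof -
        have "measure M (space M) * r' < (2 * measure M (space M) + 1) * r'"
          using r' measure_nonneg[of M "space M"] by (intro mult_strict_right_mono) linarith+
        also have "\<dots> = r" using pos by (simp add: r'_def)
        finally show ?thesis .
      qed
      finally show ?thesis by simp
    qed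
    then show "\<exists>N. \<forall>n\<ge>N. norm ((\<integral>x. \<bar>y n x - z x\<bar> \<partial>M) - 0) < r" by blast
  qed
  have vi: "integrable M v" using Lp_on_imp_integrable(1)[OF p1 finite_measures(1) v, of 1] by simp
  have gi: "integrable M (wgrad \<Omega> (y n))" for n
    using Lp_on_imp_integrable(1)[OF p1 finite_measures(1) W1pD(4)[OF yW], of 1] by simp
  have wg: "is_weak_gradient U z v"
  proof (rule is_weak_gradient_limit[OF measurable_domain(4)])
    show "is_weak_gradient U (y n) (wgrad \<Omega> (y n))" for n by (rule W1pD(3)[OF yW])
    show "(\<lambda>n. \<integral>x. \<bar>y n x - z x\<bar> \<partial>lebesgue_on U) \<longlonglongrightarrow> 0" using L1 by (simp only: integral_M)
    show "(\<lambda>n. \<integral>x. norm (wgrad \<Omega> (y n) x - v x) \<partial>lebesgue_on U) \<longlonglongrightarrow> 0"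
      using Lp_convergence_imp_L1[OF p1 finite_measures(1) W1pD(4)[OF yW] v lim] by (simp only: integral_M)
  qed (use yi gi zi vi in \<open>simp_all only: integrable_M_iff\<close>)
  have "(\<lambda>n. (\<integral>x. y n x \<partial>M)) \<longlonglongrightarrow> (\<integral>x. z x \<partial>M)"
    using tendsto_integral_mult_L1[OF yi zi L1, of "\<lambda>x. 1" 1] by simp
  moreover have "(\<integral>x. y n x \<partial>M) = 0" for n using y[of n] by (simp add: W1p_mean0_def)
  ultimately have "(\<integral>x. z x \<partial>M) = 0" by (simp add: LIMSEQ_const_iff)
  then have "z \<in> W1p_mean0 p \<Omega>" using W1pI[OF zL v wg] by (simp add: W1p_mean0_def)
  moreover have "AE x in M. v x = wgrad \<Omega> z x" using wgrad_AE[OF wg] by eventually_elim simp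
  ultimately show ?thesis by blast
qed

end

locale lipschitz_compact_measures = lipschitz_compact +
  fixes \<mu>p \<mu>m :: "'a measure"
  assumes prob_p: "prob_space \<mu>p" and sets_p: "sets \<mu>p = sets (restrict_space borel \<Omega>)"
    and prob_m: "prob_space \<mu>m" and sets_m: "sets \<mu>m = sets (restrict_space borel \<Omega>)"
begin

lemma continuous_integrable_measure:
  fixes u :: "'a \<Rightarrow> real"
  assumes \<mu>: "prob_space \<mu>" "sets \<mu> = sets (restrict_space borel \<Omega>)" and u: "continuous_on \<Omega> u"
  shows "integrable \<mu> u" "space \<mu> = \<Omega>"
proof -
  interpret prob_space \<mu> by fact
  show sp: "space \<mu> = \<Omega>" using sets_eq_imp_space_eq[OF \<mu>(2)] by (simp add: space_restrict_space)
  obtain B where B: "\<And>x. x \<in> \<Omega> \<Longrightarrow> norm (u x) \<le> B"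
    using compact_imp_bounded[OF compact_continuous_image[OF u compact]] by (auto simp: bounded_iff)
  show "integrable \<mu> u"
  proof (rule integrable_const_bound)
    show "AE x in \<mu>. norm (u x) \<le> B" by (rule AE_I2) (use B sp in auto)
    have "u \<in> borel_measurable (restrict_space borel \<Omega>)" by (rule borel_measurable_continuous_on_restrict[OF u])
    then show "u \<in> borel_measurable \<mu>" using measurable_cong_sets[OF \<mu>(2) refl] by blast
  qed
qed

abbreviation pairing :: "('a \<Rightarrow> real) \<Rightarrow> real" where
  "pairing \<equiv> meas_pairing \<Omega> \<mu>p \<mu>m"

lemma pairing_lincomb:
  assumes y: "y \<in> W1p p \<Omega>" "z \<in> W1p p \<Omega>"
  shows "pairing (\<lambda>x. a * y x + b * z x) = a * pairing y + b * pairing z"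
proof -
  have "(\<integral>x. cont_rep \<Omega> (\<lambda>x. a * y x + b * z x) x \<partial>\<mu>) = a * (\<integral>x. cont_rep \<Omega> y x \<partial>\<mu>) + b * (\<integral>x. cont_rep \<Omega> z x \<partial>\<mu>)"
    if \<mu>: "prob_space \<mu>" "sets \<mu> = sets (restrict_space borel \<Omega>)" for \<mu>
  proof -
    note i = continuous_integrable_measure[OF \<mu> cont_rep_props(1)]
    have "(\<integral>x. cont_rep \<Omega> (\<lambda>x. a * y x + b * z x) x \<partial>\<mu>) = (\<integral>x. a * cont_rep \<Omega> y x + b * cont_rep \<Omega> z x \<partial>\<mu>)"
      using i(2)[OF y(1)] by (intro Bochner_Integration.integral_cong refl cont_rep_lincomb y) auto
    then show ?thesis using i(1)[OF y(1)] i(1)[OF y(2)] by simp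
  qed
  from this[OF prob_p sets_p] this[OF prob_m sets_m] show ?thesis
    by (simp add: meas_pairing_def algebra_simps)
qed

lemma pairing_bound:
  obtains C where "C \<ge> 0" "\<And>y. y \<in> W1p p \<Omega> \<Longrightarrow> \<bar>pairing y\<bar> \<le> C * seminorm y"
proof -
  obtain C where C: "C \<ge> 0"
    "\<And>y x x'. y \<in> W1p p \<Omega> \<Longrightarrow> x \<in> \<Omega> \<Longrightarrow> x' \<in> \<Omega> \<Longrightarrow> \<bar>cont_rep \<Omega> y x - cont_rep \<Omega> y x'\<bar> \<le> C * seminorm y"
    using embedding by metis
  obtain x0 where x0: "x0 \<in> \<Omega>" using volume_pos by (cases "\<Omega> = {}") auto
  have b: "\<bar>(\<integral>x. cont_rep \<Omega> y x \<partial>\<mu>) - cont_rep \<Omega> y x0\<bar> \<le> C * seminorm y"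
    if y: "y \<in> W1p p \<Omega>" and \<mu>: "prob_space \<mu>" "sets \<mu> = sets (restrict_space borel \<Omega>)" for y \<mu>
  proof -
    interpret prob_space \<mu> by fact
    note i = continuous_integrable_measure[OF \<mu> cont_rep_props(1)[OF y]]
    have "(\<integral>x. cont_rep \<Omega> y x \<partial>\<mu>) - cont_rep \<Omega> y x0 = (\<integral>x. cont_rep \<Omega> y x - cont_rep \<Omega> y x0 \<partial>\<mu>)"
      using i(1) by (simp add: prob_space)
    also have "\<bar>\<dots>\<bar> \<le> (\<integral>x. \<bar>cont_rep \<Omega> y x - cont_rep \<Omega> y x0\<bar> \<partial>\<mu>)" by (rule integral_abs_bound)
    also have "\<dots> \<le> (\<integral>x. C * seminorm y \<partial>\<mu>)"
    proof (rule integral_mono)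
      show "integrable \<mu> (\<lambda>x. \<bar>cont_rep \<Omega> y x - cont_rep \<Omega> y x0\<bar>)" using i(1) by simp
      show "\<bar>cont_rep \<Omega> y x - cont_rep \<Omega> y x0\<bar> \<le> C * seminorm y" if "x \<in> space \<mu>" for x
        using that i(2) x0 by (intro C(2) y) auto
    qed simp
    also have "\<dots> = C * seminorm y" by (simp add: prob_space)
    finally show ?thesis .
  qed
  show ?thesis
  proof (rule that[of "2 * C"])
    show "2 * C \<ge> 0" using C(1) by simp
    fix y assume y: "y \<in> W1p p \<Omega>"
    show "\<bar>pairing y\<bar> \<le> 2 * C * seminorm y"
      using b[OF y prob_p sets_p] b[OF y prob_m sets_m] unfolding meas_pairing_def by (simp add: abs_le_iff)
  qed
qed

end

subsection \<open>Vector measures with a density\<close>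

context lipschitz_compact
begin

lemma restrict_borel_iff: "A \<in> sets (restrict_space borel \<Omega>) \<longleftrightarrow> A \<in> sets borel \<and> A \<subseteq> \<Omega>"
  using borel_compact[OF compact] by (auto simp: sets_restrict_space_iff)

lemma restrict_borel_in_M: "A \<in> sets (restrict_space borel \<Omega>) \<Longrightarrow> A \<in> sets M"
  using measurable_domain by (auto simp: restrict_borel_iff sets_restrict_space_iff)

lemma AE_M_null:
  assumes "N \<in> null_sets lborel"
  shows "AE x in M. x \<notin> N"
proof -
  have "AE x in lebesgue. x \<notin> N" using AE_not_in[OF null_sets_completionI[OF assms]] .
  then have "AE x in lebesgue. x \<in> \<Omega> \<longrightarrow> x \<notin> N" by eventually_elim simp
  then show ?thesis using measurable_domain by (subst AE_restrict_space_iff) auto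
qed

lemma density_AE_unique:
  assumes f: "is_density \<Omega> q f" and g: "is_density \<Omega> q g"
  shows "AE x in M. f x = g x"
proof -
  interpret finite_measure M by (rule finite_measures)
  show ?thesis
  proof (rule density_unique_banach)
    show fi: "integrable M f" and gi: "integrable M g" using f g by (auto simp: is_density_def)
    fix A assume A: "A \<in> sets M"
    then have AL: "A \<in> sets lebesgue" "A \<subseteq> \<Omega>" using measurable_domain by (auto simp: sets_restrict_space_iff)
    obtain S N N' where S: "A = S \<union> N" "N \<subseteq> N'" "N' \<in> null_sets lborel" "S \<in> sets lborel"
      using AL(1) by (rule sets_completionE)
    have SB: "S \<in> sets (restrict_space borel \<Omega>)" using S AL by (auto simp: restrict_borel_iff)
    have eq: "(\<integral>x. indicator A x *\<^sub>R h x \<partial>M) = (\<integral>x. indicator S x *\<^sub>R h x \<partial>M)" if h: "integrable M h" for h :: "'a \<Rightarrow> 'a"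
    proof (rule integral_cong_AE)
      show "(\<lambda>x. indicator A x *\<^sub>R h x) \<in> borel_measurable M"
        by (rule borel_measurable_integrable[OF integrable_mult_indicator[OF A h]])
      show "(\<lambda>x. indicator S x *\<^sub>R h x) \<in> borel_measurable M"
        by (rule borel_measurable_integrable[OF integrable_mult_indicator[OF restrict_borel_in_M[OF SB] h]])
      show "AE x in M. indicator A x *\<^sub>R h x = indicator S x *\<^sub>R h x"
        using AE_M_null[OF S(3)] by eventually_elim (use S in \<open>auto simp: indicator_def\<close>)
    qed
    have "(\<integral>x. indicator S x *\<^sub>R f x \<partial>M) = (\<integral>x. indicator S x *\<^sub>R g x \<partial>M)"
      using f g SB unfolding is_density_def by metis
    then show "set_lebesgue_integral M A f = set_lebesgue_integral M A g"
      unfolding set_lebesgue_integral_def eq[OF fi] eq[OF gi] .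
  qed
qed

definition density_measure :: "('a \<Rightarrow> 'a) \<Rightarrow> 'a set \<Rightarrow> 'a" where
  "density_measure f A = (if A \<in> sets (restrict_space borel \<Omega>) then \<integral>x. indicator A x *\<^sub>R f x \<partial>M else 0)"

lemma density_measure_sums:
  assumes f: "integrable M f" and A: "range A \<subseteq> sets (restrict_space borel \<Omega>)" "disjoint_family A"
  shows "(\<lambda>n. density_measure f (A n)) sums density_measure f (\<Union>n. A n)"
  unfolding sums_def
proof -
  have A': "A n \<in> sets (restrict_space borel \<Omega>)" for n using A(1) by auto
  have U: "(\<Union>n. A n) \<in> sets (restrict_space borel \<Omega>)" using A' by auto
  have i: "integrable M (\<lambda>x. indicator B x *\<^sub>R f x)" if "B \<in> sets (restrict_space borel \<Omega>)" for B
    by (rule integrable_mult_indicator[OF restrict_borel_in_M[OF that] f])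
  have "(\<Sum>k<n. density_measure f (A k)) = (\<integral>x. indicator (\<Union>k<n. A k) x *\<^sub>R f x \<partial>M)" for n
  proof -
    have "(\<Sum>k<n. density_measure f (A k)) = (\<integral>x. (\<Sum>k<n. indicator (A k) x *\<^sub>R f x) \<partial>M)"
      unfolding density_measure_def if_P[OF A']
      by (rule Bochner_Integration.integral_sum[symmetric]) (rule i[OF A'])
    also have "\<dots> = (\<integral>x. indicator (\<Union>k<n. A k) x *\<^sub>R f x \<partial>M)"
    proof (rule Bochner_Integration.integral_cong[OF refl])
      fix x
      have "(indicator (\<Union>k<n. A k) x :: real) = (\<Sum>k<n. indicator (A k) x)"
        using A(2) by (intro indicator_UN_disjoint) (auto simp: disjoint_family_on_def)
      then show "(\<Sum>k<n. indicator (A k) x *\<^sub>R f x) = indicator (\<Union>k<n. A k) x *\<^sub>R f x"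
        by (simp add: scaleR_sum_left)
    qed
    finally show ?thesis .
  qed
  moreover have "(\<lambda>n. \<integral>x. indicator (\<Union>k<n. A k) x *\<^sub>R f x \<partial>M) \<longlonglongrightarrow> (\<integral>x. indicator (\<Union>k. A k) x *\<^sub>R f x \<partial>M)"
  proof (rule integral_dominated_convergence[where w="\<lambda>x. norm (f x)"])
    show "(\<lambda>x. indicator (\<Union>k. A k) x *\<^sub>R f x) \<in> borel_measurable M" by (rule borel_measurable_integrable[OF i[OF U]])
    show "(\<lambda>x. indicator (\<Union>k<n. A k) x *\<^sub>R f x) \<in> borel_measurable M" for n
      by (rule borel_measurable_integrable[OF i]) (use A' in auto)
    show "integrable M (\<lambda>x. norm (f x))" using f by simp
    show "AE x in M. (\<lambda>n. indicator (\<Union>k<n. A k) x *\<^sub>R f x) \<longlonglongrightarrow> indicator (\<Union>k. A k) x *\<^sub>R f x"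
      by (intro AE_I2 tendsto_scaleR tendsto_const LIMSEQ_indicator_UN)
    show "AE x in M. norm (indicator (\<Union>k<n. A k) x *\<^sub>R f x) \<le> norm (f x)" for n
      by (intro AE_I2) (auto simp: indicator_def)
  qed
  ultimately show "(\<lambda>n. \<Sum>k<n. density_measure f (A k)) \<longlonglongrightarrow> density_measure f (\<Union>n. A n)"
    using U by (simp add: density_measure_def)
qed

lemma density_measure_in:
  assumes a: "1 < a" and f: "f \<in> Lp_on a M"
  shows "density_measure f \<in> measures_with_Lp_density a \<Omega>" "is_density \<Omega> (density_measure f) f"
proof -
  have fi: "integrable M f" using Lp_on_imp_integrable(1)[OF a finite_measures(1) f, of 1] by simp
  show d: "is_density \<Omega> (density_measure f) f" using fi by (simp add: is_density_def density_measure_def)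
  have "abs_cont \<Omega> (density_measure f)"
    unfolding abs_cont_def
  proof (intro ballI impI)
    fix A assume A: "A \<in> sets (restrict_space borel \<Omega>)" "emeasure lborel A = 0"
    have "A \<in> null_sets lborel" using A by (auto simp: restrict_borel_iff null_sets_def)
    then have "AE x in M. x \<notin> A" by (rule AE_M_null)
    then have "AE x in M. indicator A x *\<^sub>R f x = 0" by eventually_elim simp
    then have "(\<integral>x. indicator A x *\<^sub>R f x \<partial>M) = 0" by (rule integral_eq_zero_AE)
    then show "density_measure f A = 0" by (simp add: density_measure_def)
  qed
  moreover have "density_measure f \<in> vector_measures \<Omega>"
    using density_measure_sums[OF fi] by (auto simp: vector_measures_def) (simp add: density_measure_def)
  ultimately show "density_measure f \<in> measures_with_Lp_density a \<Omega>"
    using d f by (auto simp: measures_with_Lp_density_def Lp_eq_Lp_on)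
qed

lemma dens_props:
  assumes q: "q \<in> measures_with_Lp_density a \<Omega>"
  shows "is_density \<Omega> q (dens \<Omega> q)" "dens \<Omega> q \<in> Lp_on a M"
proof -
  obtain f where f: "f \<in> Lp_on a M" "is_density \<Omega> q f"
    using q by (auto simp: measures_with_Lp_density_def Lp_eq_Lp_on)
  show d: "is_density \<Omega> q (dens \<Omega> q)" unfolding dens_def by (rule someI[of "is_density \<Omega> q", OF f(2)])
  have ae: "AE x in M. dens \<Omega> q x = f x" by (rule density_AE_unique[OF d f(2)])
  have m: "dens \<Omega> q \<in> borel_measurable M" using d by (auto simp: is_density_def)
  have "integrable M (\<lambda>x. norm (dens \<Omega> q x) powr a)"
  proof (rule integrable_cong_AE_imp[OF Lp_onD(2)[OF f(1)]])
    show "(\<lambda>x. norm (dens \<Omega> q x) powr a) \<in> borel_measurable M" using m by measurable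
    show "AE x in M. norm (f x) powr a = norm (dens \<Omega> q x) powr a" using ae by eventually_elim simp
  qed
  then show "dens \<Omega> q \<in> Lp_on a M" using m by (simp add: Lp_on_def)
qed

lemma dens_density_measure:
  assumes "1 < a" "f \<in> Lp_on a M"
  shows "AE x in M. dens \<Omega> (density_measure f) x = f x"
  by (rule density_AE_unique[OF dens_props(1) density_measure_in(2)]) (use assms density_measure_in in auto)

end

subsection \<open>The two problems\<close>

locale predual_problem = lipschitz_compact_measures \<Omega> "conj_exp \<alpha>" \<mu>p \<mu>m
  for \<Omega> :: "'a::euclidean_space set" and \<alpha> :: real and \<mu>p \<mu>m +
  fixes w :: "'a \<Rightarrow> real" and \<epsilon> \<delta> :: real
  assumes \<alpha>1: "1 < \<alpha>" and w_continuous: "continuous_on \<Omega> w" and w_nonneg: "\<And>x. x \<in> \<Omega> \<Longrightarrow> 0 \<le> w x"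
    and eps: "0 < \<epsilon>" and del: "0 < \<delta>"
begin

abbreviation p :: real where "p \<equiv> conj_exp \<alpha>"
abbreviation X :: "('a \<Rightarrow> real) set" where "X \<equiv> W1p_mean0 p \<Omega>"

abbreviation Primal :: "('a \<Rightarrow> real) \<Rightarrow> real" where "Primal \<equiv> primal_functional \<alpha> w \<epsilon> \<delta> \<Omega> \<mu>p \<mu>m"
abbreviation Dual :: "('a set \<Rightarrow> 'a) \<Rightarrow> real" where "Dual \<equiv> dual_functional \<alpha> w \<epsilon> \<delta> \<Omega>"
abbreviation Admissible :: "('a set \<Rightarrow> 'a) set" where "Admissible \<equiv> dual_admissible \<alpha> \<Omega> \<mu>p \<mu>m"
abbreviation Measures :: "('a set \<Rightarrow> 'a) set" where "Measures \<equiv> measures_with_Lp_density \<alpha> \<Omega>"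
abbreviation Integrand :: "'a \<Rightarrow> 'a \<Rightarrow> real" where "Integrand \<equiv> G_int \<alpha> w \<epsilon> \<delta>"
abbreviation Conjugate :: "'a \<Rightarrow> 'a \<Rightarrow> real" where "Conjugate \<equiv> G_conj \<alpha> w \<epsilon> \<delta>"

lemma conj_p: "conj_exp p = \<alpha>"
  by (rule conj_exp_props(4)[OF \<alpha>1])

lemma continuous_on_M:
  fixes u :: "'a \<Rightarrow> real"
  assumes "continuous_on \<Omega> u"
  shows "u \<in> borel_measurable M" and "\<exists>m. \<forall>x\<in>\<Omega>. u x \<le> m"
proof -
  show "u \<in> borel_measurable M" by (rule continuous_imp_measurable_on_sets_lebesgue[OF assms measurable_domain(1)])
  show "\<exists>m. \<forall>x\<in>\<Omega>. u x \<le> m"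
    using compact_imp_bounded[OF compact_continuous_image[OF assms compact]]
    by (auto simp: bounded_iff) (meson abs_ge_self order_trans)
qed

lemma riesz_in_dual:
  assumes q: "q \<in> Measures"
  shows "riesz_functional \<Omega> q \<in> dual_space (Lp p \<Omega>) (Lp_norm p \<Omega>)"
proof -
  let ?f = "dens \<Omega> q"
  have f: "?f \<in> Lp_on (conj_exp p) M" using dens_props(2)[OF q] by (simp only: conj_p)
  define F where "F = (\<integral>x. norm (?f x) powr conj_exp p \<partial>M)"
  have F0: "F \<ge> 0" by (simp add: F_def)
  have bd: "\<bar>riesz_functional \<Omega> q v\<bar> \<le> (F + 1) * Lp_norm p \<Omega> v" if v: "v \<in> Lp_on p M" for v
  proof (rule field_le_epsilon)
    fix e :: real assume e: "e > 0"
    define N where "N = (\<integral>x. norm (v x) powr p \<partial>M)"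
    define c where "c = N powr (1 / p) + e / (F + 1)"
    have N0: "N \<ge> 0" by (simp add: N_def)
    have c: "c > 0" using e F0 by (simp add: c_def add_nonneg_pos)
    have "N = (N powr (1 / p)) powr p" using p1 N0 by (simp add: powr_powr)
    also have "\<dots> \<le> c powr p" using e F0 p1 by (intro powr_mono2) (auto simp: c_def)
    finally have Nc: "N / c powr p \<le> 1" using c by simp
    have vc: "(\<lambda>x. (1 / c) *\<^sub>R v x) \<in> Lp_on p M" using Lp_on_lincomb[OF v v, of "1 / c" 0] p1 by simp
    have "\<bar>\<integral>x. ?f x \<bullet> ((1 / c) *\<^sub>R v x) \<partial>M\<bar> \<le> F + (\<integral>x. norm ((1 / c) *\<^sub>R v x) powr p \<partial>M)"
      unfolding F_def by (rule Lp_on_pairing_integrable(3)[OF p1 f vc])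
    also have "(\<integral>x. norm ((1 / c) *\<^sub>R v x) powr p \<partial>M) = (\<integral>x. norm (v x) powr p / c powr p \<partial>M)"
      using c by (simp add: powr_divide)
    also have "\<dots> = N / c powr p" by (simp add: N_def)
    finally have "\<bar>\<integral>x. ?f x \<bullet> ((1 / c) *\<^sub>R v x) \<partial>M\<bar> \<le> F + 1" using Nc by linarith
    moreover have "(\<integral>x. ?f x \<bullet> ((1 / c) *\<^sub>R v x) \<partial>M) = (1 / c) * riesz_functional \<Omega> q v"
      by (simp add: riesz_functional_def)
    ultimately have "(1 / c) * \<bar>riesz_functional \<Omega> q v\<bar> \<le> F + 1" using c by (simp add: abs_mult)
    then have "\<bar>riesz_functional \<Omega> q v\<bar> \<le> (F + 1) * c" using c by (simp add: field_simps)
    also have "\<dots> = (F + 1) * Lp_norm p \<Omega> v + e" using F0 by (simp add: c_def Lp_norm_def N_def field_simps)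
    finally show "\<bar>riesz_functional \<Omega> q v\<bar> \<le> (F + 1) * Lp_norm p \<Omega> v + e" .
  qed
  have lin: "riesz_functional \<Omega> q (\<lambda>x. a *\<^sub>R u x + b *\<^sub>R v x) = a * riesz_functional \<Omega> q u + b * riesz_functional \<Omega> q v"
    if uv: "u \<in> Lp_on p M" "v \<in> Lp_on p M" for u v a b
    using Lp_on_pairing_integrable(1)[OF p1 f uv(1)] Lp_on_pairing_integrable(1)[OF p1 f uv(2)]
    by (simp add: riesz_functional_def inner_add_right)
  show ?thesis unfolding dual_space_def Lp_eq_Lp_on using bd lin by blast
qed

lemma riesz_representation:
  assumes \<xi>: "\<xi> \<in> dual_space (Lp p \<Omega> :: ('a \<Rightarrow> 'a) set) (Lp_norm p \<Omega>)"
  shows "\<exists>!q. q \<in> Measures \<and> (\<forall>v\<in>Lp p \<Omega>. \<xi> v = riesz_functional \<Omega> q v)"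
proof -
  have lin: "\<xi> (\<lambda>x. a *\<^sub>R u x + b *\<^sub>R v x) = a * \<xi> u + b * \<xi> v" if "u \<in> Lp_on p M" "v \<in> Lp_on p M" for u v a b
    using \<xi> that unfolding dual_space_def Lp_eq_Lp_on by blast
  obtain C where C: "\<And>v. v \<in> Lp_on p M \<Longrightarrow> \<bar>\<xi> v\<bar> \<le> C * Lp_norm p \<Omega> v"
    using \<xi> unfolding dual_space_def Lp_eq_Lp_on by blast
  obtain f where f: "f \<in> Lp_on (conj_exp p) M" "\<And>v. v \<in> Lp_on p M \<Longrightarrow> \<xi> v = (\<integral>x. f x \<bullet> v x \<partial>M)"
    using riesz_Lp[OF finite_measures(1) p1 lin C[unfolded Lp_norm_def]] by blast
  have f': "f \<in> Lp_on \<alpha> M" using f(1) by (simp only: conj_p)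
  let ?q = "density_measure f"
  have q: "?q \<in> Measures" by (rule density_measure_in(1)[OF \<alpha>1 f'])
  have rep: "\<xi> v = riesz_functional \<Omega> ?q v" if v: "v \<in> Lp_on p M" for v
    unfolding f(2)[OF v] riesz_functional_def
  proof (rule integral_cong_AE)
    show "(\<lambda>x. f x \<bullet> v x) \<in> borel_measurable M" "(\<lambda>x. dens \<Omega> ?q x \<bullet> v x) \<in> borel_measurable M"
      using Lp_onD(1)[OF v] Lp_onD(1)[OF f'] Lp_onD(1)[OF dens_props(2)[OF q]] by measurable
    show "AE x in M. f x \<bullet> v x = dens \<Omega> ?q x \<bullet> v x"
      using dens_density_measure[OF \<alpha>1 f'] by eventually_elim simp
  qed
  show ?thesis
  proof (rule ex1I[of _ ?q])
    show "?q \<in> Measures \<and> (\<forall>v\<in>Lp p \<Omega>. \<xi> v = riesz_functional \<Omega> ?q v)"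
      using q rep by (simp add: Lp_eq_Lp_on)
    fix r assume r: "r \<in> Measures \<and> (\<forall>v\<in>Lp p \<Omega>. \<xi> v = riesz_functional \<Omega> r v)"
    interpret finite_measure M by (rule finite_measures)
    have val: "s A \<bullet> b = \<xi> (\<lambda>x. indicator A x *\<^sub>R b)"
      if s: "s \<in> Measures" "\<And>v. v \<in> Lp_on p M \<Longrightarrow> \<xi> v = riesz_functional \<Omega> s v"
        and A: "A \<in> sets (restrict_space borel \<Omega>)" for s A b
    proof -
      have AM: "A \<in> sets M" by (rule restrict_borel_in_M[OF A])
      have "integrable M (\<lambda>x. norm (indicator A x *\<^sub>R b) powr p)"
      proof (rule integrable_const_bound)
        show "AE x in M. norm (norm (indicator A x *\<^sub>R b) powr p) \<le> norm b powr p"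
          by (rule AE_I2) (auto simp: indicator_def)
      qed (use AM in measurable)
      then have L: "(\<lambda>x. indicator A x *\<^sub>R b) \<in> Lp_on p M" using AM by (simp add: Lp_on_def)
      have i: "integrable M (\<lambda>x. indicator A x *\<^sub>R dens \<Omega> s x)"
        using dens_props(1)[OF s(1)] AM by (intro integrable_mult_indicator) (auto simp: is_density_def)
      have "s A \<bullet> b = (\<integral>x. indicator A x *\<^sub>R dens \<Omega> s x \<partial>M) \<bullet> b"
        using dens_props(1)[OF s(1)] A by (simp add: is_density_def)
      also have "\<dots> = (\<integral>x. (indicator A x *\<^sub>R dens \<Omega> s x) \<bullet> b \<partial>M)"
        by (rule integral_inner_left[symmetric]) (rule i)
      also have "\<dots> = riesz_functional \<Omega> s (\<lambda>x. indicator A x *\<^sub>R b)" by (simp add: riesz_functional_def)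
      finally show ?thesis using s(2)[OF L] by simp
    qed
    show "r = ?q"
    proof
      fix A
      show "r A = ?q A"
      proof (cases "A \<in> sets (restrict_space borel \<Omega>)")
        case True
        have "r A \<bullet> b = ?q A \<bullet> b" for b
          using val[OF _ _ True, of r b] val[OF q rep True, of b] r by (simp add: Lp_eq_Lp_on)
        then show ?thesis by (rule euclidean_eqI)
      next
        case False
        then show ?thesis using r q by (simp add: measures_with_Lp_density_def vector_measures_def)
      qed
    qed
  qed
qed

lemma neg_grad_Lp: "y \<in> X \<Longrightarrow> neg_grad \<Omega> y \<in> Lp_on p M"
  using Lp_on_lincomb[OF W1pD(4) W1pD(4), of y y "-1" 0] p1 by (simp add: W1p_mean0_subset neg_grad_def)

text \<open>
  The primal problem is posed on the closed space of gradients; since a gradient determines the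
  pairing with the measures, the linear term may be regarded as a functional of the gradient.
\<close>

definition V :: "('a \<Rightarrow> 'a) set" where
  "V = {v \<in> Lp_on p M. \<exists>y\<in>X. AE x in M. v x = neg_grad \<Omega> y x}"

definition ell :: "('a \<Rightarrow> 'a) \<Rightarrow> real" where
  "ell v = pairing (SOME y. y \<in> X \<and> (AE x in M. v x = neg_grad \<Omega> y x))"

lemma seminorm_eq:
  assumes y: "y \<in> X" and v: "v \<in> Lp_on p M" "AE x in M. v x = neg_grad \<Omega> y x"
  shows "seminorm y = (\<integral>x. norm (v x) powr p \<partial>M) powr (1 / p)"
proof -
  have "(\<integral>x. norm (wgrad \<Omega> y x) powr p \<partial>M) = (\<integral>x. norm (v x) powr p \<partial>M)"
  proof (rule integral_cong_AE)
    show "AE x in M. norm (wgrad \<Omega> y x) powr p = norm (v x) powr p"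
      using v(2) by eventually_elim (simp add: neg_grad_def)
  qed (use Lp_onD(2)[OF v(1)] Lp_onD(2)[OF W1pD(4)[OF W1p_mean0_subset[OF y]]] in auto)
  then show ?thesis by (simp add: seminorm_def)
qed

lemma ell_eq:
  assumes y: "y \<in> X" and ae: "AE x in M. v x = neg_grad \<Omega> y x"
  shows "ell v = pairing y"
proof -
  define z where "z = (SOME y. y \<in> X \<and> (AE x in M. v x = neg_grad \<Omega> y x))"
  have z: "z \<in> X \<and> (AE x in M. v x = neg_grad \<Omega> z x)"
    unfolding z_def by (rule someI[of "\<lambda>y. y \<in> X \<and> (AE x in M. v x = neg_grad \<Omega> y x)"]) (use y ae in blast)
  then have zX: "z \<in> X" and zae: "AE x in M. v x = neg_grad \<Omega> z x" by blast+
  note W = W1p_mean0_subset[OF y] W1p_mean0_subset[OF zX]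
  let ?d = "\<lambda>x. 1 * y x + (- 1) * z x"
  have d: "?d \<in> X" by (rule W1p_mean0_lincomb[OF y zX])
  have "AE x in M. (0 :: 'a) = neg_grad \<Omega> ?d x"
    using W1p_lincomb(2)[OF W, of 1 "-1"] ae zae by eventually_elim (simp add: neg_grad_def)
  then have "seminorm ?d = 0" using seminorm_eq[OF d Lp_on_zero] by simp
  then have "pairing ?d = 0" using pairing_bound W1p_mean0_subset[OF d] by (metis abs_le_zero_iff mult_zero_right)
  then show ?thesis using pairing_lincomb[OF W, of 1 "-1"] by (simp add: ell_def z_def[symmetric])
qed

lemma neg_grad_in_V: "y \<in> X \<Longrightarrow> neg_grad \<Omega> y \<in> V" "y \<in> X \<Longrightarrow> ell (neg_grad \<Omega> y) = pairing y"
  using neg_grad_Lp ell_eq[of y "neg_grad \<Omega> y"] by (auto simp: V_def)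

lemma V_lincomb:
  assumes u: "u \<in> V" and v: "v \<in> V"
  shows "(\<lambda>x. a *\<^sub>R u x + b *\<^sub>R v x) \<in> V" "ell (\<lambda>x. a *\<^sub>R u x + b *\<^sub>R v x) = a * ell u + b * ell v"
proof -
  obtain y z where y: "y \<in> X" "AE x in M. u x = neg_grad \<Omega> y x" and z: "z \<in> X" "AE x in M. v x = neg_grad \<Omega> z x"
    and L: "u \<in> Lp_on p M" "v \<in> Lp_on p M" using u v unfolding V_def by blast
  note W = W1p_mean0_subset[OF y(1)] W1p_mean0_subset[OF z(1)]
  let ?c = "\<lambda>x. a * y x + b * z x"
  have c: "?c \<in> X" by (rule W1p_mean0_lincomb[OF y(1) z(1)])
  have ae: "AE x in M. a *\<^sub>R u x + b *\<^sub>R v x = neg_grad \<Omega> ?c x"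
    using W1p_lincomb(2)[OF W, of a b] y(2) z(2) by eventually_elim (simp add: neg_grad_def)
  show "(\<lambda>x. a *\<^sub>R u x + b *\<^sub>R v x) \<in> V"
    unfolding V_def using Lp_on_lincomb[OF L, of a b] p1 c ae by (intro CollectI conjI bexI[of _ ?c]) auto
  show "ell (\<lambda>x. a *\<^sub>R u x + b *\<^sub>R v x) = a * ell u + b * ell v"
    unfolding ell_eq[OF c ae] ell_eq[OF y] ell_eq[OF z] by (rule pairing_lincomb[OF W])
qed

lemma V_closed:
  assumes s: "\<And>n. s n \<in> V" and u: "u \<in> Lp_on p M"
    and lim: "(\<lambda>n. \<integral>x. norm (s n x - u x) powr p \<partial>M) \<longlonglongrightarrow> 0"
  shows "u \<in> V"
proof -
  have "\<exists>y. y \<in> X \<and> (AE x in M. s n x = neg_grad \<Omega> y x)" for n using s[of n] unfolding V_def by blast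
  then obtain y where y: "\<And>n. y n \<in> X" "\<And>n. AE x in M. s n x = neg_grad \<Omega> (y n) x" by metis
  have sL: "s n \<in> Lp_on p M" for n using s[of n] by (simp add: V_def)
  have mu: "(\<lambda>x. - u x) \<in> Lp_on p M" using Lp_on_lincomb[OF u u, of "-1" 0] p1 by simp
  have "(\<integral>x. norm (wgrad \<Omega> (y n) x - (- u x)) powr p \<partial>M) = (\<integral>x. norm (s n x - u x) powr p \<partial>M)" for n
  proof (rule integral_cong_AE)
    show "AE x in M. norm (wgrad \<Omega> (y n) x - (- u x)) powr p = norm (s n x - u x) powr p"
      using y(2)[of n]
    proof eventually_elim
      case (elim x)
      have "wgrad \<Omega> (y n) x - (- u x) = - (s n x - u x)" using elim by (simp add: neg_grad_def)
      then show ?case by (simp only: norm_minus_cancel)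
    qed
    have L1: "(\<lambda>x. wgrad \<Omega> (y n) x - (- u x)) \<in> Lp_on p M"
      using p1 by (intro Lp_on_diff W1pD(4) W1p_mean0_subset y mu) auto
    have L2: "(\<lambda>x. s n x - u x) \<in> Lp_on p M" using p1 by (intro Lp_on_diff sL u) auto
    show "(\<lambda>x. norm (wgrad \<Omega> (y n) x - (- u x)) powr p) \<in> borel_measurable M"
      by (rule borel_measurable_integrable[OF Lp_onD(2)[OF L1]])
    show "(\<lambda>x. norm (s n x - u x) powr p) \<in> borel_measurable M"
      by (rule borel_measurable_integrable[OF Lp_onD(2)[OF L2]])
  qed
  then have "(\<lambda>n. \<integral>x. norm (wgrad \<Omega> (y n) x - (- u x)) powr p \<partial>M) \<longlonglongrightarrow> 0" using lim by (simp only:)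
  from gradients_closed[OF y(1) mu this]
  obtain z where z: "z \<in> X" "AE x in M. - u x = wgrad \<Omega> z x" by blast
  have "AE x in M. u x = neg_grad \<Omega> z x"
    using z(2)
  proof eventually_elim
    case (elim x)
    then have "u x = - wgrad \<Omega> z x" by (metis minus_minus)
    then show ?case by (simp add: neg_grad_def)
  qed
  then show ?thesis unfolding V_def using u z(1) by blast
qed

lemma variational_problem:
  assumes W: "continuous_on \<Omega> W" "\<And>x. x \<in> \<Omega> \<Longrightarrow> 0 \<le> W x"
  shows "\<exists>c C CL. convex_integral_problem M p c C CL (\<lambda>x. G_split p \<epsilon> \<delta> (w x) (W x)) (\<lambda>x. G_field p \<epsilon> \<delta> (w x) (W x)) V ell"
proof -
  obtain CL where CL: "CL \<ge> 0" "\<And>y. y \<in> W1p p \<Omega> \<Longrightarrow> \<bar>pairing y\<bar> \<le> CL * seminorm y" using pairing_bound by metis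
  obtain mw where mw: "\<And>x. x \<in> \<Omega> \<Longrightarrow> w x \<le> mw" using continuous_on_M(2)[OF w_continuous] by blast
  obtain mW where mW: "\<And>x. x \<in> \<Omega> \<Longrightarrow> W x \<le> mW" using continuous_on_M(2)[OF W(1)] by blast
  define c where "c = \<epsilon> powr (1 - p) / (p * 2 powr p)"
  define C1 where "C1 = \<epsilon> powr (1 - p) + \<delta>"
  define C2 where "C2 = \<epsilon> powr (1 - p) / p * mw powr p"
  define C where "C = C1 + \<delta> * \<bar>mW\<bar> + C2"
  have c0: "c > 0" using eps p1 by (simp add: c_def)
  have C0: "C1 \<ge> 0" "C2 \<ge> 0" "\<delta> * \<bar>mW\<bar> \<ge> 0" using eps del p1 by (auto simp: C1_def C2_def)
  have "convex_integral_problem M p c C CL (\<lambda>x. G_split p \<epsilon> \<delta> (w x) (W x)) (\<lambda>x. G_field p \<epsilon> \<delta> (w x) (W x)) V ell"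
  proof (intro convex_integral_problem.intro convex_integral_problem_axioms.intro)
    show "finite_measure M" by (rule finite_measures)
    show "1 < p" "0 < c" "0 \<le> CL" by (rule p1, rule c0, rule CL(1))
    show "0 \<le> C" using C0 by (simp add: C_def)
    show "V \<subseteq> Lp_on p M" by (auto simp: V_def)
    show "(\<lambda>x. 0) \<in> V" using zero_in_W1p_mean0 Lp_on_zero unfolding V_def neg_grad_def
      by (intro CollectI conjI bexI[of _ "\<lambda>x. 0"]) (auto elim!: eventually_mono)
  next
    fix v :: "'a \<Rightarrow> 'a" assume v: "v \<in> borel_measurable M"
    note m = G_split_measurable[OF p1 eps del v continuous_on_M(1)[OF w_continuous] continuous_on_M(1)[OF W(1)]]
    show "(\<lambda>x. G_split p \<epsilon> \<delta> (w x) (W x) (v x)) \<in> borel_measurable M" by (rule m(1))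
    show "(\<lambda>x. G_field p \<epsilon> \<delta> (w x) (W x) (v x)) \<in> borel_measurable M" by (rule m(2))
  next
    fix x and a b :: 'a assume "x \<in> space M"
    then have x: "x \<in> \<Omega>" by simp
    show "G_split p \<epsilon> \<delta> (w x) (W x) a + G_field p \<epsilon> \<delta> (w x) (W x) a \<bullet> (b - a) \<le> G_split p \<epsilon> \<delta> (w x) (W x) b"
      by (rule G_subgradient[OF p1 eps del W(2)[OF x]])
  next
    fix x and a :: 'a assume "x \<in> space M"
    then have x: "x \<in> \<Omega>" by simp
    have "norm (G_field p \<epsilon> \<delta> (w x) (W x) a) \<le> C1 * (1 + norm a) powr (p - 1)"
      unfolding C1_def by (rule G_field_growth[OF p1 eps del w_nonneg[OF x] W(2)[OF x]])
    also have "\<dots> \<le> C * (1 + norm a) powr (p - 1)" using C0 by (intro mult_right_mono) (auto simp: C_def)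
    finally show "norm (G_field p \<epsilon> \<delta> (w x) (W x) a) \<le> C * (1 + norm a) powr (p - 1)" .
    have "c * norm a powr p - C2 \<le> G_split p \<epsilon> \<delta> (w x) (W x) a"
      unfolding c_def C2_def by (rule G_split_coercive[OF p1 eps del w_nonneg[OF x] mw[OF x] W(2)[OF x]])
    moreover have "C2 \<le> C" using C0 by (simp add: C_def)
    ultimately show "c * norm a powr p - C \<le> G_split p \<epsilon> \<delta> (w x) (W x) a" by linarith
  next
    fix x assume "x \<in> space M"
    then have x: "x \<in> \<Omega>" by simp
    have "G_split p \<epsilon> \<delta> (w x) (W x) (0 :: 'a) = \<delta> * W x"
      by (rule G_split_zero[OF p1 eps del w_nonneg[OF x] W(2)[OF x]])
    then have "\<bar>G_split p \<epsilon> \<delta> (w x) (W x) (0 :: 'a)\<bar> = \<delta> * W x" using del W(2)[OF x] by simp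
    also have "\<dots> \<le> \<delta> * \<bar>mW\<bar>" using mW[OF x] del by (intro mult_left_mono) auto
    also have "\<dots> \<le> C" using C0 by (simp add: C_def)
    finally show "\<bar>G_split p \<epsilon> \<delta> (w x) (W x) (0 :: 'a)\<bar> \<le> C" .
  next
    fix v assume v: "v \<in> V"
    then obtain y where y: "y \<in> X" "AE x in M. v x = neg_grad \<Omega> y x" and L: "v \<in> Lp_on p M" unfolding V_def by blast
    show "\<bar>ell v\<bar> \<le> CL * (\<integral>x. norm (v x) powr p \<partial>M) powr (1 / p)"
      using CL(2)[OF W1p_mean0_subset[OF y(1)]] by (simp only: ell_eq[OF y] seminorm_eq[OF y(1) L y(2)])
  qed (rule V_lincomb V_closed; assumption)+
  then show ?thesis by blast
qed

lemma G_int_integrable: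
  assumes v: "v \<in> Lp_on p M"
  shows "integrable M (\<lambda>x. Integrand x (v x))"
proof -
  obtain c C CL where "convex_integral_problem M p c C CL (\<lambda>x. G_split p \<epsilon> \<delta> (w x) (w x)) (\<lambda>x. G_field p \<epsilon> \<delta> (w x) (w x)) V ell"
    using variational_problem[OF w_continuous w_nonneg] by blast
  then interpret convex_integral_problem M p c C CL "\<lambda>x. G_split p \<epsilon> \<delta> (w x) (w x)" "\<lambda>x. G_field p \<epsilon> \<delta> (w x) (w x)" V ell .
  show ?thesis using \<Gamma>_integrable[OF v] by (simp only: G_int_eq_split)
qed

lemma primal_functional_eq:
  assumes y: "y \<in> X" and v: "v \<in> V" "AE x in M. v x = neg_grad \<Omega> y x"
  shows "Primal y = (\<integral>x. Integrand x (v x) \<partial>M) - ell v"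
proof -
  have vL: "v \<in> Lp_on p M" using v(1) by (simp add: V_def)
  have "(\<integral>x. Integrand x (neg_grad \<Omega> y x) \<partial>M) = (\<integral>x. Integrand x (v x) \<partial>M)"
  proof (rule integral_cong_AE)
    show "AE x in M. Integrand x (neg_grad \<Omega> y x) = Integrand x (v x)" using v(2) by eventually_elim simp
  qed (rule borel_measurable_integrable[OF G_int_integrable], rule neg_grad_Lp[OF y],
       rule borel_measurable_integrable[OF G_int_integrable], rule vL)
  then show ?thesis unfolding primal_functional_def ell_eq[OF y v(2)] by (simp add: neg_grad_def)
qed

lemma primal_minimizer:
  "\<exists>y\<in>X. \<forall>z\<in>X. Primal y \<le> Primal z"
proof -
  obtain c C CL where "convex_integral_problem M p c C CL (\<lambda>x. G_split p \<epsilon> \<delta> (w x) (w x)) (\<lambda>x. G_field p \<epsilon> \<delta> (w x) (w x)) V ell"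
    using variational_problem[OF w_continuous w_nonneg] by blast
  then interpret convex_integral_problem M p c C CL "\<lambda>x. G_split p \<epsilon> \<delta> (w x) (w x)" "\<lambda>x. G_field p \<epsilon> \<delta> (w x) (w x)" V ell .
  obtain v where v: "v \<in> V" "\<And>u. u \<in> V \<Longrightarrow> J v \<le> J u" using minimizer_exists by blast
  obtain y where y: "y \<in> X" "AE x in M. v x = neg_grad \<Omega> y x" using v(1) unfolding V_def by blast
  have J: "J u = (\<integral>x. Integrand x (u x) \<partial>M) - ell u" for u unfolding J_def by (simp only: G_int_eq_split)
  have "Primal y \<le> Primal z" if z: "z \<in> X" for z
    using v(2)[OF neg_grad_in_V(1)[OF z]] primal_functional_eq[OF y(1) v(1) y(2)]
      primal_functional_eq[OF z neg_grad_in_V(1)[OF z]] by (simp add: J)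
  then show ?thesis using y(1) by blast
qed

lemma G_conj_field:
  assumes f: "f \<in> Lp_on \<alpha> M"
  obtains P where "P \<in> Lp_on p M"
    "\<And>x. x \<in> \<Omega> \<Longrightarrow> Conjugate x (f x) = f x \<bullet> P x - Integrand x (P x)"
    "integrable M (\<lambda>x. f x \<bullet> P x)" "integrable M (\<lambda>x. Conjugate x (f x))"
proof -
  obtain mw where mw: "\<And>x. x \<in> \<Omega> \<Longrightarrow> w x \<le> mw" using continuous_on_M(2)[OF w_continuous] by blast
  define P where "P x = conj_point p \<epsilon> \<delta> (w x) (f x)" for x
  have f': "f \<in> Lp_on (conj_exp p) M" using f by (simp only: conj_p)
  have P: "P \<in> Lp_on p M" unfolding P_def
    by (rule conj_point_Lp[OF p1 eps del finite_measures(1) f' continuous_on_M(1)[OF w_continuous]])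
       (use w_nonneg mw in auto)
  have eq: "Conjugate x (f x) = f x \<bullet> P x - Integrand x (P x)" if "x \<in> \<Omega>" for x
    unfolding P_def by (rule G_conj_eq(1)[where w=w and x=x, OF \<alpha>1 eps del w_nonneg[OF that]])
  have i: "integrable M (\<lambda>x. f x \<bullet> P x)" by (rule Lp_on_pairing_integrable(1)[OF p1 f' P])
  have "integrable M (\<lambda>x. f x \<bullet> P x - Integrand x (P x))"
    by (rule Bochner_Integration.integrable_diff[OF i G_int_integrable[OF P]])
  moreover have "integrable M (\<lambda>x. Conjugate x (f x)) = integrable M (\<lambda>x. f x \<bullet> P x - Integrand x (P x))"
    by (rule Bochner_Integration.integrable_cong[OF refl]) (use eq in simp)
  ultimately show ?thesis using that[OF P eq i] by blast
qed

lemma fenchel_conj_G_term: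
  assumes q: "q \<in> Measures"
  shows "fenchel_conj (Lp p \<Omega>) (G_term \<alpha> w \<epsilon> \<delta> \<Omega>) (riesz_functional \<Omega> q) = ereal (Dual q)"
proof -
  have f: "dens \<Omega> q \<in> Lp_on \<alpha> M" by (rule dens_props(2)[OF q])
  have f': "dens \<Omega> q \<in> Lp_on (conj_exp p) M" using f by (simp only: conj_p)
  obtain P where P: "P \<in> Lp_on p M"
    "\<And>x. x \<in> \<Omega> \<Longrightarrow> Conjugate x (dens \<Omega> q x) = dens \<Omega> q x \<bullet> P x - Integrand x (P x)"
    "integrable M (\<lambda>x. dens \<Omega> q x \<bullet> P x)" "integrable M (\<lambda>x. Conjugate x (dens \<Omega> q x))"
    using G_conj_field[OF f] by blast
  have val: "ereal (riesz_functional \<Omega> q v) - G_term \<alpha> w \<epsilon> \<delta> \<Omega> v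
      = ereal (\<integral>x. dens \<Omega> q x \<bullet> v x - Integrand x (v x) \<partial>M)" if v: "v \<in> Lp_on p M" for v :: "'a \<Rightarrow> 'a"
    using Lp_on_pairing_integrable(1)[OF p1 f' v] G_int_integrable[OF v]
    by (simp add: riesz_functional_def G_term_def)
  show ?thesis unfolding fenchel_conj_def Lp_eq_Lp_on
  proof (rule antisym)
    show "(SUP v\<in>Lp_on p M. ereal (riesz_functional \<Omega> q v) - G_term \<alpha> w \<epsilon> \<delta> \<Omega> v) \<le> ereal (Dual q)"
    proof (rule SUP_least)
      fix v :: "'a \<Rightarrow> 'a" assume v: "v \<in> Lp_on p M"
      have "(\<integral>x. dens \<Omega> q x \<bullet> v x - Integrand x (v x) \<partial>M) \<le> (\<integral>x. Conjugate x (dens \<Omega> q x) \<partial>M)"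
      proof (rule integral_mono[OF _ P(4)])
        show "integrable M (\<lambda>x. dens \<Omega> q x \<bullet> v x - Integrand x (v x))"
          by (rule Bochner_Integration.integrable_diff[OF Lp_on_pairing_integrable(1)[OF p1 f' v] G_int_integrable[OF v]])
        fix x assume "x \<in> space M"
        then show "dens \<Omega> q x \<bullet> v x - Integrand x (v x) \<le> Conjugate x (dens \<Omega> q x)"
          by (intro G_conj_eq(2) \<alpha>1 eps del w_nonneg) simp
      qed
      then show "ereal (riesz_functional \<Omega> q v) - G_term \<alpha> w \<epsilon> \<delta> \<Omega> v \<le> ereal (Dual q)"
        unfolding val[OF v] by (simp add: dual_functional_def)
    qed
    have "Dual q = (\<integral>x. dens \<Omega> q x \<bullet> P x - Integrand x (P x) \<partial>M)"
      unfolding dual_functional_def by (rule Bochner_Integration.integral_cong[OF refl]) (use P(2) in simp)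
    then have "ereal (Dual q) = ereal (riesz_functional \<Omega> q P) - G_term \<alpha> w \<epsilon> \<delta> \<Omega> P"
      by (simp only: val[OF P(1)])
    then show "ereal (Dual q) \<le> (SUP v\<in>Lp_on p M. ereal (riesz_functional \<Omega> q v) - G_term \<alpha> w \<epsilon> \<delta> \<Omega> v)"
      using P(1) by (intro SUP_upper2[of P]) auto
  qed
qed

lemma riesz_neg_grad:
  assumes q: "q \<in> Measures"
  shows "riesz_functional \<Omega> q (neg_grad \<Omega> y) = div_op \<Omega> (dens \<Omega> q) y"
  by (simp add: riesz_functional_def neg_grad_def div_op_def)

lemma fenchel_conj_F_term:
  assumes q: "q \<in> Measures"
  shows "fenchel_conj X (F_term \<Omega> \<mu>p \<mu>m) (\<lambda>v. - riesz_functional \<Omega> q (neg_grad \<Omega> v))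
    = (if q \<in> Admissible then 0 else \<infinity>)"
proof -
  define L where "L y = pairing y - div_op \<Omega> (dens \<Omega> q) y" for y
  have conj: "fenchel_conj X (F_term \<Omega> \<mu>p \<mu>m) (\<lambda>v. - riesz_functional \<Omega> q (neg_grad \<Omega> v)) = (SUP y\<in>X. ereal (L y))"
    unfolding fenchel_conj_def F_term_def riesz_neg_grad[OF q] L_def by simp
  have adm: "q \<in> Admissible \<longleftrightarrow> (\<forall>y\<in>X. L y = 0)"
    using q by (auto simp: dual_admissible_def L_def)
  show ?thesis
  proof (cases "q \<in> Admissible")
    case True
    then have "(SUP y\<in>X. ereal (L y)) = (SUP y\<in>X. 0)" using adm by (intro SUP_cong) auto
    also have "\<dots> = 0" using zero_in_W1p_mean0(1) by (intro SUP_const) auto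
    finally show ?thesis using True conj by simp
  next
    case False
    then obtain y where y: "y \<in> X" "L y \<noteq> 0" using adm by blast
    have f': "dens \<Omega> q \<in> Lp_on (conj_exp p) M" using dens_props(2)[OF q] by (simp only: conj_p)
    have scale: "(\<lambda>x. t * y x) \<in> X" "L (\<lambda>x. t * y x) = t * L y" for t
    proof -
      note W = W1p_mean0_subset[OF y(1)]
      show tX: "(\<lambda>x. t * y x) \<in> X" using W1p_mean0_lincomb[OF y(1) y(1), of t 0] by simp
      have "(\<integral>x. dens \<Omega> q x \<bullet> wgrad \<Omega> (\<lambda>x. t * y x) x \<partial>M) = (\<integral>x. t * (dens \<Omega> q x \<bullet> wgrad \<Omega> y x) \<partial>M)"
      proof (rule integral_cong_AE)
        show "AE x in M. dens \<Omega> q x \<bullet> wgrad \<Omega> (\<lambda>x. t * y x) x = t * (dens \<Omega> q x \<bullet> wgrad \<Omega> y x)"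
          using W1p_lincomb(2)[OF W W, of t 0] by (simp, eventually_elim) simp
        show "(\<lambda>x. dens \<Omega> q x \<bullet> wgrad \<Omega> (\<lambda>x. t * y x) x) \<in> borel_measurable M"
          by (rule borel_measurable_integrable[OF Lp_on_pairing_integrable(1)[OF p1 f' W1pD(4)[OF W1p_mean0_subset[OF tX]]]])
        show "(\<lambda>x. t * (dens \<Omega> q x \<bullet> wgrad \<Omega> y x)) \<in> borel_measurable M"
          using borel_measurable_integrable[OF Lp_on_pairing_integrable(1)[OF p1 f' W1pD(4)[OF W]]] by simp
      qed
      moreover have "pairing (\<lambda>x. t * y x) = t * pairing y" using pairing_lincomb[OF W W, of t 0] by simp
      ultimately show "L (\<lambda>x. t * y x) = t * L y" by (simp add: L_def div_op_def algebra_simps)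
    qed
    have "(SUP y\<in>X. ereal (L y)) = \<infinity>"
    proof (rule SUP_PInfty)
      fix n :: nat
      show "\<exists>z\<in>X. ereal (real n) \<le> ereal (L z)"
        using scale(1)[of "real n / L y"] scale(2)[of "real n / L y"] y(2)
        by (intro bexI[of _ "\<lambda>x. (real n / L y) * y x"]) simp_all
    qed
    then show ?thesis using False conj by simp
  qed
qed

lemma weak_duality:
  assumes q: "q \<in> Admissible" and y: "y \<in> X"
  shows "- Primal y \<le> Dual q"
proof -
  have q': "q \<in> Measures" and div: "div_op \<Omega> (dens \<Omega> q) y = pairing y"
    using q y by (auto simp: dual_admissible_def)
  have "neg_grad \<Omega> y \<in> Lp p \<Omega>" using neg_grad_Lp[OF y] by (simp only: Lp_eq_Lp_on)
  then have "ereal (riesz_functional \<Omega> q (neg_grad \<Omega> y)) - G_term \<alpha> w \<epsilon> \<delta> \<Omega> (neg_grad \<Omega> y)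
      \<le> fenchel_conj (Lp p \<Omega>) (G_term \<alpha> w \<epsilon> \<delta> \<Omega>) (riesz_functional \<Omega> q)"
    unfolding fenchel_conj_def by (rule SUP_upper)
  then show ?thesis unfolding fenchel_conj_G_term[OF q'] riesz_neg_grad[OF q'] div
    by (simp add: G_term_def primal_functional_def neg_grad_def)
qed

lemma dual_almost_optimal:
  assumes y0: "\<And>z. z \<in> X \<Longrightarrow> Primal y \<le> Primal z" and e: "0 < e"
  shows "\<exists>q\<in>Admissible. Dual q \<le> - Primal y + e"
proof -
  define \<eta> where "\<eta> = e / (\<delta> * measure lebesgue \<Omega>)"
  have \<eta>: "\<eta> > 0" using e del volume_pos by (simp add: \<eta>_def)
  define W where "W x = max (w x) \<eta>" for x
  have Wc: "continuous_on \<Omega> W" unfolding W_def by (intro continuous_on_max w_continuous continuous_on_const)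
  have W0: "0 < W x" "w x \<le> W x" for x using \<eta> by (auto simp: W_def)
  have Ww: "W x - w x \<le> \<eta>" if "x \<in> \<Omega>" for x using w_nonneg[OF that] \<eta> by (auto simp: W_def)
  obtain c C CL where "convex_integral_problem M p c C CL (\<lambda>x. G_split p \<epsilon> \<delta> (w x) (W x)) (\<lambda>x. G_field p \<epsilon> \<delta> (w x) (W x)) V ell"
    using variational_problem[OF Wc less_imp_le[OF W0(1)]] by blast
  then interpret P: convex_integral_problem M p c C CL "\<lambda>x. G_split p \<epsilon> \<delta> (w x) (W x)" "\<lambda>x. G_field p \<epsilon> \<delta> (w x) (W x)" V ell .
  obtain v where v: "v \<in> V" "\<And>u. u \<in> V \<Longrightarrow> P.J v \<le> P.J u" using P.minimizer_exists by blast
  have vL: "v \<in> Lp_on p M" using v(1) by (simp add: V_def)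
  obtain z where z: "z \<in> X" "AE x in M. v x = neg_grad \<Omega> z x" using v(1) unfolding V_def by blast
  define f where "f x = G_field p \<epsilon> \<delta> (w x) (W x) (v x)" for x
  have f': "f \<in> Lp_on (conj_exp p) M" unfolding f_def by (rule P.D_Lp[OF vL])
  then have f: "f \<in> Lp_on \<alpha> M" by (simp only: conj_p)
  have el: "(\<integral>x. f x \<bullet> h x \<partial>M) = ell h" if h: "h \<in> V" for h
    unfolding f_def
  proof (rule P.euler_lagrange[OF _ v h])
    fix x assume "x \<in> space M"
    then show "continuous_on UNIV (G_field p \<epsilon> \<delta> (w x) (W x) :: 'a \<Rightarrow> 'a)"
      using w_nonneg W0(1) by (intro G_field_continuous[OF p1 eps del]) auto
  qed
  let ?q = "density_measure f"
  have q: "?q \<in> Measures" by (rule density_measure_in(1)[OF \<alpha>1 f])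
  have dq: "AE x in M. dens \<Omega> ?q x = f x" by (rule dens_density_measure[OF \<alpha>1 f])
  have qL: "dens \<Omega> ?q \<in> Lp_on (conj_exp p) M" using dens_props(2)[OF q] by (simp only: conj_p)
  have "div_op \<Omega> (dens \<Omega> ?q) \<phi> = pairing \<phi>" if \<phi>: "\<phi> \<in> X" for \<phi>
  proof -
    have "div_op \<Omega> (dens \<Omega> ?q) \<phi> = (\<integral>x. dens \<Omega> ?q x \<bullet> neg_grad \<Omega> \<phi> x \<partial>M)"
      unfolding riesz_neg_grad[OF q, symmetric] riesz_functional_def ..
    also have "\<dots> = (\<integral>x. f x \<bullet> neg_grad \<Omega> \<phi> x \<partial>M)"
    proof (rule integral_cong_AE)
      show "AE x in M. dens \<Omega> ?q x \<bullet> neg_grad \<Omega> \<phi> x = f x \<bullet> neg_grad \<Omega> \<phi> x" using dq by eventually_elim simp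
    qed (rule borel_measurable_integrable[OF Lp_on_pairing_integrable(1)[OF p1 qL neg_grad_Lp[OF \<phi>]]],
         rule borel_measurable_integrable[OF Lp_on_pairing_integrable(1)[OF p1 f' neg_grad_Lp[OF \<phi>]]])
    also have "\<dots> = pairing \<phi>" using el[OF neg_grad_in_V(1)[OF \<phi>]] neg_grad_in_V(2)[OF \<phi>] by simp
    finally show ?thesis .
  qed
  then have adm: "?q \<in> Admissible" using q by (simp add: dual_admissible_def)
  obtain R where R: "integrable M (\<lambda>x. Conjugate x (f x))" using G_conj_field[OF f] by blast
  obtain R' where R': "integrable M (\<lambda>x. Conjugate x (dens \<Omega> ?q x))" using G_conj_field[OF dens_props(2)[OF q]] by blast
  have fv: "integrable M (\<lambda>x. f x \<bullet> v x)" by (rule Lp_on_pairing_integrable(1)[OF p1 f' vL])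
  have "Dual ?q = (\<integral>x. Conjugate x (f x) \<partial>M)"
    unfolding dual_functional_def
  proof (rule integral_cong_AE)
    show "AE x in M. Conjugate x (dens \<Omega> ?q x) = Conjugate x (f x)" using dq by eventually_elim simp
  qed (rule borel_measurable_integrable[OF R'], rule borel_measurable_integrable[OF R])
  also have "\<dots> \<le> (\<integral>x. (f x \<bullet> v x - Integrand x (v x)) + \<delta> * \<eta> \<partial>M)"
  proof (rule integral_mono[OF R])
    show "integrable M (\<lambda>x. (f x \<bullet> v x - Integrand x (v x)) + \<delta> * \<eta>)"
      using fv G_int_integrable[OF vL] by (intro Bochner_Integration.integrable_add Bochner_Integration.integrable_diff P.integrable_const)
    fix x assume "x \<in> space M"
    then have x: "x \<in> \<Omega>" by simp
    have cmp: "G_split p \<epsilon> \<delta> (w x) (w x) a \<le> G_split p \<epsilon> \<delta> (w x) (W x) a"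
      "G_split p \<epsilon> \<delta> (w x) (W x) a \<le> G_split p \<epsilon> \<delta> (w x) (w x) a + \<delta> * \<eta>" for a :: 'a
    proof -
      note h = huber_part_weight_bounds[OF w_nonneg[OF x] W0(2) norm_ge_zero[of a]]
      show "G_split p \<epsilon> \<delta> (w x) (w x) a \<le> G_split p \<epsilon> \<delta> (w x) (W x) a"
        using mult_left_mono[OF h(1), of \<delta>] del by (simp add: G_split_def)
      have "huber_part (W x) (norm a) \<le> huber_part (w x) (norm a) + \<eta>" using h(2) Ww[OF x] by linarith
      then have "\<delta> * huber_part (W x) (norm a) \<le> \<delta> * (huber_part (w x) (norm a) + \<eta>)" using del by (intro mult_left_mono) auto
      then show "G_split p \<epsilon> \<delta> (w x) (W x) a \<le> G_split p \<epsilon> \<delta> (w x) (w x) a + \<delta> * \<eta>"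
        by (simp add: G_split_def algebra_simps)
    qed
    define Q where "Q = conj_point p \<epsilon> \<delta> (w x) (f x)"
    have "Conjugate x (f x) = f x \<bullet> Q - G_split p \<epsilon> \<delta> (w x) (w x) Q"
      unfolding Q_def G_conj_eq(1)[where w=w and x=x, OF \<alpha>1 eps del w_nonneg[OF x]]
      by (simp only: G_int_eq_split)
    moreover have "G_split p \<epsilon> \<delta> (w x) (W x) (v x) + f x \<bullet> (Q - v x) \<le> G_split p \<epsilon> \<delta> (w x) (W x) Q"
      unfolding f_def by (rule G_subgradient[OF p1 eps del less_imp_le[OF W0(1)]])
    ultimately show "Conjugate x (f x) \<le> (f x \<bullet> v x - Integrand x (v x)) + \<delta> * \<eta>"
      using cmp(1)[of "v x"] cmp(2)[of Q] unfolding G_int_eq_split inner_diff_right by linarith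
  qed
  also have "\<dots> = (ell v - (\<integral>x. Integrand x (v x) \<partial>M)) + measure M (space M) * (\<delta> * \<eta>)"
    using fv G_int_integrable[OF vL] el[OF v(1)] by simp
  also have "measure M (space M) * (\<delta> * \<eta>) = e"
    using del volume_pos measurable_domain by (simp add: \<eta>_def measure_restrict_space)
  also have "ell v - (\<integral>x. Integrand x (v x) \<partial>M) = - Primal z"
    using primal_functional_eq[OF z(1) v(1) z(2)] by simp
  also have "- Primal z + e \<le> - Primal y + e"
    using y0[OF z(1)] by simp
  finally show ?thesis using adm by blast
qed

lemma strong_duality:
  "- (INF q\<in>Admissible. ereal (Dual q))
    = (INF y\<in>X. ereal (Primal y))"
proof -
  obtain y where y: "y \<in> X" "\<And>z. z \<in> X \<Longrightarrow> Primal y \<le> Primal z"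
    using primal_minimizer by blast
  let ?m = "Primal y"
  have 1: "(INF y\<in>X. ereal (Primal y)) = ereal ?m"
    using y by (intro antisym INF_lower INF_greatest) auto
  have 2: "(INF q\<in>Admissible. ereal (Dual q)) = ereal (- ?m)"
  proof (rule antisym)
    show "ereal (- ?m) \<le> (INF q\<in>Admissible. ereal (Dual q))"
      using weak_duality[OF _ y(1)] by (intro INF_greatest) auto
    show "(INF q\<in>Admissible. ereal (Dual q)) \<le> ereal (- ?m)"
    proof (rule ereal_le_epsilon2)
      fix e :: real assume "0 < e"
      then obtain q where q: "q \<in> Admissible" "Dual q \<le> - ?m + e"
        using dual_almost_optimal[OF y(2)] by blast
      have "(INF q\<in>Admissible. ereal (Dual q)) \<le> ereal (Dual q)"
        by (rule INF_lower[OF q(1)])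
      also have "\<dots> \<le> ereal (- ?m) + ereal e" using q(2) by simp
      finally show "(INF q\<in>Admissible. ereal (Dual q)) \<le> ereal (- ?m) + ereal e" .
    qed
  qed
  show ?thesis unfolding 1 2 by simp
qed

end

theorem theorem3p5:
  fixes \<Omega> :: "'a::euclidean_space set"
    and w :: "'a \<Rightarrow> real"
    and \<alpha> \<epsilon> \<delta> :: real
    and \<mu>p \<mu>m :: "'a measure"
  assumes "compact \<Omega>"
    and "\<Omega> = closure (interior \<Omega>)"
    and "bounded_lipschitz_domain (interior \<Omega>)"
    and "continuous_on \<Omega> w"
    and "\<And>x. x \<in> \<Omega> \<Longrightarrow> 0 \<le> w x"
    and "1 < \<alpha>"
    and "DIM('a) = 1 \<or> \<alpha> < real DIM('a) / (real DIM('a) - 1)"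
    and "prob_space \<mu>p" and "sets \<mu>p = sets (restrict_space borel \<Omega>)"
    and "prob_space \<mu>m" and "sets \<mu>m = sets (restrict_space borel \<Omega>)"
    and "neumann_uniquely_solvable (conj_exp \<alpha>) \<Omega>"
    and "0 < \<epsilon>" and "0 < \<delta>"
  shows
    \<comment> \<open>the second problem is a Fenchel-Rockafellar problem\<close>
    "(\<forall>y\<in>W1p_mean0 (conj_exp \<alpha>) \<Omega>.
        neg_grad \<Omega> y \<in> Lp (conj_exp \<alpha>) \<Omega> \<and>
        ereal (primal_functional \<alpha> w \<epsilon> \<delta> \<Omega> \<mu>p \<mu>m y)
          = fenchel_primal_objective (F_term \<Omega> \<mu>p \<mu>m) (G_term \<alpha> w \<epsilon> \<delta> \<Omega>) (neg_grad \<Omega>) y)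
    \<comment> \<open>the measures with density in the Lebesgue space represent exactly its dual variables\<close>
   \<and> (\<forall>q\<in>measures_with_Lp_density \<alpha> \<Omega>.
        riesz_functional \<Omega> q
          \<in> dual_space (Lp (conj_exp \<alpha>) \<Omega>) (Lp_norm (conj_exp \<alpha>) \<Omega>))
   \<and> (\<forall>\<xi>\<in>dual_space (Lp (conj_exp \<alpha>) \<Omega> :: ('a \<Rightarrow> 'a) set) (Lp_norm (conj_exp \<alpha>) \<Omega>).
        \<exists>!q. q \<in> measures_with_Lp_density \<alpha> \<Omega> \<and>
          (\<forall>p\<in>Lp (conj_exp \<alpha>) \<Omega>. \<xi> p = riesz_functional \<Omega> q p))
    \<comment> \<open>the first problem is the dual problem\<close>
   \<and> (\<forall>q\<in>measures_with_Lp_density \<alpha> \<Omega>.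
        fenchel_dual_objective
          (W1p_mean0 (conj_exp \<alpha>) \<Omega>) (F_term \<Omega> \<mu>p \<mu>m)
          (Lp (conj_exp \<alpha>) \<Omega>) (G_term \<alpha> w \<epsilon> \<delta> \<Omega>)
          (neg_grad \<Omega>) (riesz_functional \<Omega> q)
        = (if q \<in> dual_admissible \<alpha> \<Omega> \<mu>p \<mu>m
           then - ereal (dual_functional \<alpha> w \<epsilon> \<delta> \<Omega> q) else - \<infinity>))
    \<comment> \<open>the minimum is attained\<close>
   \<and> (\<exists>y\<in>W1p_mean0 (conj_exp \<alpha>) \<Omega>. \<forall>z\<in>W1p_mean0 (conj_exp \<alpha>) \<Omega>.
        primal_functional \<alpha> w \<epsilon> \<delta> \<Omega> \<mu>p \<mu>m y \<le> primal_functional \<alpha> w \<epsilon> \<delta> \<Omega> \<mu>p \<mu>m z)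
    \<comment> \<open>strong duality\<close>
   \<and> - (INF q\<in>dual_admissible \<alpha> \<Omega> \<mu>p \<mu>m. ereal (dual_functional \<alpha> w \<epsilon> \<delta> \<Omega> q))
      = (INF y\<in>W1p_mean0 (conj_exp \<alpha>) \<Omega>. ereal (primal_functional \<alpha> w \<epsilon> \<delta> \<Omega> \<mu>p \<mu>m y))"
proof -
  have pd: "real DIM('a) < conj_exp \<alpha>"
  proof (cases "DIM('a) = 1")
    case True
    then show ?thesis using conj_exp_props(1)[OF assms(6)] by simp
  next
    case False
    then have d: "real DIM('a) > 1" using DIM_positive[where 'a='a] by linarith
    then have "\<alpha> * (real DIM('a) - 1) < real DIM('a)" using assms(7) False by (simp add: less_divide_eq)
    then show ?thesis using assms(6) by (simp add: conj_exp_def less_divide_eq algebra_simps)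
  qed
  interpret predual_problem \<Omega> \<alpha> \<mu>p \<mu>m w \<epsilon> \<delta>
  proof (intro predual_problem.intro lipschitz_compact_measures.intro lipschitz_compact.intro
      lipschitz_compact_measures_axioms.intro predual_problem_axioms.intro)
    show "closure (interior \<Omega>) = \<Omega>" by (rule assms(2)[symmetric])
    show "1 < conj_exp \<alpha>" by (rule conj_exp_props(1)[OF assms(6)])
    show "0 \<le> w x" if "x \<in> \<Omega>" for x by (rule assms(5)[OF that])
  qed (rule assms pd)+
  have A: "neg_grad \<Omega> y \<in> Lp (conj_exp \<alpha>) \<Omega> \<and>
      ereal (primal_functional \<alpha> w \<epsilon> \<delta> \<Omega> \<mu>p \<mu>m y)
        = fenchel_primal_objective (F_term \<Omega> \<mu>p \<mu>m) (G_term \<alpha> w \<epsilon> \<delta> \<Omega>) (neg_grad \<Omega>) y"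
    if "y \<in> W1p_mean0 (conj_exp \<alpha>) \<Omega>" for y
    using neg_grad_Lp[OF that]
    by (simp add: Lp_eq_Lp_on fenchel_primal_objective_def primal_functional_def F_term_def G_term_def neg_grad_def)
  have B: "fenchel_dual_objective (W1p_mean0 (conj_exp \<alpha>) \<Omega>) (F_term \<Omega> \<mu>p \<mu>m)
      (Lp (conj_exp \<alpha>) \<Omega>) (G_term \<alpha> w \<epsilon> \<delta> \<Omega>) (neg_grad \<Omega>) (riesz_functional \<Omega> q)
      = (if q \<in> dual_admissible \<alpha> \<Omega> \<mu>p \<mu>m then - ereal (dual_functional \<alpha> w \<epsilon> \<delta> \<Omega> q) else - \<infinity>)"
    if "q \<in> measures_with_Lp_density \<alpha> \<Omega>" for q
    unfolding fenchel_dual_objective_def fenchel_conj_F_term[OF that] fenchel_conj_G_term[OF that] by simp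
  show ?thesis
    by (rule conjI[OF ballI[OF A] conjI[OF ballI[OF riesz_in_dual] conjI[OF ballI[OF riesz_representation]
      conjI[OF ballI[OF B] conjI[OF primal_minimizer strong_duality]]]]])
qed

end
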